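(* Let $T$ be a theory. The 2-category $\mathcal{C}$ of small pseudo $T$-algebras admits bicolimits: every pseudo functor $F:\mathcal{J}\to\mathcal{C}$ from a small 1-category $\mathcal{J}$ admits a bicolimit in $\mathcal{C}$.
   Context: Bicolimits. Pseudo functors and pseudo natural transformations have invertible coherence 2-cells. For a pseudo functor $F:\mathcal{J}\to\mathcal{C}$, a bicolimit is an object $W$ of $\mathcal{C}$ with a pseudo natural transformation $\pi:F\Rightarrow\Delta_W$ to the constant 2-functor such that for every object $V$ the functor $(\circ\,\pi):Mor_{\mathcal{C}}(W,V)\to PseudoCone(F,V)$ is an equivalence of categories, where $PseudoCone(F,V)$ has as objects the pseudo natural transformations $F\Rightarrow\Delta_V$ and as morphisms the modifications. Theories. A theory $T$ is a category with objects $0,1,2,\dots$ in which $n$ is the product of $n$ copies of $1$, with chosen projections $pr_i:n\to 1$. Put $T(n)=Mor_T(n,1)$ (words of arity $n$). For a function $f:\{1,\dots,k\}\to\{1,\dots,\ell\}$ let $f':\ell\to k$ be the morphism with $pr_i f'=pr_{f(i)}$, and for $w\in T(k)$ put $w_f=w\circ f'\in T(\ell)$. For $w\in T(k)$, $w_i\in T(n_i)$ put $\gamma(w,w_1,\dots,w_k)=w\circ(w_1,\dots,w_k)\in T(n_1+\dots+n_k)$, where $(w_1,\dots,w_k):n_1+\dots+n_k\to k$ has $i$-th component $(w_i)_{\iota_i}$, $\iota_i$ being the inclusion onto the $i$-th block. The unit $1\in T(1)$ is the projection $pr_1:1\to1$. For a category $X$, $End(X)$ is the theory with $End(X)(n)=Functors(X^n,X)$;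 there $\gamma(F,F_1,\dots,F_k)=F\circ(F_1\times\dots\times F_k)$, $F_f(x_1,\dots,x_\ell)=F(x_{f1},\dots,x_{fk})$, and the unit is $1_X$; these operations also apply to natural transformations. Pseudo $T$-algebras. A pseudo $T$-algebra is a category $X$ with functions $\Phi:T(n)\to Functors(X^n,X)$ for all $n\ge 0$ and natural isomorphisms $c_{w,w_1,\dots,w_k}:\Phi(\gamma(w,w_1,\dots,w_k))\Rightarrow\gamma(\Phi(w),\Phi(w_1),\dots,\Phi(w_k))$, $I:\Phi(1)\Rightarrow 1_X$, $s_{w,f}:\Phi(w_f)\Rightarrow\Phi(w)_f$, such that (vertical composition written $\circ$, $i$ = identity 2-cell): (1) $\gamma(c_{w,w_1,\dots,w_k},i,\dots,i)\circ c_{\gamma(w,w_1,\dots,w_k),w_{11},\dots,w_{kn_k}}=\gamma(i_{\Phi(w)},c_{w_1,w_{11},\dots,w_{1n_1}},\dots,c_{w_k,w_{k1},\dots,w_{kn_k}})\circ c_{w,\gamma(w_1,w_{11},\dots),\dots,\gamma(w_k,w_{k1},\dots)}$; (2) $\gamma(i_{\Phi(w)},I,\dots,I)\circ c_{w,1,\dots,1}=i$; (3) $\gamma(I,i_{\Phi(w)})\circ c_{1,w}=i$; (4) for $f:\{1,\dots,k\}\to\{1,\dots,\ell\}$, $w\in T(k)$, $w_j\in T(n_j)$ ($1\le j\le\ell$), with $\bar f:\{1,\dots,n_{f1}+\dots+n_{fk}\}\to\{1,\dots,n_1+\dots+n_\ell\}$ carrying the $i$-th block identically onto the $f(i)$-th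 block: $(c_{w,w_{f1},\dots,w_{fk}})_{\bar f}\circ s_{\gamma(w,w_{f1},\dots,w_{fk}),\bar f}=\gamma(s_{w,f},i,\dots,i)\circ c_{w_f,w_1,\dots,w_\ell}$; (5) for functions $g_i:\{1,\dots,n_i\}\to\{1,\dots,n_i'\}$ with block sum $g=g_1+\dots+g_k$: $(c_{w,w_1,\dots,w_k})_g\circ s_{\gamma(w,w_1,\dots,w_k),g}=\gamma(i_{\Phi(w)},s_{w_1,g_1},\dots,s_{w_k,g_k})\circ c_{w,(w_1)_{g_1},\dots,(w_k)_{g_k}}$; (6) $(s_{w,f})_g\circ s_{w_f,g}=s_{w,g\circ f}$; (7) $s_{w,id}$ is the identity. A morphism $H:(X,\Phi)\to(Y,\Psi)$ of pseudo $T$-algebras is a functor with natural isomorphisms $\rho_w:H\circ\Phi(w)\Rightarrow\Psi(w)\circ(H,\dots,H)$ for all words $w$ such that $(c*i)\circ\rho_{\gamma(w,w_1,\dots,w_k)}=(i_{\Psi(w)}*(\rho_{w_1},\dots,\rho_{w_k}))\circ(\rho_w*i)\circ(i_H*c)$, $(I*i_H)\circ\rho_1=i_H*I$, and $(s_{w,f}*i)\circ\rho_{w_f}=(\rho_w)_f\circ(i_H*s_{w,f})$. Composites have $\rho^{HG}_w=(\rho^H_w*i)\circ(i_H*\rho^G_w)$. A 2-cell $\alpha:G\Rightarrow H$ is a natural transformation with $\rho^H_w\circ(\alpha*i_{\Phi(w)})=(i_{\Psi(w)}*(\alpha,\dots,\alpha))\circ\rho^G_w$ for all $w$. *)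

theory Defs
  imports Main "HOL-Library.FuncSet"
begin

unbundle cardinal_syntax

section \<open>Categories, functors, natural transformations\<close>

text \<open>
  \<^term>\<open>Comp C g f\<close> is the composite ``first f, then g''.  Functors and transformations are
  restricted to their domains (value \<^const>\<open>undefined\<close> outside), so that HOL equality of
  functors, transformations, cones etc. is the mathematical equality.  Category records (and
  pseudo algebras) are not normalised: two that differ only off their carriers are isomorphic.
\<close>

record ('o, 'a) cat =
  Obj :: "'o set"
  Arr :: "'a set"
  Dom :: "'a \<Rightarrow> 'o"
  Cod :: "'a \<Rightarrow> 'o"
  Id :: "'o \<Rightarrow> 'a"
  Comp :: "'a \<Rightarrow> 'a \<Rightarrow> 'a"

definition hom :: "('o, 'a, 'z) cat_scheme \<Rightarrow> 'o \<Rightarrow> 'o \<Rightarrow> 'a set" where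
  "hom C a b = {f \<in> Arr C. Dom C f = a \<and> Cod C f = b}"

locale category =
  fixes C :: "('o, 'a, 'z) cat_scheme"
  assumes Dom_closed: "f \<in> Arr C \<Longrightarrow> Dom C f \<in> Obj C"
    and Cod_closed: "f \<in> Arr C \<Longrightarrow> Cod C f \<in> Obj C"
    and Id_hom: "a \<in> Obj C \<Longrightarrow> Id C a \<in> hom C a a"
    and Comp_hom: "\<lbrakk>f \<in> hom C a b; g \<in> hom C b c\<rbrakk> \<Longrightarrow> Comp C g f \<in> hom C a c"
    and Comp_Id_right: "f \<in> hom C a b \<Longrightarrow> Comp C f (Id C a) = f"
    and Comp_Id_left: "f \<in> hom C a b \<Longrightarrow> Comp C (Id C b) f = f"
    and Comp_assoc: "\<lbrakk>f \<in> hom C a b; g \<in> hom C b c; h \<in> hom C c d\<rbrakk>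
      \<Longrightarrow> Comp C h (Comp C g f) = Comp C (Comp C h g) f"

definition iso_in :: "('o, 'a, 'z) cat_scheme \<Rightarrow> 'a \<Rightarrow> bool" where
  "iso_in C f \<longleftrightarrow> f \<in> Arr C \<and>
     (\<exists>g \<in> hom C (Cod C f) (Dom C f).
        Comp C g f = Id C (Dom C f) \<and> Comp C f g = Id C (Cod C f))"

record ('o1, 'a1, 'o2, 'a2) func =
  Src :: "('o1, 'a1) cat"
  Trg :: "('o2, 'a2) cat"
  OMap :: "'o1 \<Rightarrow> 'o2"
  AMap :: "'a1 \<Rightarrow> 'a2"

definition functors ::
    "('o1, 'a1) cat \<Rightarrow> ('o2, 'a2) cat \<Rightarrow> ('o1, 'a1, 'o2, 'a2) func set" where
  "functors C D = {F. Src F = C \<and> Trg F = D \<and>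
     OMap F \<in> Obj C \<rightarrow>\<^sub>E Obj D \<and> AMap F \<in> Arr C \<rightarrow>\<^sub>E Arr D \<and>
     (\<forall>f \<in> Arr C. AMap F f \<in> hom D (OMap F (Dom C f)) (OMap F (Cod C f))) \<and>
     (\<forall>a \<in> Obj C. AMap F (Id C a) = Id D (OMap F a)) \<and>
     (\<forall>f \<in> Arr C. \<forall>g \<in> Arr C. Dom C g = Cod C f \<longrightarrow>
        AMap F (Comp C g f) = Comp D (AMap F g) (AMap F f))}"

definition func_id :: "('o, 'a) cat \<Rightarrow> ('o, 'a, 'o, 'a) func" where
  "func_id C = \<lparr>Src = C, Trg = C, OMap = restrict (\<lambda>x. x) (Obj C), AMap = restrict (\<lambda>f. f) (Arr C)\<rparr>"

definition func_comp ::
    "('o2, 'a2, 'o3, 'a3) func \<Rightarrow> ('o1, 'a1, 'o2, 'a2) func \<Rightarrow> ('o1, 'a1, 'o3, 'a3) func" where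
  "func_comp G F = \<lparr>Src = Src F, Trg = Trg G,
     OMap = restrict (\<lambda>x. OMap G (OMap F x)) (Obj (Src F)),
     AMap = restrict (\<lambda>f. AMap G (AMap F f)) (Arr (Src F))\<rparr>"

record ('o1, 'a1, 'o2, 'a2) ntrans =
  NSrc :: "('o1, 'a1, 'o2, 'a2) func"
  NTrg :: "('o1, 'a1, 'o2, 'a2) func"
  NComp :: "'o1 \<Rightarrow> 'a2"

definition nat_transs ::
    "('o1, 'a1, 'o2, 'a2) func \<Rightarrow> ('o1, 'a1, 'o2, 'a2) func \<Rightarrow> ('o1, 'a1, 'o2, 'a2) ntrans set" where
  "nat_transs F G = {\<eta>. NSrc \<eta> = F \<and> NTrg \<eta> = G \<and> Src F = Src G \<and> Trg F = Trg G \<and>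
     NComp \<eta> \<in> extensional (Obj (Src F)) \<and>
     (\<forall>x \<in> Obj (Src F). NComp \<eta> x \<in> hom (Trg F) (OMap F x) (OMap G x)) \<and>
     (\<forall>f \<in> Arr (Src F). Comp (Trg F) (NComp \<eta> (Cod (Src F) f)) (AMap F f)
                       = Comp (Trg F) (AMap G f) (NComp \<eta> (Dom (Src F) f)))}"

definition nat_isos ::
    "('o1, 'a1, 'o2, 'a2) func \<Rightarrow> ('o1, 'a1, 'o2, 'a2) func \<Rightarrow> ('o1, 'a1, 'o2, 'a2) ntrans set" where
  "nat_isos F G = {\<eta> \<in> nat_transs F G. \<forall>x \<in> Obj (Src F). iso_in (Trg F) (NComp \<eta> x)}"

definition nat_id :: "('o1, 'a1, 'o2, 'a2) func \<Rightarrow> ('o1, 'a1, 'o2, 'a2) ntrans" where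
  "nat_id F = \<lparr>NSrc = F, NTrg = F,
     NComp = restrict (\<lambda>x. Id (Trg F) (OMap F x)) (Obj (Src F))\<rparr>"

definition nat_vcomp ::
    "('o1, 'a1, 'o2, 'a2) ntrans \<Rightarrow> ('o1, 'a1, 'o2, 'a2) ntrans \<Rightarrow> ('o1, 'a1, 'o2, 'a2) ntrans"
    (infixl "\<circ>\<^sub>v" 65) where
  "\<beta> \<circ>\<^sub>v \<alpha> = \<lparr>NSrc = NSrc \<alpha>, NTrg = NTrg \<beta>,
     NComp = restrict (\<lambda>x. Comp (Trg (NSrc \<alpha>)) (NComp \<beta> x) (NComp \<alpha> x)) (Obj (Src (NSrc \<alpha>)))\<rparr>"

definition nat_hcomp ::
    "('o2, 'a2, 'o3, 'a3) ntrans \<Rightarrow> ('o1, 'a1, 'o2, 'a2) ntrans \<Rightarrow> ('o1, 'a1, 'o3, 'a3) ntrans"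
    (infixl "\<star>" 70) where
  "\<beta> \<star> \<alpha> = \<lparr>NSrc = func_comp (NSrc \<beta>) (NSrc \<alpha>), NTrg = func_comp (NTrg \<beta>) (NTrg \<alpha>),
     NComp = restrict (\<lambda>x. Comp (Trg (NSrc \<beta>)) (NComp \<beta> (OMap (NTrg \<alpha>) x)) (AMap (NSrc \<beta>) (NComp \<alpha> x)))
       (Obj (Src (NSrc \<alpha>)))\<rparr>"

definition equivalence_of_cats ::
    "('o1, 'a1) cat \<Rightarrow> ('o2, 'a2) cat \<Rightarrow> ('o1, 'a1, 'o2, 'a2) func \<Rightarrow> bool" where
  "equivalence_of_cats C D F \<longleftrightarrow> F \<in> functors C D \<and>
     (\<exists>G \<in> functors D C. nat_isos (func_id C) (func_comp G F) \<noteq> {} \<and>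
                          nat_isos (func_comp F G) (func_id D) \<noteq> {})"


section \<open>Smallness\<close>

text \<open>
  HOL has no class of all small sets.  A universe is modelled by a type 'u whose cardinality
  is uncountable and regular; a set is small when it has fewer elements than 'u.  A small
  category then has, up to renaming of objects and arrows, its objects and arrows in 'u.  The
  sets of a Grothendieck universe are the case where the cardinality of 'u is strongly
  inaccessible.
\<close>

definition universe :: "'u itself \<Rightarrow> bool" where
  "universe U \<longleftrightarrow> |UNIV :: nat set| <o |UNIV :: 'u set| \<and> regularCard |UNIV :: 'u set|"

definition small_set :: "'u itself \<Rightarrow> 'a set \<Rightarrow> bool" where
  "small_set U A \<longleftrightarrow> |A| <o |UNIV :: 'u set|"

definition small_cat :: "'u itself \<Rightarrow> ('o, 'a, 'z) cat_scheme \<Rightarrow> bool" where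
  "small_cat U C \<longleftrightarrow> small_set U (Obj C) \<and> small_set U (Arr C)"


section \<open>2-categories, pseudo functors and bicolimits\<close>

text \<open>
  The data of a (strict) 2-category: the underlying category of objects and 1-cells, the
  category of 1-cells and 2-cells under vertical composition, and the horizontal composition
  of 2-cells.
\<close>

record ('o, 'm, 'c) twocat =
  Und :: "('o, 'm) cat"
  Vert :: "('m, 'c) cat"
  HComp :: "'c \<Rightarrow> 'c \<Rightarrow> 'c"

abbreviation comp1 :: "('o, 'm, 'c) twocat \<Rightarrow> 'm \<Rightarrow> 'm \<Rightarrow> 'm" where
  "comp1 K \<equiv> Comp (Und K)"

abbreviation vcomp :: "('o, 'm, 'c) twocat \<Rightarrow> 'c \<Rightarrow> 'c \<Rightarrow> 'c" where
  "vcomp K \<equiv> Comp (Vert K)"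

abbreviation id2 :: "('o, 'm, 'c) twocat \<Rightarrow> 'm \<Rightarrow> 'c" where
  "id2 K \<equiv> Id (Vert K)"

definition Mor :: "('o, 'm, 'c) twocat \<Rightarrow> 'o \<Rightarrow> 'o \<Rightarrow> ('m, 'c) cat" where
  "Mor K A B = \<lparr>Obj = hom (Und K) A B,
     Arr = {\<alpha> \<in> Arr (Vert K). Dom (Vert K) \<alpha> \<in> hom (Und K) A B \<and> Cod (Vert K) \<alpha> \<in> hom (Und K) A B},
     Dom = Dom (Vert K), Cod = Cod (Vert K), Id = Id (Vert K), Comp = Comp (Vert K)\<rparr>"

definition inv_2cells :: "('o, 'm, 'c) twocat \<Rightarrow> 'm \<Rightarrow> 'm \<Rightarrow> 'c set" where
  "inv_2cells K f g = {\<alpha> \<in> hom (Vert K) f g. iso_in (Vert K) \<alpha>}"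

text \<open>
  A pseudo functor has coherence cells
  \<^term>\<open>PUnit F j\<close> from the identity of \<^term>\<open>PObj F j\<close> to the image of the identity of j, and
  \<^term>\<open>PComp F g f\<close> from the composite of the images of g and f to the image of the composite.
  Since the domain is a 1-category, there are no naturality conditions on coherence cells.
\<close>

record ('jo, 'ja, 'o, 'm, 'c) psfun =
  PObj :: "'jo \<Rightarrow> 'o"
  PArr :: "'ja \<Rightarrow> 'm"
  PUnit :: "'jo \<Rightarrow> 'c"
  PComp :: "'ja \<Rightarrow> 'ja \<Rightarrow> 'c"

locale pseudo_functor =
  fixes J :: "('jo, 'ja) cat" and K :: "('o, 'm, 'c) twocat" and F :: "('jo, 'ja, 'o, 'm, 'c) psfun"
  assumes PObj_closed: "j \<in> Obj J \<Longrightarrow> PObj F j \<in> Obj (Und K)"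
    and PArr_hom: "f \<in> hom J a b \<Longrightarrow> PArr F f \<in> hom (Und K) (PObj F a) (PObj F b)"
    and PUnit_cell: "j \<in> Obj J \<Longrightarrow>
      PUnit F j \<in> inv_2cells K (Id (Und K) (PObj F j)) (PArr F (Id J j))"
    and PComp_cell: "\<lbrakk>f \<in> hom J a b; g \<in> hom J b c\<rbrakk> \<Longrightarrow>
      PComp F g f \<in> inv_2cells K (comp1 K (PArr F g) (PArr F f)) (PArr F (Comp J g f))"
    and unit_right: "f \<in> hom J a b \<Longrightarrow>
      vcomp K (PComp F f (Id J a)) (HComp K (id2 K (PArr F f)) (PUnit F a)) = id2 K (PArr F f)"
    and unit_left: "f \<in> hom J a b \<Longrightarrow>
      vcomp K (PComp F (Id J b) f) (HComp K (PUnit F b) (id2 K (PArr F f))) = id2 K (PArr F f)"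
    and assoc: "\<lbrakk>f \<in> hom J a b; g \<in> hom J b c; h \<in> hom J c d\<rbrakk> \<Longrightarrow>
      vcomp K (PComp F (Comp J h g) f) (HComp K (PComp F h g) (id2 K (PArr F f)))
      = vcomp K (PComp F h (Comp J g f)) (HComp K (id2 K (PArr F h)) (PComp F g f))"

definition const_psfun :: "('o, 'm, 'c) twocat \<Rightarrow> 'o \<Rightarrow> ('jo, 'ja, 'o, 'm, 'c) psfun" where
  "const_psfun K W = \<lparr>PObj = (\<lambda>j. W), PArr = (\<lambda>f. Id (Und K) W),
     PUnit = (\<lambda>j. id2 K (Id (Und K) W)), PComp = (\<lambda>g f. id2 K (Id (Und K) W))\<rparr>"

text \<open>
  For \<^term>\<open>f \<in> hom J a b\<close>, the coherence cell \<^term>\<open>TArr \<alpha> f\<close> of a pseudo natural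
  transformation from F to G goes from ``G f after the component at a'' to ``the component at b after F f''.
\<close>

record ('jo, 'ja, 'm, 'c) psnat =
  TObj :: "'jo \<Rightarrow> 'm"
  TArr :: "'ja \<Rightarrow> 'c"

definition psnats ::
    "('jo, 'ja) cat \<Rightarrow> ('o, 'm, 'c) twocat \<Rightarrow> ('jo, 'ja, 'o, 'm, 'c) psfun \<Rightarrow>
     ('jo, 'ja, 'o, 'm, 'c) psfun \<Rightarrow> ('jo, 'ja, 'm, 'c) psnat set" where
  "psnats J K F G = {\<alpha>.
     TObj \<alpha> \<in> extensional (Obj J) \<and> TArr \<alpha> \<in> extensional (Arr J) \<and>
     (\<forall>j \<in> Obj J. TObj \<alpha> j \<in> hom (Und K) (PObj F j) (PObj G j)) \<and>
     (\<forall>f \<in> Arr J. TArr \<alpha> f \<in> inv_2cells K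
        (comp1 K (PArr G f) (TObj \<alpha> (Dom J f))) (comp1 K (TObj \<alpha> (Cod J f)) (PArr F f))) \<and>
     (\<forall>j \<in> Obj J.
        vcomp K (TArr \<alpha> (Id J j)) (HComp K (PUnit G j) (id2 K (TObj \<alpha> j)))
        = HComp K (id2 K (TObj \<alpha> j)) (PUnit F j)) \<and>
     (\<forall>f \<in> Arr J. \<forall>g \<in> Arr J. Dom J g = Cod J f \<longrightarrow>
        vcomp K (TArr \<alpha> (Comp J g f)) (HComp K (PComp G g f) (id2 K (TObj \<alpha> (Dom J f))))
        = vcomp K (HComp K (id2 K (TObj \<alpha> (Cod J g))) (PComp F g f))
            (vcomp K (HComp K (TArr \<alpha> g) (id2 K (PArr F f)))
                     (HComp K (id2 K (PArr G g)) (TArr \<alpha> f))))}"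

record ('jo, 'ja, 'm, 'c) modif =
  MoSrc :: "('jo, 'ja, 'm, 'c) psnat"
  MoTrg :: "('jo, 'ja, 'm, 'c) psnat"
  MoComp :: "'jo \<Rightarrow> 'c"

definition modifs ::
    "('jo, 'ja) cat \<Rightarrow> ('o, 'm, 'c) twocat \<Rightarrow> ('jo, 'ja, 'o, 'm, 'c) psfun \<Rightarrow>
     ('jo, 'ja, 'o, 'm, 'c) psfun \<Rightarrow> ('jo, 'ja, 'm, 'c) modif set" where
  "modifs J K F G = {\<Xi>.
     MoSrc \<Xi> \<in> psnats J K F G \<and> MoTrg \<Xi> \<in> psnats J K F G \<and>
     MoComp \<Xi> \<in> extensional (Obj J) \<and>
     (\<forall>j \<in> Obj J. MoComp \<Xi> j \<in> hom (Vert K) (TObj (MoSrc \<Xi>) j) (TObj (MoTrg \<Xi>) j)) \<and>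
     (\<forall>f \<in> Arr J.
        vcomp K (HComp K (MoComp \<Xi> (Cod J f)) (id2 K (PArr F f))) (TArr (MoSrc \<Xi>) f)
        = vcomp K (TArr (MoTrg \<Xi>) f) (HComp K (id2 K (PArr G f)) (MoComp \<Xi> (Dom J f))))}"

definition psnat_cat ::
    "('jo, 'ja) cat \<Rightarrow> ('o, 'm, 'c) twocat \<Rightarrow> ('jo, 'ja, 'o, 'm, 'c) psfun \<Rightarrow>
     ('jo, 'ja, 'o, 'm, 'c) psfun \<Rightarrow>
     (('jo, 'ja, 'm, 'c) psnat, ('jo, 'ja, 'm, 'c) modif) cat" where
  "psnat_cat J K F G = \<lparr>Obj = psnats J K F G, Arr = modifs J K F G, Dom = MoSrc, Cod = MoTrg,
     Id = (\<lambda>\<alpha>. \<lparr>MoSrc = \<alpha>, MoTrg = \<alpha>, MoComp = restrict (\<lambda>j. id2 K (TObj \<alpha> j)) (Obj J)\<rparr>),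
     Comp = (\<lambda>\<Theta> \<Xi>. \<lparr>MoSrc = MoSrc \<Xi>, MoTrg = MoTrg \<Theta>,
        MoComp = restrict (\<lambda>j. vcomp K (MoComp \<Theta> j) (MoComp \<Xi> j)) (Obj J)\<rparr>)\<rparr>"

definition pseudo_cone_cat ::
    "('jo, 'ja) cat \<Rightarrow> ('o, 'm, 'c) twocat \<Rightarrow> ('jo, 'ja, 'o, 'm, 'c) psfun \<Rightarrow> 'o \<Rightarrow>
     (('jo, 'ja, 'm, 'c) psnat, ('jo, 'ja, 'm, 'c) modif) cat" where
  "pseudo_cone_cat J K F V = psnat_cat J K F (const_psfun K V)"

definition cone_postcomp ::
    "('jo, 'ja) cat \<Rightarrow> ('o, 'm, 'c) twocat \<Rightarrow> ('jo, 'ja, 'm, 'c) psnat \<Rightarrow> 'm \<Rightarrow>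
     ('jo, 'ja, 'm, 'c) psnat" where
  "cone_postcomp J K \<pi> b = \<lparr>TObj = restrict (\<lambda>j. comp1 K b (TObj \<pi> j)) (Obj J),
     TArr = restrict (\<lambda>f. HComp K (id2 K b) (TArr \<pi> f)) (Arr J)\<rparr>"

definition cone_functor ::
    "('jo, 'ja) cat \<Rightarrow> ('o, 'm, 'c) twocat \<Rightarrow> ('jo, 'ja, 'o, 'm, 'c) psfun \<Rightarrow> 'o \<Rightarrow>
     ('jo, 'ja, 'm, 'c) psnat \<Rightarrow> 'o \<Rightarrow>
     ('m, 'c, ('jo, 'ja, 'm, 'c) psnat, ('jo, 'ja, 'm, 'c) modif) func" where
  "cone_functor J K F W \<pi> V = \<lparr>Src = Mor K W V, Trg = pseudo_cone_cat J K F V,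
     OMap = restrict (cone_postcomp J K \<pi>) (Obj (Mor K W V)),
     AMap = restrict (\<lambda>\<beta>. \<lparr>MoSrc = cone_postcomp J K \<pi> (Dom (Vert K) \<beta>),
                            MoTrg = cone_postcomp J K \<pi> (Cod (Vert K) \<beta>),
                            MoComp = restrict (\<lambda>j. HComp K \<beta> (id2 K (TObj \<pi> j))) (Obj J)\<rparr>)
                     (Arr (Mor K W V))\<rparr>"

definition bicolimit ::
    "('jo, 'ja) cat \<Rightarrow> ('o, 'm, 'c) twocat \<Rightarrow> ('jo, 'ja, 'o, 'm, 'c) psfun \<Rightarrow> 'o \<Rightarrow>
     ('jo, 'ja, 'm, 'c) psnat \<Rightarrow> bool" where
  "bicolimit J K F W \<pi> \<longleftrightarrow> W \<in> Obj (Und K) \<and> \<pi> \<in> psnats J K F (const_psfun K W) \<and>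
     (\<forall>V \<in> Obj (Und K).
        equivalence_of_cats (Mor K W V) (pseudo_cone_cat J K F V) (cone_functor J K F W \<pi> V))"


section \<open>Finite functions\<close>

text \<open>
  A function from a k-element index set to an l-element index set is encoded by the list of
  its values, indices counted from 0; the number l is carried separately.
\<close>

definition fin_fun :: "nat \<Rightarrow> nat \<Rightarrow> nat list \<Rightarrow> bool" where
  "fin_fun k l f \<longleftrightarrow> length f = k \<and> set f \<subseteq> {..<l}"

definition offset :: "nat list \<Rightarrow> nat \<Rightarrow> nat" where
  "offset ns i = sum_list (take i ns)"

text \<open>The inclusion onto the i-th block of a sum of finite index sets.\<close>

definition incl :: "nat list \<Rightarrow> nat \<Rightarrow> nat list" where
  "incl ns i = [offset ns i ..< offset ns i + ns ! i]"

text \<open>The function called f bar in the axioms: the i-th block goes identically onto the f(i)-th.\<close>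

definition block_fun :: "nat list \<Rightarrow> nat list \<Rightarrow> nat list" where
  "block_fun ns f = concat (map (incl ns) f)"

text \<open>The block sum of the gs, the i-th of which takes values in an index set of size ns ! i.\<close>

definition block_sum :: "nat list \<Rightarrow> nat list list \<Rightarrow> nat list" where
  "block_sum ns gs = concat (map (\<lambda>i. map (\<lambda>x. offset ns i + x) (gs ! i)) [0..<length gs])"

fun split_blocks :: "nat list \<Rightarrow> 'a list \<Rightarrow> 'a list list" where
  "split_blocks [] xs = []"
| "split_blocks (n # ns) xs = take n xs # split_blocks ns (drop n xs)"


section \<open>Theories\<close>

text \<open>\<^term>\<open>Pr T n i\<close> is the i-th of the n chosen projections, i counted from 0.\<close>

record 't thy = "(nat, 't) cat" +
  Pr :: "nat \<Rightarrow> nat \<Rightarrow> 't"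

locale lawvere_theory = category T
  for T :: "'t thy" +
  assumes Obj_UNIV: "Obj T = UNIV"
    and Pr_hom: "i < n \<Longrightarrow> Pr T n i \<in> hom T n 1"
    and product: "\<lbrakk>length fs = n; \<And>i. i < n \<Longrightarrow> fs ! i \<in> hom T m 1\<rbrakk> \<Longrightarrow>
      \<exists>!f. f \<in> hom T m n \<and> (\<forall>i<n. Comp T (Pr T n i) f = fs ! i)"

definition words :: "'t thy \<Rightarrow> nat \<Rightarrow> 't set" where
  "words T n = hom T n 1"

definition tuple :: "'t thy \<Rightarrow> nat \<Rightarrow> 't list \<Rightarrow> 't" where
  "tuple T m fs = (THE f. f \<in> hom T m (length fs) \<and>
     (\<forall>i<length fs. Comp T (Pr T (length fs) i) f = fs ! i))"

text \<open>\<^term>\<open>subst_word T l w f\<close> is the word of arity l obtained from w by the substitution f.\<close>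

definition subst_word :: "'t thy \<Rightarrow> nat \<Rightarrow> 't \<Rightarrow> nat list \<Rightarrow> 't" where
  "subst_word T l w f = Comp T w (tuple T l (map (Pr T l) f))"

definition gam :: "'t thy \<Rightarrow> 't \<Rightarrow> 't list \<Rightarrow> 't" where
  "gam T w ws = (let ns = map (Dom T) ws; N = sum_list ns in
     Comp T w (tuple T N (map (\<lambda>i. subst_word T N (ws ! i) (incl ns i)) [0..<length ws])))"

definition word1 :: "'t thy \<Rightarrow> 't" where
  "word1 T = Pr T 1 0"


section \<open>The endomorphism theory of a category\<close>

text \<open>
  Powers of categories are encoded by lists.  In \<^term>\<open>func_prod X Y ns Fs\<close> the i-th functor
  goes from the power of X with exponent ns ! i to Y, and the product functor goes from the power of
  X with exponent \<^term>\<open>sum_list ns\<close> to the power of Y with exponent \<^term>\<open>length ns\<close>.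
\<close>

definition pow_cat :: "('o, 'a) cat \<Rightarrow> nat \<Rightarrow> ('o list, 'a list) cat" where
  "pow_cat X n = \<lparr>Obj = {xs. length xs = n \<and> set xs \<subseteq> Obj X},
     Arr = {fs. length fs = n \<and> set fs \<subseteq> Arr X},
     Dom = map (Dom X), Cod = map (Cod X), Id = map (Id X), Comp = map2 (Comp X)\<rparr>"

definition func_pow :: "('o1, 'a1, 'o2, 'a2) func \<Rightarrow> nat \<Rightarrow>
    ('o1 list, 'a1 list, 'o2 list, 'a2 list) func" where
  "func_pow H n = \<lparr>Src = pow_cat (Src H) n, Trg = pow_cat (Trg H) n,
     OMap = restrict (map (OMap H)) (Obj (pow_cat (Src H) n)),
     AMap = restrict (map (AMap H)) (Arr (pow_cat (Src H) n))\<rparr>"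

definition nat_pow :: "('o1, 'a1, 'o2, 'a2) ntrans \<Rightarrow> nat \<Rightarrow>
    ('o1 list, 'a1 list, 'o2 list, 'a2 list) ntrans" where
  "nat_pow \<alpha> n = \<lparr>NSrc = func_pow (NSrc \<alpha>) n, NTrg = func_pow (NTrg \<alpha>) n,
     NComp = restrict (map (NComp \<alpha>)) (Obj (pow_cat (Src (NSrc \<alpha>)) n))\<rparr>"

definition func_prod :: "('o1, 'a1) cat \<Rightarrow> ('o2, 'a2) cat \<Rightarrow> nat list \<Rightarrow>
    ('o1 list, 'a1 list, 'o2, 'a2) func list \<Rightarrow> ('o1 list, 'a1 list, 'o2 list, 'a2 list) func" where
  "func_prod X Y ns Fs = \<lparr>Src = pow_cat X (sum_list ns), Trg = pow_cat Y (length ns),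
     OMap = restrict (\<lambda>xs. map2 OMap Fs (split_blocks ns xs)) (Obj (pow_cat X (sum_list ns))),
     AMap = restrict (\<lambda>fs. map2 AMap Fs (split_blocks ns fs)) (Arr (pow_cat X (sum_list ns)))\<rparr>"

definition nat_prod :: "('o1, 'a1) cat \<Rightarrow> ('o2, 'a2) cat \<Rightarrow> nat list \<Rightarrow>
    ('o1 list, 'a1 list, 'o2, 'a2) ntrans list \<Rightarrow> ('o1 list, 'a1 list, 'o2 list, 'a2 list) ntrans" where
  "nat_prod X Y ns \<alpha>s = \<lparr>NSrc = func_prod X Y ns (map NSrc \<alpha>s), NTrg = func_prod X Y ns (map NTrg \<alpha>s),
     NComp = restrict (\<lambda>xs. map2 NComp \<alpha>s (split_blocks ns xs)) (Obj (pow_cat X (sum_list ns)))\<rparr>"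

text \<open>The operations of End(X), on functors and on natural transformations.\<close>

definition end_gam :: "('o, 'a) cat \<Rightarrow> nat list \<Rightarrow> ('o list, 'a list, 'o, 'a) func \<Rightarrow>
    ('o list, 'a list, 'o, 'a) func list \<Rightarrow> ('o list, 'a list, 'o, 'a) func" where
  "end_gam X ns F Fs = func_comp F (func_prod X X ns Fs)"

definition end_gam_nat :: "('o, 'a) cat \<Rightarrow> nat list \<Rightarrow> ('o list, 'a list, 'o, 'a) ntrans \<Rightarrow>
    ('o list, 'a list, 'o, 'a) ntrans list \<Rightarrow> ('o list, 'a list, 'o, 'a) ntrans" where
  "end_gam_nat X ns \<alpha> \<alpha>s = \<alpha> \<star> nat_prod X X ns \<alpha>s"

definition reindex :: "('o, 'a) cat \<Rightarrow> nat \<Rightarrow> nat list \<Rightarrow> ('o list, 'a list, 'o list, 'a list) func" where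
  "reindex X l f = \<lparr>Src = pow_cat X l, Trg = pow_cat X (length f),
     OMap = restrict (\<lambda>xs. map ((!) xs) f) (Obj (pow_cat X l)),
     AMap = restrict (\<lambda>xs. map ((!) xs) f) (Arr (pow_cat X l))\<rparr>"

definition end_subst :: "('o, 'a) cat \<Rightarrow> nat \<Rightarrow> ('o list, 'a list, 'o2, 'a2) func \<Rightarrow> nat list \<Rightarrow>
    ('o list, 'a list, 'o2, 'a2) func" where
  "end_subst X l F f = func_comp F (reindex X l f)"

definition end_subst_nat :: "('o, 'a) cat \<Rightarrow> nat \<Rightarrow> ('o list, 'a list, 'o2, 'a2) ntrans \<Rightarrow> nat list \<Rightarrow>
    ('o list, 'a list, 'o2, 'a2) ntrans" where
  "end_subst_nat X l \<alpha> f = \<alpha> \<star> nat_id (reindex X l f)"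

text \<open>The identity functor of X, as a functor from the first power of X (lists of length 1) to X.\<close>

definition end_unit :: "('o, 'a) cat \<Rightarrow> ('o list, 'a list, 'o, 'a) func" where
  "end_unit X = \<lparr>Src = pow_cat X 1, Trg = X,
     OMap = restrict hd (Obj (pow_cat X 1)), AMap = restrict hd (Arr (pow_cat X 1))\<rparr>"


section \<open>The 2-category of small pseudo algebras\<close>

record ('t, 'o, 'a) palg =
  Cat :: "('o, 'a) cat"
  Phi :: "'t \<Rightarrow> ('o list, 'a list, 'o, 'a) func"
  CC :: "'t \<Rightarrow> 't list \<Rightarrow> ('o list, 'a list, 'o, 'a) ntrans"
  CI :: "('o list, 'a list, 'o, 'a) ntrans"
  CS :: "'t \<Rightarrow> nat \<Rightarrow> nat list \<Rightarrow> ('o list, 'a list, 'o, 'a) ntrans"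

text \<open>
  The arity of a word w is \<^term>\<open>Dom T w\<close>.  \<^term>\<open>CS A w l f\<close> is the coherence
  isomorphism for the substitution f with values below l.
\<close>

locale pseudo_algebra =
  fixes T :: "'t thy" and A :: "('t, 'o, 'a) palg"
  assumes Cat: "category (Cat A)"
    and Phi: "w \<in> words T n \<Longrightarrow> Phi A w \<in> functors (pow_cat (Cat A) n) (Cat A)"
    and CC: "\<lbrakk>w \<in> words T (length ws); \<And>v. v \<in> set ws \<Longrightarrow> v \<in> words T (Dom T v)\<rbrakk> \<Longrightarrow>
      CC A w ws \<in> nat_isos (Phi A (gam T w ws))
        (end_gam (Cat A) (map (Dom T) ws) (Phi A w) (map (Phi A) ws))"
    and CI: "CI A \<in> nat_isos (Phi A (word1 T)) (end_unit (Cat A))"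
    and CS: "\<lbrakk>w \<in> words T k; fin_fun k l f\<rbrakk> \<Longrightarrow>
      CS A w l f \<in> nat_isos (Phi A (subst_word T l w f)) (end_subst (Cat A) l (Phi A w) f)"
    and CC_assoc: "\<lbrakk>w \<in> words T (length ws); length wss = length ws;
        \<And>i. i < length ws \<Longrightarrow> ws ! i \<in> words T (length (wss ! i));
        \<And>v. v \<in> set (concat wss) \<Longrightarrow> v \<in> words T (Dom T v)\<rbrakk> \<Longrightarrow>
      end_gam_nat (Cat A) (map (Dom T) (concat wss)) (CC A w ws)
          (map (\<lambda>v. nat_id (Phi A v)) (concat wss))
        \<circ>\<^sub>v CC A (gam T w ws) (concat wss)
      = end_gam_nat (Cat A) (map (\<lambda>vs. sum_list (map (Dom T) vs)) wss) (nat_id (Phi A w))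
          (map2 (CC A) ws wss)
        \<circ>\<^sub>v CC A w (map2 (gam T) ws wss)"
    and CC_unit_right: "w \<in> words T k \<Longrightarrow>
      end_gam_nat (Cat A) (replicate k 1) (nat_id (Phi A w)) (replicate k (CI A))
        \<circ>\<^sub>v CC A w (replicate k (word1 T)) = nat_id (Phi A w)"
    and CC_unit_left: "w \<in> words T k \<Longrightarrow>
      end_gam_nat (Cat A) [k] (CI A) [nat_id (Phi A w)] \<circ>\<^sub>v CC A (word1 T) [w] = nat_id (Phi A w)"
    and CC_CS_outer: "\<lbrakk>w \<in> words T k; fin_fun k (length ws) f;
        \<And>v. v \<in> set ws \<Longrightarrow> v \<in> words T (Dom T v);
        ns = map (Dom T) ws; ws\<^sub>f = map ((!) ws) f\<rbrakk> \<Longrightarrow>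
      end_subst_nat (Cat A) (sum_list ns) (CC A w ws\<^sub>f) (block_fun ns f)
        \<circ>\<^sub>v CS A (gam T w ws\<^sub>f) (sum_list ns) (block_fun ns f)
      = end_gam_nat (Cat A) ns (CS A w (length ws) f) (map (\<lambda>v. nat_id (Phi A v)) ws)
        \<circ>\<^sub>v CC A (subst_word T (length ws) w f) ws"
    and CC_CS_inner: "\<lbrakk>w \<in> words T k; length ws = k; length gs = k; length ns' = k;
        \<And>i. i < k \<Longrightarrow> ws ! i \<in> words T (Dom T (ws ! i));
        \<And>i. i < k \<Longrightarrow> fin_fun (Dom T (ws ! i)) (ns' ! i) (gs ! i);
        g = block_sum ns' gs\<rbrakk> \<Longrightarrow>
      end_subst_nat (Cat A) (sum_list ns') (CC A w ws) g
        \<circ>\<^sub>v CS A (gam T w ws) (sum_list ns') g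
      = end_gam_nat (Cat A) ns' (nat_id (Phi A w))
          (map (\<lambda>i. CS A (ws ! i) (ns' ! i) (gs ! i)) [0..<k])
        \<circ>\<^sub>v CC A w (map (\<lambda>i. subst_word T (ns' ! i) (ws ! i) (gs ! i)) [0..<k])"
    and CS_comp: "\<lbrakk>w \<in> words T k; fin_fun k l f; fin_fun l m g\<rbrakk> \<Longrightarrow>
      end_subst_nat (Cat A) m (CS A w l f) g \<circ>\<^sub>v CS A (subst_word T l w f) m g
      = CS A w m (map ((!) g) f)"
    and CS_id: "w \<in> words T k \<Longrightarrow> CS A w k [0..<k] = nat_id (Phi A w)"

record ('t, 'o, 'a) pmor =
  MSrc :: "('t, 'o, 'a) palg"
  MTrg :: "('t, 'o, 'a) palg"
  MFun :: "('o, 'a, 'o, 'a) func"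
  MRho :: "'t \<Rightarrow> ('o list, 'a list, 'o, 'a) ntrans"

locale pseudo_algebra_mor =
  fixes T :: "'t thy" and H :: "('t, 'o, 'a) pmor"
  fixes A B X Y
  defines "A \<equiv> MSrc H" and "B \<equiv> MTrg H" and "X \<equiv> Cat A" and "Y \<equiv> Cat B"
  assumes MFun: "MFun H \<in> functors X Y"
    and MRho_extensional: "MRho H \<in> extensional (\<Union>n. words T n)"
    and MRho: "w \<in> words T n \<Longrightarrow>
      MRho H w \<in> nat_isos (func_comp (MFun H) (Phi A w)) (func_comp (Phi B w) (func_pow (MFun H) n))"
    and MRho_CC: "\<lbrakk>w \<in> words T (length ws); \<And>v. v \<in> set ws \<Longrightarrow> v \<in> words T (Dom T v);
        ns = map (Dom T) ws\<rbrakk> \<Longrightarrow>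
      (CC B w ws \<star> nat_id (func_pow (MFun H) (sum_list ns))) \<circ>\<^sub>v MRho H (gam T w ws)
      = (nat_id (Phi B w) \<star> nat_prod X Y ns (map (MRho H) ws))
        \<circ>\<^sub>v (MRho H w \<star> nat_id (func_prod X X ns (map (Phi A) ws)))
        \<circ>\<^sub>v (nat_id (MFun H) \<star> CC A w ws)"
    and MRho_CI: "(CI B \<star> nat_id (func_pow (MFun H) 1)) \<circ>\<^sub>v MRho H (word1 T)
      = nat_id (MFun H) \<star> CI A"
    and MRho_CS: "\<lbrakk>w \<in> words T k; fin_fun k l f\<rbrakk> \<Longrightarrow>
      (CS B w l f \<star> nat_id (func_pow (MFun H) l)) \<circ>\<^sub>v MRho H (subst_word T l w f)
      = end_subst_nat X l (MRho H w) f \<circ>\<^sub>v (nat_id (MFun H) \<star> CS A w l f)"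

definition pmor_id :: "'t thy \<Rightarrow> ('t, 'o, 'a) palg \<Rightarrow> ('t, 'o, 'a) pmor" where
  "pmor_id T A = \<lparr>MSrc = A, MTrg = A, MFun = func_id (Cat A),
     MRho = restrict (\<lambda>w. nat_id (Phi A w)) (\<Union>n. words T n)\<rparr>"

definition pmor_comp :: "'t thy \<Rightarrow> ('t, 'o, 'a) pmor \<Rightarrow> ('t, 'o, 'a) pmor \<Rightarrow> ('t, 'o, 'a) pmor" where
  "pmor_comp T H G = \<lparr>MSrc = MSrc G, MTrg = MTrg H, MFun = func_comp (MFun H) (MFun G),
     MRho = restrict (\<lambda>w. (MRho H w \<star> nat_id (func_pow (MFun G) (Dom T w)))
                            \<circ>\<^sub>v (nat_id (MFun H) \<star> MRho G w)) (\<Union>n. words T n)\<rparr>"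

record ('t, 'o, 'a) pcell =
  CSrc :: "('t, 'o, 'a) pmor"
  CTrg :: "('t, 'o, 'a) pmor"
  CNat :: "('o, 'a, 'o, 'a) ntrans"

definition pseudo_algebra_cells ::
    "'t thy \<Rightarrow> ('t, 'o, 'a) pmor \<Rightarrow> ('t, 'o, 'a) pmor \<Rightarrow> ('t, 'o, 'a) pcell set" where
  "pseudo_algebra_cells T G H = {\<alpha>. CSrc \<alpha> = G \<and> CTrg \<alpha> = H \<and>
     MSrc G = MSrc H \<and> MTrg G = MTrg H \<and> CNat \<alpha> \<in> nat_transs (MFun G) (MFun H) \<and>
     (\<forall>n. \<forall>w \<in> words T n.
        MRho H w \<circ>\<^sub>v (CNat \<alpha> \<star> nat_id (Phi (MSrc G) w))
        = (nat_id (Phi (MTrg G) w) \<star> nat_pow (CNat \<alpha>) n) \<circ>\<^sub>v MRho G w)}"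

definition small_palgs :: "'t thy \<Rightarrow> ('t, 'u, 'u) palg set" where
  "small_palgs T = {A. pseudo_algebra T A \<and> small_cat TYPE('u) (Cat A)}"

definition small_pmors :: "'t thy \<Rightarrow> ('t, 'u, 'u) pmor set" where
  "small_pmors T = {H. MSrc H \<in> small_palgs T \<and> MTrg H \<in> small_palgs T \<and> pseudo_algebra_mor T H}"

definition PsAlg :: "'t thy \<Rightarrow> (('t, 'u, 'u) palg, ('t, 'u, 'u) pmor, ('t, 'u, 'u) pcell) twocat" where
  "PsAlg T = \<lparr>
     Und = \<lparr>Obj = small_palgs T, Arr = small_pmors T, Dom = MSrc, Cod = MTrg,
            Id = pmor_id T, Comp = pmor_comp T\<rparr>,
     Vert = \<lparr>Obj = small_pmors T,
             Arr = (\<Union>G \<in> small_pmors T. \<Union>H \<in> small_pmors T. pseudo_algebra_cells T G H),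
             Dom = CSrc, Cod = CTrg,
             Id = (\<lambda>H. \<lparr>CSrc = H, CTrg = H, CNat = nat_id (MFun H)\<rparr>),
             Comp = (\<lambda>\<beta> \<alpha>. \<lparr>CSrc = CSrc \<alpha>, CTrg = CTrg \<beta>, CNat = CNat \<beta> \<circ>\<^sub>v CNat \<alpha>\<rparr>)\<rparr>,
     HComp = (\<lambda>\<beta> \<alpha>. \<lparr>CSrc = pmor_comp T (CSrc \<beta>) (CSrc \<alpha>), CTrg = pmor_comp T (CTrg \<beta>) (CTrg \<alpha>),
                       CNat = CNat \<beta> \<star> CNat \<alpha>\<rparr>)\<rparr>"

end

theory Submission
  imports Defs
begin

text \<open>The bicolimit is a term model. Its objects are the formal terms built by words of \<open>T\<close> from the
  objects of all \<open>F j\<close>. Its arrows are generated under composition and the operations of \<open>T\<close> by identities,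
  the arrows of all \<open>F j\<close>, and structural isomorphisms with their inverses: the coherences of a pseudo
  algebra, and those making each \<open>F j \<rightarrow> W\<close> a morphism and these morphisms a cone. Two parallel arrows are
  identified when they take the same value under every cone to every small pseudo algebra; hence every
  coherence axiom holds in \<open>W\<close>, since it holds in all of these algebras. Regularity and uncountability of
  the universe make \<open>W\<close> small. Evaluation factors each cone through \<open>W\<close>, strictly. A modification between
  two cones restricted along \<open>W\<close> has at most one extension to terms commuting with the operations, defined
  by recursion, and it is natural by induction on the generation of arrows. So restriction along the cone
  is surjective on objects and fully faithful.\<close>

section \<open>Small sets\<close>

text \<open>Terms are never identified: \<open>Op (gam T w ws) ts\<close> and
  \<open>Op w (evs T Op ws ts)\<close> stay different objects, joined only by \<open>gasc\<close>.
  This freeness makes evaluation strict and permits recursion on objects. The comparison of arrows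
  ranges over all cones to all small pseudo algebras, \<open>W\<close> included. That is not
  circular, since an arrow merely records a function of the cone, fixed before \<open>W\<close>
  exists as an algebra. The type of such records is large, but those generated from small data by
  finitary operations form a small set. As \<open>W\<close> must live on the same type
  \<open>'u\<close> as the given algebras, terms and arrows are coded there by injections. The other
  obstacle is formal. The axioms equate natural transformations whose end functors agree only by
  identities in \<open>T\<close> and by regroupings of lists. These equalities of functors are
  settled for any category with operations and coherence isomorphisms. Afterwards each axiom is a
  family of equations between arrows, and such an equation in \<open>W\<close> can be tested by
  evaluating both sides in every \<open>V\<close>.\<close>

lemma stable_universe:
  assumes "universe (U :: 'u itself)"
  shows "stable |UNIV :: 'u set|"
proof -
  \<comment> \<open>Uncountability gives an infinite cardinal, which
    \<open>regularCard_stable\<close> requires next to regularity.\<close>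
  have "natLeq \<le>o |UNIV :: 'u set|"
    using assms unfolding universe_def
    by (meson card_of_nat ordIso_symmetric ordIso_ordLess_trans ordLess_imp_ordLeq)
  then have "infinite (UNIV :: 'u set)" using infinite_iff_natLeq_ordLeq by blast
  then have "infinite (Field |UNIV :: 'u set| )" by (simp add: Field_card_of)
  moreover have "regularCard |UNIV :: 'u set|" using assms by (simp add: universe_def)
  ultimately show ?thesis by (intro regularCard_stable card_of_Card_order)
qed

lemma small_subset: "small_set U B \<Longrightarrow> A \<subseteq> B \<Longrightarrow> small_set U A"
  unfolding small_set_def by (meson card_of_mono1 ordLeq_ordLess_trans)

lemma small_image: "small_set U A \<Longrightarrow> small_set U (f ` A)"
  unfolding small_set_def by (meson card_of_image ordLeq_ordLess_trans)

lemma small_nat: "universe U \<Longrightarrow> small_set U (A :: nat set)"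
  unfolding universe_def small_set_def
  by (meson card_of_mono1 ordLeq_ordLess_trans subset_UNIV)

text \<open>Regularity enters here, in the form of stability (\<open>stable_UNION\<close>). The
  later smallness arguments for infinite families go through this lemma.\<close>

lemma small_UN:
  assumes "universe U" "small_set U A" "\<And>a. a \<in> A \<Longrightarrow> small_set U (B a)"
  shows "small_set U (\<Union>a\<in>A. B a)"
  using assms stable_universe[OF assms(1)] unfolding small_set_def by (auto intro!: stable_UNION)

lemma small_finite:
  assumes "universe U" "finite A"
  shows "small_set U A"
proof -
  obtain f and n :: nat where "A = f ` {i. i < n}"
    using assms(2) finite_imp_nat_seg_image_inj_on by metis
  then show ?thesis by (simp only: small_image small_nat[OF assms(1)])
qed

lemma small_Un:
  assumes "universe U" "small_set U A" "small_set U B"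
  shows "small_set U (A \<union> B)"
proof -
  \<comment> \<open>A binary union is written as a union indexed by \<open>bool\<close>, a finite
    and therefore small set.\<close>
  have "A \<union> B = (\<Union>b\<in>UNIV. if b then A else B)" by auto
  then show ?thesis using small_UN[OF assms(1) small_finite[OF assms(1) finite], of UNIV "\<lambda>b::bool. if b then A else B"] assms
    by simp
qed

lemma small_Sigma:
  assumes "universe U" "small_set U A" "\<And>a. a \<in> A \<Longrightarrow> small_set U (B a)"
  shows "small_set U (Sigma A B)"
proof -
  have "Sigma A B = (\<Union>a\<in>A. Pair a ` B a)" by auto
  then show ?thesis using assms by (auto intro!: small_UN small_image)
qed

text \<open>The lists of a fixed length are small by induction on the length. Joining the countably
  many lengths is where uncountability of the universe is needed: the index set \<open>nat\<close>
  has to be small.\<close>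

lemma small_lists:
  assumes U: "universe U" and A: "small_set U A"
  shows "small_set U (lists A)"
proof -
  have n: "small_set U {xs \<in> lists A. length xs = n}" for n
  proof (induction n)
    case 0
    have "{xs \<in> lists A. length xs = 0} = {[]}" by auto
    then show ?case using small_finite[OF U, of "{[]}"] by simp
  next
    case (Suc n)
    have "{xs \<in> lists A. length xs = Suc n} \<subseteq>
        (\<lambda>(x, xs). x # xs) ` (A \<times> {xs \<in> lists A. length xs = n})"
      by (auto simp: length_Suc_conv)
    moreover have "small_set U (A \<times> {xs \<in> lists A. length xs = n})"
      using Suc A U by (intro small_Sigma) auto
    ultimately show ?case using small_image small_subset by blast
  qed
  have "lists A = (\<Union>n. {xs \<in> lists A. length xs = n})" by auto
  also have "small_set U \<dots>" by (rule small_UN[OF U small_nat[OF U] n])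
  finally show ?thesis .
qed

text \<open>A common upper bound for \<open>Tm\<close> and \<open>Gen\<close>: an index
  \<open>p\<close> acts on lists of every length, and arities and composability are ignored, since
  only the size of the closure matters.\<close>

inductive_set finitary_closure :: "'a set \<Rightarrow> 'p set \<Rightarrow> ('p \<Rightarrow> 'a list \<Rightarrow> 'a) \<Rightarrow> 'a set"
  for B P h where
  base: "b \<in> B \<Longrightarrow> b \<in> finitary_closure B P h"
| step: "p \<in> P \<Longrightarrow> \<forall>x \<in> set xs. x \<in> finitary_closure B P h \<Longrightarrow> h p xs \<in> finitary_closure B P h"

text \<open>Operations take finite lists, so the closure is exhausted after countably many stages.
  Each stage adds the images of all lists over the previous one and is therefore small.\<close>

lemma small_finitary_closure:
  assumes U: "universe U" and B: "small_set U B" and P: "small_set U P"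
  shows "small_set U (finitary_closure B P h)"
proof -
  define S where "S = rec_nat B (\<lambda>_ X. X \<union> (\<lambda>(p, xs). h p xs) ` (P \<times> lists X))"
  have S0: "S 0 = B" and SS: "S (Suc n) = S n \<union> (\<lambda>(p, xs). h p xs) ` (P \<times> lists (S n))" for n
    by (simp_all add: S_def)
  have small: "small_set U (S n)" for n
    by (induction n) (auto simp: S0 SS B P U intro!: small_Un small_image small_Sigma small_lists)
  have mono: "S m \<subseteq> S n" if "m \<le> n" for m n
    using that by (induction rule: dec_induct) (auto simp: SS)
  \<comment> \<open>Finitely many arguments lie in a common stage, the maximum of theirs, because
    the stages increase.\<close>
  have stage: "\<exists>n. set xs \<subseteq> S n" if "\<forall>x\<in>set xs. \<exists>n. x \<in> S n" for xs
    using that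
  proof (induction xs)
    case (Cons x xs)
    then obtain m n where "x \<in> S m" "set xs \<subseteq> S n" by auto
    then have "set (x # xs) \<subseteq> S (max m n)"
      using mono[of m "max m n"] mono[of n "max m n"] by auto
    then show ?case by blast
  qed simp
  have "finitary_closure B P h \<subseteq> (\<Union>n. S n)"
  proof
    fix x assume "x \<in> finitary_closure B P h"
    then show "x \<in> (\<Union>n. S n)"
    proof induction
      case (base b)
      then show ?case using S0 by blast
    next
      case (step p xs)
      then obtain n where "set xs \<subseteq> S n" using stage[of xs] by auto
      then have "h p xs \<in> S (Suc n)" using step(1) by (auto simp: SS in_lists_conv_set intro!: image_eqI[of _ _ "(p, xs)"])
      then show ?case by blast
    qed
  qed
  then show ?thesis by (rule small_subset[rotated]) (simp add: small_UN U small_nat small)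
qed

text \<open>The source of the codes: objects and arrows of a small algebra must be elements of
  \<open>'u\<close>, and smallness of \<open>Tm\<close> and \<open>Gen\<close> provides injections
  into \<open>'u\<close>.\<close>

lemma small_set_inj:
  assumes "small_set TYPE('u) A"
  obtains e :: "'a \<Rightarrow> 'u" where "inj_on e A"
proof -
  have "|A| \<le>o |UNIV :: 'u set|" using assms unfolding small_set_def by (rule ordLess_imp_ordLeq)
  then obtain e :: "'a \<Rightarrow> 'u" where "inj_on e A" by (auto simp: card_of_ordLeq[symmetric])
  then show ?thesis using that by blast
qed

section \<open>Categories\<close>

lemma homD: "f \<in> hom C a b \<Longrightarrow> f \<in> Arr C \<and> Dom C f = a \<and> Cod C f = b"
  by (simp add: hom_def)

text \<open>A definite description, meaningful on isomorphisms. Having the inverse as a function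
  lets a formal inverse be evaluated at every cone at once (\<open>ginv\<close>) and lets
  \<open>al\<close> be defined by recursion.\<close>

definition inv_arr :: "('o, 'a, 'z) cat_scheme \<Rightarrow> 'a \<Rightarrow> 'a" where
  "inv_arr C f = (THE g. g \<in> hom C (Cod C f) (Dom C f) \<and>
     Comp C g f = Id C (Dom C f) \<and> Comp C f g = Id C (Cod C f))"

text \<open>Horizontal sides \<open>m\<close> and \<open>n\<close>, vertical sides \<open>u\<close> and \<open>v\<close>.\<close>

definition square :: "('o, 'a, 'z) cat_scheme \<Rightarrow> 'a \<Rightarrow> 'a \<Rightarrow> 'a \<Rightarrow> 'a \<Rightarrow> bool" where
  "square C m u v n \<longleftrightarrow> m \<in> hom C (Dom C u) (Dom C v) \<and> n \<in> hom C (Cod C u) (Cod C v) \<and>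
     u \<in> Arr C \<and> v \<in> Arr C \<and> Comp C n u = Comp C v m"

context category
begin

lemma hom_Obj: "f \<in> hom C a b \<Longrightarrow> a \<in> Obj C \<and> b \<in> Obj C"
  using Dom_closed Cod_closed by (auto simp: hom_def)

lemma Arr_hom: "f \<in> Arr C \<Longrightarrow> f \<in> hom C (Dom C f) (Cod C f)"
  by (simp add: hom_def)

lemma inv_unique:
  assumes "f \<in> hom C a b" "g \<in> hom C b a" "h \<in> hom C b a" "Comp C g f = Id C a" "Comp C f h = Id C b"
  shows "g = h"
proof -
  have "g = Comp C g (Comp C f h)" using Comp_Id_right[OF assms(2)] assms(5) by simp
  also have "\<dots> = Comp C (Comp C g f) h" by (rule Comp_assoc[OF assms(3,1,2)])
  also have "\<dots> = h" using Comp_Id_left[OF assms(3)] assms(4) by simp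
  finally show ?thesis .
qed

lemma inv_arr_eqI:
  assumes "f \<in> hom C a b" "g \<in> hom C b a" "Comp C g f = Id C a" "Comp C f g = Id C b"
  shows "inv_arr C f = g"
  unfolding inv_arr_def
proof (rule the_equality)
  have d: "Dom C f = a" "Cod C f = b" using assms(1) by (auto simp: hom_def)
  show "g \<in> hom C (Cod C f) (Dom C f) \<and> Comp C g f = Id C (Dom C f) \<and> Comp C f g = Id C (Cod C f)"
    using assms d by simp
  show "h = g" if "h \<in> hom C (Cod C f) (Dom C f) \<and> Comp C h f = Id C (Dom C f) \<and> Comp C f h = Id C (Cod C f)" for h
    using that inv_unique[OF assms(1) _ assms(2) _ assms(4), of h] d by simp
qed

lemma iso_inI:
  assumes "f \<in> hom C a b" "g \<in> hom C b a" "Comp C g f = Id C a" "Comp C f g = Id C b"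
  shows "iso_in C f"
  using assms by (auto simp: iso_in_def hom_def)

lemma iso_inE:
  assumes "iso_in C f" "f \<in> hom C a b"
  obtains g where "g \<in> hom C b a" "Comp C g f = Id C a" "Comp C f g = Id C b"
  using assms by (auto simp: iso_in_def hom_def)

lemma inv_arr:
  assumes "iso_in C f" "f \<in> hom C a b"
  shows "inv_arr C f \<in> hom C b a" "Comp C (inv_arr C f) f = Id C a" "Comp C f (inv_arr C f) = Id C b"
proof -
  obtain g where g: "g \<in> hom C b a" "Comp C g f = Id C a" "Comp C f g = Id C b"
    using iso_inE[OF assms] by blast
  then have "inv_arr C f = g" by (rule inv_arr_eqI[OF assms(2)])
  then show "inv_arr C f \<in> hom C b a" "Comp C (inv_arr C f) f = Id C a" "Comp C f (inv_arr C f) = Id C b"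
    using g by simp_all
qed

lemma iso_Id: "a \<in> Obj C \<Longrightarrow> iso_in C (Id C a)"
  by (rule iso_inI[OF Id_hom Id_hom]) (auto intro: Comp_Id_left Id_hom)

lemma iso_Comp:
  assumes "iso_in C f" "f \<in> hom C a b" "iso_in C g" "g \<in> hom C b c"
  shows "iso_in C (Comp C g f)"
proof (rule iso_inI)
  note f = inv_arr[OF assms(1,2)] and g = inv_arr[OF assms(3,4)]
  show gf: "Comp C g f \<in> hom C a c" "Comp C (inv_arr C f) (inv_arr C g) \<in> hom C c a"
    using Comp_hom[OF assms(2,4)] Comp_hom[OF g(1) f(1)] by auto
  show "Comp C (Comp C (inv_arr C f) (inv_arr C g)) (Comp C g f) = Id C a"
    using Comp_assoc[OF gf(1) g(1) f(1)] Comp_assoc[OF assms(2,4) g(1)] Comp_Id_left[OF assms(2)] f g by simp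
  show "Comp C (Comp C g f) (Comp C (inv_arr C f) (inv_arr C g)) = Id C c"
    using Comp_assoc[OF gf(2) assms(2,4)] Comp_assoc[OF g(1) f(1) assms(2)] Comp_Id_left[OF g(1)] f g by simp
qed

lemma iso_cancel_left:
  assumes "iso_in C m" "m \<in> hom C b c" "f \<in> hom C a b" "g \<in> hom C a b" "Comp C m f = Comp C m g"
  shows "f = g"
proof -
  note i = inv_arr[OF assms(1,2)]
  have "f = Comp C (inv_arr C m) (Comp C m f)"
    using Comp_assoc[OF assms(3,2) i(1)] Comp_Id_left[OF assms(3)] i by simp
  also have "\<dots> = Comp C (inv_arr C m) (Comp C m g)" using assms(5) by simp
  also have "\<dots> = g" using Comp_assoc[OF assms(4,2) i(1)] Comp_Id_left[OF assms(4)] i by simp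
  finally show ?thesis .
qed

lemma squareI:
  "m \<in> hom C a b \<Longrightarrow> n \<in> hom C a' b' \<Longrightarrow> u \<in> hom C a a' \<Longrightarrow> v \<in> hom C b b' \<Longrightarrow>
    Comp C n u = Comp C v m \<Longrightarrow> square C m u v n"
  by (auto simp: square_def hom_def)

lemma square_comp:
  assumes "square C m u v n" "square C m' v w n'"
  shows "square C (Comp C m' m) u w (Comp C n' n)"
proof -
  have s: "m \<in> hom C (Dom C u) (Dom C v)" "n \<in> hom C (Cod C u) (Cod C v)"
    "m' \<in> hom C (Dom C v) (Dom C w)" "n' \<in> hom C (Cod C v) (Cod C w)"
    "u \<in> hom C (Dom C u) (Cod C u)" "v \<in> hom C (Dom C v) (Cod C v)" "w \<in> hom C (Dom C w) (Cod C w)"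
    "Comp C n u = Comp C v m" "Comp C n' v = Comp C w m'"
    using assms by (auto simp: square_def hom_def)
  have "Comp C (Comp C n' n) u = Comp C w (Comp C m' m)"
    using Comp_assoc[OF s(5,2,4)] Comp_assoc[OF s(1,6,4)] Comp_assoc[OF s(1,3,7)] s(8,9) by simp
  then show ?thesis using Comp_hom[OF s(1,3)] Comp_hom[OF s(2,4)] s(5,7) by (rule squareI[rotated 4])
qed

text \<open>Two squares share the side \<open>v\<close>; when the outer rectangle and the right
  square commute, cancelling the isomorphism \<open>n'\<close> yields the left square. Later
  \<open>m'\<close> and \<open>n'\<close> are coherence isomorphisms of two morphisms at the same
  term, and naturality at a structural arrow reduces to an equation in the target algebra.\<close>

lemma square_cancel:
  assumes m: "iso_in C m'" "m' \<in> hom C b c" "m \<in> hom C a b"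
    and n: "iso_in C n'" "n' \<in> hom C b' c'" "n \<in> hom C a' b'"
    and u: "u \<in> hom C a a'" "v \<in> hom C b b'" 
    and sq: "square C (Comp C m' m) u w (Comp C n' n)" "square C m' v w n'"
  shows "square C m u v n"
proof (rule squareI[OF m(3) n(3) u])
  have w: "w \<in> hom C c c'" using sq(2) m(2) n(2) by (auto simp: square_def hom_def)
  have "Comp C n' (Comp C n u) = Comp C (Comp C n' n) u" by (rule Comp_assoc[OF u(1) n(3,2)])
  also have "\<dots> = Comp C w (Comp C m' m)" using sq(1) by (simp add: square_def)
  also have "\<dots> = Comp C (Comp C w m') m" by (rule Comp_assoc[OF m(3,2) w])
  also have "\<dots> = Comp C (Comp C n' v) m" using sq(2) by (simp add: square_def)
  also have "\<dots> = Comp C n' (Comp C v m)" by (rule Comp_assoc[OF m(3) u(2) n(2), symmetric])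
  finally show "Comp C n u = Comp C v m"
    by (rule iso_cancel_left[OF n(1,2) Comp_hom[OF u(1) n(3)] Comp_hom[OF m(3) u(2)]])
qed

text \<open>Cancelling \<open>n\<close> on the left turns the claim into the given square. It
  carries naturality from a structural isomorphism to its formal inverse, and shows that
  componentwise inverses of a 2-cell form a 2-cell.\<close>

lemma square_inv:
  assumes m: "iso_in C m" and n: "iso_in C n" and sq: "square C m u v n"
  shows "square C (inv_arr C m) v u (inv_arr C n)"
proof -
  have s: "m \<in> hom C (Dom C u) (Dom C v)" "n \<in> hom C (Cod C u) (Cod C v)"
    "u \<in> hom C (Dom C u) (Cod C u)" "v \<in> hom C (Dom C v) (Cod C v)"
    "Comp C n u = Comp C v m"
    using sq by (auto simp: square_def hom_def)
  note im = inv_arr[OF m s(1)] and iN = inv_arr[OF n s(2)]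
  have "Comp C (inv_arr C n) v = Comp C u (inv_arr C m)"
  proof (rule iso_cancel_left[OF n s(2) Comp_hom[OF s(4) iN(1)] Comp_hom[OF im(1) s(3)]])
    have "Comp C n (Comp C (inv_arr C n) v) = v"
      using Comp_assoc[OF s(4) iN(1) s(2)] iN(3) Comp_Id_left[OF s(4)] by simp
    moreover have "Comp C n (Comp C u (inv_arr C m)) = v"
      using Comp_assoc[OF im(1) s(3,2)] Comp_assoc[OF im(1) s(1,4)] im(3) s(5) Comp_Id_right[OF s(4)] by simp
    ultimately show "Comp C n (Comp C (inv_arr C n) v) = Comp C n (Comp C u (inv_arr C m))" by simp
  qed
  then show ?thesis by (rule squareI[OF im(1) iN(1) s(4,3)])
qed

end

section \<open>Functors and natural transformations\<close>

lemma functorsD: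
  assumes "F \<in> functors C D"
  shows "Src F = C" "Trg F = D"
    and "x \<in> Obj C \<Longrightarrow> OMap F x \<in> Obj D"
    and "f \<in> Arr C \<Longrightarrow> AMap F f \<in> Arr D"
    and "f \<in> hom C x y \<Longrightarrow> AMap F f \<in> hom D (OMap F x) (OMap F y)"
    and "x \<in> Obj C \<Longrightarrow> AMap F (Id C x) = Id D (OMap F x)"
    and "f \<in> hom C x y \<Longrightarrow> g \<in> hom C y z \<Longrightarrow> AMap F (Comp C g f) = Comp D (AMap F g) (AMap F f)"
    and "f \<in> Arr C \<Longrightarrow> Dom D (AMap F f) = OMap F (Dom C f)"
    and "f \<in> Arr C \<Longrightarrow> Cod D (AMap F f) = OMap F (Cod C f)"
  using assms by (auto simp: functors_def hom_def)

lemma functorsI: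
  assumes "Src F = C" "Trg F = D" "OMap F \<in> extensional (Obj C)" "AMap F \<in> extensional (Arr C)"
    and "\<And>x. x \<in> Obj C \<Longrightarrow> OMap F x \<in> Obj D"
    and "\<And>f. f \<in> Arr C \<Longrightarrow> AMap F f \<in> hom D (OMap F (Dom C f)) (OMap F (Cod C f))"
    and "\<And>x. x \<in> Obj C \<Longrightarrow> AMap F (Id C x) = Id D (OMap F x)"
    and "\<And>f g. f \<in> Arr C \<Longrightarrow> g \<in> Arr C \<Longrightarrow> Dom C g = Cod C f \<Longrightarrow>
      AMap F (Comp C g f) = Comp D (AMap F g) (AMap F f)"
  shows "F \<in> functors C D"
  using assms by (auto simp: functors_def PiE_def) (auto simp: hom_def)

lemma functors_extensional:
  assumes "F \<in> functors C D"
  shows "OMap F \<in> extensional (Obj C)" "AMap F \<in> extensional (Arr C)"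
  using assms by (simp_all add: functors_def PiE_def)

lemma functors_eqI:
  assumes "F \<in> functors C D" "G \<in> functors C D"
    and "\<And>x. x \<in> Obj C \<Longrightarrow> OMap F x = OMap G x" "\<And>f. f \<in> Arr C \<Longrightarrow> AMap F f = AMap G f"
  shows "F = G"
proof -
  have "OMap F = OMap G" "AMap F = AMap G"
    using assms functors_extensional
    by (blast intro: extensionalityI[of _ "Obj C"], blast intro: extensionalityI[of _ "Arr C"])
  then show ?thesis using assms(1,2) by (simp add: functors_def)
qed

lemma nat_transsD:
  assumes "\<eta> \<in> nat_transs F G"
  shows "NSrc \<eta> = F" "NTrg \<eta> = G" "Src F = Src G" "Trg F = Trg G"
    and "x \<in> Obj (Src F) \<Longrightarrow> NComp \<eta> x \<in> hom (Trg F) (OMap F x) (OMap G x)"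
    and "f \<in> hom (Src F) x y \<Longrightarrow>
      Comp (Trg F) (NComp \<eta> y) (AMap F f) = Comp (Trg F) (AMap G f) (NComp \<eta> x)"
  using assms by (auto simp: nat_transs_def hom_def)

lemma nat_transsI:
  assumes "NSrc \<eta> = F" "NTrg \<eta> = G" "Src F = C" "Src G = C" "Trg F = D" "Trg G = D"
    "NComp \<eta> \<in> extensional (Obj C)"
    and "\<And>x. x \<in> Obj C \<Longrightarrow> NComp \<eta> x \<in> hom D (OMap F x) (OMap G x)"
    and "\<And>f. f \<in> Arr C \<Longrightarrow>
      Comp D (NComp \<eta> (Cod C f)) (AMap F f) = Comp D (AMap G f) (NComp \<eta> (Dom C f))"
  shows "\<eta> \<in> nat_transs F G"
  using assms by (auto simp: nat_transs_def)

lemma nat_transs_eqI: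
  assumes "\<eta> \<in> nat_transs F G" "\<theta> \<in> nat_transs F G" "\<And>x. x \<in> Obj (Src F) \<Longrightarrow> NComp \<eta> x = NComp \<theta> x"
  shows "\<eta> = \<theta>"
proof -
  have "NComp \<eta> = NComp \<theta>" using assms by (auto simp: nat_transs_def intro: extensionalityI)
  then show ?thesis using assms(1,2) by (simp add: nat_transs_def)
qed

lemma nat_isos_transs: "\<eta> \<in> nat_isos F G \<Longrightarrow> \<eta> \<in> nat_transs F G"
  by (simp add: nat_isos_def)

lemma nat_isosD: "\<eta> \<in> nat_isos F G \<Longrightarrow> x \<in> Obj (Src F) \<Longrightarrow> iso_in (Trg F) (NComp \<eta> x)"
  by (simp add: nat_isos_def)

lemma nat_isosI: "\<eta> \<in> nat_transs F G \<Longrightarrow> (\<And>x. x \<in> Obj (Src F) \<Longrightarrow> iso_in (Trg F) (NComp \<eta> x)) \<Longrightarrow> \<eta> \<in> nat_isos F G"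
  by (simp add: nat_isos_def)

lemma func_comp_sel [simp]:
  "Src (func_comp G F) = Src F" "Trg (func_comp G F) = Trg G"
  "x \<in> Obj (Src F) \<Longrightarrow> OMap (func_comp G F) x = OMap G (OMap F x)"
  "f \<in> Arr (Src F) \<Longrightarrow> AMap (func_comp G F) f = AMap G (AMap F f)"
  by (simp_all add: func_comp_def)

lemma func_comp_functors:
  assumes "category C" "F \<in> functors C D" "G \<in> functors D E"
  shows "func_comp G F \<in> functors C E"
proof -
  interpret category C by fact
  note F = functorsD[OF assms(2)] and G = functorsD[OF assms(3)]
  show ?thesis
  proof (rule functorsI)
    fix f g assume f: "f \<in> Arr C" and g: "g \<in> Arr C" and fg: "Dom C g = Cod C f"
    have h: "f \<in> hom C (Dom C f) (Cod C f)" "g \<in> hom C (Cod C f) (Cod C g)" using f g fg by (auto simp: hom_def)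
    have c: "Comp C g f \<in> Arr C" using Comp_hom[OF h] homD by fast
    show "AMap (func_comp G F) (Comp C g f) = Comp E (AMap (func_comp G F) g) (AMap (func_comp G F) f)"
      using F(7)[OF h] G(7)[OF F(5)[OF h(1)] F(5)[OF h(2)]] f g c F(1) by simp
  next
    fix x assume x: "x \<in> Obj C"
    then have "Id C x \<in> Arr C" using Id_hom homD by fast
    then show "AMap (func_comp G F) (Id C x) = Id E (OMap (func_comp G F) x)"
      using x F(1,3,6) G(6) by simp
  next
    fix f assume f: "f \<in> Arr C"
    then have "AMap G (AMap F f) \<in> hom E (OMap G (OMap F (Dom C f))) (OMap G (OMap F (Cod C f)))"
      by (intro G(5) F(5) Arr_hom)
    then show "AMap (func_comp G F) f \<in> hom E (OMap (func_comp G F) (Dom C f)) (OMap (func_comp G F) (Cod C f))"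
      using f F(1) Dom_closed Cod_closed by simp
  qed (use F(1,2,3) G(1,2,3) in \<open>simp_all add: func_comp_def\<close>)
qed

lemma func_comp_assoc:
  assumes "F \<in> functors C D" "Src G = D" 
  shows "func_comp H (func_comp G F) = func_comp (func_comp H G) F"
  using functorsD[OF assms(1)] assms(2)
  by (auto simp: func_comp_def restrict_def fun_eq_iff)

lemma func_id_functors: "category C \<Longrightarrow> func_id C \<in> functors C C"
  unfolding category_def by (intro functorsI) (auto simp: func_id_def hom_def)

lemma func_id_sel [simp]: "Src (func_id C) = C" "Trg (func_id C) = C"
  "x \<in> Obj C \<Longrightarrow> OMap (func_id C) x = x" "f \<in> Arr C \<Longrightarrow> AMap (func_id C) f = f"
  by (simp_all add: func_id_def)

lemma func_id_left: "category D \<Longrightarrow> F \<in> functors C D \<Longrightarrow> func_comp (func_id D) F = F"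
proof -
  assume D: "category D" and F: "F \<in> functors C D"
  note FD = functorsD[OF F]
  have "restrict (\<lambda>x. OMap (func_id D) (OMap F x)) (Obj C) = OMap F"
    "restrict (\<lambda>f. AMap (func_id D) (AMap F f)) (Arr C) = AMap F"
    using FD(3,4) functors_extensional[OF F]
    by (auto intro!: extensionalityI[of _ "Obj C"] extensionalityI[of _ "Arr C"])
  then show ?thesis using FD(1,2) by (cases F) (simp add: func_comp_def)
qed

lemma nat_vcomp_sel [simp]:
  "NSrc (\<beta> \<circ>\<^sub>v \<alpha>) = NSrc \<alpha>" "NTrg (\<beta> \<circ>\<^sub>v \<alpha>) = NTrg \<beta>"
  "x \<in> Obj (Src (NSrc \<alpha>)) \<Longrightarrow> NComp (\<beta> \<circ>\<^sub>v \<alpha>) x = Comp (Trg (NSrc \<alpha>)) (NComp \<beta> x) (NComp \<alpha> x)"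
  by (simp_all add: nat_vcomp_def)

lemma nat_hcomp_sel [simp]:
  "NSrc (\<beta> \<star> \<alpha>) = func_comp (NSrc \<beta>) (NSrc \<alpha>)" "NTrg (\<beta> \<star> \<alpha>) = func_comp (NTrg \<beta>) (NTrg \<alpha>)"
  "x \<in> Obj (Src (NSrc \<alpha>)) \<Longrightarrow>
    NComp (\<beta> \<star> \<alpha>) x = Comp (Trg (NSrc \<beta>)) (NComp \<beta> (OMap (NTrg \<alpha>) x)) (AMap (NSrc \<beta>) (NComp \<alpha> x))"
  by (simp_all add: nat_hcomp_def)

lemma nat_id_sel [simp]:
  "NSrc (nat_id F) = F" "NTrg (nat_id F) = F"
  "x \<in> Obj (Src F) \<Longrightarrow> NComp (nat_id F) x = Id (Trg F) (OMap F x)"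
  by (simp_all add: nat_id_def)

lemma nat_vcomp_eq_iff:
  assumes "Src (NSrc \<alpha>) = C" "Trg (NSrc \<alpha>) = D" "NSrc \<alpha> = NSrc \<alpha>'" "NTrg \<beta> = NTrg \<beta>'"
  shows "\<beta> \<circ>\<^sub>v \<alpha> = \<beta>' \<circ>\<^sub>v \<alpha>' \<longleftrightarrow>
    (\<forall>x \<in> Obj C. Comp D (NComp \<beta> x) (NComp \<alpha> x) = Comp D (NComp \<beta>' x) (NComp \<alpha>' x))"
  using assms by (auto simp: nat_vcomp_def restrict_def fun_eq_iff)

lemma nat_id_isos: "category C \<Longrightarrow> category D \<Longrightarrow> F \<in> functors C D \<Longrightarrow> nat_id F \<in> nat_isos F F"
proof -
  assume C: "category C" and D: "category D" and "F \<in> functors C D"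
  interpret category D by fact
  note F = functorsD[OF \<open>F \<in> functors C D\<close>]
  show ?thesis
  proof (rule nat_isosI, rule nat_transsI)
    fix f assume f: "f \<in> Arr C"
    then have "AMap F f \<in> hom D (OMap F (Dom C f)) (OMap F (Cod C f))"
      using F(4,8,9) by (simp add: hom_def)
    then show "Comp D (NComp (nat_id F) (Cod C f)) (AMap F f) = Comp D (AMap F f) (NComp (nat_id F) (Dom C f))"
      using Comp_Id_left Comp_Id_right F(1,2) category.Dom_closed[OF C f] category.Cod_closed[OF C f] by simp
  qed (use F in \<open>simp_all add: iso_Id Id_hom\<close>, simp add: nat_id_def)
qed

lemma nat_vcomp_transs:
  assumes "category D" "F \<in> functors C D" "G \<in> functors C D" "H \<in> functors C D"
    "\<alpha> \<in> nat_transs F G" "\<beta> \<in> nat_transs G H" "category C"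
  shows "\<beta> \<circ>\<^sub>v \<alpha> \<in> nat_transs F H"
proof -
  interpret category D by fact
  interpret C: category C by fact
  note F = functorsD[OF assms(2)] functorsD[OF assms(3)] functorsD[OF assms(4)]
  note a = nat_transsD[OF assms(5), unfolded F] and b = nat_transsD[OF assms(6), unfolded F]
  show ?thesis
  proof (rule nat_transsI)
    fix f assume f: "f \<in> Arr C"
    then have f': "f \<in> hom C (Dom C f) (Cod C f)" "Dom C f \<in> Obj C" "Cod C f \<in> Obj C"
      using C.Dom_closed C.Cod_closed by (auto simp: hom_def)
    have "Comp D (Comp D (NComp \<beta> (Cod C f)) (NComp \<alpha> (Cod C f))) (AMap F f)
        = Comp D (AMap H f) (Comp D (NComp \<beta> (Dom C f)) (NComp \<alpha> (Dom C f)))"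
      using Comp_assoc[OF F(5)[OF f'(1)] a(5)[OF f'(3)] b(5)[OF f'(3)]]
        Comp_assoc[OF a(5)[OF f'(2)] F(14)[OF f'(1)] b(5)[OF f'(3)]]
        Comp_assoc[OF a(5)[OF f'(2)] b(5)[OF f'(2)] F(23)[OF f'(1)]]
        a(6)[OF f'(1)] b(6)[OF f'(1)] by simp
    then show "Comp D (NComp (\<beta> \<circ>\<^sub>v \<alpha>) (Cod C f)) (AMap F f) = Comp D (AMap H f) (NComp (\<beta> \<circ>\<^sub>v \<alpha>) (Dom C f))"
      using f' a(1) F by simp
  next
    fix x assume x: "x \<in> Obj C"
    then show "NComp (\<beta> \<circ>\<^sub>v \<alpha>) x \<in> hom D (OMap F x) (OMap H x)"
      using Comp_hom[OF a(5) b(5), of x] a(1) F(1,2) by simp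
  qed (use F a b in \<open>simp_all add: nat_vcomp_def\<close>)
qed

lemma nat_vcomp_isos:
  assumes "category D" "F \<in> functors C D" "G \<in> functors C D" "H \<in> functors C D"
    "\<alpha> \<in> nat_isos F G" "\<beta> \<in> nat_isos G H" "category C"
  shows "\<beta> \<circ>\<^sub>v \<alpha> \<in> nat_isos F H"
proof (rule nat_isosI)
  interpret category D by fact
  note F[simp] = functorsD(1,2)[OF assms(2)] functorsD(1,2)[OF assms(3)]
  note a = nat_transsD[OF nat_isos_transs[OF assms(5)], unfolded F] nat_isosD[OF assms(5), unfolded F]
  note b = nat_transsD[OF nat_isos_transs[OF assms(6)], unfolded F] nat_isosD[OF assms(6), unfolded F]
  show "\<beta> \<circ>\<^sub>v \<alpha> \<in> nat_transs F H" by (rule nat_vcomp_transs[OF assms(1-4) nat_isos_transs[OF assms(5)] nat_isos_transs[OF assms(6)] assms(7)])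
  show "iso_in (Trg F) (NComp (\<beta> \<circ>\<^sub>v \<alpha>) x)" if "x \<in> Obj (Src F)" for x
    using that iso_Comp[OF a(7) a(5) b(7) b(5), of x] a(1) F by simp
qed

lemma functor_iso:
  assumes "category C" "category D" "F \<in> functors C D" "iso_in C f" "f \<in> hom C a b"
  shows "iso_in D (AMap F f)" "AMap F (inv_arr C f) = inv_arr D (AMap F f)"
proof -
  interpret C: category C by fact
  interpret D: category D by fact
  note F = functorsD[OF assms(3)] and i = C.inv_arr[OF assms(4,5)] and ob = C.hom_Obj[OF assms(5)]
  have 1: "AMap F f \<in> hom D (OMap F a) (OMap F b)" "AMap F (inv_arr C f) \<in> hom D (OMap F b) (OMap F a)"
    using F(5) assms(5) i(1) by auto
  have 2: "Comp D (AMap F (inv_arr C f)) (AMap F f) = Id D (OMap F a)"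
    "Comp D (AMap F f) (AMap F (inv_arr C f)) = Id D (OMap F b)"
    using F(7)[OF assms(5) i(1)] F(7)[OF i(1) assms(5)] F(6) i ob by auto
  show "iso_in D (AMap F f)" by (rule D.iso_inI[OF 1 2])
  show "AMap F (inv_arr C f) = inv_arr D (AMap F f)" by (rule D.inv_arr_eqI[OF 1 2, symmetric])
qed

lemma functor_square:
  assumes "F \<in> functors C D" "category C" "square C m u v n"
  shows "square D (AMap F m) (AMap F u) (AMap F v) (AMap F n)"
proof -
  have s: "m \<in> hom C (Dom C u) (Dom C v)" "n \<in> hom C (Cod C u) (Cod C v)" "u \<in> Arr C" "v \<in> Arr C"
    "u \<in> hom C (Dom C u) (Cod C u)" "v \<in> hom C (Dom C v) (Cod C v)" "Comp C n u = Comp C v m"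
    using assms(3) by (auto simp: square_def hom_def)
  note F = functorsD[OF assms(1)]
  show ?thesis unfolding square_def
    using F(5)[OF s(1)] F(5)[OF s(2)] F(4,8,9) s(3,4) F(7)[OF s(5,2)] F(7)[OF s(1,6)] s(7) by simp
qed

lemma nat_transs_square:
  assumes "\<eta> \<in> nat_transs F G" "F \<in> functors C D" "G \<in> functors C D" "f \<in> hom C x y" "category C"
  shows "square D (AMap F f) (NComp \<eta> x) (NComp \<eta> y) (AMap G f)"
proof -
  note F = functorsD[OF assms(2)] and G = functorsD[OF assms(3)] and e = nat_transsD[OF assms(1)]
  have xy: "x \<in> Obj C" "y \<in> Obj C" using category.hom_Obj[OF assms(5,4)] by auto
  show ?thesis unfolding square_def
    using e(5,6) F(1,2,5) G(1,2,5) xy assms(4) by (fastforce simp: hom_def)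
qed

section \<open>An equivalence criterion\<close>

text \<open>Surjectivity on objects is required on the nose, so a section \<open>r\<close> of the
  object map satisfies \<open>OMap F (r d) = d\<close>. Then \<open>func_comp F G\<close> is the
  identity functor of \<open>D\<close> itself, and only the unit has to be constructed. Equations in
  \<open>C\<close> are verified after applying \<open>F\<close>, by faithfulness.\<close>

lemma equivalence_of_catsI:
  assumes C: "category C" and D: "category D" and F: "F \<in> functors C D"
    and surj: "\<And>d. d \<in> Obj D \<Longrightarrow> \<exists>c \<in> Obj C. OMap F c = d"
    and full: "\<And>a b g. a \<in> Obj C \<Longrightarrow> b \<in> Obj C \<Longrightarrow> g \<in> hom D (OMap F a) (OMap F b) \<Longrightarrow>
      \<exists>f \<in> hom C a b. AMap F f = g"
    and faithful: "\<And>a b f f'. f \<in> hom C a b \<Longrightarrow> f' \<in> hom C a b \<Longrightarrow> AMap F f = AMap F f' \<Longrightarrow> f = f'"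
  shows "equivalence_of_cats C D F"
proof -
  interpret C: category C by fact
  interpret D: category D by fact
  note FD = functorsD[OF F]
  define r where "r d = (SOME c. c \<in> Obj C \<and> OMap F c = d)" for d
  have r: "r d \<in> Obj C" "OMap F (r d) = d" if "d \<in> Obj D" for d
    using someI_ex[of "\<lambda>c. c \<in> Obj C \<and> OMap F c = d"] surj[OF that] unfolding r_def by auto
  \<comment> \<open>The lift of \<open>g\<close> along the fully faithful functor; together with
    \<open>r\<close> it gives the arrow map of the inverse \<open>G\<close>.\<close>
  define l where "l a b g = (SOME f. f \<in> hom C a b \<and> AMap F f = g)" for a b g
  have l: "l a b g \<in> hom C a b" "AMap F (l a b g) = g"
    if "a \<in> Obj C" "b \<in> Obj C" "g \<in> hom D (OMap F a) (OMap F b)" for a b g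
    using someI_ex[of "\<lambda>f. f \<in> hom C a b \<and> AMap F f = g"] full[OF that] unfolding l_def by auto
  define G where "G = \<lparr>Src = D, Trg = C, OMap = restrict r (Obj D),
    AMap = restrict (\<lambda>g. l (r (Dom D g)) (r (Cod D g)) g) (Arr D)\<rparr>"
  have lD: "l (r (Dom D g)) (r (Cod D g)) g \<in> hom C (r (Dom D g)) (r (Cod D g))"
    "AMap F (l (r (Dom D g)) (r (Cod D g)) g) = g" if "g \<in> Arr D" for g
    using l[of "r (Dom D g)" "r (Cod D g)" g] r[OF D.Dom_closed[OF that]] r[OF D.Cod_closed[OF that]] that
    by (auto simp: hom_def)
  have G: "G \<in> functors D C"
  proof (rule functorsI)
    fix f g assume fg: "f \<in> Arr D" "g \<in> Arr D" "Dom D g = Cod D f"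
    have gf: "Comp D g f \<in> hom D (Dom D f) (Cod D g)"
      using D.Comp_hom[of f "Dom D f" "Cod D f" g "Cod D g"] fg by (auto simp: hom_def)
    have gf': "Comp D g f \<in> Arr D" "Dom D (Comp D g f) = Dom D f" "Cod D (Comp D g f) = Cod D g"
      using homD[OF gf] by auto
    have "l (r (Dom D f)) (r (Cod D g)) (Comp D g f)
        = Comp C (l (r (Cod D f)) (r (Cod D g)) g) (l (r (Dom D f)) (r (Cod D f)) f)"
    proof (rule faithful)
      show "l (r (Dom D f)) (r (Cod D g)) (Comp D g f) \<in> hom C (r (Dom D f)) (r (Cod D g))"
        using lD(1)[OF gf'(1)] gf' by simp
      show "Comp C (l (r (Cod D f)) (r (Cod D g)) g) (l (r (Dom D f)) (r (Cod D f)) f)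
        \<in> hom C (r (Dom D f)) (r (Cod D g))"
        using C.Comp_hom lD(1)[OF fg(1)] lD(1)[OF fg(2)] fg(3) by simp
      show "AMap F (l (r (Dom D f)) (r (Cod D g)) (Comp D g f))
        = AMap F (Comp C (l (r (Cod D f)) (r (Cod D g)) g) (l (r (Dom D f)) (r (Cod D f)) f))"
        using lD[OF gf'(1)] gf' lD[OF fg(1)] lD[OF fg(2)] fg(3) FD(7) by simp
    qed
    then show "AMap G (Comp D g f) = Comp C (AMap G g) (AMap G f)"
      using gf' fg by (simp add: G_def)
  next
    fix x assume x: "x \<in> Obj D"
    have i: "Id D x \<in> Arr D" "Dom D (Id D x) = x" "Cod D (Id D x) = x"
      using D.Id_hom[OF x] by (auto simp: hom_def)
    have "l (r x) (r x) (Id D x) = Id C (r x)"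
      using lD[OF i(1)] i r[OF x] by (intro faithful) (auto simp: C.Id_hom FD(6))
    then show "AMap G (Id D x) = Id C (OMap G x)" using i x by (simp add: G_def)
  qed (auto simp: G_def r lD D.Dom_closed D.Cod_closed)
  note GD = functorsD[OF G]
  \<comment> \<open>Since \<open>OMap F (r (OMap F x))\<close> equals \<open>OMap F x\<close>, the
    identity of \<open>OMap F x\<close> lifts to an arrow from \<open>x\<close> to
    \<open>r (OMap F x)\<close>; its inverse is the lift in the other direction.\<close>
  define \<eta> where "\<eta> = \<lparr>NSrc = func_id C, NTrg = func_comp G F,
    NComp = restrict (\<lambda>x. l x (r (OMap F x)) (Id D (OMap F x))) (Obj C)\<rparr>"
  have n: "l x (r (OMap F x)) (Id D (OMap F x)) \<in> hom C x (r (OMap F x))"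
    "AMap F (l x (r (OMap F x)) (Id D (OMap F x))) = Id D (OMap F x)" if "x \<in> Obj C" for x
    using l[of x "r (OMap F x)"] that r FD(3) D.Id_hom by simp_all
  have n': "l (r (OMap F x)) x (Id D (OMap F x)) \<in> hom C (r (OMap F x)) x"
    "AMap F (l (r (OMap F x)) x (Id D (OMap F x))) = Id D (OMap F x)" if "x \<in> Obj C" for x
    using l[of "r (OMap F x)" x] that r FD(3) D.Id_hom by simp_all
  have "\<eta> \<in> nat_isos (func_id C) (func_comp G F)"
  proof (rule nat_isosI, rule nat_transsI)
    fix f assume f: "f \<in> Arr C"
    let ?x = "Dom C f" and ?y = "Cod C f"
    have fh: "f \<in> hom C ?x ?y" and xy: "?x \<in> Obj C" "?y \<in> Obj C"
      using f C.Dom_closed C.Cod_closed by (auto simp: hom_def)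
    let ?Gf = "l (r (Dom D (AMap F f))) (r (Cod D (AMap F f))) (AMap F f)"
    have Gf: "?Gf \<in> hom C (r (OMap F ?x)) (r (OMap F ?y))" "AMap F ?Gf = AMap F f"
      using lD[OF FD(4)[OF f]] FD(8,9)[OF f] by auto
    have "Comp C (l ?y (r (OMap F ?y)) (Id D (OMap F ?y))) f
      = Comp C ?Gf (l ?x (r (OMap F ?x)) (Id D (OMap F ?x)))"
    proof (rule faithful)
      show "AMap F (Comp C (l ?y (r (OMap F ?y)) (Id D (OMap F ?y))) f)
        = AMap F (Comp C ?Gf (l ?x (r (OMap F ?x)) (Id D (OMap F ?x))))"
        using FD(7)[OF fh n(1)[OF xy(2)]] FD(7)[OF n(1)[OF xy(1)] Gf(1)] n(2)[OF xy(1)] n(2)[OF xy(2)] Gf(2)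
          D.Comp_Id_left[OF FD(5)[OF fh]] D.Comp_Id_right[OF FD(5)[OF fh]] by simp
    qed (use C.Comp_hom[OF fh n(1)[OF xy(2)]] C.Comp_hom[OF n(1)[OF xy(1)] Gf(1)] in auto)
    then show "Comp C (NComp \<eta> (Cod C f)) (AMap (func_id C) f)
      = Comp C (AMap (func_comp G F) f) (NComp \<eta> (Dom C f))"
      using f xy FD(1,4) by (simp add: \<eta>_def G_def)
  next
    fix x assume "x \<in> Obj (Src (func_id C))"
    then have x: "x \<in> Obj C" by simp
    have "iso_in C (l x (r (OMap F x)) (Id D (OMap F x)))"
    proof (rule C.iso_inI)
      note h = n[OF x] n'[OF x] and Fx = FD(3)[OF x]
      have ii: "Comp D (Id D (OMap F x)) (Id D (OMap F x)) = Id D (OMap F x)"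
        by (rule D.Comp_Id_left[OF D.Id_hom[OF Fx]])
      show "Comp C (l (r (OMap F x)) x (Id D (OMap F x))) (l x (r (OMap F x)) (Id D (OMap F x))) = Id C x"
        by (rule faithful[OF C.Comp_hom[OF h(1,3)] C.Id_hom[OF x]])
           (simp add: FD(7)[OF h(1,3)] h(2,4) ii FD(6)[OF x])
      show "Comp C (l x (r (OMap F x)) (Id D (OMap F x))) (l (r (OMap F x)) x (Id D (OMap F x))) = Id C (r (OMap F x))"
        by (rule faithful[OF C.Comp_hom[OF h(3,1)] C.Id_hom[OF r(1)[OF Fx]]])
           (simp add: FD(7)[OF h(3,1)] h(2,4) ii FD(6)[OF r(1)[OF Fx]] r(2)[OF Fx])
      show "l x (r (OMap F x)) (Id D (OMap F x)) \<in> hom C x (r (OMap F x))"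
        "l (r (OMap F x)) x (Id D (OMap F x)) \<in> hom C (r (OMap F x)) x"
        by (fact h(1), fact h(3))
    qed
    then show "iso_in (Trg (func_id C)) (NComp \<eta> x)" using x by (simp add: \<eta>_def)
  qed (use FD(1,2,3) n(1) GD(1,2) in \<open>simp_all add: \<eta>_def\<close>, simp add: G_def)
  moreover have "nat_id (func_comp F G) \<in> nat_isos (func_comp F G) (func_comp F G)"
    by (rule nat_id_isos[OF D D func_comp_functors[OF D G F]])
  moreover have "func_comp F G = func_id D"
    by (rule functors_eqI[OF func_comp_functors[OF D G F] func_id_functors[OF D]])
       (simp_all add: GD(1), simp_all add: G_def r lD)
  ultimately show ?thesis using F G unfolding equivalence_of_cats_def by auto
qed

section \<open>Blocks of lists\<close>

lemma length_split_blocks [simp]: "length (split_blocks ns xs) = length ns"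
  by (induction ns xs rule: split_blocks.induct) simp_all

lemma split_blocks_append:
  "split_blocks (ns @ ms) xs = split_blocks ns (take (sum_list ns) xs) @ split_blocks ms (drop (sum_list ns) xs)"
  by (induction ns arbitrary: xs) (simp_all add: drop_take add.commute)

lemma split_blocks_concat: "split_blocks (map length xss) (concat xss) = xss"
  by (induction xss) simp_all

lemma map_length_split_blocks: "length xs = sum_list ns \<Longrightarrow> map length (split_blocks ns xs) = ns"
  by (induction ns xs rule: split_blocks.induct) simp_all

lemma length_split_blocks_nth: 
  "length xs = sum_list ns \<Longrightarrow> i < length ns \<Longrightarrow> length (split_blocks ns xs ! i) = ns ! i"
  using map_length_split_blocks[of xs ns] by (metis length_split_blocks nth_map)

lemma split_blocks_map: "split_blocks ns (map f xs) = map (map f) (split_blocks ns xs)"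
  by (induction ns xs rule: split_blocks.induct) (simp_all add: take_map drop_map)

lemma set_split_blocks: "ys \<in> set (split_blocks ns xs) \<Longrightarrow> set ys \<subseteq> set xs"
  by (induction ns xs rule: split_blocks.induct) (auto dest: in_set_takeD in_set_dropD)

lemma set_split_blocks_nth: "i < length ns \<Longrightarrow> set (split_blocks ns xs ! i) \<subseteq> set xs"
  by (rule set_split_blocks[of _ ns]) simp

lemma split_blocks_nth: "i < length ns \<Longrightarrow> split_blocks ns xs ! i = take (ns ! i) (drop (offset ns i) xs)"
proof (induction ns xs arbitrary: i rule: split_blocks.induct)
  case (2 n ns xs)
  then show ?case by (cases i) (simp_all add: offset_def add.commute)
qed simp

lemma offset_bound: "i < length ns \<Longrightarrow> offset ns i + ns ! i \<le> sum_list ns"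
proof (induction ns arbitrary: i)
  case (Cons n ns)
  then show ?case by (cases i) (auto simp: offset_def)
qed simp

lemma split_blocks_nth_nth:
  assumes "i < length ns" "length xs = sum_list ns" "k < ns ! i"
  shows "split_blocks ns xs ! i ! k = xs ! (offset ns i + k)"
  using assms offset_bound[OF assms(1)] by (simp add: split_blocks_nth)

text \<open>Cutting at once into the fine blocks agrees with cutting coarsely and then refining each
  coarse block. This regrouping is the list content of associativity of substitution.\<close>

lemma split_blocks_concat_sizes:
  "split_blocks (concat nss) xs = concat (map2 split_blocks nss (split_blocks (map sum_list nss) xs))"
proof (induction nss arbitrary: xs)
  case (Cons ns nss)
  then show ?case by (simp add: split_blocks_append)
qed simp

lemma sum_list_concat: "sum_list (concat nss) = sum_list (map sum_list nss)"
  by (induction nss) simp_all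

lemma map2_concat:
  assumes "map length xss = map length yss"
  shows "map2 f (concat xss) (concat yss) = concat (map2 (map2 f) xss yss)"
  using assms
proof (induction xss arbitrary: yss)
  case (Cons xs xss)
  then show ?case by (cases yss) auto
qed simp

lemma length_incl [simp]: "length (incl ns i) = ns ! i"
  by (simp add: incl_def)

lemma set_incl: "i < length ns \<Longrightarrow> set (incl ns i) \<subseteq> {..<sum_list ns}"
  using offset_bound[of i ns] by (auto simp: incl_def)

lemma map_nth_incl:
  assumes "i < length ns" "length xs = sum_list ns"
  shows "map ((!) xs) (incl ns i) = split_blocks ns xs ! i"
proof (rule nth_equalityI)
  show "length (map ((!) xs) (incl ns i)) = length (split_blocks ns xs ! i)"
    using assms by (simp add: length_split_blocks_nth)
  show "map ((!) xs) (incl ns i) ! k = split_blocks ns xs ! i ! k" if "k < length (map ((!) xs) (incl ns i))" for k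
    using that assms by (simp add: split_blocks_nth_nth) (simp add: incl_def)
qed

lemma fin_fun_block_fun:
  assumes "fin_fun k (length ns) f"
  shows "fin_fun (sum_list (map ((!) ns) f)) (sum_list ns) (block_fun ns f)"
proof -
  have "length (block_fun ns f) = sum_list (map ((!) ns) f)"
    by (simp add: block_fun_def length_concat comp_def)
  moreover have "set (incl ns i) \<subseteq> {..<sum_list ns}" if "i \<in> set f" for i
    using that assms by (intro set_incl) (auto simp: fin_fun_def)
  then have "set (block_fun ns f) \<subseteq> {..<sum_list ns}" by (auto simp: block_fun_def)
  ultimately show ?thesis by (simp add: fin_fun_def)
qed

text \<open>Along \<open>block_fun\<close> whole blocks are copied, dropped or permuted. The
  reindexed list is thus the concatenation of the selected blocks, and
  \<open>split_blocks_concat\<close> recovers them because their lengths are the prescribed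
  sizes.\<close>

lemma split_blocks_block_fun:
  assumes "fin_fun k (length ns) f" "length xs = sum_list ns"
  shows "split_blocks (map ((!) ns) f) (map ((!) xs) (block_fun ns f)) = map ((!) (split_blocks ns xs)) f"
proof -
  have b: "\<And>i. i \<in> set f \<Longrightarrow> i < length ns" using assms by (auto simp: fin_fun_def)
  have "map ((!) xs) (block_fun ns f) = concat (map ((!) (split_blocks ns xs)) f)"
    unfolding block_fun_def map_concat map_map comp_def
    using map_nth_incl[OF b assms(2)] by (intro arg_cong[of _ _ concat] map_cong) auto
  moreover have "map ((!) ns) f = map length (map ((!) (split_blocks ns xs)) f)"
    using length_split_blocks_nth[OF assms(2) b] by auto
  ultimately show ?thesis by (simp only: split_blocks_concat)
qed

lemma fin_fun_block_sum:
  assumes "length gs = length ns" "\<And>i. i < length ns \<Longrightarrow> set (gs ! i) \<subseteq> {..<ns ! i}"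
  shows "fin_fun (sum_list (map length gs)) (sum_list ns) (block_sum ns gs)"
proof -
  have "map length gs = map (\<lambda>i. length (gs ! i)) [0..<length gs]"
    by (rule nth_equalityI) simp_all
  then have "length (block_sum ns gs) = sum_list (map length gs)"
    by (simp add: block_sum_def length_concat comp_def)
  moreover have "offset ns i + x < sum_list ns" if "i < length gs" "x \<in> set (gs ! i)" for i x
    using that assms(1) assms(2)[of i] offset_bound[of i ns] by fastforce
  ultimately show ?thesis by (auto simp: fin_fun_def block_sum_def)
qed

text \<open>Reindexing along a block sum never leaves a block, so it may be done block by block;
  again \<open>split_blocks_concat\<close> recovers the pieces.\<close>

lemma split_blocks_block_sum:
  assumes "length gs = length ns" "\<And>i. i < length ns \<Longrightarrow> set (gs ! i) \<subseteq> {..<ns ! i}" "length xs = sum_list ns"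
  shows "split_blocks (map length gs) (map ((!) xs) (block_sum ns gs))
    = map (\<lambda>i. map ((!) (split_blocks ns xs ! i)) (gs ! i)) [0..<length ns]"
proof -
  let ?h = "map (\<lambda>i. map ((!) (split_blocks ns xs ! i)) (gs ! i)) [0..<length ns]"
  have "map ((!) xs) (block_sum ns gs) = concat ?h"
    unfolding block_sum_def map_concat map_map comp_def
  proof (intro arg_cong[of _ _ concat] map_cong)
    show "[0..<length gs] = [0..<length ns]" using assms by simp
    show "xs ! (offset ns i + x) = split_blocks ns xs ! i ! x" if "i \<in> set [0..<length ns]" "x \<in> set (gs ! i)" for i x
    proof -
      have "x < ns ! i" using that assms(2)[of i] by auto
      then show ?thesis using that assms(3) by (simp add: split_blocks_nth_nth)
    qed
  qed simp
  moreover have "map length gs = map length ?h"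
    using assms(1) by (intro nth_equalityI) simp_all
  ultimately show ?thesis by (simp only: split_blocks_concat)
qed

section \<open>Theories as clones\<close>

text \<open>The operation \<open>e w\<close> named by each word \<open>w\<close> is applied to its own block of \<open>xs\<close>.\<close>

definition evs :: "'t thy \<Rightarrow> ('t \<Rightarrow> 'a list \<Rightarrow> 'b) \<Rightarrow> 't list \<Rightarrow> 'a list \<Rightarrow> 'b list" where
  "evs T e ws xs = map2 e ws (split_blocks (map (Dom T) ws) xs)"

text \<open>The domain of a word is its arity, so this says only that every entry is an arrow of
  \<open>T\<close> into 1; the arities may differ.\<close>

definition word_list :: "'t thy \<Rightarrow> 't list \<Rightarrow> bool" where
  "word_list T ws \<longleftrightarrow> (\<forall>v \<in> set ws. v \<in> words T (Dom T v))"

text \<open>Substitution of words into a word, as in an abstract clone. In this form a word acts on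
  lists of words just as it acts on objects, on arrows and on formal terms, so the same lemmas about
  \<open>evs\<close> serve in all four cases.\<close>

definition app :: "'t thy \<Rightarrow> nat \<Rightarrow> 't \<Rightarrow> 't list \<Rightarrow> 't" where
  "app T m w fs = Comp T w (tuple T m fs)"

lemma length_evs [simp]: "length (evs T e ws xs) = length ws"
  by (simp add: evs_def)

lemma evs_nth: "i < length ws \<Longrightarrow> evs T e ws xs ! i = e (ws ! i) (split_blocks (map (Dom T) ws) xs ! i)"
  by (simp add: evs_def)

lemma map_evs: "map h (evs T e ws xs) = evs T (\<lambda>w ys. h (e w ys)) ws xs"
  by (rule nth_equalityI) (simp_all add: evs_nth)

lemma evs_map: "evs T e ws (map h xs) = evs T (\<lambda>w ys. e w (map h ys)) ws xs"
  unfolding evs_def split_blocks_map by (rule nth_equalityI) simp_all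

lemma evs_cong:
  assumes "length xs = sum_list (map (Dom T) ws)"
    and "\<And>w ys. w \<in> set ws \<Longrightarrow> length ys = Dom T w \<Longrightarrow> set ys \<subseteq> set xs \<Longrightarrow> e w ys = e' w ys"
  shows "evs T e ws xs = evs T e' ws xs"
proof (rule nth_equalityI)
  fix i assume "i < length (evs T e ws xs)"
  then have i: "i < length ws" by simp
  then show "evs T e ws xs ! i = evs T e' ws xs ! i"
    using assms(2)[of "ws ! i" "split_blocks (map (Dom T) ws) xs ! i"] assms(1)
      length_split_blocks_nth[of xs "map (Dom T) ws" i] set_split_blocks_nth[of i "map (Dom T) ws" xs]
    by (simp add: evs_nth)
qed simp

lemma set_evs:
  assumes "length xs = sum_list (map (Dom T) ws)"
    and "\<And>w ys. w \<in> set ws \<Longrightarrow> length ys = Dom T w \<Longrightarrow> set ys \<subseteq> set xs \<Longrightarrow> e w ys \<in> S"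
  shows "set (evs T e ws xs) \<subseteq> S"
proof
  fix x assume "x \<in> set (evs T e ws xs)"
  then obtain i where i: "i < length ws" "x = evs T e ws xs ! i" by (metis in_set_conv_nth length_evs)
  then show "x \<in> S"
    using assms(2)[of "ws ! i" "split_blocks (map (Dom T) ws) xs ! i"] assms(1)
      length_split_blocks_nth[of xs "map (Dom T) ws" i] set_split_blocks_nth[of i "map (Dom T) ws" xs]
    by (simp add: evs_nth)
qed

text \<open>The group \<open>wss ! i\<close> produces as many results as \<open>ws ! i\<close> has
  arguments, so the blocks cut for the outer words are exactly the outputs of the groups.\<close>

lemma split_blocks_evs_concat:
  assumes "length wss = length ws" "\<And>i. i < length ws \<Longrightarrow> Dom T (ws ! i) = length (wss ! i)"
    "length xs = sum_list (map (Dom T) (concat wss))"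
  shows "split_blocks (map (Dom T) ws) (evs T e (concat wss) xs)
    = map2 (evs T e) wss (split_blocks (map (\<lambda>vs. sum_list (map (Dom T) vs)) wss) xs)"
proof -
  let ?nss = "map (map (Dom T)) wss"
  let ?yss = "split_blocks (map sum_list ?nss) xs"
  have sz: "map (Dom T) ws = map length wss" using assms(1,2) by (intro nth_equalityI) simp_all
  let ?zss = "map2 split_blocks ?nss ?yss"
  have "evs T e (concat wss) xs = map2 e (concat wss) (concat ?zss)"
    by (simp add: evs_def map_concat split_blocks_concat_sizes)
  also have "\<dots> = concat (map2 (map2 e) wss ?zss)"
    by (rule map2_concat, rule nth_equalityI) simp_all
  also have "map2 (map2 e) wss ?zss = map2 (evs T e) wss ?yss"
    by (rule nth_equalityI) (simp_all add: evs_def)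
  finally have "evs T e (concat wss) xs = concat (map2 (evs T e) wss ?yss)" .
  moreover have "map (Dom T) ws = map length (map2 (evs T e) wss ?yss)"
    unfolding sz by (rule nth_equalityI) simp_all
  ultimately show ?thesis by (simp only: split_blocks_concat) (simp add: comp_def)
qed

text \<open>The regrouping holds for arbitrary interpretations, so the same lemma handles
  substitution of words and the operations of an algebra on objects and on arrows.\<close>

lemma evs_evs:
  assumes "length wss = length ws" "\<And>i. i < length ws \<Longrightarrow> Dom T (ws ! i) = length (wss ! i)"
    "length xs = sum_list (map (Dom T) (concat wss))"
  shows "evs T e ws (evs T e' (concat wss) xs)
    = map (\<lambda>i. e (ws ! i) (evs T e' (wss ! i) (split_blocks (map (\<lambda>vs. sum_list (map (Dom T) vs)) wss) xs ! i)))
        [0..<length ws]"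
  by (rule nth_equalityI) (simp_all add: evs_nth split_blocks_evs_concat[OF assms] assms(1))

text \<open>This is compatibility of composition with substitution in the outer word, for any
  interpretation: selecting words together with their blocks selects the results.\<close>

lemma evs_block_fun:
  assumes "fin_fun k (length ws) f" "length xs = sum_list (map (Dom T) ws)"
  shows "evs T e (map ((!) ws) f) (map ((!) xs) (block_fun (map (Dom T) ws) f)) = map ((!) (evs T e ws xs)) f"
proof -
  have f: "fin_fun k (length (map (Dom T) ws)) f" using assms(1) by simp
  have b: "\<And>i. i \<in> set f \<Longrightarrow> i < length ws" using assms by (auto simp: fin_fun_def)
  have "map (Dom T) (map ((!) ws) f) = map ((!) (map (Dom T) ws)) f" using b by simp
  then have "evs T e (map ((!) ws) f) (map ((!) xs) (block_fun (map (Dom T) ws) f))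
      = map2 e (map ((!) ws) f) (map ((!) (split_blocks (map (Dom T) ws) xs)) f)"
    using split_blocks_block_fun[OF f assms(2)] by (simp add: evs_def del: map_map)
  also have "\<dots> = map ((!) (evs T e ws xs)) f"
    by (rule nth_equalityI) (use b in \<open>simp_all add: evs_nth\<close>)
  finally show ?thesis .
qed

text \<open>The counterpart for substitution in the inner words. The lengths of the
  \<open>gs\<close> are the arities of \<open>ws\<close>, so block \<open>i\<close> of the reindexed
  list is block \<open>i\<close> of \<open>xs\<close> reindexed by \<open>gs ! i\<close>.\<close>

lemma evs_block_sum:
  assumes "length gs = length ws" "length ns' = length ws"
    "\<And>i. i < length ws \<Longrightarrow> fin_fun (Dom T (ws ! i)) (ns' ! i) (gs ! i)"
    "length xs = sum_list ns'"
  shows "evs T e ws (map ((!) xs) (block_sum ns' gs))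
    = map (\<lambda>i. e (ws ! i) (map ((!) (split_blocks ns' xs ! i)) (gs ! i))) [0..<length ws]"
proof -
  have "map length gs = map (Dom T) ws"
    using assms(1,3) by (intro nth_equalityI) (simp_all add: fin_fun_def)
  moreover have "split_blocks (map length gs) (map ((!) xs) (block_sum ns' gs))
    = map (\<lambda>i. map ((!) (split_blocks ns' xs ! i)) (gs ! i)) [0..<length ns']"
    using assms by (intro split_blocks_block_sum) (simp_all add: fin_fun_def)
  ultimately show ?thesis using assms(2)
    unfolding evs_def by (intro nth_equalityI) simp_all
qed

lemma evs_singleton: "length xs = Dom T w \<Longrightarrow> evs T e [w] xs = [e w xs]"
  by (simp add: evs_def)

lemma fin_fun_map_nth:
  assumes "fin_fun k l f" "fin_fun l m g"
  shows "fin_fun k m (map ((!) g) f)"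
  using assms by (simp add: fin_fun_def image_subset_iff) (meson lessThan_iff nth_mem subsetD)

lemma map_nth_map_nth: "fin_fun k l f \<Longrightarrow> fin_fun l m g \<Longrightarrow>
  map ((!) xs) (map ((!) g) f) = map ((!) (map ((!) xs) g)) f"
  by (auto simp: fin_fun_def)

lemma set_map_nth: "fin_fun k l f \<Longrightarrow> length xs = l \<Longrightarrow> set (map ((!) xs) f) \<subseteq> set xs"
  by (auto simp: fin_fun_def)

context lawvere_theory
begin

lemma tuple:
  assumes "length fs = n" "set fs \<subseteq> words T m"
  shows "tuple T m fs \<in> hom T m n" "i < n \<Longrightarrow> Comp T (Pr T n i) (tuple T m fs) = fs ! i"
proof -
  have "\<exists>!f. f \<in> hom T m n \<and> (\<forall>i<n. Comp T (Pr T n i) f = fs ! i)"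
    using assms by (intro product) (auto simp: words_def)
  from theI'[OF this] show "tuple T m fs \<in> hom T m n" "i < n \<Longrightarrow> Comp T (Pr T n i) (tuple T m fs) = fs ! i"
    using assms(1) by (auto simp: tuple_def)
qed

lemma tuple_unique:
  assumes "length fs = n" "set fs \<subseteq> words T m" "f \<in> hom T m n" "\<And>i. i < n \<Longrightarrow> Comp T (Pr T n i) f = fs ! i"
  shows "f = tuple T m fs"
proof -
  have "\<exists>!f. f \<in> hom T m n \<and> (\<forall>i<n. Comp T (Pr T n i) f = fs ! i)"
    using assms by (intro product) (auto simp: words_def)
  then show ?thesis using tuple[OF assms(1,2)] assms(3,4) by blast
qed

lemma words_Dom: "w \<in> words T n \<Longrightarrow> Dom T w = n"
  by (simp add: words_def hom_def)

lemma words_Arr: "w \<in> words T n \<Longrightarrow> w \<in> Arr T"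
  by (simp add: words_def hom_def)

lemma Pr_words: "i < n \<Longrightarrow> Pr T n i \<in> words T n"
  using Pr_hom by (simp add: words_def)

lemma set_Pr: "fin_fun k l f \<Longrightarrow> set (map (Pr T l) f) \<subseteq> words T l"
  using Pr_words by (auto simp: fin_fun_def)

lemma app_words:
  assumes "w \<in> words T (length fs)" "set fs \<subseteq> words T m"
  shows "app T m w fs \<in> words T m"
  using Comp_hom[OF tuple(1)[OF refl assms(2)]] assms(1) by (simp add: app_def words_def)

lemma app_Pr:
  assumes "i < length gs" "set gs \<subseteq> words T m"
  shows "app T m (Pr T (length gs) i) gs = gs ! i"
  using tuple(2)[OF refl assms(2,1)] by (simp add: app_def)

text \<open>Composites of tuples are tuples of composites, by the uniqueness part of the product
  property; the rest is associativity in \<open>T\<close>.\<close>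

lemma app_app:
  assumes "w \<in> words T (length fs)" "set fs \<subseteq> words T (length gs)" "set gs \<subseteq> words T m"
  shows "app T m (app T (length gs) w fs) gs = app T m w (map (\<lambda>f. app T m f gs) fs)"
proof -
  note f = tuple[OF refl assms(2)] and g = tuple[OF refl assms(3)]
  have s: "set (map (\<lambda>f. app T m f gs) fs) \<subseteq> words T m"
    using assms app_words by auto
  have "Comp T (tuple T (length gs) fs) (tuple T m gs) = tuple T m (map (\<lambda>f. app T m f gs) fs)"
  proof (rule tuple_unique[OF _ s])
    show "Comp T (tuple T (length gs) fs) (tuple T m gs) \<in> hom T m (length fs)"
      by (rule Comp_hom[OF g(1) f(1)])
    show "Comp T (Pr T (length fs) i) (Comp T (tuple T (length gs) fs) (tuple T m gs))
        = map (\<lambda>f. app T m f gs) fs ! i" if "i < length fs" for i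
      using that Comp_assoc[OF g(1) f(1) Pr_hom[OF that]] f(2)[OF that] by (simp add: app_def)
  qed simp
  then show ?thesis
    using Comp_assoc[OF g(1) f(1), of w 1] assms(1) by (simp add: app_def words_def)
qed

lemma app_id:
  assumes "w \<in> words T n"
  shows "app T n w (map (Pr T n) [0..<n]) = w"
proof -
  have "tuple T n (map (Pr T n) [0..<n]) = Id T n"
    by (rule tuple_unique[symmetric])
      (use Pr_words Obj_UNIV in \<open>auto intro: Id_hom Comp_Id_right[OF Pr_hom]\<close>)
  then show ?thesis using Comp_Id_right assms by (simp add: app_def words_def)
qed

text \<open>Substituting the projections gives a word back (\<open>app_id\<close>), so a word is
  determined by its action. Identities such as \<open>gam_assoc\<close> are proved through this
  principle instead of by handling tuples.\<close>

lemma word_eqI: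
  assumes "v \<in> words T n" "w \<in> words T n"
    and "\<And>m gs. length gs = n \<Longrightarrow> set gs \<subseteq> words T m \<Longrightarrow> app T m v gs = app T m w gs"
  shows "v = w"
proof -
  have "set (map (Pr T n) [0..<n]) \<subseteq> words T n" using Pr_words by auto
  from assms(3)[OF _ this] show ?thesis using app_id[OF assms(1)] app_id[OF assms(2)] by simp
qed

lemma subst_word_app: "subst_word T l w f = app T l w (map (Pr T l) f)"
  by (simp add: subst_word_def app_def)

lemma subst_word_words:
  assumes "w \<in> words T k" "fin_fun k l f"
  shows "subst_word T l w f \<in> words T l"
  unfolding subst_word_app using assms set_Pr[OF assms(2)] by (intro app_words) (auto simp: fin_fun_def)

text \<open>The words substituted along \<open>f\<close> are projections, and a projection acts by
  picking an entry.\<close>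

lemma app_subst_word:
  assumes "w \<in> words T k" "fin_fun k l f" "length gs = l" "set gs \<subseteq> words T m"
  shows "app T m (subst_word T l w f) gs = app T m w (map ((!) gs) f)"
proof -
  have "map (\<lambda>v. app T m v gs) (map (Pr T l) f) = map ((!) gs) f"
    using assms app_Pr by (auto simp: fin_fun_def)
  moreover have "app T m (app T (length gs) w (map (Pr T l) f)) gs
      = app T m w (map (\<lambda>v. app T m v gs) (map (Pr T l) f))"
    using assms set_Pr[OF assms(2)] by (intro app_app) (simp_all add: fin_fun_def)
  ultimately show ?thesis by (simp only: subst_word_app assms(3))
qed

lemma fin_fun_incl: "i < length ns \<Longrightarrow> fin_fun (ns ! i) (sum_list ns) (incl ns i)"
  using set_incl by (auto simp: fin_fun_def)

text \<open>\<open>gam\<close> places each inner word on its block through an inclusion. Read as an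
  action on lists, the inclusions disappear into \<open>split_blocks\<close>, and \<open>gam\<close>
  becomes blockwise evaluation followed by \<open>w\<close>.\<close>

lemma
  assumes "w \<in> words T (length ws)" "word_list T ws"
  shows gam_words: "gam T w ws \<in> words T (sum_list (map (Dom T) ws))"
    and app_gam: "length gs = sum_list (map (Dom T) ws) \<Longrightarrow> set gs \<subseteq> words T m \<Longrightarrow>
      app T m (gam T w ws) gs = app T m w (evs T (app T m) ws gs)"
proof -
  let ?ns = "map (Dom T) ws" and ?N = "sum_list (map (Dom T) ws)"
  let ?fs = "map (\<lambda>i. subst_word T ?N (ws ! i) (incl ?ns i)) [0..<length ws]"
  have g: "gam T w ws = app T ?N w ?fs" by (simp add: gam_def app_def Let_def)
  have w: "ws ! i \<in> words T (?ns ! i)" if "i < length ws" for i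
    using assms(2) that by (simp add: word_list_def)
  have ff: "fin_fun (?ns ! i) ?N (incl ?ns i)" if "i < length ws" for i
    using that by (intro fin_fun_incl) simp
  have s: "set ?fs \<subseteq> words T ?N" using subst_word_words[OF w ff] by auto
  show "gam T w ws \<in> words T ?N" unfolding g using assms(1) s by (intro app_words) simp_all
  assume gs: "length gs = ?N" "set gs \<subseteq> words T m"
  have "map (\<lambda>f. app T m f gs) ?fs = evs T (app T m) ws gs"
  proof (rule nth_equalityI)
    fix i assume "i < length (map (\<lambda>f. app T m f gs) ?fs)"
    then have i: "i < length ws" by simp
    then show "map (\<lambda>f. app T m f gs) ?fs ! i = evs T (app T m) ws gs ! i"
      using app_subst_word[OF w ff gs] map_nth_incl[of i ?ns gs] gs by (simp add: evs_nth)
  qed simp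
  then show "app T m (gam T w ws) gs = app T m w (evs T (app T m) ws gs)"
    unfolding g using app_app[of w ?fs gs m] assms(1) s gs by simp
qed

lemma word1_words: "word1 T \<in> words T 1"
  using Pr_words by (simp add: word1_def)

lemma app_word1: "g \<in> words T m \<Longrightarrow> app T m (word1 T) [g] = g"
  using app_Pr[of 0 "[g]" m] by (simp add: word1_def)

text \<open>Both sides of the associativity axiom for \<open>CC\<close> must start at the operation
  of the same word; that is the first claim, and the others are the bookkeeping of arities under
  which the axiom is well typed. The equation holds because both words act by the same nested
  evaluation.\<close>

lemma
  assumes "w \<in> words T (length ws)" "length wss = length ws"
    "\<And>i. i < length ws \<Longrightarrow> ws ! i \<in> words T (length (wss ! i))" "word_list T (concat wss)"
  shows gam_assoc: "gam T (gam T w ws) (concat wss) = gam T w (map2 (gam T) ws wss)"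
    and word_list_map2_gam: "word_list T (map2 (gam T) ws wss)"
    and map_Dom_map2_gam: "map (Dom T) (map2 (gam T) ws wss) = map (\<lambda>vs. sum_list (map (Dom T) vs)) wss"
    and length_concat_words: "length (concat wss) = sum_list (map (Dom T) ws)"
    and word_list_nested: "i < length ws \<Longrightarrow> word_list T (wss ! i)" "word_list T ws"
proof -
  have d: "Dom T (ws ! i) = length (wss ! i)" if "i < length ws" for i
    using words_Dom[OF assms(3)[OF that]] .
  show wl: "word_list T ws" using assms(3) d by (auto simp: word_list_def in_set_conv_nth)
  show wls: "word_list T (wss ! i)" if "i < length ws" for i
    using assms(2,4) that by (auto simp: word_list_def)
  have "map (Dom T) ws = map length wss" using d assms(2) by (intro nth_equalityI) simp_all
  then show len: "length (concat wss) = sum_list (map (Dom T) ws)" by (simp add: length_concat)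
  have g: "gam T (ws ! i) (wss ! i) \<in> words T (sum_list (map (Dom T) (wss ! i)))" if "i < length ws" for i
    using that by (intro gam_words assms(3) wls)
  show md: "map (Dom T) (map2 (gam T) ws wss) = map (\<lambda>vs. sum_list (map (Dom T) vs)) wss"
    using words_Dom[OF g] assms(2) by (intro nth_equalityI) simp_all
  show wlg: "word_list T (map2 (gam T) ws wss)"
    using g words_Dom[OF g] assms(2) by (fastforce simp: word_list_def in_set_conv_nth)
  have sum: "sum_list (map (\<lambda>vs. sum_list (map (Dom T) vs)) wss) = sum_list (map (Dom T) (concat wss))"
    by (simp add: map_concat sum_list_concat comp_def)
  have gw: "gam T w ws \<in> words T (length (concat wss))" using gam_words[OF assms(1) wl] len by simp
  show "gam T (gam T w ws) (concat wss) = gam T w (map2 (gam T) ws wss)"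
  proof (rule word_eqI)
    show "gam T (gam T w ws) (concat wss) \<in> words T (sum_list (map (Dom T) (concat wss)))"
      by (rule gam_words[OF gw assms(4)])
    show "gam T w (map2 (gam T) ws wss) \<in> words T (sum_list (map (Dom T) (concat wss)))"
      using gam_words[OF _ wlg, of w] assms(1,2) md sum by simp
    fix m gs assume gs: "length gs = sum_list (map (Dom T) (concat wss))" "set gs \<subseteq> words T m"
    let ?b = "split_blocks (map (\<lambda>vs. sum_list (map (Dom T) vs)) wss) gs"
    have b: "length (?b ! i) = sum_list (map (Dom T) (wss ! i))" "set (?b ! i) \<subseteq> words T m" if "i < length ws" for i
      using length_split_blocks_nth[of gs "map (\<lambda>vs. sum_list (map (Dom T) vs)) wss" i]
        set_split_blocks_nth[of i "map (\<lambda>vs. sum_list (map (Dom T) vs)) wss" gs] gs sum that assms(2) by auto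
    have "set (evs T (app T m) (concat wss) gs) \<subseteq> words T m"
      using gs assms(4) by (intro set_evs app_words) (auto simp: word_list_def)
    then have "app T m (gam T (gam T w ws) (concat wss)) gs
        = app T m w (evs T (app T m) ws (evs T (app T m) (concat wss) gs))"
      using app_gam[OF gw assms(4) gs] app_gam[OF assms(1) wl, of "evs T (app T m) (concat wss) gs" m] len by simp
    also have "evs T (app T m) ws (evs T (app T m) (concat wss) gs) = evs T (app T m) (map2 (gam T) ws wss) gs"
      by (rule nth_equalityI)
        (use assms(2) app_gam[OF assms(3) wls b] in
          \<open>simp_all add: evs_evs[OF assms(2) d gs(1)], simp_all add: evs_nth md del: map_map\<close>)
    also have "app T m w (evs T (app T m) (map2 (gam T) ws wss) gs) = app T m (gam T w (map2 (gam T) ws wss)) gs"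
      using assms(1,2) md gs sum by (intro app_gam[OF _ wlg, symmetric]) simp_all
    finally show "app T m (gam T (gam T w ws) (concat wss)) gs = app T m (gam T w (map2 (gam T) ws wss)) gs" .
  qed
qed

lemma map_Dom_replicate_word1: "map (Dom T) (replicate k (word1 T)) = replicate k 1"
  using words_Dom[OF word1_words] by simp

lemma split_blocks_ones: "length xs = k \<Longrightarrow> split_blocks (replicate k 1) xs = map (\<lambda>x. [x]) xs"
  by (induction xs arbitrary: k) auto

lemma evs_word1: "length xs = k \<Longrightarrow> evs T e (replicate k (word1 T)) xs = map (\<lambda>x. e (word1 T) [x]) xs"
  unfolding evs_def map_Dom_replicate_word1 split_blocks_ones by (intro nth_equalityI) simp_all

lemma word_list_word1: "word_list T (replicate k (word1 T))"
  using word1_words words_Dom[OF word1_words] by (auto simp: word_list_def)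

lemma gam_unit_right:
  assumes "w \<in> words T k"
  shows "gam T w (replicate k (word1 T)) = w"
proof (rule word_eqI[OF _ assms])
  have w: "w \<in> words T (length (replicate k (word1 T)))" using assms by simp
  have k: "sum_list (map (Dom T) (replicate k (word1 T))) = k"
    unfolding map_Dom_replicate_word1 by (simp add: sum_list_replicate)
  show "gam T w (replicate k (word1 T)) \<in> words T k"
    using gam_words[OF w word_list_word1] k by simp
  fix m gs assume gs: "length gs = k" "set gs \<subseteq> words T m"
  have "map (\<lambda>x. app T m (word1 T) [x]) gs = gs" using gs app_word1 by (auto intro!: map_idI)
  then show "app T m (gam T w (replicate k (word1 T))) gs = app T m w gs"
    using app_gam[OF w word_list_word1, of gs m] gs k by (simp add: evs_word1)
qed

lemma word_list_single: "w \<in> words T k \<Longrightarrow> word_list T [w]"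
  using words_Dom by (auto simp: word_list_def)

lemma gam_unit_left:
  assumes "w \<in> words T k"
  shows "gam T (word1 T) [w] = w"
proof (rule word_eqI[OF _ assms])
  have w: "word1 T \<in> words T (length [w])" using word1_words by simp
  show "gam T (word1 T) [w] \<in> words T k"
    using gam_words[OF w word_list_single[OF assms]] words_Dom[OF assms] by simp
  fix m gs assume gs: "length gs = k" "set gs \<subseteq> words T m"
  then show "app T m (gam T (word1 T) [w]) gs = app T m w gs"
    using app_gam[OF w word_list_single[OF assms], of gs m] words_Dom[OF assms] app_words[of w gs m] assms
    by (simp add: evs_singleton app_word1)
qed

text \<open>The two sides of \<open>CC_CS_outer\<close> start at the same word: as actions, both
  select results of the inner words through \<open>f\<close>, by
  \<open>evs_block_fun\<close>.\<close>

lemma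
  assumes "w \<in> words T k" "fin_fun k (length ws) f" "word_list T ws"
  shows subst_gam_outer: "subst_word T (sum_list (map (Dom T) ws)) (gam T w (map ((!) ws) f)) (block_fun (map (Dom T) ws) f)
      = gam T (subst_word T (length ws) w f) ws"
    and word_list_map_nth: "word_list T (map ((!) ws) f)"
    and words_length_map_nth: "w \<in> words T (length (map ((!) ws) f))"
    and fin_fun_block_fun_Dom: "fin_fun (sum_list (map (Dom T) (map ((!) ws) f))) (sum_list (map (Dom T) ws)) (block_fun (map (Dom T) ws) f)"
proof -
  let ?N = "sum_list (map (Dom T) ws)" and ?f = "block_fun (map (Dom T) ws) f"
  have b: "\<And>i. i \<in> set f \<Longrightarrow> i < length ws" using assms by (auto simp: fin_fun_def)
  show wl: "word_list T (map ((!) ws) f)" using assms(3) b by (auto simp: word_list_def)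
  show w: "w \<in> words T (length (map ((!) ws) f))" using assms by (simp add: fin_fun_def)
  have "map (Dom T) (map ((!) ws) f) = map ((!) (map (Dom T) ws)) f" using b by simp
  then show ff: "fin_fun (sum_list (map (Dom T) (map ((!) ws) f))) ?N ?f"
    using fin_fun_block_fun[of k "map (Dom T) ws" f] assms(2) by (simp del: map_map)
  note gw = gam_words[OF w wl] and sw = subst_word_words[OF assms(1,2)]
  show "subst_word T ?N (gam T w (map ((!) ws) f)) ?f = gam T (subst_word T (length ws) w f) ws"
  proof (rule word_eqI[OF subst_word_words[OF gw ff] gam_words[OF sw assms(3)]])
    fix m gs assume gs: "length gs = ?N" "set gs \<subseteq> words T m"
    have s: "set (map ((!) gs) ?f) \<subseteq> words T m" using set_map_nth[OF ff gs(1)] gs(2) by blast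
    have "length (map ((!) gs) ?f) = sum_list (map (Dom T) (map ((!) ws) f))" using ff by (simp add: fin_fun_def)
    then have "app T m (subst_word T ?N (gam T w (map ((!) ws) f)) ?f) gs = app T m w (map ((!) (evs T (app T m) ws gs)) f)"
      using app_subst_word[OF gw ff gs] app_gam[OF w wl _ s] by (simp add: evs_block_fun[OF assms(2) gs(1)] del: map_map)
    moreover have "set (evs T (app T m) ws gs) \<subseteq> words T m"
      using gs assms(3) by (intro set_evs app_words) (auto simp: word_list_def)
    ultimately show "app T m (subst_word T ?N (gam T w (map ((!) ws) f)) ?f) gs
        = app T m (gam T (subst_word T (length ws) w f) ws) gs"
      using app_gam[OF sw assms(3) gs] app_subst_word[OF assms(1,2)] by simp
  qed
qed

text \<open>The same for \<open>CC_CS_inner\<close>: both words apply every \<open>ws ! i\<close> to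
  its own block reindexed by \<open>gs ! i\<close>, by \<open>evs_block_sum\<close>.\<close>

lemma
  assumes "w \<in> words T k" "length ws = k" "length gs = k" "length ns' = k"
    "\<And>i. i < k \<Longrightarrow> ws ! i \<in> words T (Dom T (ws ! i))"
    "\<And>i. i < k \<Longrightarrow> fin_fun (Dom T (ws ! i)) (ns' ! i) (gs ! i)"
  shows subst_gam_inner: "subst_word T (sum_list ns') (gam T w ws) (block_sum ns' gs)
      = gam T w (map (\<lambda>i. subst_word T (ns' ! i) (ws ! i) (gs ! i)) [0..<k])"
    and map_Dom_substs: "map (Dom T) (map (\<lambda>i. subst_word T (ns' ! i) (ws ! i) (gs ! i)) [0..<k]) = ns'"
    and word_list_substs: "word_list T (map (\<lambda>i. subst_word T (ns' ! i) (ws ! i) (gs ! i)) [0..<k])"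
    and fin_fun_block_sum_Dom: "fin_fun (sum_list (map (Dom T) ws)) (sum_list ns') (block_sum ns' gs)"
    and word_list_inner: "word_list T ws"
proof -
  let ?vs = "map (\<lambda>i. subst_word T (ns' ! i) (ws ! i) (gs ! i)) [0..<k]"
  have sw: "subst_word T (ns' ! i) (ws ! i) (gs ! i) \<in> words T (ns' ! i)" if "i < k" for i
    using that by (intro subst_word_words[OF assms(5,6)])
  show d: "map (Dom T) ?vs = ns'" using assms(4) words_Dom[OF sw] by (intro nth_equalityI) simp_all
  show wl': "word_list T ?vs" using sw words_Dom[OF sw] by (auto simp: word_list_def)
  show wl: "word_list T ws" using assms(2,5) by (auto simp: word_list_def in_set_conv_nth)
  have "map length gs = map (Dom T) ws"
    using assms(2,3,6) by (intro nth_equalityI) (simp_all add: fin_fun_def)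
  then show ff: "fin_fun (sum_list (map (Dom T) ws)) (sum_list ns') (block_sum ns' gs)"
    using fin_fun_block_sum[of gs ns'] assms(3,4,6) by (simp add: fin_fun_def)
  have w: "w \<in> words T (length ws)" "w \<in> words T (length ?vs)" using assms(1,2) by simp_all
  note gw = gam_words[OF w(1) wl] and gv = gam_words[OF w(2) wl', unfolded d]
  show "subst_word T (sum_list ns') (gam T w ws) (block_sum ns' gs) = gam T w ?vs"
  proof (rule word_eqI[OF subst_word_words[OF gw ff] gv])
    fix m hs assume hs: "length hs = sum_list ns'" "set hs \<subseteq> words T m"
    have s: "set (map ((!) hs) (block_sum ns' gs)) \<subseteq> words T m" using set_map_nth[OF ff hs(1)] hs(2) by blast
    have b: "length (split_blocks ns' hs ! i) = ns' ! i" "set (split_blocks ns' hs ! i) \<subseteq> words T m" if "i < k" for i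
      using that length_split_blocks_nth[OF hs(1)] set_split_blocks_nth[of i ns' hs] hs(2) assms(4) by auto
    have "length (map ((!) hs) (block_sum ns' gs)) = sum_list (map (Dom T) ws)" using ff by (simp add: fin_fun_def)
    then have "app T m (subst_word T (sum_list ns') (gam T w ws) (block_sum ns' gs)) hs
        = app T m w (evs T (app T m) ws (map ((!) hs) (block_sum ns' gs)))"
      using app_subst_word[OF gw ff hs] app_gam[OF w(1) wl _ s] by simp
    also have "evs T (app T m) ws (map ((!) hs) (block_sum ns' gs))
        = map (\<lambda>i. app T m (ws ! i) (map ((!) (split_blocks ns' hs ! i)) (gs ! i))) [0..<length ws]"
      using assms(2-4,6) hs(1) by (intro evs_block_sum) simp_all
    also have "\<dots> = evs T (app T m) ?vs hs"
      by (rule nth_equalityI)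
        (use assms(2) app_subst_word[OF assms(5,6) b] in \<open>simp_all add: evs_nth d del: map_map\<close>)
    also have "app T m w (evs T (app T m) ?vs hs) = app T m (gam T w ?vs) hs"
      using app_gam[OF w(2) wl', of hs m] hs d by simp
    finally show "app T m (subst_word T (sum_list ns') (gam T w ws) (block_sum ns' gs)) hs = app T m (gam T w ?vs) hs" .
  qed
qed

lemma subst_subst:
  assumes "w \<in> words T k" "fin_fun k l f" "fin_fun l m g"
  shows "subst_word T m (subst_word T l w f) g = subst_word T m w (map ((!) g) f)"
proof (rule word_eqI)
  note sw = subst_word_words[OF assms(1,2)] and ff = fin_fun_map_nth[OF assms(2,3)]
  show "subst_word T m (subst_word T l w f) g \<in> words T m" by (rule subst_word_words[OF sw assms(3)])
  show "subst_word T m w (map ((!) g) f) \<in> words T m" by (rule subst_word_words[OF assms(1) ff])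
  fix n gs assume gs: "length gs = m" "set gs \<subseteq> words T n"
  have "length (map ((!) gs) g) = l" "set (map ((!) gs) g) \<subseteq> words T n"
    using set_map_nth[OF assms(3) gs(1)] gs(2) assms(3) by (auto simp: fin_fun_def)
  then show "app T n (subst_word T m (subst_word T l w f) g) gs = app T n (subst_word T m w (map ((!) g) f)) gs"
    using app_subst_word[OF sw assms(3) gs] app_subst_word[OF assms(1,2)] app_subst_word[OF assms(1) ff gs]
      by (simp add: map_nth_map_nth[OF assms(2,3)] del: map_map)
qed

lemma subst_id: "w \<in> words T k \<Longrightarrow> subst_word T k w [0..<k] = w"
  unfolding subst_word_app by (rule app_id)

lemma fin_fun_id: "fin_fun k k [0..<k]"
  by (auto simp: fin_fun_def)

end

section \<open>Powers and products\<close>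

lemma pow_cat_sel [simp]:
  "Obj (pow_cat X n) = {xs. length xs = n \<and> set xs \<subseteq> Obj X}"
  "Arr (pow_cat X n) = {fs. length fs = n \<and> set fs \<subseteq> Arr X}"
  "Dom (pow_cat X n) = map (Dom X)" "Cod (pow_cat X n) = map (Cod X)"
  "Id (pow_cat X n) = map (Id X)" "Comp (pow_cat X n) = map2 (Comp X)"
  by (simp_all add: pow_cat_def)

lemma hom_pow_iff: "fs \<in> hom (pow_cat X n) xs ys \<longleftrightarrow>
    length fs = n \<and> length xs = n \<and> length ys = n \<and> (\<forall>i<n. fs ! i \<in> hom X (xs ! i) (ys ! i))"
  (is "?L \<longleftrightarrow> ?R")
proof
  assume ?L
  then have "length fs = n" "set fs \<subseteq> Arr X" "xs = map (Dom X) fs" "ys = map (Cod X) fs"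
    by (auto simp: hom_def)
  then show ?R by (auto simp: hom_def subset_iff)
next
  assume R: ?R
  then have "set fs \<subseteq> Arr X" by (auto simp: hom_def in_set_conv_nth)
  moreover have "map (Dom X) fs = xs" "map (Cod X) fs = ys"
    by (rule nth_equalityI; use R in \<open>auto simp: hom_def\<close>)+
  ultimately show ?L using R by (simp add: hom_def)
qed

lemma category_pow_cat:
  assumes "category X"
  shows "category (pow_cat X n)"
proof -
  interpret X: category X by fact
  show ?thesis
  proof
    fix fs assume "fs \<in> Arr (pow_cat X n)"
    then show "Dom (pow_cat X n) fs \<in> Obj (pow_cat X n)" "Cod (pow_cat X n) fs \<in> Obj (pow_cat X n)"
      using X.Dom_closed X.Cod_closed by auto
  next
    fix xs assume "xs \<in> Obj (pow_cat X n)"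
    then show "Id (pow_cat X n) xs \<in> hom (pow_cat X n) xs xs"
      unfolding hom_pow_iff using X.Id_hom by (auto simp: subset_iff)
  next
    fix fs xs ys gs zs assume f: "fs \<in> hom (pow_cat X n) xs ys" and g: "gs \<in> hom (pow_cat X n) ys zs"
    then show "Comp (pow_cat X n) gs fs \<in> hom (pow_cat X n) xs zs"
      using X.Comp_hom by (auto simp: hom_pow_iff)
    fix hs vs assume h: "hs \<in> hom (pow_cat X n) zs vs"
    show "Comp (pow_cat X n) hs (Comp (pow_cat X n) gs fs) = Comp (pow_cat X n) (Comp (pow_cat X n) hs gs) fs"
    proof (rule nth_equalityI)
      fix i assume i: "i < length (Comp (pow_cat X n) hs (Comp (pow_cat X n) gs fs))"
      then have "i < n" using f g h by (simp add: hom_pow_iff)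
      then show "Comp (pow_cat X n) hs (Comp (pow_cat X n) gs fs) ! i = Comp (pow_cat X n) (Comp (pow_cat X n) hs gs) fs ! i"
        using f g h X.Comp_assoc[of "fs ! i" "xs ! i" "ys ! i" "gs ! i" "zs ! i" "hs ! i" "vs ! i"]
        by (simp add: hom_pow_iff)
    qed (use f g h in \<open>simp add: hom_pow_iff\<close>)
  next
    fix fs xs ys assume f: "fs \<in> hom (pow_cat X n) xs ys"
    show "Comp (pow_cat X n) fs (Id (pow_cat X n) xs) = fs"
      by (rule nth_equalityI) (use f X.Comp_Id_right in \<open>auto simp: hom_pow_iff\<close>)
    show "Comp (pow_cat X n) (Id (pow_cat X n) ys) fs = fs"
      by (rule nth_equalityI) (use f X.Comp_Id_left in \<open>auto simp: hom_pow_iff\<close>)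
  qed
qed

lemma square_pow_cat:
  assumes "length ms = n" "length us = n" "length vs = n" "length ns = n"
    "\<And>i. i < n \<Longrightarrow> square X (ms ! i) (us ! i) (vs ! i) (ns ! i)"
  shows "square (pow_cat X n) ms us vs ns"
proof -
  have "set us \<subseteq> Arr X" "set vs \<subseteq> Arr X" using assms by (auto simp: square_def in_set_conv_nth)
  moreover have "map2 (Comp X) ns us = map2 (Comp X) vs ms"
    by (rule nth_equalityI) (use assms in \<open>auto simp: square_def\<close>)
  moreover have "ms \<in> hom (pow_cat X n) (map (Dom X) us) (map (Dom X) vs)"
    "ns \<in> hom (pow_cat X n) (map (Cod X) us) (map (Cod X) vs)"
    using assms unfolding hom_pow_iff by (simp_all add: square_def)
  ultimately show ?thesis using assms by (simp add: square_def)
qed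

lemma iso_pow_cat:
  assumes "category X" "\<And>i. i < n \<Longrightarrow> iso_in X (fs ! i)" "length fs = n"
  shows "iso_in (pow_cat X n) fs"
proof -
  interpret X: category X by fact
  interpret P: category "pow_cat X n" by (rule category_pow_cat) fact
  have f: "fs ! i \<in> hom X (Dom X (fs ! i)) (Cod X (fs ! i))" if "i < n" for i
    using assms(2)[OF that] by (simp add: iso_in_def hom_def)
  note iv = X.inv_arr[OF assms(2) f]
  show ?thesis
  proof (rule P.iso_inI)
    show "fs \<in> hom (pow_cat X n) (map (Dom X) fs) (map (Cod X) fs)"
      using assms(3) f by (simp add: hom_pow_iff)
    show "map (inv_arr X) fs \<in> hom (pow_cat X n) (map (Cod X) fs) (map (Dom X) fs)"
      using assms(3) iv(1) by (simp add: hom_pow_iff)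
    show "Comp (pow_cat X n) (map (inv_arr X) fs) fs = Id (pow_cat X n) (map (Dom X) fs)"
      by (rule nth_equalityI) (use assms(3) iv(2) in simp_all)
    show "Comp (pow_cat X n) fs (map (inv_arr X) fs) = Id (pow_cat X n) (map (Cod X) fs)"
      by (rule nth_equalityI) (use assms(3) iv(3) in simp_all)
  qed
qed

text \<open>Conditions on hom-sets instead of arrows with matching ends, because facts about lists
  and blocks of arrows come in that form.\<close>

lemma functorsI_hom:
  assumes "category C" "Src F = C" "Trg F = D" "OMap F \<in> extensional (Obj C)" "AMap F \<in> extensional (Arr C)"
    and "\<And>x. x \<in> Obj C \<Longrightarrow> OMap F x \<in> Obj D"
    and "\<And>f x y. f \<in> hom C x y \<Longrightarrow> x \<in> Obj C \<Longrightarrow> y \<in> Obj C \<Longrightarrow> AMap F f \<in> hom D (OMap F x) (OMap F y)"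
    and "\<And>x. x \<in> Obj C \<Longrightarrow> AMap F (Id C x) = Id D (OMap F x)"
    and "\<And>f g x y z. f \<in> hom C x y \<Longrightarrow> g \<in> hom C y z \<Longrightarrow> AMap F (Comp C g f) = Comp D (AMap F g) (AMap F f)"
  shows "F \<in> functors C D"
proof -
  interpret C: category C by fact
  show ?thesis
  proof (rule functorsI)
    fix f assume f: "f \<in> Arr C"
    show "AMap F f \<in> hom D (OMap F (Dom C f)) (OMap F (Cod C f))"
      using f by (intro assms(7) C.Arr_hom C.Dom_closed C.Cod_closed)
    fix g assume "g \<in> Arr C" "Dom C g = Cod C f"
    then show "AMap F (Comp C g f) = Comp D (AMap F g) (AMap F f)"
      using f by (intro assms(9)[of f "Dom C f" "Cod C f" g "Cod C g"]) (simp_all add: hom_def)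
  qed (use assms in simp_all)
qed

lemma nat_transsI_hom:
  assumes "NSrc \<eta> = F" "NTrg \<eta> = G" "F \<in> functors C D" "G \<in> functors C D" "category C"
    "NComp \<eta> \<in> extensional (Obj C)"
    and "\<And>x. x \<in> Obj C \<Longrightarrow> NComp \<eta> x \<in> hom D (OMap F x) (OMap G x)"
    and "\<And>f x y. f \<in> hom C x y \<Longrightarrow> x \<in> Obj C \<Longrightarrow> y \<in> Obj C \<Longrightarrow>
      Comp D (NComp \<eta> y) (AMap F f) = Comp D (AMap G f) (NComp \<eta> x)"
  shows "\<eta> \<in> nat_transs F G"
proof (rule nat_transsI)
  fix f assume "f \<in> Arr C"
  then show "Comp D (NComp \<eta> (Cod C f)) (AMap F f) = Comp D (AMap G f) (NComp \<eta> (Dom C f))"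
    using category.Dom_closed category.Cod_closed assms(5) by (intro assms(8)) (auto simp: hom_def)
qed (use assms functorsD in auto)

lemma hom_blocks:
  assumes "fs \<in> hom (pow_cat X (sum_list ns)) xs ys" "i < length ns"
  shows "split_blocks ns fs ! i \<in> hom (pow_cat X (ns ! i)) (split_blocks ns xs ! i) (split_blocks ns ys ! i)"
  using assms offset_bound[OF assms(2)]
  by (auto simp: hom_pow_iff length_split_blocks_nth split_blocks_nth_nth)

lemma blocks_Obj:
  assumes "xs \<in> Obj (pow_cat X (sum_list ns))" "i < length ns"
  shows "split_blocks ns xs ! i \<in> Obj (pow_cat X (ns ! i))"
  using assms set_split_blocks_nth[OF assms(2), of xs] by (auto simp: length_split_blocks_nth)

lemma func_prod_sel [simp]:
  "Src (func_prod X Y ns Fs) = pow_cat X (sum_list ns)" "Trg (func_prod X Y ns Fs) = pow_cat Y (length ns)"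
  by (simp_all add: func_prod_def)

lemma func_prod_OMap:
  "xs \<in> Obj (pow_cat X (sum_list ns)) \<Longrightarrow> OMap (func_prod X Y ns Fs) xs = map2 OMap Fs (split_blocks ns xs)"
  by (simp add: func_prod_def)

lemma func_prod_AMap:
  "fs \<in> Arr (pow_cat X (sum_list ns)) \<Longrightarrow> AMap (func_prod X Y ns Fs) fs = map2 AMap Fs (split_blocks ns fs)"
  by (simp add: func_prod_def)

lemma func_prod_functors:
  assumes X: "category X" and l: "length Fs = length ns"
    and F: "\<And>i. i < length ns \<Longrightarrow> Fs ! i \<in> functors (pow_cat X (ns ! i)) Y"
  shows "func_prod X Y ns Fs \<in> functors (pow_cat X (sum_list ns)) (pow_cat Y (length ns))"
proof (rule functorsI_hom[OF category_pow_cat[OF X]])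
  let ?P = "pow_cat X (sum_list ns)" and ?F = "func_prod X Y ns Fs"
  interpret P: category ?P by (rule category_pow_cat[OF X])
  note FD = functorsD[OF F]
  fix xs assume xs: "xs \<in> Obj ?P"
  show "OMap ?F xs \<in> Obj (pow_cat Y (length ns))"
    unfolding func_prod_OMap[OF xs] using l FD(3)[OF _ blocks_Obj[OF xs]] by (auto simp: in_set_conv_nth)
  have i: "Id ?P xs \<in> Arr ?P" using P.Id_hom[OF xs] homD by fast
  show "AMap ?F (Id ?P xs) = Id (pow_cat Y (length ns)) (OMap ?F xs)"
    unfolding func_prod_OMap[OF xs] func_prod_AMap[OF i]
    by (rule nth_equalityI) (use l FD(6)[OF _ blocks_Obj[OF xs]] in \<open>auto simp: split_blocks_map\<close>)
next
  let ?P = "pow_cat X (sum_list ns)" and ?F = "func_prod X Y ns Fs"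
  note FD = functorsD[OF F]
  fix fs xs ys assume f: "fs \<in> hom ?P xs ys" and ob: "xs \<in> Obj ?P" "ys \<in> Obj ?P"
  show "AMap ?F fs \<in> hom (pow_cat Y (length ns)) (OMap ?F xs) (OMap ?F ys)"
    unfolding func_prod_OMap[OF ob(1)] func_prod_OMap[OF ob(2)] func_prod_AMap[OF homD[OF f, THEN conjunct1]]
    unfolding hom_pow_iff using l FD(5)[OF _ hom_blocks[OF f]] by simp
next
  let ?P = "pow_cat X (sum_list ns)" and ?F = "func_prod X Y ns Fs"
  interpret P: category ?P by (rule category_pow_cat[OF X])
  note FD = functorsD[OF F]
  fix fs gs xs ys zs assume f: "fs \<in> hom ?P xs ys" and g: "gs \<in> hom ?P ys zs"
  \<comment> \<open>Cutting into blocks commutes with entrywise composition; the lengths known from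
    the hom-sets justify the computation by index.\<close>
  have c: "split_blocks ns (map2 (Comp X) gs fs) ! i = map2 (Comp X) (split_blocks ns gs ! i) (split_blocks ns fs ! i)"
    if "i < length ns" for i
    using hom_blocks[OF f that] hom_blocks[OF g that] hom_blocks[OF P.Comp_hom[OF f g] that] f g that offset_bound[OF that]
    by (intro nth_equalityI) (auto simp: hom_pow_iff split_blocks_nth_nth)
  show "AMap ?F (Comp ?P gs fs) = Comp (pow_cat Y (length ns)) (AMap ?F gs) (AMap ?F fs)"
    unfolding func_prod_AMap[OF homD[OF f, THEN conjunct1]] func_prod_AMap[OF homD[OF g, THEN conjunct1]]
      func_prod_AMap[OF homD[OF P.Comp_hom[OF f g], THEN conjunct1]]
    by (rule nth_equalityI) (use l FD(7)[OF _ hom_blocks[OF f] hom_blocks[OF g]] c in auto)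
qed (simp_all add: func_prod_def)

lemma nat_prod_sel [simp]:
  "NSrc (nat_prod X Y ns \<alpha>s) = func_prod X Y ns (map NSrc \<alpha>s)"
  "NTrg (nat_prod X Y ns \<alpha>s) = func_prod X Y ns (map NTrg \<alpha>s)"
  by (simp_all add: nat_prod_def)

lemma nat_prod_NComp:
  "xs \<in> Obj (pow_cat X (sum_list ns)) \<Longrightarrow> NComp (nat_prod X Y ns \<alpha>s) xs = map2 NComp \<alpha>s (split_blocks ns xs)"
  by (simp add: nat_prod_def)

lemma nat_prod_transs:
  assumes X: "category X" and l: "length Fs = length ns" "length Gs = length ns" "length \<alpha>s = length ns"
    and F: "\<And>i. i < length ns \<Longrightarrow> Fs ! i \<in> functors (pow_cat X (ns ! i)) Y"
    and G: "\<And>i. i < length ns \<Longrightarrow> Gs ! i \<in> functors (pow_cat X (ns ! i)) Y"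
    and a: "\<And>i. i < length ns \<Longrightarrow> \<alpha>s ! i \<in> nat_transs (Fs ! i) (Gs ! i)"
  shows "nat_prod X Y ns \<alpha>s \<in> nat_transs (func_prod X Y ns Fs) (func_prod X Y ns Gs)"
proof (rule nat_transsI_hom)
  let ?P = "pow_cat X (sum_list ns)"
  interpret P: category ?P by (rule category_pow_cat[OF X])
  note FD = functorsD[OF F] and GD = functorsD[OF G] and aD = nat_transsD[OF a]
  have e: "map NSrc \<alpha>s = Fs" "map NTrg \<alpha>s = Gs" by (rule nth_equalityI; use l aD in simp)+
  then show "NSrc (nat_prod X Y ns \<alpha>s) = func_prod X Y ns Fs" "NTrg (nat_prod X Y ns \<alpha>s) = func_prod X Y ns Gs"
    by simp_all
  show "func_prod X Y ns Fs \<in> functors ?P (pow_cat Y (length ns))"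
    "func_prod X Y ns Gs \<in> functors ?P (pow_cat Y (length ns))"
    using func_prod_functors[OF X l(1) F] func_prod_functors[OF X l(2) G] by auto
  fix xs assume xs: "xs \<in> Obj ?P"
  show "NComp (nat_prod X Y ns \<alpha>s) xs \<in> hom (pow_cat Y (length ns)) (OMap (func_prod X Y ns Fs) xs) (OMap (func_prod X Y ns Gs) xs)"
    unfolding func_prod_OMap[OF xs] nat_prod_NComp[OF xs] hom_pow_iff
    using l aD(5) blocks_Obj[OF xs] FD(1,2) by simp
next
  let ?P = "pow_cat X (sum_list ns)"
  note FD = functorsD[OF F] and aD = nat_transsD[OF a]
  fix fs xs ys assume f: "fs \<in> hom ?P xs ys" and ob: "xs \<in> Obj ?P" "ys \<in> Obj ?P"
  show "Comp (pow_cat Y (length ns)) (NComp (nat_prod X Y ns \<alpha>s) ys) (AMap (func_prod X Y ns Fs) fs)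
    = Comp (pow_cat Y (length ns)) (AMap (func_prod X Y ns Gs) fs) (NComp (nat_prod X Y ns \<alpha>s) xs)"
    unfolding nat_prod_NComp[OF ob(1)] nat_prod_NComp[OF ob(2)] func_prod_AMap[OF homD[OF f, THEN conjunct1]]
    by (rule nth_equalityI) (use l aD(6) hom_blocks[OF f] FD(1,2) in simp_all)
qed (use X category_pow_cat in \<open>simp_all add: nat_prod_def\<close>)

text \<open>The axioms whisker with a product of identities, whereas \<open>hcomp_id_right\<close>
  expects a single identity transformation.\<close>

lemma nat_prod_id:
  assumes "length Fs = length ns" "\<And>i. i < length ns \<Longrightarrow> Fs ! i \<in> functors (pow_cat X (ns ! i)) Y"
  shows "nat_prod X Y ns (map nat_id Fs) = nat_id (func_prod X Y ns Fs)"
proof -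
  have "map2 NComp (map nat_id Fs) (split_blocks ns xs) = Id (pow_cat Y (length ns)) (OMap (func_prod X Y ns Fs) xs)"
    if "xs \<in> Obj (pow_cat X (sum_list ns))" for xs
    unfolding func_prod_OMap[OF that]
    by (rule nth_equalityI)
       (use assms(1) blocks_Obj[OF that] functorsD(1,2)[OF assms(2)] in simp_all)
  then show ?thesis by (simp add: nat_prod_def nat_id_def comp_def cong: restrict_cong)
qed

text \<open>The factor coming from the identity is an identity arrow and disappears. The horizontal
  composites in the axioms for algebras, morphisms and 2-cells are whiskerings of this kind or of
  the kind of the next lemma, which is why the axioms have simple pointwise forms.\<close>

lemma hcomp_id_right:
  assumes "category E" "\<alpha> \<in> nat_transs F G" "F \<in> functors D E" "G \<in> functors D E" "H \<in> functors C D" "x \<in> Obj C"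
  shows "NComp (\<alpha> \<star> nat_id H) x = NComp \<alpha> (OMap H x)"
proof -
  have o: "OMap H x \<in> Obj D" using functorsD(3)[OF assms(5,6)] .
  then have "NComp \<alpha> (OMap H x) \<in> hom E (OMap F (OMap H x)) (OMap G (OMap H x))"
    using nat_transsD(5)[OF assms(2)] functorsD(1,2)[OF assms(3)] by simp
  then show ?thesis
    using assms(6) functorsD(1,2)[OF assms(5)] functorsD(2,6)[OF assms(3)] o nat_transsD(1)[OF assms(2)]
      category.Comp_Id_right[OF assms(1)] by simp
qed

lemma hcomp_id_left:
  assumes "category E" "F \<in> functors D E" "\<beta> \<in> nat_transs G H" "G \<in> functors C D" "H \<in> functors C D" "x \<in> Obj C"
  shows "NComp (nat_id F \<star> \<beta>) x = AMap F (NComp \<beta> x)"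
proof -
  have b: "NComp \<beta> x \<in> hom D (OMap G x) (OMap H x)"
    using nat_transsD(5)[OF assms(3)] functorsD(1,2)[OF assms(4)] assms(6) by simp
  have o: "OMap H x \<in> Obj D" using functorsD(3)[OF assms(5,6)] .
  show ?thesis
    using functorsD(5)[OF assms(2) b] assms(6) functorsD(1)[OF assms(4)] functorsD(1,2)[OF assms(2)] o nat_transsD(1,2)[OF assms(3)]
      category.Comp_Id_left[OF assms(1)] by simp
qed

lemma hcomp_transs:
  assumes cat: "category C" "category D" "category E"
    and \<beta>: "\<beta> \<in> nat_transs F F'" "F \<in> functors D E" "F' \<in> functors D E"
    and \<alpha>: "\<alpha> \<in> nat_transs G G'" "G \<in> functors C D" "G' \<in> functors C D"
  shows "\<beta> \<star> \<alpha> \<in> nat_transs (func_comp F G) (func_comp F' G')"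
proof (rule nat_transsI_hom)
  interpret E: category E by fact
  note F = functorsD[OF \<beta>(2)] and F' = functorsD[OF \<beta>(3)] and G = functorsD[OF \<alpha>(2)] and G' = functorsD[OF \<alpha>(3)]
  note a = nat_transsD[OF \<alpha>(1), unfolded G(1,2)] and b = nat_transsD[OF \<beta>(1), unfolded F(1,2)]
  show "func_comp F G \<in> functors C E" "func_comp F' G' \<in> functors C E"
    using func_comp_functors \<alpha> \<beta> cat by metis+
  fix x assume x: "x \<in> Obj C"
  show "NComp (\<beta> \<star> \<alpha>) x \<in> hom E (OMap (func_comp F G) x) (OMap (func_comp F' G') x)"
    using x E.Comp_hom[OF F(5)[OF a(5)[OF x]] b(5)[OF G'(3)[OF x]]] a(1,2) b(1) F(2) G(1) G'(1) by simp
next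
  interpret E: category E by fact
  note F = functorsD[OF \<beta>(2)] and F' = functorsD[OF \<beta>(3)] and G = functorsD[OF \<alpha>(2)] and G' = functorsD[OF \<alpha>(3)]
  note a = nat_transsD[OF \<alpha>(1), unfolded G(1,2)] and b = nat_transsD[OF \<beta>(1), unfolded F(1,2)]
  fix f x y assume f: "f \<in> hom C x y" and x: "x \<in> Obj C" and y: "y \<in> Obj C"
  \<comment> \<open>Naturality of \<alpha> is carried over by \<open>F\<close>; naturality of
    \<beta> at \<open>AMap G' f\<close> then completes the rectangle.\<close>
  have "square E (AMap F (AMap G f)) (AMap F (NComp \<alpha> x)) (AMap F (NComp \<alpha> y)) (AMap F (AMap G' f))"
    by (rule functor_square[OF \<beta>(2) cat(2) nat_transs_square[OF \<alpha> f cat(1)]])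
  then have 1: "Comp E (AMap F (AMap G' f)) (AMap F (NComp \<alpha> x)) = Comp E (AMap F (NComp \<alpha> y)) (AMap F (AMap G f))"
    by (simp add: square_def)
  have "Comp E (Comp E (NComp \<beta> (OMap G' y)) (AMap F (NComp \<alpha> y))) (AMap F (AMap G f))
    = Comp E (AMap F' (AMap G' f)) (Comp E (NComp \<beta> (OMap G' x)) (AMap F (NComp \<alpha> x)))"
    using E.Comp_assoc[OF F(5)[OF G(5)[OF f]] F(5)[OF a(5)[OF y]] b(5)[OF G'(3)[OF y]]]
      E.Comp_assoc[OF F(5)[OF a(5)[OF x]] F(5)[OF G'(5)[OF f]] b(5)[OF G'(3)[OF y]]]
      E.Comp_assoc[OF F(5)[OF a(5)[OF x]] b(5)[OF G'(3)[OF x]] F'(5)[OF G'(5)[OF f]]]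
      b(6)[OF G'(5)[OF f]] 1 by simp
  then show "Comp E (NComp (\<beta> \<star> \<alpha>) y) (AMap (func_comp F G) f) = Comp E (AMap (func_comp F' G') f) (NComp (\<beta> \<star> \<alpha>) x)"
    using x y homD[OF f] a(1,2) b(1) F(2) G(1) G'(1) by simp
qed (use cat nat_transsD(1,2)[OF \<alpha>(1)] nat_transsD(1,2)[OF \<beta>(1)] functorsD(1)[OF \<alpha>(2)] in \<open>simp_all add: nat_hcomp_def\<close>)

lemma func_pow_sel [simp]:
  "Src (func_pow H n) = pow_cat (Src H) n" "Trg (func_pow H n) = pow_cat (Trg H) n"
  by (simp_all add: func_pow_def)

lemma func_pow_OMap: "xs \<in> Obj (pow_cat (Src H) n) \<Longrightarrow> OMap (func_pow H n) xs = map (OMap H) xs"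
  by (simp add: func_pow_def)

lemma func_pow_AMap: "fs \<in> Arr (pow_cat (Src H) n) \<Longrightarrow> AMap (func_pow H n) fs = map (AMap H) fs"
  by (simp add: func_pow_def)

lemma func_pow_functors:
  assumes "category X" "H \<in> functors X Y"
  shows "func_pow H n \<in> functors (pow_cat X n) (pow_cat Y n)"
proof (rule functorsI_hom[OF category_pow_cat[OF assms(1)]])
  note H = functorsD[OF assms(2)]
  interpret P: category "pow_cat X n" by (rule category_pow_cat[OF assms(1)])
  fix xs assume xs: "xs \<in> Obj (pow_cat X n)"
  then show "OMap (func_pow H n) xs \<in> Obj (pow_cat Y n)"
    using H(1,3) by (auto simp: func_pow_def)
  have "Id (pow_cat X n) xs \<in> Arr (pow_cat X n)" using P.Id_hom[OF xs] homD by fast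
  then show "AMap (func_pow H n) (Id (pow_cat X n) xs) = Id (pow_cat Y n) (OMap (func_pow H n) xs)"
    using xs H(1,6) by (auto simp: func_pow_def)
next
  note H = functorsD[OF assms(2)]
  fix fs xs ys assume f: "fs \<in> hom (pow_cat X n) xs ys" and ob: "xs \<in> Obj (pow_cat X n)" "ys \<in> Obj (pow_cat X n)"
  then show "AMap (func_pow H n) fs \<in> hom (pow_cat Y n) (OMap (func_pow H n) xs) (OMap (func_pow H n) ys)"
    using homD[OF f] H(1) unfolding func_pow_def by (simp add: hom_pow_iff H(5))
next
  note H = functorsD[OF assms(2)]
  interpret P: category "pow_cat X n" by (rule category_pow_cat[OF assms(1)])
  fix fs gs xs ys zs assume f: "fs \<in> hom (pow_cat X n) xs ys" and g: "gs \<in> hom (pow_cat X n) ys zs"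
  have "map (AMap H) (map2 (Comp X) gs fs) = map2 (Comp Y) (map (AMap H) gs) (map (AMap H) fs)"
  proof (rule nth_equalityI)
    fix i assume "i < length (map (AMap H) (map2 (Comp X) gs fs))"
    then have i: "i < n" using f g by (simp add: hom_pow_iff)
    then have "fs ! i \<in> hom X (xs ! i) (ys ! i)" "gs ! i \<in> hom X (ys ! i) (zs ! i)"
      using f g by (simp_all add: hom_pow_iff)
    from H(7)[OF this] show "map (AMap H) (map2 (Comp X) gs fs) ! i = map2 (Comp Y) (map (AMap H) gs) (map (AMap H) fs) ! i"
      using f g i by (simp add: hom_pow_iff)
  qed (use f g in \<open>simp add: hom_pow_iff\<close>)
  then show "AMap (func_pow H n) (Comp (pow_cat X n) gs fs) = Comp (pow_cat Y n) (AMap (func_pow H n) gs) (AMap (func_pow H n) fs)"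
    using homD[OF f] homD[OF g] homD[OF P.Comp_hom[OF f g]] H(1)
    by (simp add: func_pow_def del: map_map)
qed (use functorsD[OF assms(2)] in \<open>simp_all add: func_pow_def\<close>)

lemma nat_pow_sel [simp]: "NSrc (nat_pow \<alpha> n) = func_pow (NSrc \<alpha>) n" "NTrg (nat_pow \<alpha> n) = func_pow (NTrg \<alpha>) n"
  by (simp_all add: nat_pow_def)

lemma nat_pow_NComp: "xs \<in> Obj (pow_cat (Src (NSrc \<alpha>)) n) \<Longrightarrow> NComp (nat_pow \<alpha> n) xs = map (NComp \<alpha>) xs"
  by (simp add: nat_pow_def)

lemma nat_pow_transs:
  assumes "category X" "F \<in> functors X Y" "G \<in> functors X Y" "\<alpha> \<in> nat_transs F G"
  shows "nat_pow \<alpha> n \<in> nat_transs (func_pow F n) (func_pow G n)"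
proof (rule nat_transsI_hom)
  note F = functorsD[OF assms(2)] and G = functorsD[OF assms(3)] and a = nat_transsD[OF assms(4), unfolded functorsD[OF assms(2)]]
  show "func_pow F n \<in> functors (pow_cat X n) (pow_cat Y n)" "func_pow G n \<in> functors (pow_cat X n) (pow_cat Y n)"
    using func_pow_functors assms by blast+
  show "NSrc (nat_pow \<alpha> n) = func_pow F n" "NTrg (nat_pow \<alpha> n) = func_pow G n" using a by simp_all
  fix xs assume xs: "xs \<in> Obj (pow_cat X n)"
  then show "NComp (nat_pow \<alpha> n) xs \<in> hom (pow_cat Y n) (OMap (func_pow F n) xs) (OMap (func_pow G n) xs)"
    using a(1,5) F(1) G(1) by (simp add: nat_pow_NComp func_pow_OMap) (simp add: hom_pow_iff subset_iff)
next
  note F = functorsD[OF assms(2)] and G = functorsD[OF assms(3)] and a = nat_transsD[OF assms(4), unfolded functorsD[OF assms(2)]]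
  fix fs xs ys assume f: "fs \<in> hom (pow_cat X n) xs ys" and ob: "xs \<in> Obj (pow_cat X n)" "ys \<in> Obj (pow_cat X n)"
  have "map2 (Comp Y) (map (NComp \<alpha>) ys) (map (AMap F) fs) = map2 (Comp Y) (map (AMap G) fs) (map (NComp \<alpha>) xs)"
    by (rule nth_equalityI) (use f a(6) in \<open>auto simp: hom_pow_iff\<close>)
  then show "Comp (pow_cat Y n) (NComp (nat_pow \<alpha> n) ys) (AMap (func_pow F n) fs)
    = Comp (pow_cat Y n) (AMap (func_pow G n) fs) (NComp (nat_pow \<alpha> n) xs)"
    using homD[OF f] ob a(1) F(1) G(1) by (simp add: func_pow_def nat_pow_def)
qed (use assms category_pow_cat nat_transsD(1)[OF assms(4)] functorsD(1)[OF assms(2)] in \<open>simp_all add: nat_pow_def\<close>)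

lemma reindex_sel [simp]: "Src (reindex X l f) = pow_cat X l" "Trg (reindex X l f) = pow_cat X (length f)"
  "length xs = l \<Longrightarrow> set xs \<subseteq> Obj X \<Longrightarrow> OMap (reindex X l f) xs = map ((!) xs) f"
  "length fs = l \<Longrightarrow> set fs \<subseteq> Arr X \<Longrightarrow> AMap (reindex X l f) fs = map ((!) fs) f"
  by (simp_all add: reindex_def)

lemma reindex_functors:
  assumes "category X" "fin_fun k l f"
  shows "reindex X l f \<in> functors (pow_cat X l) (pow_cat X k)"
proof (rule functorsI_hom[OF category_pow_cat[OF assms(1)]])
  interpret P: category "pow_cat X l" by (rule category_pow_cat[OF assms(1)])
  have k: "length f = k" using assms(2) by (simp add: fin_fun_def)
  have b: "f ! i < l" if "i < k" for i
    using assms(2) that by (metis fin_fun_def lessThan_iff nth_mem subsetD)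
  have b': "\<And>i. i \<in> set f \<Longrightarrow> i < l" using assms(2) by (auto simp: fin_fun_def)
  show "Trg (reindex X l f) = pow_cat X k" using k by simp
  {
    fix xs assume xs: "xs \<in> Obj (pow_cat X l)"
    show "OMap (reindex X l f) xs \<in> Obj (pow_cat X k)"
      using xs k b' by (auto simp: subset_iff)
    have i: "Id (pow_cat X l) xs \<in> Arr (pow_cat X l)" using P.Id_hom[OF xs] homD by fast
    then show "AMap (reindex X l f) (Id (pow_cat X l) xs) = Id (pow_cat X k) (OMap (reindex X l f) xs)"
      using xs b' by auto
  }
  {
    fix fs xs ys assume f: "fs \<in> hom (pow_cat X l) xs ys" and ob: "xs \<in> Obj (pow_cat X l)" "ys \<in> Obj (pow_cat X l)"
    then show "AMap (reindex X l f) fs \<in> hom (pow_cat X k) (OMap (reindex X l f) xs) (OMap (reindex X l f) ys)"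
      using homD[OF f] k b by (simp add: hom_pow_iff)
  }
  {
    fix fs gs xs ys zs assume f: "fs \<in> hom (pow_cat X l) xs ys" and g: "gs \<in> hom (pow_cat X l) ys zs"
    have "map ((!) (map2 (Comp X) gs fs)) f = map2 (Comp X) (map ((!) gs) f) (map ((!) fs) f)"
      by (rule nth_equalityI) (use f g k b in \<open>auto simp: hom_pow_iff\<close>)
    then show "AMap (reindex X l f) (Comp (pow_cat X l) gs fs)
      = Comp (pow_cat X k) (AMap (reindex X l f) gs) (AMap (reindex X l f) fs)"
      using homD[OF f] homD[OF g] homD[OF P.Comp_hom[OF f g]] by simp
  }
qed (simp_all add: reindex_def)

lemma end_unit_sel [simp]: "Src (end_unit X) = pow_cat X 1" "Trg (end_unit X) = X"
  "x \<in> Obj X \<Longrightarrow> OMap (end_unit X) [x] = x" "f \<in> Arr X \<Longrightarrow> AMap (end_unit X) [f] = f"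
  by (simp_all add: end_unit_def)

lemma end_unit_functors: "category X \<Longrightarrow> end_unit X \<in> functors (pow_cat X 1) X"
proof (rule functorsI_hom[OF category_pow_cat])
  assume X: "category X"
  interpret P: category "pow_cat X 1" by (rule category_pow_cat[OF X])
  interpret X: category X by fact
  {
    fix xs assume "xs \<in> Obj (pow_cat X 1)"
    then obtain x where "xs = [x]" "x \<in> Obj X" by (auto simp: length_Suc_conv)
    then show "OMap (end_unit X) xs \<in> Obj X"
      "AMap (end_unit X) (Id (pow_cat X 1) xs) = Id X (OMap (end_unit X) xs)"
      using X.Id_hom homD by fastforce+
  }
  {
    fix fs xs ys assume f: "fs \<in> hom (pow_cat X 1) xs ys" and ob: "xs \<in> Obj (pow_cat X 1)" "ys \<in> Obj (pow_cat X 1)"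
    then obtain x y f where "xs = [x]" "ys = [y]" "fs = [f]" "x \<in> Obj X" "y \<in> Obj X" "f \<in> hom X x y"
      by (auto simp: length_Suc_conv hom_pow_iff)
    then show "AMap (end_unit X) fs \<in> hom X (OMap (end_unit X) xs) (OMap (end_unit X) ys)"
      by (auto simp: hom_def)
  }
  {
    fix fs gs xs ys zs assume f: "fs \<in> hom (pow_cat X 1) xs ys" and g: "gs \<in> hom (pow_cat X 1) ys zs"
    then obtain f g x y z where "fs = [f]" "gs = [g]" "f \<in> hom X x y" "g \<in> hom X y z"
      by (auto simp: length_Suc_conv hom_pow_iff)
    moreover from this have "Comp X g f \<in> Arr X" "f \<in> Arr X" "g \<in> Arr X" using X.Comp_hom homD by fast+
    ultimately show "AMap (end_unit X) (Comp (pow_cat X 1) gs fs) = Comp X (AMap (end_unit X) gs) (AMap (end_unit X) fs)"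
      by simp
  }
qed (simp_all add: end_unit_def)

section \<open>Pseudo algebras pointwise\<close>

abbreviation opo :: "('t, 'o, 'a) palg \<Rightarrow> 't \<Rightarrow> 'o list \<Rightarrow> 'o" where "opo A w \<equiv> OMap (Phi A w)"
abbreviation opa :: "('t, 'o, 'a) palg \<Rightarrow> 't \<Rightarrow> 'a list \<Rightarrow> 'a" where "opa A w \<equiv> AMap (Phi A w)"
abbreviation asc :: "('t, 'o, 'a) palg \<Rightarrow> 't \<Rightarrow> 't list \<Rightarrow> 'o list \<Rightarrow> 'a" where "asc A w ws \<equiv> NComp (CC A w ws)"
abbreviation unt :: "('t, 'o, 'a) palg \<Rightarrow> 'o list \<Rightarrow> 'a" where "unt A \<equiv> NComp (CI A)"
abbreviation sbs :: "('t, 'o, 'a) palg \<Rightarrow> 't \<Rightarrow> nat \<Rightarrow> nat list \<Rightarrow> 'o list \<Rightarrow> 'a" where "sbs A w l f \<equiv> NComp (CS A w l f)"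

lemma nat_vcomp_eqI_iff:
  assumes "\<gamma> \<in> nat_transs F G" "NSrc \<alpha> = F" "NTrg \<beta> = G" "Src F = C" "Trg F = D"
  shows "\<beta> \<circ>\<^sub>v \<alpha> = \<gamma> \<longleftrightarrow> (\<forall>x \<in> Obj C. Comp D (NComp \<beta> x) (NComp \<alpha> x) = NComp \<gamma> x)"
proof
  assume "\<beta> \<circ>\<^sub>v \<alpha> = \<gamma>"
  then show "\<forall>x \<in> Obj C. Comp D (NComp \<beta> x) (NComp \<alpha> x) = NComp \<gamma> x"
    using assms nat_vcomp_sel(3)[of _ \<alpha> \<beta>] by auto
next
  assume e: "\<forall>x \<in> Obj C. Comp D (NComp \<beta> x) (NComp \<alpha> x) = NComp \<gamma> x"
  have "NComp \<gamma> \<in> extensional (Obj C)" using assms by (auto simp: nat_transs_def)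
  then have "NComp (\<beta> \<circ>\<^sub>v \<alpha>) = NComp \<gamma>"
    using e assms by (intro extensionalityI[of _ "Obj C"]) (auto simp: nat_vcomp_def)
  then show "\<beta> \<circ>\<^sub>v \<alpha> = \<gamma>" using assms nat_transsD(1,2)[OF assms(1)] by (simp add: nat_vcomp_def)
qed

lemma map2_OMap_evs: "map2 OMap (map (Phi A) ws) (split_blocks (map (Dom T) ws) xs) = evs T (opo A) ws xs"
  unfolding evs_def by (rule nth_equalityI) simp_all

lemma map2_AMap_evs: "map2 AMap (map (Phi A) ws) (split_blocks (map (Dom T) ws) xs) = evs T (opa A) ws xs"
  unfolding evs_def by (rule nth_equalityI) simp_all

text \<open>Operations without coherence. The layers \<open>algebra_ops\<close>,
  \<open>pre_algebra\<close> and \<open>pointwise_algebra\<close> follow the construction of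
  \<open>W\<close>: its operations, then its coherence isomorphisms, then the axioms, each stage
  using lemmas of the layers below.\<close>

locale algebra_ops = lawvere_theory T for T :: "'t thy" +
  fixes A :: "('t, 'o, 'a) palg"
  assumes Cat: "category (Cat A)"
    and Phi: "w \<in> words T n \<Longrightarrow> Phi A w \<in> functors (pow_cat (Cat A) n) (Cat A)"
begin

abbreviation X where "X \<equiv> Cat A"

sublocale X: category X by (rule Cat)

lemma PX: "category (pow_cat X n)" by (rule category_pow_cat[OF Cat])

lemmas PhiD = functorsD[OF Phi]

lemma Phi_nth: "word_list T ws \<Longrightarrow> i < length (map (Dom T) ws) \<Longrightarrow>
    map (Phi A) ws ! i \<in> functors (pow_cat X (map (Dom T) ws ! i)) X"
  using Phi by (simp add: word_list_def)

lemma prod_functors: "word_list T ws \<Longrightarrow> func_prod X X (map (Dom T) ws) (map (Phi A) ws)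
    \<in> functors (pow_cat X (sum_list (map (Dom T) ws))) (pow_cat X (length ws))"
  using func_prod_functors[OF Cat, of "map (Phi A) ws" "map (Dom T) ws" X] Phi_nth by simp

lemma prod_OMap: "xs \<in> Obj (pow_cat X (sum_list (map (Dom T) ws))) \<Longrightarrow>
    OMap (func_prod X X (map (Dom T) ws) (map (Phi A) ws)) xs = evs T (opo A) ws xs"
  by (simp only: func_prod_OMap map2_OMap_evs)

lemma prod_AMap: "fs \<in> Arr (pow_cat X (sum_list (map (Dom T) ws))) \<Longrightarrow>
    AMap (func_prod X X (map (Dom T) ws) (map (Phi A) ws)) fs = evs T (opa A) ws fs"
  by (simp only: func_prod_AMap map2_AMap_evs)

lemma evs_opo:
  assumes "word_list T ws" "xs \<in> Obj (pow_cat X (sum_list (map (Dom T) ws)))"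
  shows "evs T (opo A) ws xs \<in> Obj (pow_cat X (length ws))"
  using functorsD(3)[OF prod_functors[OF assms(1)] assms(2)] unfolding prod_OMap[OF assms(2)] .

lemma end_gam_functors:
  assumes "w \<in> words T (length ws)" "word_list T ws"
  shows "end_gam X (map (Dom T) ws) (Phi A w) (map (Phi A) ws) \<in> functors (pow_cat X (sum_list (map (Dom T) ws))) X"
  unfolding end_gam_def using func_comp_functors[OF PX prod_functors Phi] assms by simp

lemma end_gam_OMap: "xs \<in> Obj (pow_cat X (sum_list (map (Dom T) ws))) \<Longrightarrow>
    OMap (end_gam X (map (Dom T) ws) (Phi A w) (map (Phi A) ws)) xs = opo A w (evs T (opo A) ws xs)"
  unfolding end_gam_def by (subst func_comp_sel(3)) (simp only: func_prod_sel, simp only: prod_OMap)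

lemma end_gam_AMap: "fs \<in> Arr (pow_cat X (sum_list (map (Dom T) ws))) \<Longrightarrow>
    AMap (end_gam X (map (Dom T) ws) (Phi A w) (map (Phi A) ws)) fs = opa A w (evs T (opa A) ws fs)"
  unfolding end_gam_def by (subst func_comp_sel(4)) (simp only: func_prod_sel, simp only: prod_AMap)

lemma end_subst_functors:
  assumes "w \<in> words T k" "fin_fun k l f"
  shows "end_subst X l (Phi A w) f \<in> functors (pow_cat X l) X"
  unfolding end_subst_def by (rule func_comp_functors[OF PX reindex_functors[OF Cat assms(2)] Phi[OF assms(1)]])

lemma end_subst_OMap: "xs \<in> Obj (pow_cat X l) \<Longrightarrow> OMap (end_subst X l F f) xs = OMap F (map ((!) xs) f)"
  by (simp add: end_subst_def)

lemma end_subst_AMap: "fs \<in> Arr (pow_cat X l) \<Longrightarrow> AMap (end_subst X l F f) fs = AMap F (map ((!) fs) f)"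
  by (simp add: end_subst_def)

end

text \<open>Coherence isomorphisms subject to no axioms yet. At this level the translation of each
  axiom into a pointwise equation is an equivalence, so it serves both to unpack a given algebra and
  to assemble \<open>W\<close>.\<close>

locale pre_algebra = algebra_ops +
  assumes CC: "\<lbrakk>w \<in> words T (length ws); word_list T ws\<rbrakk> \<Longrightarrow>
      CC A w ws \<in> nat_isos (Phi A (gam T w ws)) (end_gam (Cat A) (map (Dom T) ws) (Phi A w) (map (Phi A) ws))"
    and CI: "CI A \<in> nat_isos (Phi A (word1 T)) (end_unit (Cat A))"
    and CS: "\<lbrakk>w \<in> words T k; fin_fun k l f\<rbrakk> \<Longrightarrow>
      CS A w l f \<in> nat_isos (Phi A (subst_word T l w f)) (end_subst (Cat A) l (Phi A w) f)"
begin

lemma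
  assumes "w \<in> words T (length ws)" "word_list T ws"
  shows asc_hom: "xs \<in> Obj (pow_cat X (sum_list (map (Dom T) ws))) \<Longrightarrow>
      asc A w ws xs \<in> hom X (opo A (gam T w ws) xs) (opo A w (evs T (opo A) ws xs))"
    and asc_iso: "xs \<in> Obj (pow_cat X (sum_list (map (Dom T) ws))) \<Longrightarrow> iso_in X (asc A w ws xs)"
    and asc_square: "fs \<in> hom (pow_cat X (sum_list (map (Dom T) ws))) xs ys \<Longrightarrow>
      square X (asc A w ws xs) (opa A (gam T w ws) fs) (opa A w (evs T (opa A) ws fs)) (asc A w ws ys)"
proof -
  note g = Phi[OF gam_words[OF assms]] and gD = functorsD[OF Phi[OF gam_words[OF assms]]]
  note c = nat_transsD[OF nat_isos_transs[OF CC[OF assms]], unfolded gD(1,2)]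
  show "asc A w ws xs \<in> hom X (opo A (gam T w ws) xs) (opo A w (evs T (opo A) ws xs))"
    if "xs \<in> Obj (pow_cat X (sum_list (map (Dom T) ws)))" using c(5)[OF that] end_gam_OMap[OF that] by simp
  show "iso_in X (asc A w ws xs)" if "xs \<in> Obj (pow_cat X (sum_list (map (Dom T) ws)))"
    using nat_isosD[OF CC[OF assms], unfolded gD(1,2)] that by blast
  show "square X (asc A w ws xs) (opa A (gam T w ws) fs) (opa A w (evs T (opa A) ws fs)) (asc A w ws ys)"
    if fs: "fs \<in> hom (pow_cat X (sum_list (map (Dom T) ws))) xs ys"
    using nat_transs_square[OF nat_isos_transs[OF CC[OF assms]] g end_gam_functors[OF assms] fs PX]
      end_gam_AMap[OF homD[OF fs, THEN conjunct1]] by (auto simp: square_def hom_def)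
qed

lemma
  shows unt_hom: "x \<in> Obj X \<Longrightarrow> unt A [x] \<in> hom X (opo A (word1 T) [x]) x"
    and unt_iso: "x \<in> Obj X \<Longrightarrow> iso_in X (unt A [x])"
    and unt_square: "f \<in> hom X x y \<Longrightarrow> square X (unt A [x]) (opa A (word1 T) [f]) f (unt A [y])"
proof -
  note g = Phi[OF word1_words] and gD = functorsD[OF Phi[OF word1_words]]
  note c = nat_transsD[OF nat_isos_transs[OF CI], unfolded gD(1,2)]
  show "unt A [x] \<in> hom X (opo A (word1 T) [x]) x" if "x \<in> Obj X" using c(5)[of "[x]"] that by simp
  show "iso_in X (unt A [x])" if "x \<in> Obj X"
    using nat_isosD[OF CI, unfolded gD(1,2), of "[x]"] that by simp
  show "square X (unt A [x]) (opa A (word1 T) [f]) f (unt A [y])" if f: "f \<in> hom X x y"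
  proof -
    have "[f] \<in> hom (pow_cat X 1) [x] [y]" using f by (simp add: hom_pow_iff)
    from nat_transs_square[OF nat_isos_transs[OF CI] g end_unit_functors[OF Cat] this PX]
    show ?thesis using homD[OF f] by (auto simp: square_def hom_def)
  qed
qed

lemma
  assumes "w \<in> words T k" "fin_fun k l f"
  shows sbs_hom: "xs \<in> Obj (pow_cat X l) \<Longrightarrow>
      sbs A w l f xs \<in> hom X (opo A (subst_word T l w f) xs) (opo A w (map ((!) xs) f))"
    and sbs_iso: "xs \<in> Obj (pow_cat X l) \<Longrightarrow> iso_in X (sbs A w l f xs)"
    and sbs_square: "fs \<in> hom (pow_cat X l) xs ys \<Longrightarrow>
      square X (sbs A w l f xs) (opa A (subst_word T l w f) fs) (opa A w (map ((!) fs) f)) (sbs A w l f ys)"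
proof -
  note g = Phi[OF subst_word_words[OF assms]] and gD = functorsD[OF Phi[OF subst_word_words[OF assms]]]
  note c = nat_transsD[OF nat_isos_transs[OF CS[OF assms]], unfolded gD(1,2)]
  show "sbs A w l f xs \<in> hom X (opo A (subst_word T l w f) xs) (opo A w (map ((!) xs) f))"
    if "xs \<in> Obj (pow_cat X l)" using c(5)[OF that] by (simp only: end_subst_OMap[OF that])
  show "iso_in X (sbs A w l f xs)" if "xs \<in> Obj (pow_cat X l)"
    using nat_isosD[OF CS[OF assms], unfolded gD(1,2)] that by blast
  show "square X (sbs A w l f xs) (opa A (subst_word T l w f) fs) (opa A w (map ((!) fs) f)) (sbs A w l f ys)"
    if fs: "fs \<in> hom (pow_cat X l) xs ys"
    using nat_transs_square[OF nat_isos_transs[OF CS[OF assms]] g end_subst_functors[OF assms] fs PX]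
    unfolding end_subst_AMap[OF homD[OF fs, THEN conjunct1]] by (auto simp: square_def hom_def)
qed

lemma pow_nth: "fin_fun k l f \<Longrightarrow> xs \<in> Obj (pow_cat X l) \<Longrightarrow> map ((!) xs) f \<in> Obj (pow_cat X k)"
  by (auto simp: fin_fun_def subset_iff)

text \<open>A product of identity transformations is an identity transformation, so what remains is
  a right whiskering by the product of the operations.\<close>

lemma end_gam_nat_id_right:
  assumes "\<alpha> \<in> nat_transs F G" "F \<in> functors (pow_cat X (length ws)) X" "G \<in> functors (pow_cat X (length ws)) X"
    "word_list T ws" "xs \<in> Obj (pow_cat X (sum_list (map (Dom T) ws)))"
  shows "NComp (end_gam_nat X (map (Dom T) ws) \<alpha> (map (\<lambda>v. nat_id (Phi A v)) ws)) xs = NComp \<alpha> (evs T (opo A) ws xs)"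
proof -
  have "map (\<lambda>v. nat_id (Phi A v)) ws = map nat_id (map (Phi A) ws)" by simp
  then show ?thesis
    using nat_prod_id[of "map (Phi A) ws" "map (Dom T) ws" X X] Phi_nth[OF assms(4)]
      hcomp_id_right[OF Cat assms(1-3) prod_functors[OF assms(4)] assms(5)] prod_OMap[OF assms(5)]
    by (simp only: end_gam_nat_def length_map)
qed

lemma end_gam_nat_id_left:
  assumes "w \<in> words T (length ns)" "length Fs = length ns" "length Gs = length ns" "length \<beta>s = length ns"
    "\<And>i. i < length ns \<Longrightarrow> Fs ! i \<in> functors (pow_cat X (ns ! i)) X"
    "\<And>i. i < length ns \<Longrightarrow> Gs ! i \<in> functors (pow_cat X (ns ! i)) X"
    "\<And>i. i < length ns \<Longrightarrow> \<beta>s ! i \<in> nat_transs (Fs ! i) (Gs ! i)"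
    "xs \<in> Obj (pow_cat X (sum_list ns))"
  shows "NComp (end_gam_nat X ns (nat_id (Phi A w)) \<beta>s) xs = opa A w (map2 NComp \<beta>s (split_blocks ns xs))"
  unfolding end_gam_nat_def
  using hcomp_id_left[OF Cat Phi[OF assms(1)] nat_prod_transs[OF Cat assms(2-7)]
      func_prod_functors[OF Cat assms(2,5)] func_prod_functors[OF Cat assms(3,6)] assms(8)]
    by (simp only: nat_prod_NComp[OF assms(8)])

text \<open>Equality of transformations as records includes equality of their source and target
  functors. The sources agree because the two words are equal; the targets are composites bracketed
  differently, whose equality has to be proved. After that only the equation of components is
  left.\<close>

lemma CC_assoc_iff:
  assumes w: "w \<in> words T (length ws)" and l: "length wss = length ws"
    and ws: "\<And>i. i < length ws \<Longrightarrow> ws ! i \<in> words T (length (wss ! i))" and wss: "word_list T (concat wss)"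
  shows "end_gam_nat X (map (Dom T) (concat wss)) (CC A w ws) (map (\<lambda>v. nat_id (Phi A v)) (concat wss))
        \<circ>\<^sub>v CC A (gam T w ws) (concat wss)
      = end_gam_nat X (map (\<lambda>vs. sum_list (map (Dom T) vs)) wss) (nat_id (Phi A w)) (map2 (CC A) ws wss)
        \<circ>\<^sub>v CC A w (map2 (gam T) ws wss) \<longleftrightarrow>
    (\<forall>xs \<in> Obj (pow_cat X (sum_list (map (Dom T) (concat wss)))).
      Comp X (asc A w ws (evs T (opo A) (concat wss) xs)) (asc A (gam T w ws) (concat wss) xs)
      = Comp X (opa A w (map (\<lambda>i. asc A (ws ! i) (wss ! i)
            (split_blocks (map (\<lambda>vs. sum_list (map (Dom T) vs)) wss) xs ! i)) [0..<length ws]))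
          (asc A w (map2 (gam T) ws wss) xs))"
proof -
  have th: "gam T (gam T w ws) (concat wss) = gam T w (map2 (gam T) ws wss)"
    "word_list T (map2 (gam T) ws wss)"
    "map (Dom T) (map2 (gam T) ws wss) = map (\<lambda>vs. sum_list (map (Dom T) vs)) wss"
    "length (concat wss) = sum_list (map (Dom T) ws)"
    "word_list T ws"
    by (rule gam_assoc[OF w l ws wss] word_list_map2_gam[OF w l ws wss] map_Dom_map2_gam[OF w l ws wss]
      length_concat_words[OF w l ws wss] word_list_nested(2)[OF w l ws wss]; assumption)+
  have th5: "word_list T (wss ! i)" if "i < length ws" for i
    using that by (intro word_list_nested(1)[OF w l ws wss])
  let ?N = "sum_list (map (Dom T) (concat wss))"
  let ?ns = "map (\<lambda>vs. sum_list (map (Dom T) vs)) wss"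
  have N: "sum_list ?ns = ?N" by (simp add: map_concat sum_list_concat comp_def)
  have gw: "gam T w ws \<in> words T (length (concat wss))" using gam_words[OF w th(5)] th(4) by simp
  have gg: "gam T (gam T w ws) (concat wss) \<in> words T ?N" by (rule gam_words[OF gw wss])
  have w2: "w \<in> words T (length (map2 (gam T) ws wss))" using w l by simp
  note c1 = nat_transsD[OF nat_isos_transs[OF CC[OF gw wss]]]
    and c2 = nat_transsD[OF nat_isos_transs[OF CC[OF w2 th(2)]]]
    and c3 = nat_transsD[OF nat_isos_transs[OF CC[OF w th(5)]]]
  let ?F = "\<lambda>i. end_gam X (map (Dom T) (wss ! i)) (Phi A (ws ! i)) (map (Phi A) (wss ! i))"
  have c: "CC A (ws ! i) (wss ! i) \<in> nat_transs (Phi A (gam T (ws ! i) (wss ! i))) (?F i)" if "i < length ws" for i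
    using that by (intro nat_isos_transs CC ws th5)
  have PG: "Phi A (gam T (ws ! i) (wss ! i)) \<in> functors (pow_cat X (?ns ! i)) X" if "i < length ws" for i
    using Phi[OF gam_words[OF ws[OF that] th5[OF that]]] that l by simp
  have EG: "?F i \<in> functors (pow_cat X (?ns ! i)) X" if "i < length ws" for i
    using end_gam_functors[OF ws[OF that] th5[OF that]] that l by simp
  let ?Fs = "map ?F [0..<length ws]"
  have d: "\<And>i. i < length ws \<Longrightarrow> Dom T (ws ! i) = length (wss ! i)" using words_Dom[OF ws] .
  let ?L = "func_comp (end_gam X (map (Dom T) ws) (Phi A w) (map (Phi A) ws))
      (func_prod X X (map (Dom T) (concat wss)) (map (Phi A) (concat wss)))"
  have Lf: "?L \<in> functors (pow_cat X ?N) X"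
    using func_comp_functors[OF PX prod_functors[OF wss]] end_gam_functors[OF w th(5)] th(4) by simp
  have P: "func_prod X X ?ns ?Fs \<in> functors (pow_cat X ?N) (pow_cat X (length ws))"
    using func_prod_functors[OF Cat, of ?Fs ?ns X] EG l N by simp
  have Rf: "func_comp (Phi A w) (func_prod X X ?ns ?Fs) \<in> functors (pow_cat X ?N) X"
    by (rule func_comp_functors[OF PX P Phi[OF w]])
  \<comment> \<open>The two target functors apply the same nested operations; on objects and on
    arrows this is \<open>evs_evs\<close>.\<close>
  have T: "?L = func_comp (Phi A w) (func_prod X X ?ns ?Fs)"
  proof (rule functors_eqI[OF Lf Rf])
    fix xs assume xs: "xs \<in> Obj (pow_cat X ?N)"
    have xs': "xs \<in> Obj (pow_cat X (sum_list ?ns))" using xs N by simp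
    have l1: "length xs = ?N" using xs by simp
    have b: "split_blocks ?ns xs ! i \<in> Obj (pow_cat X (sum_list (map (Dom T) (wss ! i))))" if "i < length ws" for i
      using blocks_Obj[OF xs', of i] that l by (simp del: pow_cat_sel)
    have "OMap ?L xs = opo A w (evs T (opo A) ws (evs T (opo A) (concat wss) xs))"
      using xs evs_opo[OF wss xs] by (simp add: prod_OMap end_gam_OMap th(4) del: pow_cat_sel)
    also have "evs T (opo A) ws (evs T (opo A) (concat wss) xs) = OMap (func_prod X X ?ns ?Fs) xs"
      unfolding func_prod_OMap[OF xs']
      by (rule nth_equalityI) (use l end_gam_OMap[OF b] in \<open>simp_all add: evs_evs[OF l d l1] del: pow_cat_sel\<close>)
    finally show "OMap ?L xs = OMap (func_comp (Phi A w) (func_prod X X ?ns ?Fs)) xs"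
      using xs' by (simp del: pow_cat_sel)
  next
    fix xs assume xs: "xs \<in> Arr (pow_cat X ?N)"
    have xs': "xs \<in> Arr (pow_cat X (sum_list ?ns))" using xs N by simp
    have l1: "length xs = ?N" using xs by simp
    have b: "split_blocks ?ns xs ! i \<in> Arr (pow_cat X (sum_list (map (Dom T) (wss ! i))))" if "i < length ws" for i
      using hom_blocks[OF category.Arr_hom[OF PX xs'], of i] that l homD by fastforce
    have "evs T (opa A) (concat wss) xs \<in> Arr (pow_cat X (length (concat wss)))"
      using functorsD(4)[OF prod_functors[OF wss] xs] prod_AMap[OF xs] by simp
    then have "AMap ?L xs = opa A w (evs T (opa A) ws (evs T (opa A) (concat wss) xs))"
      using xs by (simp add: prod_AMap end_gam_AMap th(4) del: pow_cat_sel)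
    also have "evs T (opa A) ws (evs T (opa A) (concat wss) xs) = AMap (func_prod X X ?ns ?Fs) xs"
      unfolding func_prod_AMap[OF xs']
      by (rule nth_equalityI) (use l end_gam_AMap[OF b] in \<open>simp_all add: evs_evs[OF l d l1] del: pow_cat_sel\<close>)
    finally show "AMap ?L xs = AMap (func_comp (Phi A w) (func_prod X X ?ns ?Fs)) xs"
      using xs' by (simp del: pow_cat_sel)
  qed
  have m: "map NTrg (map2 (CC A) ws wss) = ?Fs"
    by (rule nth_equalityI) (use l nat_transsD(2)[OF c] in simp_all)
  have L: "NComp (end_gam_nat X (map (Dom T) (concat wss)) (CC A w ws) (map (\<lambda>v. nat_id (Phi A v)) (concat wss))) xs
      = asc A w ws (evs T (opo A) (concat wss) xs)" if "xs \<in> Obj (pow_cat X ?N)" for xs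
    using end_gam_nat_id_right[OF nat_isos_transs[OF CC[OF w th(5)]] Phi[OF gw] _ wss that] end_gam_functors[OF w th(5)] th(4)
    by simp
  have R: "NComp (end_gam_nat X ?ns (nat_id (Phi A w)) (map2 (CC A) ws wss)) xs
      = opa A w (map (\<lambda>i. asc A (ws ! i) (wss ! i) (split_blocks ?ns xs ! i)) [0..<length ws])" if "xs \<in> Obj (pow_cat X ?N)" for xs
  proof -
    have "NComp (end_gam_nat X ?ns (nat_id (Phi A w)) (map2 (CC A) ws wss)) xs
      = opa A w (map2 NComp (map2 (CC A) ws wss) (split_blocks ?ns xs))"
      by (rule end_gam_nat_id_left[of _ _ "map (\<lambda>i. Phi A (gam T (ws ! i) (wss ! i))) [0..<length ws]" ?Fs])
        (use w l PG EG c that N in simp_all)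
    also have "map2 NComp (map2 (CC A) ws wss) (split_blocks ?ns xs)
      = map (\<lambda>i. asc A (ws ! i) (wss ! i) (split_blocks ?ns xs ! i)) [0..<length ws]"
      by (rule nth_equalityI) (use l in simp_all)
    finally show ?thesis .
  qed
  have "map NTrg (map (\<lambda>v. nat_id (Phi A v)) (concat wss)) = map (Phi A) (concat wss)" by simp
  then have "NTrg (end_gam_nat X (map (Dom T) (concat wss)) (CC A w ws) (map (\<lambda>v. nat_id (Phi A v)) (concat wss))) = ?L"
    unfolding end_gam_nat_def nat_hcomp_sel nat_prod_sel c3(2) by (simp only:)
  moreover have "NTrg (end_gam_nat X ?ns (nat_id (Phi A w)) (map2 (CC A) ws wss)) = func_comp (Phi A w) (func_prod X X ?ns ?Fs)"
    unfolding end_gam_nat_def nat_hcomp_sel nat_prod_sel m by simp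
  ultimately have NT: "NTrg (end_gam_nat X (map (Dom T) (concat wss)) (CC A w ws) (map (\<lambda>v. nat_id (Phi A v)) (concat wss)))
    = NTrg (end_gam_nat X ?ns (nat_id (Phi A w)) (map2 (CC A) ws wss))" using T by simp
  show ?thesis
    by (subst nat_vcomp_eq_iff[OF _ _ _ NT, of _ "pow_cat X ?N" X])
       (use c1(1) c2(1) th(1) functorsD(1,2)[OF Phi[OF gg]] L R in \<open>simp_all del: pow_cat_sel cong: ball_cong\<close>)
qed

lemma CC_unit_right_iff:
  assumes w: "w \<in> words T k"
  shows "end_gam_nat X (replicate k 1) (nat_id (Phi A w)) (replicate k (CI A))
        \<circ>\<^sub>v CC A w (replicate k (word1 T)) = nat_id (Phi A w) \<longleftrightarrow>
    (\<forall>xs \<in> Obj (pow_cat X k). Comp X (opa A w (map (\<lambda>x. unt A [x]) xs)) (asc A w (replicate k (word1 T)) xs)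
      = Id X (opo A w xs))"
proof -
  let ?ns = "replicate k (1::nat)"
  have N: "sum_list ?ns = k" by (simp add: sum_list_replicate)
  have w1: "w \<in> words T (length (replicate k (word1 T)))" "w \<in> words T (length ?ns)" using w by simp_all
  note c = nat_transsD(1)[OF nat_isos_transs[OF CC[OF w1(1) word_list_word1]]]
  let ?P = "func_prod X X ?ns (replicate k (end_unit X))"
  have P: "?P \<in> functors (pow_cat X k) (pow_cat X k)"
    using func_prod_functors[OF Cat, of "replicate k (end_unit X)" ?ns X] end_unit_functors[OF Cat] N by simp
  \<comment> \<open>Cutting into blocks of length 1 and unwrapping each of them changes nothing, so
    the target of the left-hand side is \<open>Phi A w\<close> itself.\<close>
  have T: "func_comp (Phi A w) ?P = Phi A w"
  proof (rule functors_eqI[OF func_comp_functors[OF PX P Phi[OF w]] Phi[OF w]])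
    fix xs assume xs: "xs \<in> Obj (pow_cat X k)"
    then have "OMap ?P xs = map2 OMap (replicate k (end_unit X)) (split_blocks ?ns xs)"
      by (intro func_prod_OMap) (simp only: N)
    also have "\<dots> = xs"
      unfolding split_blocks_ones[of xs k, OF conjunct1[OF xs[simplified]]]
      by (rule nth_equalityI) (use xs in \<open>simp_all add: subset_iff\<close>)
    finally show "OMap (func_comp (Phi A w) ?P) xs = opo A w xs"
      using xs by (simp add: sum_list_replicate del: pow_cat_sel)
  next
    fix xs assume xs: "xs \<in> Arr (pow_cat X k)"
    then have "AMap ?P xs = map2 AMap (replicate k (end_unit X)) (split_blocks ?ns xs)"
      by (intro func_prod_AMap) (simp only: N)
    also have "\<dots> = xs"
      unfolding split_blocks_ones[of xs k, OF conjunct1[OF xs[simplified]]]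
      by (rule nth_equalityI) (use xs in \<open>simp_all add: subset_iff\<close>)
    finally show "AMap (func_comp (Phi A w) ?P) xs = opa A w xs"
      using xs by (simp add: sum_list_replicate del: pow_cat_sel)
  qed
  have "NComp (end_gam_nat X ?ns (nat_id (Phi A w)) (replicate k (CI A))) xs = opa A w (map (\<lambda>x. unt A [x]) xs)"
    if xs: "xs \<in> Obj (pow_cat X k)" for xs
  proof -
    have "NComp (end_gam_nat X ?ns (nat_id (Phi A w)) (replicate k (CI A))) xs
      = opa A w (map2 NComp (replicate k (CI A)) (split_blocks ?ns xs))"
      by (rule end_gam_nat_id_left[OF w1(2), of "replicate k (Phi A (word1 T))" "replicate k (end_unit X)"])
        (use xs Phi[OF word1_words] end_unit_functors[OF Cat] nat_isos_transs[OF CI] in \<open>simp_all add: sum_list_replicate\<close>)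
    also have "map2 NComp (replicate k (CI A)) (split_blocks ?ns xs) = map (\<lambda>x. unt A [x]) xs"
      unfolding split_blocks_ones[of xs k, OF conjunct1[OF xs[simplified]]]
      by (rule nth_equalityI) (use xs in \<open>simp_all add: subset_iff\<close>)
    finally show ?thesis .
  qed
  moreover have "NTrg (end_gam_nat X ?ns (nat_id (Phi A w)) (replicate k (CI A))) = Phi A w"
    using T nat_transsD(2)[OF nat_isos_transs[OF CI]] by (simp add: end_gam_nat_def)
  ultimately show ?thesis
    by (subst nat_vcomp_eqI_iff[OF nat_isos_transs[OF nat_id_isos[OF PX Cat Phi[OF w]]], of _ _ "pow_cat X k" X])
       (use c gam_unit_right[OF w] PhiD(1,2)[OF w] in \<open>simp_all del: pow_cat_sel cong: ball_cong\<close>)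
qed

lemma CC_unit_left_iff:
  assumes w: "w \<in> words T k"
  shows "end_gam_nat X [k] (CI A) [nat_id (Phi A w)] \<circ>\<^sub>v CC A (word1 T) [w] = nat_id (Phi A w) \<longleftrightarrow>
    (\<forall>xs \<in> Obj (pow_cat X k). Comp X (unt A [opo A w xs]) (asc A (word1 T) [w] xs) = Id X (opo A w xs))"
proof -
  note wl = word_list_single[OF w]
  have w1: "word1 T \<in> words T (length [w])" using word1_words by simp
  have D: "map (Dom T) [w] = [k]" using words_Dom[OF w] by simp
  note c = nat_transsD(1)[OF nat_isos_transs[OF CC[OF w1 wl]]]
  note P = prod_functors[OF wl, unfolded D, simplified]
  have T: "func_comp (end_unit X) (func_prod X X [k] [Phi A w]) = Phi A w"
  proof (rule functors_eqI[OF _ Phi[OF w]])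
    show "func_comp (end_unit X) (func_prod X X [k] [Phi A w]) \<in> functors (pow_cat X k) X"
      using func_comp_functors[OF PX P] end_unit_functors[OF Cat] by simp
    show "OMap (func_comp (end_unit X) (func_prod X X [k] [Phi A w])) xs = opo A w xs"
      if "xs \<in> Obj (pow_cat X k)" for xs
      using that PhiD(3)[OF w] by (simp add: func_prod_OMap)
    show "AMap (func_comp (end_unit X) (func_prod X X [k] [Phi A w])) xs = opa A w xs"
      if "xs \<in> Arr (pow_cat X k)" for xs
      using that PhiD(4)[OF w] by (simp add: func_prod_AMap)
  qed
  have "NComp (end_gam_nat X [k] (CI A) [nat_id (Phi A w)]) xs = unt A [opo A w xs]"
    if xs: "xs \<in> Obj (pow_cat X k)" for xs
    using end_gam_nat_id_right[OF nat_isos_transs[OF CI] _ _ wl, of xs] Phi[OF word1_words] end_unit_functors[OF Cat]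
      words_Dom[OF w] xs evs_singleton[of xs T w "opo A"] by simp
  moreover have "NTrg (end_gam_nat X [k] (CI A) [nat_id (Phi A w)]) = Phi A w"
    using T nat_transsD(2)[OF nat_isos_transs[OF CI]] by (simp add: end_gam_nat_def)
  ultimately show ?thesis
    by (subst nat_vcomp_eqI_iff[OF nat_isos_transs[OF nat_id_isos[OF PX Cat Phi[OF w]]], of _ _ "pow_cat X k" X])
       (use c gam_unit_left[OF w] PhiD(1,2)[OF w] in \<open>simp_all del: pow_cat_sel cong: ball_cong\<close>)
qed

lemma CC_CS_outer_iff:
  assumes w: "w \<in> words T k" and f: "fin_fun k (length ws) f" and wl: "word_list T ws"
  shows "end_subst_nat X (sum_list (map (Dom T) ws)) (CC A w (map ((!) ws) f)) (block_fun (map (Dom T) ws) f)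
        \<circ>\<^sub>v CS A (gam T w (map ((!) ws) f)) (sum_list (map (Dom T) ws)) (block_fun (map (Dom T) ws) f)
      = end_gam_nat X (map (Dom T) ws) (CS A w (length ws) f) (map (\<lambda>v. nat_id (Phi A v)) ws)
        \<circ>\<^sub>v CC A (subst_word T (length ws) w f) ws \<longleftrightarrow>
    (\<forall>xs \<in> Obj (pow_cat X (sum_list (map (Dom T) ws))).
      Comp X (asc A w (map ((!) ws) f) (map ((!) xs) (block_fun (map (Dom T) ws) f)))
        (sbs A (gam T w (map ((!) ws) f)) (sum_list (map (Dom T) ws)) (block_fun (map (Dom T) ws) f) xs)
      = Comp X (sbs A w (length ws) f (evs T (opo A) ws xs)) (asc A (subst_word T (length ws) w f) ws xs))"
proof -
  let ?N = "sum_list (map (Dom T) ws)" and ?g = "block_fun (map (Dom T) ws) f" and ?vs = "map ((!) ws) f"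
  note th = subst_gam_outer[OF w f wl] word_list_map_nth[OF w f wl] words_length_map_nth[OF w f wl]
    fin_fun_block_fun_Dom[OF w f wl]
  note gw = gam_words[OF th(3,2)] and sw = subst_word_words[OF w f]
  note R = reindex_functors[OF Cat th(4)] and E = end_gam_functors[OF th(3,2)] and P = prod_functors[OF wl]
    and S = end_subst_functors[OF w f]
  \<comment> \<open>The left functor reindexes the arguments by \<open>block_fun\<close>, the right
    one reindexes the results of the inner operations by \<open>f\<close>;
    \<open>evs_block_fun\<close> identifies the two.\<close>
  have T: "func_comp (end_gam X (map (Dom T) ?vs) (Phi A w) (map (Phi A) ?vs)) (reindex X ?N ?g)
    = func_comp (end_subst X (length ws) (Phi A w) f) (func_prod X X (map (Dom T) ws) (map (Phi A) ws))" (is "?L = ?R")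
  proof (rule functors_eqI[OF func_comp_functors[OF PX R E] func_comp_functors[OF PX P S]])
    fix xs assume xs: "xs \<in> Obj (pow_cat X ?N)"
    have l: "length xs = ?N" and r: "OMap (reindex X ?N ?g) xs = map ((!) xs) ?g" using xs by simp_all
    have "OMap ?L xs = opo A w (evs T (opo A) ?vs (map ((!) xs) ?g))"
      using xs end_gam_OMap[OF pow_nth[OF th(4) xs]] by (simp add: r del: pow_cat_sel map_map)
    moreover have "OMap ?R xs = opo A w (map ((!) (evs T (opo A) ws xs)) f)"
      using xs end_subst_OMap[OF evs_opo[OF wl xs], of "Phi A w" f] by (simp add: prod_OMap del: pow_cat_sel)
    ultimately show "OMap ?L xs = OMap ?R xs" by (simp add: evs_block_fun[OF f l] del: map_map)
  next
    fix xs assume xs: "xs \<in> Arr (pow_cat X ?N)"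
    have l: "length xs = ?N" and r: "AMap (reindex X ?N ?g) xs = map ((!) xs) ?g" using xs by simp_all
    have x2: "map ((!) xs) ?g \<in> Arr (pow_cat X (sum_list (map (Dom T) ?vs)))"
      using functorsD(4)[OF R xs] r by (simp del: map_map)
    have x3: "evs T (opa A) ws xs \<in> Arr (pow_cat X (length ws))"
      using functorsD(4)[OF P xs] prod_AMap[OF xs] by (simp del: pow_cat_sel)
    have "AMap ?L xs = opa A w (evs T (opa A) ?vs (map ((!) xs) ?g))"
      using xs end_gam_AMap[OF x2] by (simp add: r del: pow_cat_sel map_map)
    moreover have "AMap ?R xs = opa A w (map ((!) (evs T (opa A) ws xs)) f)"
      using xs end_subst_AMap[OF x3, of "Phi A w" f] by (simp add: prod_AMap del: pow_cat_sel)
    ultimately show "AMap ?L xs = AMap ?R xs" by (simp add: evs_block_fun[OF f l] del: map_map)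
  qed
  note c = nat_transsD[OF nat_isos_transs[OF CC[OF th(3,2)]]] nat_transsD[OF nat_isos_transs[OF CS[OF gw th(4)]]]
    nat_transsD[OF nat_isos_transs[OF CS[OF w f]]] nat_transsD[OF nat_isos_transs[OF CC[OF sw wl]]]
  have L: "NComp (end_subst_nat X ?N (CC A w ?vs) ?g) xs = asc A w ?vs (map ((!) xs) ?g)"
    if xs: "xs \<in> Obj (pow_cat X ?N)" for xs
    using hcomp_id_right[OF Cat nat_isos_transs[OF CC[OF th(3,2)]] Phi[OF gw] E R xs] xs
    by (simp add: end_subst_nat_def)
  have Rr: "NComp (end_gam_nat X (map (Dom T) ws) (CS A w (length ws) f) (map (\<lambda>v. nat_id (Phi A v)) ws)) xs
      = sbs A w (length ws) f (evs T (opo A) ws xs)" if xs: "xs \<in> Obj (pow_cat X ?N)" for xs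
    by (rule end_gam_nat_id_right[OF nat_isos_transs[OF CS[OF w f]] Phi[OF sw] S wl xs])
  have "map NTrg (map (\<lambda>v. nat_id (Phi A v)) ws) = map (Phi A) ws" by simp
  then have NT: "NTrg (end_subst_nat X ?N (CC A w ?vs) ?g)
    = NTrg (end_gam_nat X (map (Dom T) ws) (CS A w (length ws) f) (map (\<lambda>v. nat_id (Phi A v)) ws))"
    unfolding end_gam_nat_def end_subst_nat_def nat_hcomp_sel nat_prod_sel nat_id_sel c(2) c(14) using T by (simp only:)
  show ?thesis
    by (subst nat_vcomp_eq_iff[OF _ _ _ NT, of _ "pow_cat X ?N" X])
       (use c(7) c(19) th(1) PhiD(1,2)[OF subst_word_words[OF gw th(4)]] L Rr
         in \<open>simp_all del: pow_cat_sel map_map cong: ball_cong\<close>)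
qed

lemma CC_CS_inner_iff:
  assumes w: "w \<in> words T k" and l: "length ws = k" "length gs = k" "length ns' = k"
    and ws: "\<And>i. i < k \<Longrightarrow> ws ! i \<in> words T (Dom T (ws ! i))"
    and gs: "\<And>i. i < k \<Longrightarrow> fin_fun (Dom T (ws ! i)) (ns' ! i) (gs ! i)"
  shows "end_subst_nat X (sum_list ns') (CC A w ws) (block_sum ns' gs)
        \<circ>\<^sub>v CS A (gam T w ws) (sum_list ns') (block_sum ns' gs)
      = end_gam_nat X ns' (nat_id (Phi A w)) (map (\<lambda>i. CS A (ws ! i) (ns' ! i) (gs ! i)) [0..<k])
        \<circ>\<^sub>v CC A w (map (\<lambda>i. subst_word T (ns' ! i) (ws ! i) (gs ! i)) [0..<k]) \<longleftrightarrow>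
    (\<forall>xs \<in> Obj (pow_cat X (sum_list ns')).
      Comp X (asc A w ws (map ((!) xs) (block_sum ns' gs))) (sbs A (gam T w ws) (sum_list ns') (block_sum ns' gs) xs)
      = Comp X (opa A w (map (\<lambda>i. sbs A (ws ! i) (ns' ! i) (gs ! i) (split_blocks ns' xs ! i)) [0..<k]))
          (asc A w (map (\<lambda>i. subst_word T (ns' ! i) (ws ! i) (gs ! i)) [0..<k]) xs))"
proof -
  let ?N = "sum_list ns'" and ?g = "block_sum ns' gs"
  let ?vs = "map (\<lambda>i. subst_word T (ns' ! i) (ws ! i) (gs ! i)) [0..<k]"
  have th: "subst_word T ?N (gam T w ws) ?g = gam T w ?vs" "map (Dom T) ?vs = ns'" "word_list T ?vs"
    "fin_fun (sum_list (map (Dom T) ws)) ?N ?g" "word_list T ws"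
    by (rule subst_gam_inner[OF w l ws gs] map_Dom_substs[OF w l ws gs] word_list_substs[OF w l ws gs]
      fin_fun_block_sum_Dom[OF w l ws gs] word_list_inner[OF w l ws gs]; assumption)+
  have w': "w \<in> words T (length ws)" "w \<in> words T (length ?vs)" "w \<in> words T (length ns')" using w l by simp_all
  note gw = gam_words[OF w'(1) th(5)]
  have c: "CS A (ws ! i) (ns' ! i) (gs ! i)
      \<in> nat_transs (Phi A (subst_word T (ns' ! i) (ws ! i) (gs ! i))) (end_subst X (ns' ! i) (Phi A (ws ! i)) (gs ! i))"
    if "i < k" for i using that by (intro nat_isos_transs CS[OF ws gs])
  have SF: "end_subst X (ns' ! i) (Phi A (ws ! i)) (gs ! i) \<in> functors (pow_cat X (ns' ! i)) X" if "i < k" for i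
    using that by (intro end_subst_functors[OF ws gs])
  have PF: "Phi A (subst_word T (ns' ! i) (ws ! i) (gs ! i)) \<in> functors (pow_cat X (ns' ! i)) X" if "i < k" for i
    using that by (intro Phi subst_word_words[OF ws gs])
  let ?Fs = "map (\<lambda>i. end_subst X (ns' ! i) (Phi A (ws ! i)) (gs ! i)) [0..<k]"
  note R = reindex_functors[OF Cat th(4)] and E = end_gam_functors[OF w'(1) th(5)]
  have P: "func_prod X X ns' ?Fs \<in> functors (pow_cat X ?N) (pow_cat X k)"
    using func_prod_functors[OF Cat, of ?Fs ns' X] SF l by simp
  \<comment> \<open>Both functors apply each \<open>ws ! i\<close> to block \<open>i\<close>
    reindexed by \<open>gs ! i\<close>, and then \<open>w\<close>; the list computation is
    \<open>evs_block_sum\<close>.\<close>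
  have T: "func_comp (end_gam X (map (Dom T) ws) (Phi A w) (map (Phi A) ws)) (reindex X ?N ?g)
    = func_comp (Phi A w) (func_prod X X ns' ?Fs)" (is "?L = ?R")
  proof (rule functors_eqI[OF func_comp_functors[OF PX R E] func_comp_functors[OF PX P Phi[OF w]]])
    fix xs assume xs: "xs \<in> Obj (pow_cat X ?N)"
    have lx: "length xs = ?N" and r: "OMap (reindex X ?N ?g) xs = map ((!) xs) ?g" using xs by simp_all
    have b: "split_blocks ns' xs ! i \<in> Obj (pow_cat X (ns' ! i))" if "i < k" for i
      using blocks_Obj[OF xs, of i] that l by (simp del: pow_cat_sel)
    have "OMap ?L xs = opo A w (evs T (opo A) ws (map ((!) xs) ?g))"
      using xs end_gam_OMap[OF pow_nth[OF th(4) xs]] by (simp add: r del: pow_cat_sel map_map)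
    also have "evs T (opo A) ws (map ((!) xs) ?g) = OMap (func_prod X X ns' ?Fs) xs"
      unfolding func_prod_OMap[OF xs]
      by (rule nth_equalityI)
        (use l gs lx in \<open>simp_all add: evs_block_sum end_subst_OMap[OF b] del: pow_cat_sel map_map\<close>)
    finally show "OMap ?L xs = OMap ?R xs" using xs by (simp del: pow_cat_sel)
  next
    fix xs assume xs: "xs \<in> Arr (pow_cat X ?N)"
    have lx: "length xs = ?N" and r: "AMap (reindex X ?N ?g) xs = map ((!) xs) ?g" using xs by simp_all
    have b: "split_blocks ns' xs ! i \<in> Arr (pow_cat X (ns' ! i))" if "i < k" for i
      using hom_blocks[OF category.Arr_hom[OF PX xs], of i] that l homD by fastforce
    have x2: "map ((!) xs) ?g \<in> Arr (pow_cat X (sum_list (map (Dom T) ws)))"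
      using functorsD(4)[OF R xs] r by (simp del: map_map)
    have "AMap ?L xs = opa A w (evs T (opa A) ws (map ((!) xs) ?g))"
      using xs end_gam_AMap[OF x2] by (simp add: r del: pow_cat_sel map_map)
    also have "evs T (opa A) ws (map ((!) xs) ?g) = AMap (func_prod X X ns' ?Fs) xs"
      unfolding func_prod_AMap[OF xs]
      by (rule nth_equalityI)
        (use l gs lx in \<open>simp_all add: evs_block_sum end_subst_AMap[OF b] del: pow_cat_sel map_map\<close>)
    finally show "AMap ?L xs = AMap ?R xs" using xs by (simp del: pow_cat_sel)
  qed
  note d = nat_transsD[OF nat_isos_transs[OF CC[OF w'(1) th(5)]]] nat_transsD[OF nat_isos_transs[OF CS[OF gw th(4)]]]
    nat_transsD[OF nat_isos_transs[OF CC[OF w'(2) th(3)]]]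
  have L: "NComp (end_subst_nat X ?N (CC A w ws) ?g) xs = asc A w ws (map ((!) xs) ?g)"
    if xs: "xs \<in> Obj (pow_cat X ?N)" for xs
    using hcomp_id_right[OF Cat nat_isos_transs[OF CC[OF w'(1) th(5)]] Phi[OF gw] E R xs] xs
    by (simp add: end_subst_nat_def)
  have Rr: "NComp (end_gam_nat X ns' (nat_id (Phi A w)) (map (\<lambda>i. CS A (ws ! i) (ns' ! i) (gs ! i)) [0..<k])) xs
      = opa A w (map (\<lambda>i. sbs A (ws ! i) (ns' ! i) (gs ! i) (split_blocks ns' xs ! i)) [0..<k])"
    if xs: "xs \<in> Obj (pow_cat X ?N)" for xs
  proof -
    have "NComp (end_gam_nat X ns' (nat_id (Phi A w)) (map (\<lambda>i. CS A (ws ! i) (ns' ! i) (gs ! i)) [0..<k])) xs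
      = opa A w (map2 NComp (map (\<lambda>i. CS A (ws ! i) (ns' ! i) (gs ! i)) [0..<k]) (split_blocks ns' xs))"
      by (rule end_gam_nat_id_left[OF w'(3), of "map (\<lambda>i. Phi A (subst_word T (ns' ! i) (ws ! i) (gs ! i))) [0..<k]" ?Fs])
        (use l PF SF c xs in simp_all)
    also have "map2 NComp (map (\<lambda>i. CS A (ws ! i) (ns' ! i) (gs ! i)) [0..<k]) (split_blocks ns' xs)
      = map (\<lambda>i. sbs A (ws ! i) (ns' ! i) (gs ! i) (split_blocks ns' xs ! i)) [0..<k]"
      by (rule nth_equalityI) (use l in simp_all)
    finally show ?thesis .
  qed
  have m: "map NTrg (map (\<lambda>i. CS A (ws ! i) (ns' ! i) (gs ! i)) [0..<k]) = ?Fs"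
    by (rule nth_equalityI) (use nat_transsD(2)[OF c] in simp_all)
  have NT: "NTrg (end_subst_nat X ?N (CC A w ws) ?g)
    = NTrg (end_gam_nat X ns' (nat_id (Phi A w)) (map (\<lambda>i. CS A (ws ! i) (ns' ! i) (gs ! i)) [0..<k]))"
    unfolding end_gam_nat_def end_subst_nat_def nat_hcomp_sel nat_prod_sel nat_id_sel d(2) m using T by (simp only:)
  show ?thesis
    by (subst nat_vcomp_eq_iff[OF _ _ _ NT, of _ "pow_cat X ?N" X])
       (use d(7,13) th(1) PhiD(1,2)[OF subst_word_words[OF gw th(4)]] L Rr
         in \<open>simp_all del: pow_cat_sel map_map cong: ball_cong\<close>)
qed

lemma CS_comp_iff:
  assumes w: "w \<in> words T k" and f: "fin_fun k l f" and g: "fin_fun l m g"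
  shows "end_subst_nat X m (CS A w l f) g \<circ>\<^sub>v CS A (subst_word T l w f) m g = CS A w m (map ((!) g) f) \<longleftrightarrow>
    (\<forall>xs \<in> Obj (pow_cat X m). Comp X (sbs A w l f (map ((!) xs) g)) (sbs A (subst_word T l w f) m g xs)
      = sbs A w m (map ((!) g) f) xs)"
proof -
  note gf = fin_fun_map_nth[OF f g] and sw = subst_word_words[OF w f] and R = reindex_functors[OF Cat g]
  note c = CS[OF w gf, THEN nat_isos_transs] and S = end_subst_functors[OF w f]
  have T: "func_comp (end_subst X l (Phi A w) f) (reindex X m g) = end_subst X m (Phi A w) (map ((!) g) f)"
  proof (rule functors_eqI[OF func_comp_functors[OF PX R S] end_subst_functors[OF w gf]])
    fix xs assume xs: "xs \<in> Obj (pow_cat X m)"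
    have r: "OMap (reindex X m g) xs = map ((!) xs) g" using xs by simp
    show "OMap (func_comp (end_subst X l (Phi A w) f) (reindex X m g)) xs
      = OMap (end_subst X m (Phi A w) (map ((!) g) f)) xs"
      unfolding end_subst_OMap[OF xs] 
      using xs end_subst_OMap[OF pow_nth[OF g xs], of "Phi A w" f] map_nth_map_nth[OF f g, of xs]
      by (simp add: r del: pow_cat_sel map_map)
  next
    fix xs assume xs: "xs \<in> Arr (pow_cat X m)"
    have r: "AMap (reindex X m g) xs = map ((!) xs) g" using xs by simp
    have x2: "map ((!) xs) g \<in> Arr (pow_cat X l)" using functorsD(4)[OF R xs] r by (simp del: map_map)
    show "AMap (func_comp (end_subst X l (Phi A w) f) (reindex X m g)) xs
      = AMap (end_subst X m (Phi A w) (map ((!) g) f)) xs"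
      unfolding end_subst_AMap[OF xs] 
      using xs end_subst_AMap[OF x2, of "Phi A w" f] map_nth_map_nth[OF f g, of xs]
      by (simp add: r del: pow_cat_sel map_map)
  qed
  have "NComp (end_subst_nat X m (CS A w l f) g) xs = sbs A w l f (map ((!) xs) g)"
    if xs: "xs \<in> Obj (pow_cat X m)" for xs
    using hcomp_id_right[OF Cat nat_isos_transs[OF CS[OF w f]] Phi[OF sw] S R xs] xs by (simp add: end_subst_nat_def)
  moreover have "NTrg (end_subst_nat X m (CS A w l f) g) = end_subst X m (Phi A w) (map ((!) g) f)"
    unfolding end_subst_nat_def nat_hcomp_sel nat_id_sel nat_transsD(2)[OF nat_isos_transs[OF CS[OF w f]]] T ..
  ultimately show ?thesis
    by (subst nat_vcomp_eqI_iff[OF c, of _ _ "pow_cat X m" X])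
       (use nat_transsD(1)[OF nat_isos_transs[OF CS[OF sw g]]] subst_subst[OF w f g]
          PhiD(1,2)[OF subst_word_words[OF w gf]] in \<open>simp_all del: pow_cat_sel map_map cong: ball_cong\<close>)
qed

lemma CS_id_iff:
  assumes w: "w \<in> words T k"
  shows "CS A w k [0..<k] = nat_id (Phi A w) \<longleftrightarrow> (\<forall>xs \<in> Obj (pow_cat X k). sbs A w k [0..<k] xs = Id X (opo A w xs))"
proof -
  note c = nat_isos_transs[OF CS[OF w fin_fun_id]]
  have T: "end_subst X k (Phi A w) [0..<k] = Phi A w"
    by (rule functors_eqI[OF end_subst_functors[OF w fin_fun_id] Phi[OF w]])
       (auto simp: end_subst_OMap end_subst_AMap intro!: arg_cong[of _ _ "opo A w"] arg_cong[of _ _ "opa A w"] nth_equalityI)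
  have i: "nat_id (Phi A w) \<in> nat_transs (Phi A w) (Phi A w)"
    by (rule nat_isos_transs[OF nat_id_isos[OF PX Cat Phi[OF w]]])
  have e: "\<And>xs. xs \<in> Obj (pow_cat X k) \<Longrightarrow> NComp (nat_id (Phi A w)) xs = Id X (opo A w xs)"
    using PhiD(1,2)[OF w] by simp
  show ?thesis
  proof
    assume "CS A w k [0..<k] = nat_id (Phi A w)"
    then show "\<forall>xs \<in> Obj (pow_cat X k). sbs A w k [0..<k] xs = Id X (opo A w xs)" using e by simp
  next
    assume "\<forall>xs \<in> Obj (pow_cat X k). sbs A w k [0..<k] xs = Id X (opo A w xs)"
    then show "CS A w k [0..<k] = nat_id (Phi A w)"
      by (intro nat_transs_eqI[OF c[unfolded T subst_id[OF w]] i]) (use e PhiD(1)[OF w] in simp)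
  qed
qed

end

text \<open>The axioms of \<open>pseudo_algebra\<close> as equations between arrows. In this form
  they can be verified for \<open>W\<close>, where arrows are compared by their values.\<close>

locale pointwise_algebra = pre_algebra +
  assumes asc_asc: "\<lbrakk>w \<in> words T (length ws); length wss = length ws;
      \<And>i. i < length ws \<Longrightarrow> ws ! i \<in> words T (length (wss ! i)); word_list T (concat wss);
      xs \<in> Obj (pow_cat X (sum_list (map (Dom T) (concat wss))))\<rbrakk> \<Longrightarrow>
      Comp X (asc A w ws (evs T (opo A) (concat wss) xs)) (asc A (gam T w ws) (concat wss) xs)
      = Comp X (opa A w (map (\<lambda>i. asc A (ws ! i) (wss ! i)
            (split_blocks (map (\<lambda>vs. sum_list (map (Dom T) vs)) wss) xs ! i)) [0..<length ws]))
          (asc A w (map2 (gam T) ws wss) xs)"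
    and unt_right: "w \<in> words T k \<Longrightarrow> xs \<in> Obj (pow_cat X k) \<Longrightarrow>
      Comp X (opa A w (map (\<lambda>x. unt A [x]) xs)) (asc A w (replicate k (word1 T)) xs) = Id X (opo A w xs)"
    and unt_left: "w \<in> words T k \<Longrightarrow> xs \<in> Obj (pow_cat X k) \<Longrightarrow>
      Comp X (unt A [opo A w xs]) (asc A (word1 T) [w] xs) = Id X (opo A w xs)"
    and asc_sbs_outer: "\<lbrakk>w \<in> words T k; fin_fun k (length ws) f; word_list T ws;
      xs \<in> Obj (pow_cat X (sum_list (map (Dom T) ws)))\<rbrakk> \<Longrightarrow>
      Comp X (asc A w (map ((!) ws) f) (map ((!) xs) (block_fun (map (Dom T) ws) f)))
        (sbs A (gam T w (map ((!) ws) f)) (sum_list (map (Dom T) ws)) (block_fun (map (Dom T) ws) f) xs)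
      = Comp X (sbs A w (length ws) f (evs T (opo A) ws xs)) (asc A (subst_word T (length ws) w f) ws xs)"
    and asc_sbs_inner: "\<lbrakk>w \<in> words T k; length ws = k; length gs = k; length ns' = k;
      \<And>i. i < k \<Longrightarrow> ws ! i \<in> words T (Dom T (ws ! i));
      \<And>i. i < k \<Longrightarrow> fin_fun (Dom T (ws ! i)) (ns' ! i) (gs ! i); xs \<in> Obj (pow_cat X (sum_list ns'))\<rbrakk> \<Longrightarrow>
      Comp X (asc A w ws (map ((!) xs) (block_sum ns' gs))) (sbs A (gam T w ws) (sum_list ns') (block_sum ns' gs) xs)
      = Comp X (opa A w (map (\<lambda>i. sbs A (ws ! i) (ns' ! i) (gs ! i) (split_blocks ns' xs ! i)) [0..<k]))
          (asc A w (map (\<lambda>i. subst_word T (ns' ! i) (ws ! i) (gs ! i)) [0..<k]) xs)"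
    and sbs_sbs: "\<lbrakk>w \<in> words T k; fin_fun k l f; fin_fun l m g; xs \<in> Obj (pow_cat X m)\<rbrakk> \<Longrightarrow>
      Comp X (sbs A w l f (map ((!) xs) g)) (sbs A (subst_word T l w f) m g xs) = sbs A w m (map ((!) g) f) xs"
    and sbs_id: "w \<in> words T k \<Longrightarrow> xs \<in> Obj (pow_cat X k) \<Longrightarrow> sbs A w k [0..<k] xs = Id X (opo A w xs)"

lemma pseudo_algebra_pre_algebra:
  assumes "lawvere_theory T" "pseudo_algebra T A"
  shows "pre_algebra T A"
proof -
  interpret lawvere_theory T by fact
  interpret A: pseudo_algebra T A by fact
  show ?thesis
    by (intro pre_algebra.intro algebra_ops.intro algebra_ops_axioms.intro pre_algebra_axioms.intro)
      (use A.Cat A.Phi A.CC A.CI A.CS lawvere_theory_axioms in \<open>simp_all add: word_list_def\<close>)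
qed

lemma pseudo_algebra_pointwise:
  assumes "lawvere_theory T" "pseudo_algebra T A"
  shows "pointwise_algebra T A"
proof -
  interpret A: pseudo_algebra T A by fact
  interpret P: pre_algebra T A by (rule pseudo_algebra_pre_algebra[OF assms])
  show ?thesis
  proof (intro pointwise_algebra.intro pointwise_algebra_axioms.intro P.pre_algebra_axioms, goal_cases)
    case (1 w ws wss xs)
    then show ?case using A.CC_assoc[OF 1(1-3)] P.CC_assoc_iff[OF 1(1-4)] by (auto simp: word_list_def)
  next
    case (2 w k xs)
    then show ?case using A.CC_unit_right[OF 2(1)] P.CC_unit_right_iff[OF 2(1)] by blast
  next
    case (3 w k xs)
    then show ?case using A.CC_unit_left[OF 3(1)] P.CC_unit_left_iff[OF 3(1)] by blast
  next
    case (4 w k ws f xs)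
    then show ?case using A.CC_CS_outer[OF 4(1,2) _ refl refl] P.CC_CS_outer_iff[OF 4(1-3)]
      by (simp add: word_list_def)
  next
    case (5 w k ws gs ns' xs)
    then show ?case using A.CC_CS_inner[OF 5(1-6) refl] P.CC_CS_inner_iff[OF 5(1-6)] by simp
  next
    case (6 w k l f m g xs)
    then show ?case using A.CS_comp[OF 6(1-3)] P.CS_comp_iff[OF 6(1-3)] by blast
  next
    case (7 w k xs)
    then show ?case using A.CS_id[OF 7(1)] P.CS_id_iff[OF 7(1)] by blast
  qed
qed

text \<open>The direction needed for \<open>W\<close>, whose axioms are established
  pointwise.\<close>

lemma pointwise_pseudo_algebra:
  assumes "pointwise_algebra T A"
  shows "pseudo_algebra T A"
proof -
  interpret P: pointwise_algebra T A by fact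
  show ?thesis
  proof (intro pseudo_algebra.intro, goal_cases)
    case 1 then show ?case by (rule P.Cat)
  next
    case 2 then show ?case by (rule P.Phi)
  next
    case (3 w ws) then show ?case by (intro P.CC) (simp_all add: word_list_def)
  next
    case 4 then show ?case by (rule P.CI)
  next
    case 5 then show ?case by (rule P.CS)
  next
    case (6 w ws wss)
    have wl: "word_list T (concat wss)" using 6(4) by (simp add: word_list_def)
    show ?case
      by (subst P.CC_assoc_iff[OF 6(1-3) wl], assumption, rule ballI, rule P.asc_asc[OF 6(1-3) wl])
  next
    case (7 w k) then show ?case unfolding P.CC_unit_right_iff[OF 7] using P.unt_right[OF 7] by blast
  next
    case (8 w k) then show ?case unfolding P.CC_unit_left_iff[OF 8] using P.unt_left[OF 8] by blast
  next
    case (9 w k ws f ns ws\<^sub>f)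
    have wl: "word_list T ws" using 9(3) by (simp add: word_list_def)
    show ?case unfolding 9(4,5) P.CC_CS_outer_iff[OF 9(1,2) wl] using P.asc_sbs_outer[OF 9(1,2) wl] by blast
  next
    case (10 w k ws gs ns' g)
    show ?case unfolding 10(7)
      by (subst P.CC_CS_inner_iff[OF 10(1-6)], (assumption)+, rule ballI, rule P.asc_sbs_inner[OF 10(1-6)])
  next
    case (11 w k l f m g)
    show ?case unfolding P.CS_comp_iff[OF 11] using P.sbs_sbs[OF 11] by blast
  next
    case (12 w k)
    show ?case unfolding P.CS_id_iff[OF 12] using P.sbs_id[OF 12] by blast
  qed
qed

section \<open>Morphisms of pseudo algebras pointwise\<close>

abbreviation mo :: "('t, 'o, 'a) pmor \<Rightarrow> 'o \<Rightarrow> 'o" where "mo H \<equiv> OMap (MFun H)"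
abbreviation ma :: "('t, 'o, 'a) pmor \<Rightarrow> 'a \<Rightarrow> 'a" where "ma H \<equiv> AMap (MFun H)"
abbreviation rho :: "('t, 'o, 'a) pmor \<Rightarrow> 't \<Rightarrow> 'o list \<Rightarrow> 'a" where "rho H w \<equiv> NComp (MRho H w)"

lemma func_pow_comp:
  assumes "G \<in> functors X Y" "H \<in> functors Y Z"
  shows "func_pow (func_comp H G) n = func_comp (func_pow H n) (func_pow G n)"
proof -
  note G = functorsD[OF assms(1)] and H = functorsD[OF assms(2)]
  show ?thesis
    using G(1,2,3,4) H(1,2)
    by (auto simp: func_pow_def func_comp_def restrict_def fun_eq_iff subset_iff)
qed

lemma hcomp_id_right_isos:
  assumes "category C" "category D" "category E" "\<alpha> \<in> nat_isos F G" "F \<in> functors D E" "G \<in> functors D E" "H \<in> functors C D"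
  shows "\<alpha> \<star> nat_id H \<in> nat_isos (func_comp F H) (func_comp G H)"
proof (rule nat_isosI)
  show "\<alpha> \<star> nat_id H \<in> nat_transs (func_comp F H) (func_comp G H)"
    by (rule hcomp_transs[OF assms(1-3) nat_isos_transs[OF assms(4)] assms(5,6) nat_isos_transs[OF nat_id_isos] assms(7,7)]; fact)
  fix x assume "x \<in> Obj (Src (func_comp F H))"
  then have x: "x \<in> Obj C" using functorsD(1)[OF assms(7)] by simp
  show "iso_in (Trg (func_comp F H)) (NComp (\<alpha> \<star> nat_id H) x)"
    unfolding hcomp_id_right[OF assms(3) nat_isos_transs[OF assms(4)] assms(5-7) x]
    using nat_isosD[OF assms(4)] functorsD(1,2)[OF assms(5)] functorsD(3)[OF assms(7) x] by simp
qed

lemma hcomp_id_left_isos: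
  assumes "category C" "category D" "category E" "\<beta> \<in> nat_isos G H" "F \<in> functors D E" "G \<in> functors C D" "H \<in> functors C D"
  shows "nat_id F \<star> \<beta> \<in> nat_isos (func_comp F G) (func_comp F H)"
proof (rule nat_isosI)
  show "nat_id F \<star> \<beta> \<in> nat_transs (func_comp F G) (func_comp F H)"
    by (rule hcomp_transs[OF assms(1-3) nat_isos_transs[OF nat_id_isos] assms(5,5) nat_isos_transs[OF assms(4)] assms(6,7)]; fact)
  fix x assume "x \<in> Obj (Src (func_comp F G))"
  then have x: "x \<in> Obj C" using functorsD(1)[OF assms(6)] by simp
  note b = nat_transsD[OF nat_isos_transs[OF assms(4)], unfolded functorsD(1,2)[OF assms(6)]]
  show "iso_in (Trg (func_comp F G)) (NComp (nat_id F \<star> \<beta>) x)"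
    unfolding hcomp_id_left[OF assms(3,5) nat_isos_transs[OF assms(4)] assms(6,7) x]
    using functor_iso(1)[OF assms(2,3,5) _ b(5)[OF x]] nat_isosD[OF assms(4)] functorsD(1,2)[OF assms(6)] functorsD(2)[OF assms(5)] x
    by simp
qed

text \<open>As with \<open>pre_algebra\<close>: the isomorphisms \<open>MRho\<close> without their
  compatibilities, so that the three translations below are equivalences.\<close>

locale pre_mor = A: pointwise_algebra T A + B: pointwise_algebra T B
  for T :: "'t thy" and A B :: "('t, 'o, 'a) palg" +
  fixes H :: "('t, 'o, 'a) pmor"
  assumes MSrc: "MSrc H = A" and MTrg: "MTrg H = B"
    and MFun: "MFun H \<in> functors (Cat A) (Cat B)"
    and MRho_extensional: "MRho H \<in> extensional (\<Union>n. words T n)"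
    and MRho: "w \<in> words T n \<Longrightarrow>
      MRho H w \<in> nat_isos (func_comp (MFun H) (Phi A w)) (func_comp (Phi B w) (func_pow (MFun H) n))"
begin

lemmas MD = functorsD[OF MFun]

lemma pow_functors: "func_pow (MFun H) n \<in> functors (pow_cat (Cat A) n) (pow_cat (Cat B) n)"
  by (rule func_pow_functors[OF A.Cat MFun])

lemma pow_OMap: "xs \<in> Obj (pow_cat (Cat A) n) \<Longrightarrow> OMap (func_pow (MFun H) n) xs = map (mo H) xs"
  using MD(1) by (simp add: func_pow_OMap)

lemma pow_AMap: "xs \<in> Arr (pow_cat (Cat A) n) \<Longrightarrow> AMap (func_pow (MFun H) n) xs = map (ma H) xs"
  using MD(1) by (simp add: func_pow_AMap)

lemma map_mo: "xs \<in> Obj (pow_cat (Cat A) n) \<Longrightarrow> map (mo H) xs \<in> Obj (pow_cat (Cat B) n)"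
  using MD(3) by auto

lemma map_ma: "fs \<in> hom (pow_cat (Cat A) n) xs ys \<Longrightarrow>
    map (ma H) fs \<in> hom (pow_cat (Cat B) n) (map (mo H) xs) (map (mo H) ys)"
  using MD(5) by (auto simp: hom_pow_iff)

lemma src_functors: "w \<in> words T n \<Longrightarrow> func_comp (MFun H) (Phi A w) \<in> functors (pow_cat (Cat A) n) (Cat B)"
  by (rule func_comp_functors[OF A.PX A.Phi MFun])

lemma trg_functors: "w \<in> words T n \<Longrightarrow>
    func_comp (Phi B w) (func_pow (MFun H) n) \<in> functors (pow_cat (Cat A) n) (Cat B)"
  by (rule func_comp_functors[OF A.PX pow_functors B.Phi])

lemma src_OMap: "w \<in> words T n \<Longrightarrow> xs \<in> Obj (pow_cat (Cat A) n) \<Longrightarrow> OMap (func_comp (MFun H) (Phi A w)) xs = mo H (opo A w xs)"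
  using A.PhiD(1) by (simp del: pow_cat_sel)

lemma trg_OMap: "xs \<in> Obj (pow_cat (Cat A) n) \<Longrightarrow>
    OMap (func_comp (Phi B w) (func_pow (MFun H) n)) xs = opo B w (map (mo H) xs)"
  using functorsD(1)[OF pow_functors] pow_OMap by (simp del: pow_cat_sel func_pow_sel)

lemma src_AMap: "w \<in> words T n \<Longrightarrow> xs \<in> Arr (pow_cat (Cat A) n) \<Longrightarrow> AMap (func_comp (MFun H) (Phi A w)) xs = ma H (opa A w xs)"
  using A.PhiD(1) by (simp del: pow_cat_sel)

lemma trg_AMap: "xs \<in> Arr (pow_cat (Cat A) n) \<Longrightarrow>
    AMap (func_comp (Phi B w) (func_pow (MFun H) n)) xs = opa B w (map (ma H) xs)"
  using functorsD(1)[OF pow_functors] pow_AMap by (simp del: pow_cat_sel func_pow_sel)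

lemma
  assumes w: "w \<in> words T n"
  shows rho_hom: "xs \<in> Obj (pow_cat (Cat A) n) \<Longrightarrow> rho H w xs \<in> hom (Cat B) (mo H (opo A w xs)) (opo B w (map (mo H) xs))"
    and rho_iso: "xs \<in> Obj (pow_cat (Cat A) n) \<Longrightarrow> iso_in (Cat B) (rho H w xs)"
    and rho_square: "fs \<in> hom (pow_cat (Cat A) n) xs ys \<Longrightarrow>
      square (Cat B) (rho H w xs) (ma H (opa A w fs)) (opa B w (map (ma H) fs)) (rho H w ys)"
proof -
  note F = functorsD(1,2)[OF src_functors[OF w]]
  note c = nat_transsD[OF nat_isos_transs[OF MRho[OF w]], unfolded F]
  show "rho H w xs \<in> hom (Cat B) (mo H (opo A w xs)) (opo B w (map (mo H) xs))" if "xs \<in> Obj (pow_cat (Cat A) n)"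
    using c(5)[OF that] unfolding src_OMap[OF w that] trg_OMap[OF that] .
  show "iso_in (Cat B) (rho H w xs)" if "xs \<in> Obj (pow_cat (Cat A) n)"
    using nat_isosD[OF MRho[OF w], unfolded F, OF that] .
  show "square (Cat B) (rho H w xs) (ma H (opa A w fs)) (opa B w (map (ma H) fs)) (rho H w ys)"
    if fs: "fs \<in> hom (pow_cat (Cat A) n) xs ys"
    using nat_transs_square[OF nat_isos_transs[OF MRho[OF w]] src_functors[OF w] trg_functors[OF w] fs A.PX]
    unfolding src_AMap[OF w homD[OF fs, THEN conjunct1]] trg_AMap[OF homD[OF fs, THEN conjunct1]]
    by (auto simp: square_def hom_def)
qed

text \<open>One side is the coherence of \<open>B\<close> at the images of the arguments after
  \<open>rho\<close> of the composite word. The other is the image under \<open>H\<close> of the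
  coherence of \<open>A\<close>, followed by \<open>rho\<close> of the outer word and then by
  \<open>rho\<close> of the inner words under the outer operation.\<close>

lemma MRho_CC_iff:
  assumes w: "w \<in> words T (length ws)" and wl: "word_list T ws"
  shows "(CC B w ws \<star> nat_id (func_pow (MFun H) (sum_list (map (Dom T) ws)))) \<circ>\<^sub>v MRho H (gam T w ws)
      = (nat_id (Phi B w) \<star> nat_prod (Cat A) (Cat B) (map (Dom T) ws) (map (MRho H) ws))
        \<circ>\<^sub>v (MRho H w \<star> nat_id (func_prod (Cat A) (Cat A) (map (Dom T) ws) (map (Phi A) ws)))
        \<circ>\<^sub>v (nat_id (MFun H) \<star> CC A w ws) \<longleftrightarrow>
    (\<forall>xs \<in> Obj (pow_cat (Cat A) (sum_list (map (Dom T) ws))).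
      Comp (Cat B) (asc B w ws (map (mo H) xs)) (rho H (gam T w ws) xs)
      = Comp (Cat B) (Comp (Cat B) (opa B w (evs T (rho H) ws xs)) (rho H w (evs T (opo A) ws xs)))
          (ma H (asc A w ws xs)))"
proof -
  let ?ns = "map (Dom T) ws" and ?N = "sum_list (map (Dom T) ws)"
  let ?X = "Cat A" and ?Y = "Cat B"
  let ?Fs = "map (\<lambda>v. func_comp (MFun H) (Phi A v)) ws"
    and ?Gs = "map (\<lambda>v. func_comp (Phi B v) (func_pow (MFun H) (Dom T v))) ws"
  note gw = A.gam_words[OF w wl]
  have ww: "\<And>i. i < length ws \<Longrightarrow> ws ! i \<in> words T (Dom T (ws ! i))" using wl by (simp add: word_list_def)
  have Fs: "?Fs ! i \<in> functors (pow_cat ?X (?ns ! i)) ?Y" and Gs: "?Gs ! i \<in> functors (pow_cat ?X (?ns ! i)) ?Y"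
    and Rs: "map (MRho H) ws ! i \<in> nat_transs (?Fs ! i) (?Gs ! i)" if "i < length ?ns" for i
    using that src_functors[OF ww] trg_functors[OF ww] nat_isos_transs[OF MRho[OF ww]] by simp_all
  have NP: "nat_prod ?X ?Y ?ns (map (MRho H) ws) \<in> nat_transs (func_prod ?X ?Y ?ns ?Fs) (func_prod ?X ?Y ?ns ?Gs)"
    by (rule nat_prod_transs[OF A.Cat _ _ _ Fs Gs Rs]) simp_all
  have FP: "func_prod ?X ?Y ?ns ?Fs \<in> functors (pow_cat ?X ?N) (pow_cat ?Y (length ws))"
    using func_prod_functors[OF A.Cat, of ?Fs ?ns ?Y] Fs by simp
  have GP: "func_prod ?X ?Y ?ns ?Gs \<in> functors (pow_cat ?X ?N) (pow_cat ?Y (length ws))"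
    using func_prod_functors[OF A.Cat, of ?Gs ?ns ?Y] Gs by simp
  note EA = A.end_gam_functors[OF w wl] and EB = B.end_gam_functors[OF w wl] and PA = A.prod_functors[OF wl]
  have b1: "NComp (CC B w ws \<star> nat_id (func_pow (MFun H) ?N)) xs = asc B w ws (map (mo H) xs)"
    if "xs \<in> Obj (pow_cat ?X ?N)" for xs
    using hcomp_id_right[OF B.Cat nat_isos_transs[OF B.CC[OF w wl]] B.Phi[OF gw] EB pow_functors that] pow_OMap[OF that] by simp
  have b2: "NComp (nat_id (Phi B w) \<star> nat_prod ?X ?Y ?ns (map (MRho H) ws)) xs = opa B w (evs T (rho H) ws xs)"
    if xs: "xs \<in> Obj (pow_cat ?X ?N)" for xs
  proof -
    have "map2 NComp (map (MRho H) ws) (split_blocks ?ns xs) = evs T (rho H) ws xs"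
      by (rule nth_equalityI) (simp_all add: evs_nth)
    then show ?thesis
      using hcomp_id_left[OF B.Cat B.Phi[OF w] NP FP GP xs] nat_prod_NComp[OF xs, of ?Y "map (MRho H) ws"] by simp
  qed
  have b3: "NComp (MRho H w \<star> nat_id (func_prod ?X ?X ?ns (map (Phi A) ws))) xs = rho H w (evs T (opo A) ws xs)"
    if xs: "xs \<in> Obj (pow_cat ?X ?N)" for xs
    using hcomp_id_right[OF B.Cat nat_isos_transs[OF MRho[OF w]] src_functors[OF w] trg_functors[OF w] PA xs] A.prod_OMap[OF xs]
    by simp
  have b4: "NComp (nat_id (MFun H) \<star> CC A w ws) xs = ma H (asc A w ws xs)" if xs: "xs \<in> Obj (pow_cat ?X ?N)" for xs
    by (rule hcomp_id_left[OF B.Cat MFun nat_isos_transs[OF A.CC[OF w wl]] A.Phi[OF gw] EA xs])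
  \<comment> \<open>The target functors agree because mapping \<open>H\<close> over a list commutes
    with cutting the list into blocks.\<close>
  have T: "func_comp (end_gam ?Y ?ns (Phi B w) (map (Phi B) ws)) (func_pow (MFun H) ?N)
    = func_comp (Phi B w) (func_prod ?X ?Y ?ns ?Gs)" (is "?L = ?R")
  proof (rule functors_eqI[OF func_comp_functors[OF A.PX pow_functors EB] func_comp_functors[OF A.PX GP B.Phi[OF w]]])
    fix xs assume xs: "xs \<in> Obj (pow_cat ?X ?N)"
    have b: "split_blocks ?ns xs ! i \<in> Obj (pow_cat ?X (Dom T (ws ! i)))" if "i < length ws" for i
      using blocks_Obj[OF xs, of i] that by (simp del: pow_cat_sel)
    have "OMap ?L xs = opo B w (evs T (opo B) ws (map (mo H) xs))"
      using xs functorsD(1)[OF pow_functors, of ?N] B.end_gam_OMap[OF map_mo[OF xs]] pow_OMap[OF xs]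
      by (simp del: pow_cat_sel func_pow_sel)
    also have "evs T (opo B) ws (map (mo H) xs) = OMap (func_prod ?X ?Y ?ns ?Gs) xs"
      unfolding func_prod_OMap[OF xs] evs_map
      by (rule nth_equalityI) (simp_all add: evs_nth trg_OMap[OF b] del: pow_cat_sel)
    finally show "OMap ?L xs = OMap ?R xs" using xs by (simp del: pow_cat_sel)
  next
    fix xs assume xs: "xs \<in> Arr (pow_cat ?X ?N)"
    have b: "split_blocks ?ns xs ! i \<in> Arr (pow_cat ?X (Dom T (ws ! i)))" if "i < length ws" for i
      using hom_blocks[OF category.Arr_hom[OF A.PX xs], of i] that homD by fastforce
    have m: "map (ma H) xs \<in> Arr (pow_cat ?Y ?N)" using xs MD(4) by auto
    have "AMap ?L xs = opa B w (evs T (opa B) ws (map (ma H) xs))"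
      using xs functorsD(1)[OF pow_functors, of ?N] B.end_gam_AMap[OF m] pow_AMap[OF xs]
      by (simp del: pow_cat_sel func_pow_sel)
    also have "evs T (opa B) ws (map (ma H) xs) = AMap (func_prod ?X ?Y ?ns ?Gs) xs"
      unfolding func_prod_AMap[OF xs] evs_map
      by (rule nth_equalityI) (simp_all add: evs_nth trg_AMap[OF b] del: pow_cat_sel)
    finally show "AMap ?L xs = AMap ?R xs" using xs by (simp del: pow_cat_sel)
  qed
  have m: "map NTrg (map (MRho H) ws) = ?Gs"
    by (rule nth_equalityI) (use nat_transsD(2)[OF nat_isos_transs[OF MRho[OF ww]]] in simp_all)
  note d = nat_transsD(1,2)[OF nat_isos_transs[OF B.CC[OF w wl]]] nat_transsD(1,2)[OF nat_isos_transs[OF A.CC[OF w wl]]]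
    nat_transsD(1,2)[OF nat_isos_transs[OF MRho[OF gw]]] nat_transsD(1,2)[OF nat_isos_transs[OF MRho[OF w]]]
  have NT: "NTrg (CC B w ws \<star> nat_id (func_pow (MFun H) ?N))
    = NTrg ((nat_id (Phi B w) \<star> nat_prod ?X ?Y ?ns (map (MRho H) ws))
        \<circ>\<^sub>v (MRho H w \<star> nat_id (func_prod ?X ?X ?ns (map (Phi A) ws))))"
    unfolding nat_vcomp_sel nat_hcomp_sel nat_prod_sel nat_id_sel d m T ..
  have v: "NComp ((nat_id (Phi B w) \<star> nat_prod ?X ?Y ?ns (map (MRho H) ws))
        \<circ>\<^sub>v (MRho H w \<star> nat_id (func_prod ?X ?X ?ns (map (Phi A) ws)))) xs
      = Comp ?Y (opa B w (evs T (rho H) ws xs)) (rho H w (evs T (opo A) ws xs))" if xs: "xs \<in> Obj (pow_cat ?X ?N)" for xs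
    using xs b2[OF xs] b3[OF xs] d(7) MD(2) by (simp del: pow_cat_sel)
  show ?thesis
    by (subst nat_vcomp_eq_iff[OF _ _ _ NT, of _ "pow_cat ?X ?N" ?Y])
       (use b1 v b4 d(3,5) functorsD(1,2)[OF src_functors[OF gw]] in \<open>simp_all del: pow_cat_sel func_comp_sel cong: ball_cong\<close>)
qed

lemma MRho_CI_iff:
  "(CI B \<star> nat_id (func_pow (MFun H) 1)) \<circ>\<^sub>v MRho H (word1 T) = nat_id (MFun H) \<star> CI A \<longleftrightarrow>
    (\<forall>x \<in> Obj (Cat A). Comp (Cat B) (unt B [mo H x]) (rho H (word1 T) [x]) = ma H (unt A [x]))"
proof -
  note w1 = A.word1_words
  note eA = end_unit_functors[OF A.Cat] and eB = end_unit_functors[OF B.Cat]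
  note d = nat_transsD(1,2)[OF nat_isos_transs[OF B.CI]] nat_transsD(1,2)[OF nat_isos_transs[OF MRho[OF w1]]]
  have r: "nat_id (MFun H) \<star> CI A \<in> nat_transs (func_comp (MFun H) (Phi A (word1 T))) (func_comp (MFun H) (end_unit (Cat A)))"
    by (rule nat_isos_transs[OF hcomp_id_left_isos[OF A.PX A.Cat B.Cat A.CI MFun A.Phi[OF w1] eA]])
  have T: "func_comp (end_unit (Cat B)) (func_pow (MFun H) 1) = func_comp (MFun H) (end_unit (Cat A))"
  proof (rule functors_eqI[OF func_comp_functors[OF A.PX pow_functors eB] func_comp_functors[OF A.PX eA MFun]])
    fix xs assume xs: "xs \<in> Obj (pow_cat (Cat A) 1)"
    then obtain x where "xs = [x]" "x \<in> Obj (Cat A)" by (auto simp: length_Suc_conv)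
    then show "OMap (func_comp (end_unit (Cat B)) (func_pow (MFun H) 1)) xs = OMap (func_comp (MFun H) (end_unit (Cat A))) xs"
      using MD(1,3) by (simp add: func_pow_OMap)
  next
    fix xs assume xs: "xs \<in> Arr (pow_cat (Cat A) 1)"
    then obtain x where "xs = [x]" "x \<in> Arr (Cat A)" by (auto simp: length_Suc_conv)
    then show "AMap (func_comp (end_unit (Cat B)) (func_pow (MFun H) 1)) xs = AMap (func_comp (MFun H) (end_unit (Cat A))) xs"
      using MD(1,4) by (simp add: func_pow_AMap)
  qed
  have b1: "NComp (CI B \<star> nat_id (func_pow (MFun H) 1)) [x] = unt B [mo H x]" if "x \<in> Obj (Cat A)" for x
    using hcomp_id_right[OF B.Cat nat_isos_transs[OF B.CI] B.Phi[OF w1] eB pow_functors, of "[x]"] pow_OMap[of "[x]" 1] that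
    by simp
  have b2: "NComp (nat_id (MFun H) \<star> CI A) [x] = ma H (unt A [x])" if "x \<in> Obj (Cat A)" for x
    using hcomp_id_left[OF B.Cat MFun nat_isos_transs[OF A.CI] A.Phi[OF w1] eA, of "[x]"] that by simp
  have "Obj (pow_cat (Cat A) 1) = (\<lambda>x. [x]) ` Obj (Cat A)" by (auto simp: length_Suc_conv)
  then show ?thesis
    by (subst nat_vcomp_eqI_iff[OF r, of _ _ "pow_cat (Cat A) 1" "Cat B"])
       (use b1 b2 d T functorsD(1,2)[OF src_functors[OF w1]] in \<open>simp_all del: pow_cat_sel func_comp_sel One_nat_def cong: ball_cong\<close>)
qed

lemma MRho_CS_iff:
  assumes w: "w \<in> words T k" and f: "fin_fun k l f"
  shows "(CS B w l f \<star> nat_id (func_pow (MFun H) l)) \<circ>\<^sub>v MRho H (subst_word T l w f)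
      = end_subst_nat (Cat A) l (MRho H w) f \<circ>\<^sub>v (nat_id (MFun H) \<star> CS A w l f) \<longleftrightarrow>
    (\<forall>xs \<in> Obj (pow_cat (Cat A) l). Comp (Cat B) (sbs B w l f (map (mo H) xs)) (rho H (subst_word T l w f) xs)
      = Comp (Cat B) (rho H w (map ((!) xs) f)) (ma H (sbs A w l f xs)))"
proof -
  note sw = A.subst_word_words[OF w f]
  note SA = A.end_subst_functors[OF w f] and SB = B.end_subst_functors[OF w f] and R = reindex_functors[OF A.Cat f]
  have mn: "map ((!) (map h xs)) f = map h (map ((!) xs) f)" if "length xs = l" for xs and h
    using f that by (auto simp: fin_fun_def)
  \<comment> \<open>Here the reason is that mapping \<open>H\<close> over a list commutes with
    reindexing it.\<close>
  have T: "func_comp (end_subst (Cat B) l (Phi B w) f) (func_pow (MFun H) l)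
    = func_comp (func_comp (Phi B w) (func_pow (MFun H) k)) (reindex (Cat A) l f)" (is "?L = ?R")
  proof (rule functors_eqI[OF func_comp_functors[OF A.PX pow_functors SB] func_comp_functors[OF A.PX R trg_functors[OF w]]])
    fix xs assume xs: "xs \<in> Obj (pow_cat (Cat A) l)"
    have r: "OMap (reindex (Cat A) l f) xs = map ((!) xs) f" "length xs = l" using xs by simp_all
    have "OMap ?L xs = opo B w (map ((!) (map (mo H) xs)) f)"
      using xs functorsD(1)[OF pow_functors, of l] B.end_subst_OMap[OF map_mo[OF xs], of "Phi B w" f] pow_OMap[OF xs]
      by (simp del: pow_cat_sel func_pow_sel)
    moreover have "OMap ?R xs = OMap (func_comp (Phi B w) (func_pow (MFun H) k)) (OMap (reindex (Cat A) l f) xs)"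
      using xs by (intro func_comp_sel(3)) simp
    ultimately show "OMap ?L xs = OMap ?R xs"
      by (simp only: r trg_OMap[OF A.pow_nth[OF f xs]] mn[OF r(2)])
  next
    fix xs assume xs: "xs \<in> Arr (pow_cat (Cat A) l)"
    have r: "AMap (reindex (Cat A) l f) xs = map ((!) xs) f" "length xs = l" using xs by simp_all
    have m: "map (ma H) xs \<in> Arr (pow_cat (Cat B) l)" using xs MD(4) by auto
    have x2: "map ((!) xs) f \<in> Arr (pow_cat (Cat A) k)" using functorsD(4)[OF R xs] r by simp
    have "AMap ?L xs = opa B w (map ((!) (map (ma H) xs)) f)"
      using xs functorsD(1)[OF pow_functors, of l] B.end_subst_AMap[OF m, of "Phi B w" f] pow_AMap[OF xs]
      by (simp del: pow_cat_sel func_pow_sel)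
    moreover have "AMap ?R xs = AMap (func_comp (Phi B w) (func_pow (MFun H) k)) (AMap (reindex (Cat A) l f) xs)"
      using xs by (intro func_comp_sel(4)) simp
    ultimately show "AMap ?L xs = AMap ?R xs"
      by (simp only: r trg_AMap[OF x2] mn[OF r(2)])
  qed
  note d = nat_transsD(1,2)[OF nat_isos_transs[OF B.CS[OF w f]]] nat_transsD(1,2)[OF nat_isos_transs[OF A.CS[OF w f]]]
    nat_transsD(1,2)[OF nat_isos_transs[OF MRho[OF sw]]] nat_transsD(1,2)[OF nat_isos_transs[OF MRho[OF w]]]
  have b1: "NComp (CS B w l f \<star> nat_id (func_pow (MFun H) l)) xs = sbs B w l f (map (mo H) xs)"
    if xs: "xs \<in> Obj (pow_cat (Cat A) l)" for xs
    using hcomp_id_right[OF B.Cat nat_isos_transs[OF B.CS[OF w f]] B.Phi[OF sw] SB pow_functors xs] pow_OMap[OF xs] by simp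
  have b2: "NComp (end_subst_nat (Cat A) l (MRho H w) f) xs = rho H w (map ((!) xs) f)"
    if xs: "xs \<in> Obj (pow_cat (Cat A) l)" for xs
    using hcomp_id_right[OF B.Cat nat_isos_transs[OF MRho[OF w]] src_functors[OF w] trg_functors[OF w] R xs] xs
    by (simp add: end_subst_nat_def)
  have b3: "NComp (nat_id (MFun H) \<star> CS A w l f) xs = ma H (sbs A w l f xs)" if xs: "xs \<in> Obj (pow_cat (Cat A) l)" for xs
    by (rule hcomp_id_left[OF B.Cat MFun nat_isos_transs[OF A.CS[OF w f]] A.Phi[OF sw] SA xs])
  have NT: "NTrg (CS B w l f \<star> nat_id (func_pow (MFun H) l)) = NTrg (end_subst_nat (Cat A) l (MRho H w) f)"
    unfolding end_subst_nat_def nat_hcomp_sel nat_id_sel d T ..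
  show ?thesis
    by (subst nat_vcomp_eq_iff[OF _ _ _ NT, of _ "pow_cat (Cat A) l" "Cat B"])
       (use b1 b2 b3 d(3,5) functorsD(1,2)[OF src_functors[OF sw]] in \<open>simp_all del: pow_cat_sel func_comp_sel map_map cong: ball_cong\<close>)
qed

end

locale pointwise_mor = pre_mor +
  assumes rho_asc: "w \<in> words T (length ws) \<Longrightarrow> word_list T ws \<Longrightarrow>
      xs \<in> Obj (pow_cat (Cat A) (sum_list (map (Dom T) ws))) \<Longrightarrow>
      Comp (Cat B) (asc B w ws (map (mo H) xs)) (rho H (gam T w ws) xs)
      = Comp (Cat B) (Comp (Cat B) (opa B w (evs T (rho H) ws xs)) (rho H w (evs T (opo A) ws xs)))
          (ma H (asc A w ws xs))"
    and rho_unt: "x \<in> Obj (Cat A) \<Longrightarrow> Comp (Cat B) (unt B [mo H x]) (rho H (word1 T) [x]) = ma H (unt A [x])"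
    and rho_sbs: "w \<in> words T k \<Longrightarrow> fin_fun k l f \<Longrightarrow> xs \<in> Obj (pow_cat (Cat A) l) \<Longrightarrow>
      Comp (Cat B) (sbs B w l f (map (mo H) xs)) (rho H (subst_word T l w f) xs)
      = Comp (Cat B) (rho H w (map ((!) xs) f)) (ma H (sbs A w l f xs))"

lemma pseudo_algebra_mor_pointwise:
  assumes "lawvere_theory T" "pseudo_algebra T (MSrc H)" "pseudo_algebra T (MTrg H)" "pseudo_algebra_mor T H"
  shows "pointwise_mor T (MSrc H) (MTrg H) H"
proof -
  interpret H: pseudo_algebra_mor T H "MSrc H" "MTrg H" "Cat (MSrc H)" "Cat (MTrg H)" by fact simp_all
  interpret P: pre_mor T "MSrc H" "MTrg H" H
    by (intro pre_mor.intro pre_mor_axioms.intro pseudo_algebra_pointwise assms refl H.MFun H.MRho_extensional H.MRho)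
  show ?thesis
  proof (intro pointwise_mor.intro pointwise_mor_axioms.intro P.pre_mor_axioms, goal_cases)
    case (1 w ws xs)
    then show ?case using H.MRho_CC[OF 1(1) _ refl] P.MRho_CC_iff[OF 1(1,2)] by (simp add: word_list_def)
  next
    case (2 x)
    then show ?case using H.MRho_CI P.MRho_CI_iff by blast
  next
    case (3 w k l f xs)
    then show ?case using H.MRho_CS[OF 3(1,2)] P.MRho_CS_iff[OF 3(1,2)] by blast
  qed
qed

lemma pointwise_pseudo_algebra_mor:
  assumes "pointwise_mor T A B H"
  shows "pseudo_algebra_mor T H"
proof -
  interpret P: pointwise_mor T A B H by fact
  note [simp] = P.MSrc P.MTrg
  show ?thesis
  proof (intro pseudo_algebra_mor.intro, unfold P.MSrc P.MTrg, goal_cases)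
    case 1 then show ?case by (rule P.MFun)
  next
    case 2 then show ?case by (rule P.MRho_extensional)
  next
    case 3 then show ?case by (rule P.MRho)
  next
    case (4 w ws ns)
    have wl: "word_list T ws" using 4(2) by (simp add: word_list_def)
    show ?case unfolding 4(3) P.MRho_CC_iff[OF 4(1) wl] using P.rho_asc[OF 4(1) wl] by blast
  next
    case 5
    show ?case unfolding P.MRho_CI_iff using P.rho_unt by blast
  next
    case (6 w k l f)
    show ?case unfolding P.MRho_CS_iff[OF 6] using P.rho_sbs[OF 6] by blast
  qed
qed

text \<open>\<open>MRho\<close> is extensional and its values are transformations between functors
  fixed by \<open>MFun\<close>, so components decide. The strict unit and associativity laws for
  morphisms are proved through this criterion.\<close>

lemma pmor_eqI:
  assumes "pre_mor T A B G" "pre_mor T A B H"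
    and "\<And>x. x \<in> Obj (Cat A) \<Longrightarrow> mo G x = mo H x" "\<And>f. f \<in> Arr (Cat A) \<Longrightarrow> ma G f = ma H f"
    and "\<And>w n xs. w \<in> words T n \<Longrightarrow> xs \<in> Obj (pow_cat (Cat A) n) \<Longrightarrow> rho G w xs = rho H w xs"
  shows "G = H"
proof -
  interpret G: pre_mor T A B G by fact
  interpret H: pre_mor T A B H by fact
  have F: "MFun G = MFun H" by (rule functors_eqI[OF G.MFun H.MFun assms(3,4)])
  have "MRho G = MRho H"
  proof (rule extensionalityI[OF G.MRho_extensional H.MRho_extensional])
    fix w assume "w \<in> (\<Union>n. words T n)"
    then obtain n where w: "w \<in> words T n" by blast
    show "MRho G w = MRho H w"
      by (rule nat_transs_eqI[OF nat_isos_transs[OF G.MRho[OF w], unfolded F] nat_isos_transs[OF H.MRho[OF w]]])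
         (use assms(5)[OF w] functorsD(1)[OF H.src_functors[OF w]] in simp)
  qed
  then show ?thesis using F G.MSrc H.MSrc G.MTrg H.MTrg by (cases G; cases H) simp
qed

lemma pmor_comp_sel [simp]:
  "MSrc (pmor_comp T H G) = MSrc G" "MTrg (pmor_comp T H G) = MTrg H" "MFun (pmor_comp T H G) = func_comp (MFun H) (MFun G)"
  by (simp_all add: pmor_comp_def)

locale mor_pair = G: pointwise_mor T A B G + H: pointwise_mor T B C H
  for T :: "'t thy" and A B C :: "('t, 'o, 'a) palg" and G H
begin

abbreviation "HG \<equiv> pmor_comp T H G"

lemma HG_mo: "x \<in> Obj (Cat A) \<Longrightarrow> mo HG x = mo H (mo G x)"
  using G.MD(1) by simp

lemma HG_ma: "f \<in> Arr (Cat A) \<Longrightarrow> ma HG f = ma H (ma G f)"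
  using G.MD(1) by simp

lemma map_HG_mo: "xs \<in> Obj (pow_cat (Cat A) n) \<Longrightarrow> map (mo HG) xs = map (mo H) (map (mo G) xs)"
  using HG_mo by (auto simp: subset_iff)

lemma HG_MRho:
  assumes w: "w \<in> words T n"
  shows "MRho HG w = (MRho H w \<star> nat_id (func_pow (MFun G) n)) \<circ>\<^sub>v (nat_id (MFun H) \<star> MRho G w)"
  using w G.A.words_Dom[OF w] by (auto simp: pmor_comp_def)

lemma HG_rho:
  assumes w: "w \<in> words T n" and xs: "xs \<in> Obj (pow_cat (Cat A) n)"
  shows "rho HG w xs = Comp (Cat C) (rho H w (map (mo G) xs)) (ma H (rho G w xs))"
proof -
  have "NComp (MRho H w \<star> nat_id (func_pow (MFun G) n)) xs = rho H w (map (mo G) xs)"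
    using hcomp_id_right[OF H.B.Cat nat_isos_transs[OF H.MRho[OF w]] H.src_functors[OF w] H.trg_functors[OF w] G.pow_functors xs]
      G.pow_OMap[OF xs] by simp
  moreover have "NComp (nat_id (MFun H) \<star> MRho G w) xs = ma H (rho G w xs)"
    by (rule hcomp_id_left[OF H.B.Cat H.MFun nat_isos_transs[OF G.MRho[OF w]] G.src_functors[OF w] G.trg_functors[OF w] xs])
  ultimately show ?thesis
    using HG_MRho[OF w] xs nat_transsD(1)[OF nat_isos_transs[OF G.MRho[OF w]]] functorsD(1)[OF G.src_functors[OF w]] H.MD(2)
    by (simp del: pow_cat_sel func_comp_sel) (simp del: pow_cat_sel)
qed

lemma pre_mor_comp: "pre_mor T A C HG"
proof (intro pre_mor.intro pre_mor_axioms.intro G.A.pointwise_algebra_axioms H.B.pointwise_algebra_axioms)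
  show "MFun HG \<in> functors (Cat A) (Cat C)"
    using func_comp_functors[OF G.A.Cat G.MFun H.MFun] by simp
  show "MRho HG \<in> extensional (\<Union>n. words T n)" by (simp add: pmor_comp_def)
  fix w n assume w: "w \<in> words T n"
  \<comment> \<open>Strict associativity of functor composition makes the two whiskered halves of
    the composite coherence composable on the nose.\<close>
  have 1: "nat_id (MFun H) \<star> MRho G w \<in> nat_isos (func_comp (MFun HG) (Phi A w))
      (func_comp (MFun H) (func_comp (Phi B w) (func_pow (MFun G) n)))"
    using hcomp_id_left_isos[OF G.A.PX G.B.Cat H.B.Cat G.MRho[OF w] H.MFun G.src_functors[OF w] G.trg_functors[OF w]]
      func_comp_assoc[OF G.A.Phi[OF w] G.MD(1), of "MFun H"] by simp
  have 2: "MRho H w \<star> nat_id (func_pow (MFun G) n) \<in> nat_isos (func_comp (MFun H) (func_comp (Phi B w) (func_pow (MFun G) n)))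
      (func_comp (Phi C w) (func_pow (MFun HG) n))"
    using hcomp_id_right_isos[OF G.A.PX G.B.PX H.B.Cat H.MRho[OF w] H.src_functors[OF w] H.trg_functors[OF w] G.pow_functors]
      func_comp_assoc[OF G.pow_functors G.B.PhiD(1)[OF w], of "MFun H"]
      func_comp_assoc[OF G.pow_functors functorsD(1)[OF H.pow_functors], of "Phi C w"] func_pow_comp[OF G.MFun H.MFun]
    by simp
  show "MRho HG w \<in> nat_isos (func_comp (MFun HG) (Phi A w)) (func_comp (Phi C w) (func_pow (MFun HG) n))"
    unfolding HG_MRho[OF w]
  proof (rule nat_vcomp_isos[OF H.B.Cat _ _ _ 1 2 G.A.PX])
    have F: "MFun HG \<in> functors (Cat A) (Cat C)" using func_comp_functors[OF G.A.Cat G.MFun H.MFun] by simp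
    show "func_comp (MFun HG) (Phi A w) \<in> functors (pow_cat (Cat A) n) (Cat C)"
      by (rule func_comp_functors[OF G.A.PX G.A.Phi[OF w] F])
    show "func_comp (MFun H) (func_comp (Phi B w) (func_pow (MFun G) n)) \<in> functors (pow_cat (Cat A) n) (Cat C)"
      by (rule func_comp_functors[OF G.A.PX G.trg_functors[OF w] H.MFun])
    show "func_comp (Phi C w) (func_pow (MFun HG) n) \<in> functors (pow_cat (Cat A) n) (Cat C)"
      by (rule func_comp_functors[OF G.A.PX func_pow_functors[OF G.A.Cat F] H.B.Phi[OF w]])
  qed
qed (simp_all add: G.MSrc H.MTrg)

lemma evs_rho_hom:
  assumes wl: "word_list T ws" and xs: "xs \<in> Obj (pow_cat (Cat A) (sum_list (map (Dom T) ws)))"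
  shows "evs T (rho G) ws xs \<in> hom (pow_cat (Cat B) (length ws))
    (map (mo G) (evs T (opo A) ws xs)) (evs T (opo B) ws (map (mo G) xs))"
proof -
  have "rho G (ws ! i) (split_blocks (map (Dom T) ws) xs ! i) \<in> hom (Cat B)
      (mo G (opo A (ws ! i) (split_blocks (map (Dom T) ws) xs ! i)))
      (opo B (ws ! i) (map (mo G) (split_blocks (map (Dom T) ws) xs ! i)))" if "i < length ws" for i
    using that wl blocks_Obj[OF xs, of i] by (intro G.rho_hom) (simp_all add: word_list_def del: pow_cat_sel)
  then show ?thesis by (simp add: hom_pow_iff evs_nth split_blocks_map)
qed

end

section \<open>The 2-category of pseudo algebras pointwise\<close>

context category
begin

text \<open>Two commuting squares are pasted along \<open>k\<close>. For a composite of
  \<open>G\<close> and \<open>H\<close>, one is the compatibility equation of \<open>H\<close> and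
  the other is the image under \<open>H\<close> of that of \<open>G\<close>.\<close>

lemma Comp_paste:
  assumes "p \<in> hom C a b" "r \<in> hom C b c" "s \<in> hom C c d" "q \<in> hom C a a'" "n \<in> hom C a' b'" "v \<in> hom C b' d"
    "k \<in> hom C b b'" "Comp C s r = Comp C v k" "Comp C k p = Comp C n q"
  shows "Comp C s (Comp C r p) = Comp C (Comp C v n) q"
  using Comp_assoc[OF assms(1-3)] Comp_assoc[OF assms(4-6)] Comp_assoc[OF assms(1,7,6)] assms(8,9) by simp

text \<open>Replacement of the two middle factors. In a composite of morphisms these are
  \<open>rho H\<close> and the image under \<open>H\<close> of an operation applied to
  \<open>rho G\<close>, and the given equation is naturality of \<open>rho H\<close>.\<close>

lemma Comp_middle:
  assumes "n \<in> hom C a b" "m \<in> hom C b c" "v \<in> hom C c d" "u \<in> hom C d e" "v' \<in> hom C b c'" "m' \<in> hom C c' d"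
    "Comp C v m = Comp C m' v'"
  shows "Comp C (Comp C u v) (Comp C m n) = Comp C (Comp C u m') (Comp C v' n)"
proof -
  have "Comp C (Comp C u v) (Comp C m n) = Comp C u (Comp C v (Comp C m n))"
    by (rule Comp_assoc[OF Comp_hom[OF assms(1,2)] assms(3,4), symmetric])
  also have "Comp C v (Comp C m n) = Comp C (Comp C m' v') n" using Comp_assoc[OF assms(1-3)] assms(7) by simp
  also have "\<dots> = Comp C m' (Comp C v' n)" by (rule Comp_assoc[OF assms(1,5,6), symmetric])
  also have "Comp C u \<dots> = Comp C (Comp C u m') (Comp C v' n)"
    by (rule Comp_assoc[OF Comp_hom[OF assms(1,5)] assms(6,4)])
  finally show ?thesis .
qed

end

lemma func_pow_id: "func_pow (func_id C) n = func_id (pow_cat C n)"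
  by (auto simp: func_pow_def func_id_def restrict_def fun_eq_iff subset_iff intro!: map_idI)

lemma func_id_right: "F \<in> functors C D \<Longrightarrow> func_comp F (func_id C) = F"
proof -
  assume F: "F \<in> functors C D"
  have "restrict (\<lambda>x. OMap F (OMap (func_id C) x)) (Obj C) = OMap F"
    "restrict (\<lambda>f. AMap F (AMap (func_id C) f)) (Arr C) = AMap F"
    using functors_extensional[OF F]
    by (auto intro!: extensionalityI[of _ "Obj C"] extensionalityI[of _ "Arr C"])
  then show ?thesis using functorsD(1,2)[OF F] by (cases F) (simp add: func_comp_def)
qed

context mor_pair
begin

text \<open>Each compatibility is that of \<open>H\<close> at the images under \<open>G\<close>,
  pasted with the image under \<open>H\<close> of that of \<open>G\<close>. The one for
  \<open>asc\<close> needs naturality of \<open>rho H\<close> in addition, to bring the inner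
  coherences of \<open>G\<close> and \<open>H\<close> together.\<close>

lemma pointwise_mor_comp: "pointwise_mor T A C HG"
proof (intro pointwise_mor.intro pointwise_mor_axioms.intro pre_mor_comp, goal_cases)
  case (1 w ws xs)
  note w = 1(1) and wl = 1(2) and xs = 1(3)
  let ?N = "sum_list (map (Dom T) ws)"
  note gw = G.A.gam_words[OF w wl] and Gx = G.map_mo[OF xs] and ea = G.A.evs_opo[OF wl xs]
  note eb = G.B.evs_opo[OF wl Gx]
  note r = evs_rho_hom[OF wl xs]
  have eH: "evs T (rho H) ws (map (mo G) xs) \<in> hom (pow_cat (Cat C) (length ws))
      (map (mo H) (evs T (opo B) ws (map (mo G) xs))) (evs T (opo C) ws (map (mo H) (map (mo G) xs)))"
  proof -
    have "rho H (ws ! i) (split_blocks (map (Dom T) ws) (map (mo G) xs) ! i) \<in> hom (Cat C)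
      (mo H (opo B (ws ! i) (split_blocks (map (Dom T) ws) (map (mo G) xs) ! i)))
      (opo C (ws ! i) (map (mo H) (split_blocks (map (Dom T) ws) (map (mo G) xs) ! i)))" if "i < length ws" for i
      using that wl blocks_Obj[OF Gx, of i] by (intro H.rho_hom) (simp_all add: word_list_def del: pow_cat_sel)
    then show ?thesis by (simp add: hom_pow_iff evs_nth split_blocks_map)
  qed
  \<comment> \<open>Block by block, the composite of the inner coherences is the coherence of
    \<open>HG\<close>; functoriality of the operation of \<open>w\<close> will merge the two
    factors.\<close>
  have t: "map2 (Comp (Cat C)) (evs T (rho H) ws (map (mo G) xs)) (map (ma H) (evs T (rho G) ws xs)) = evs T (rho HG) ws xs"
  proof (rule nth_equalityI)
    fix i assume "i < length (map2 (Comp (Cat C)) (evs T (rho H) ws (map (mo G) xs)) (map (ma H) (evs T (rho G) ws xs)))"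
    then have i: "i < length ws" by simp
    have "ws ! i \<in> words T (Dom T (ws ! i))" using wl i by (simp add: word_list_def)
    moreover have "split_blocks (map (Dom T) ws) xs ! i \<in> Obj (pow_cat (Cat A) (Dom T (ws ! i)))"
      using blocks_Obj[OF xs, of i] i by (simp del: pow_cat_sel)
    ultimately show "map2 (Comp (Cat C)) (evs T (rho H) ws (map (mo G) xs)) (map (ma H) (evs T (rho G) ws xs)) ! i = evs T (rho HG) ws xs ! i"
      using i by (simp add: evs_nth split_blocks_map HG_rho del: pow_cat_sel)
  qed simp
  have "Comp (Cat C) (asc C w ws (map (mo H) (map (mo G) xs))) (Comp (Cat C) (rho H (gam T w ws) (map (mo G) xs)) (ma H (rho G (gam T w ws) xs)))
    = Comp (Cat C) (Comp (Cat C)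
        (Comp (Cat C) (opa C w (evs T (rho H) ws (map (mo G) xs))) (rho H w (evs T (opo B) ws (map (mo G) xs))))
        (Comp (Cat C) (ma H (opa B w (evs T (rho G) ws xs))) (ma H (rho G w (evs T (opo A) ws xs)))))
        (ma H (ma G (asc A w ws xs)))"
  proof (rule H.B.X.Comp_paste)
    show "ma H (rho G (gam T w ws) xs) \<in> hom (Cat C) (mo H (mo G (opo A (gam T w ws) xs))) (mo H (opo B (gam T w ws) (map (mo G) xs)))"
      by (rule H.MD(5)[OF G.rho_hom[OF gw xs]])
    show "rho H (gam T w ws) (map (mo G) xs) \<in> hom (Cat C) (mo H (opo B (gam T w ws) (map (mo G) xs))) (opo C (gam T w ws) (map (mo H) (map (mo G) xs)))"
      by (rule H.rho_hom[OF gw Gx])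
    show "asc C w ws (map (mo H) (map (mo G) xs)) \<in> hom (Cat C) (opo C (gam T w ws) (map (mo H) (map (mo G) xs)))
      (opo C w (evs T (opo C) ws (map (mo H) (map (mo G) xs))))" by (rule H.B.asc_hom[OF w wl H.map_mo[OF Gx]])
    show "ma H (ma G (asc A w ws xs)) \<in> hom (Cat C) (mo H (mo G (opo A (gam T w ws) xs))) (mo H (mo G (opo A w (evs T (opo A) ws xs))))"
      by (rule H.MD(5)[OF G.MD(5)[OF G.A.asc_hom[OF w wl xs]]])
    have 1: "rho G w (evs T (opo A) ws xs) \<in> hom (Cat B) (mo G (opo A w (evs T (opo A) ws xs))) (opo B w (map (mo G) (evs T (opo A) ws xs)))"
      by (rule G.rho_hom[OF w ea])
    have 2: "opa B w (evs T (rho G) ws xs) \<in> hom (Cat B) (opo B w (map (mo G) (evs T (opo A) ws xs))) (opo B w (evs T (opo B) ws (map (mo G) xs)))"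
      by (rule G.B.PhiD(5)[OF w r])
    show "Comp (Cat C) (ma H (opa B w (evs T (rho G) ws xs))) (ma H (rho G w (evs T (opo A) ws xs)))
      \<in> hom (Cat C) (mo H (mo G (opo A w (evs T (opo A) ws xs)))) (mo H (opo B w (evs T (opo B) ws (map (mo G) xs))))"
      by (rule H.B.X.Comp_hom[OF H.MD(5)[OF 1] H.MD(5)[OF 2]])
    show "Comp (Cat C) (opa C w (evs T (rho H) ws (map (mo G) xs))) (rho H w (evs T (opo B) ws (map (mo G) xs)))
      \<in> hom (Cat C) (mo H (opo B w (evs T (opo B) ws (map (mo G) xs)))) (opo C w (evs T (opo C) ws (map (mo H) (map (mo G) xs))))"
      by (rule H.B.X.Comp_hom[OF H.rho_hom[OF w eb] H.B.PhiD(5)[OF w eH]])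
    show "ma H (asc B w ws (map (mo G) xs)) \<in> hom (Cat C) (mo H (opo B (gam T w ws) (map (mo G) xs))) (mo H (opo B w (evs T (opo B) ws (map (mo G) xs))))"
      by (rule H.MD(5)[OF G.B.asc_hom[OF w wl Gx]])
    show "Comp (Cat C) (asc C w ws (map (mo H) (map (mo G) xs))) (rho H (gam T w ws) (map (mo G) xs))
      = Comp (Cat C) (Comp (Cat C) (opa C w (evs T (rho H) ws (map (mo G) xs))) (rho H w (evs T (opo B) ws (map (mo G) xs))))
          (ma H (asc B w ws (map (mo G) xs)))" by (rule H.rho_asc[OF w wl Gx])
    have "Comp (Cat C) (ma H (asc B w ws (map (mo G) xs))) (ma H (rho G (gam T w ws) xs))
      = ma H (Comp (Cat B) (asc B w ws (map (mo G) xs)) (rho G (gam T w ws) xs))"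
      by (rule H.MD(7)[OF G.rho_hom[OF gw xs] G.B.asc_hom[OF w wl Gx], symmetric])
    also have "\<dots> = ma H (Comp (Cat B) (Comp (Cat B) (opa B w (evs T (rho G) ws xs)) (rho G w (evs T (opo A) ws xs))) (ma G (asc A w ws xs)))"
      by (simp only: G.rho_asc[OF w wl xs])
    also have "\<dots> = Comp (Cat C) (ma H (Comp (Cat B) (opa B w (evs T (rho G) ws xs)) (rho G w (evs T (opo A) ws xs)))) (ma H (ma G (asc A w ws xs)))"
      by (rule H.MD(7)[OF G.MD(5)[OF G.A.asc_hom[OF w wl xs]] G.B.X.Comp_hom[OF 1 2]])
    also have "ma H (Comp (Cat B) (opa B w (evs T (rho G) ws xs)) (rho G w (evs T (opo A) ws xs)))
      = Comp (Cat C) (ma H (opa B w (evs T (rho G) ws xs))) (ma H (rho G w (evs T (opo A) ws xs)))"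
      by (rule H.MD(7)[OF 1 2])
    finally show "Comp (Cat C) (ma H (asc B w ws (map (mo G) xs))) (ma H (rho G (gam T w ws) xs))
      = Comp (Cat C) (Comp (Cat C) (ma H (opa B w (evs T (rho G) ws xs))) (ma H (rho G w (evs T (opo A) ws xs)))) (ma H (ma G (asc A w ws xs)))" .
  qed
  \<comment> \<open>Naturality of \<open>rho H\<close> at the arrow
    \<open>evs T (rho G) ws xs\<close> exchanges the middle factors, so that the two inner and the
    two outer coherences stand next to each other.\<close>
  also have "Comp (Cat C)
        (Comp (Cat C) (opa C w (evs T (rho H) ws (map (mo G) xs))) (rho H w (evs T (opo B) ws (map (mo G) xs))))
        (Comp (Cat C) (ma H (opa B w (evs T (rho G) ws xs))) (ma H (rho G w (evs T (opo A) ws xs))))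
     = Comp (Cat C)
        (Comp (Cat C) (opa C w (evs T (rho H) ws (map (mo G) xs))) (opa C w (map (ma H) (evs T (rho G) ws xs))))
        (Comp (Cat C) (rho H w (map (mo G) (evs T (opo A) ws xs))) (ma H (rho G w (evs T (opo A) ws xs))))"
  proof (rule H.B.X.Comp_middle[OF H.MD(5)[OF G.rho_hom[OF w ea]] H.MD(5)[OF G.B.PhiD(5)[OF w r]] H.rho_hom[OF w eb] H.B.PhiD(5)[OF w eH]
      H.rho_hom[OF w G.map_mo[OF ea]] H.B.PhiD(5)[OF w H.map_ma[OF r]]])
    show "Comp (Cat C) (rho H w (evs T (opo B) ws (map (mo G) xs))) (ma H (opa B w (evs T (rho G) ws xs)))
      = Comp (Cat C) (opa C w (map (ma H) (evs T (rho G) ws xs))) (rho H w (map (mo G) (evs T (opo A) ws xs)))"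
      using H.rho_square[OF w r] by (simp add: square_def)
  qed
  also have "Comp (Cat C) (opa C w (evs T (rho H) ws (map (mo G) xs))) (opa C w (map (ma H) (evs T (rho G) ws xs)))
    = opa C w (evs T (rho HG) ws xs)"
    using H.B.PhiD(7)[OF w H.map_ma[OF r] eH] t by simp
  finally show ?case
    using xs HG_rho[OF gw xs] HG_rho[OF w ea] map_HG_mo[OF xs] HG_ma[OF homD[OF G.A.asc_hom[OF w wl xs], THEN conjunct1]]
    by (simp only:)
next
  case (2 x)
  note w1 = G.A.word1_words
  have x1: "[x] \<in> Obj (pow_cat (Cat A) 1)" using 2 by simp
  note G1 = G.map_mo[OF x1, simplified list.map] and Gx = G.MD(3)[OF 2]
  have "Comp (Cat C) (unt C [mo H (mo G x)]) (Comp (Cat C) (rho H (word1 T) [mo G x]) (ma H (rho G (word1 T) [x])))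
    = Comp (Cat C) (Comp (Cat C) (unt C [mo H (mo G x)]) (rho H (word1 T) [mo G x])) (ma H (rho G (word1 T) [x]))"
    using H.MD(5)[OF G.rho_hom[OF w1 x1]] H.rho_hom[OF w1 G1] H.B.unt_hom[OF H.MD(3)[OF Gx]]
    by (intro H.B.X.Comp_assoc) simp_all
  also have "\<dots> = Comp (Cat C) (ma H (unt B [mo G x])) (ma H (rho G (word1 T) [x]))"
    using H.rho_unt[OF Gx] by simp
  also have "\<dots> = ma H (ma G (unt A [x]))"
    using H.MD(7)[OF G.rho_hom[OF w1 x1], of "unt B [mo G x]"] G.B.unt_hom[OF Gx] G.rho_unt[OF 2] by simp
  finally show ?case
    using HG_rho[OF w1 x1] HG_mo[OF 2] HG_ma[OF homD[OF G.A.unt_hom[OF 2], THEN conjunct1]] by simp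
next
  case (3 w k l f xs)
  note w = 3(1) and f = 3(2) and xs = 3(3)
  note sw = G.A.subst_word_words[OF w f] and Gx = G.map_mo[OF xs] and xf = G.A.pow_nth[OF f xs]
  have m: "map ((!) (map (mo G) xs)) f = map (mo G) (map ((!) xs) f)"
    using f xs by (auto simp: fin_fun_def)
  have "Comp (Cat C) (sbs C w l f (map (mo H) (map (mo G) xs))) (Comp (Cat C) (rho H (subst_word T l w f) (map (mo G) xs)) (ma H (rho G (subst_word T l w f) xs)))
    = Comp (Cat C) (Comp (Cat C) (rho H w (map (mo G) (map ((!) xs) f))) (ma H (rho G w (map ((!) xs) f)))) (ma H (ma G (sbs A w l f xs)))"
  proof (rule H.B.X.Comp_paste[OF H.MD(5)[OF G.rho_hom[OF sw xs]] H.rho_hom[OF sw Gx] H.B.sbs_hom[OF w f H.map_mo[OF Gx]]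
      H.MD(5)[OF G.MD(5)[OF G.A.sbs_hom[OF w f xs]]] H.MD(5)[OF G.rho_hom[OF w xf]]])
    note hh = H.rho_hom[OF w G.map_mo[OF xf]]
    show "rho H w (map (mo G) (map ((!) xs) f)) \<in> hom (Cat C) (mo H (opo B w (map (mo G) (map ((!) xs) f)))) (opo C w (map ((!) (map (mo H) (map (mo G) xs))) f))"
    proof -
      have "map ((!) (map (mo H) (map (mo G) xs))) f = map (mo H) (map (mo G) (map ((!) xs) f))"
        using f xs by (auto simp: fin_fun_def)
      then show ?thesis using hh by (simp only:)
    qed
    show "ma H (sbs B w l f (map (mo G) xs)) \<in> hom (Cat C) (mo H (opo B (subst_word T l w f) (map (mo G) xs))) (mo H (opo B w (map (mo G) (map ((!) xs) f))))"
      using H.MD(5)[OF G.B.sbs_hom[OF w f Gx]] unfolding m .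
    show "Comp (Cat C) (sbs C w l f (map (mo H) (map (mo G) xs))) (rho H (subst_word T l w f) (map (mo G) xs))
      = Comp (Cat C) (rho H w (map (mo G) (map ((!) xs) f))) (ma H (sbs B w l f (map (mo G) xs)))"
      using H.rho_sbs[OF w f Gx] unfolding m .
    show "Comp (Cat C) (ma H (sbs B w l f (map (mo G) xs))) (ma H (rho G (subst_word T l w f) xs))
      = Comp (Cat C) (ma H (rho G w (map ((!) xs) f))) (ma H (ma G (sbs A w l f xs)))"
      using H.MD(7)[OF G.rho_hom[OF sw xs] G.B.sbs_hom[OF w f Gx]] G.rho_sbs[OF w f xs]
        H.MD(7)[OF G.MD(5)[OF G.A.sbs_hom[OF w f xs]] G.rho_hom[OF w xf]] by simp
  qed
  then show ?case
    using HG_rho[OF sw xs] HG_rho[OF w xf] map_HG_mo[OF xs] HG_ma[OF homD[OF G.A.sbs_hom[OF w f xs], THEN conjunct1]]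
    by (simp only:)
qed

end

lemma pmor_id_sel [simp]: "MSrc (pmor_id T A) = A" "MTrg (pmor_id T A) = A" "MFun (pmor_id T A) = func_id (Cat A)"
  by (simp_all add: pmor_id_def)

context pointwise_algebra
begin

lemma pmor_id_rho: "w \<in> words T n \<Longrightarrow> xs \<in> Obj (pow_cat X n) \<Longrightarrow> rho (pmor_id T A) w xs = Id X (opo A w xs)"
  using PhiD(1,2) by (auto simp: pmor_id_def)

lemma pre_mor_id: "pre_mor T A A (pmor_id T A)"
proof (intro pre_mor.intro pre_mor_axioms.intro pointwise_algebra_axioms)
  show "MFun (pmor_id T A) \<in> functors X X" using func_id_functors[OF Cat] by simp
  show "MRho (pmor_id T A) \<in> extensional (\<Union>n. words T n)" by (simp add: pmor_id_def)
  fix w n assume w: "w \<in> words T n"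
  then show "MRho (pmor_id T A) w \<in> nat_isos (func_comp (MFun (pmor_id T A)) (Phi A w)) (func_comp (Phi A w) (func_pow (MFun (pmor_id T A)) n))"
    using func_id_left[OF Cat Phi[OF w]] func_id_right[OF Phi[OF w]] nat_id_isos[OF PX Cat Phi[OF w]]
    by (auto simp: func_pow_id) (auto simp: pmor_id_def)
qed simp_all

end

lemma (in pre_mor) pmor_id_left: "pmor_comp T (pmor_id T B) H = H"
  if "pointwise_mor T A B H" "pointwise_mor T B B (pmor_id T B)"
proof -
  interpret P: mor_pair T A B B H "pmor_id T B" using that by (simp add: mor_pair_def)
  show ?thesis
  proof (rule pmor_eqI[OF P.pre_mor_comp pre_mor_axioms])
    fix w n xs assume w: "w \<in> words T n" and xs: "xs \<in> Obj (pow_cat (Cat A) n)"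
    have "rho (pmor_comp T (pmor_id T B) H) w xs = Comp (Cat B) (Id (Cat B) (opo B w (map (mo H) xs))) (rho H w xs)"
      using P.HG_rho[OF w xs] B.pmor_id_rho[OF w map_mo[OF xs]] rho_hom[OF w xs] by (simp add: hom_def)
    then show "rho (pmor_comp T (pmor_id T B) H) w xs = rho H w xs"
      using B.X.Comp_Id_left[OF rho_hom[OF w xs]] by simp
  qed (use P.HG_mo P.HG_ma MD in auto)
qed

lemma (in pre_mor) pmor_id_right: "pmor_comp T H (pmor_id T A) = H"
  if "pointwise_mor T A B H" "pointwise_mor T A A (pmor_id T A)"
proof -
  interpret P: mor_pair T A A B "pmor_id T A" H using that by (simp add: mor_pair_def)
  show ?thesis
  proof (rule pmor_eqI[OF P.pre_mor_comp pre_mor_axioms])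
    fix w n xs assume w: "w \<in> words T n" and xs: "xs \<in> Obj (pow_cat (Cat A) n)"
    have "map (OMap (func_id (Cat A))) xs = xs" using xs by (auto intro!: map_idI)
    then have "rho (pmor_comp T H (pmor_id T A)) w xs = Comp (Cat B) (rho H w xs) (ma H (Id (Cat A) (opo A w xs)))"
      using P.HG_rho[OF w xs] A.pmor_id_rho[OF w xs] by simp
    then show "rho (pmor_comp T H (pmor_id T A)) w xs = rho H w xs"
      using B.X.Comp_Id_right[OF rho_hom[OF w xs]] MD(6)[OF A.PhiD(3)[OF w xs]] by simp
  qed (use P.HG_mo P.HG_ma in auto)
qed

lemma (in pointwise_algebra) pointwise_mor_id: "pointwise_mor T A A (pmor_id T A)"
proof (intro pointwise_mor.intro pointwise_mor_axioms.intro pre_mor_id, goal_cases)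
  case (1 w ws xs)
  note w = 1(1) and wl = 1(2) and xs = 1(3)
  note gw = gam_words[OF w wl] and ea = evs_opo[OF wl xs]
  have e: "evs T (rho (pmor_id T A)) ws xs = map (Id X) (evs T (opo A) ws xs)"
  proof (rule nth_equalityI)
    fix i assume "i < length (evs T (rho (pmor_id T A)) ws xs)"
    then have i: "i < length ws" by simp
    then have "ws ! i \<in> words T (Dom T (ws ! i))" using wl by (simp add: word_list_def)
    moreover have "split_blocks (map (Dom T) ws) xs ! i \<in> Obj (pow_cat X (Dom T (ws ! i)))"
      using blocks_Obj[OF xs, of i] i by (simp del: pow_cat_sel)
    ultimately show "evs T (rho (pmor_id T A)) ws xs ! i = map (Id X) (evs T (opo A) ws xs) ! i"
      using i pmor_id_rho by (simp add: evs_nth del: pow_cat_sel)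
  qed simp
  have "map (OMap (func_id X)) xs = xs" using xs by (auto intro!: map_idI)
  moreover have "opa A w (map (Id X) (evs T (opo A) ws xs)) = Id X (opo A w (evs T (opo A) ws xs))"
    using PhiD(6)[OF w ea] by simp
  moreover have i: "Id X (opo A w (evs T (opo A) ws xs)) \<in> hom X (opo A w (evs T (opo A) ws xs)) (opo A w (evs T (opo A) ws xs))"
    using X.Id_hom[OF PhiD(3)[OF w ea]] .
  ultimately show ?case
    using e pmor_id_rho[OF gw xs] pmor_id_rho[OF w ea] X.Comp_Id_right[OF asc_hom[OF w wl xs]]
      X.Comp_Id_left[OF asc_hom[OF w wl xs]] X.Comp_Id_left[OF i] homD[OF asc_hom[OF w wl xs]] by simp
next
  case (2 x)
  have "rho (pmor_id T A) (word1 T) [x] = Id X (opo A (word1 T) [x])" using pmor_id_rho[OF word1_words, of "[x]"] 2 by simp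
  then show ?case using 2 X.Comp_Id_right[OF unt_hom[OF 2]] homD[OF unt_hom[OF 2]] by simp
next
  case (3 w k l f xs)
  note w = 3(1) and f = 3(2) and xs = 3(3)
  have "map (OMap (func_id X)) xs = xs" using xs by (auto intro!: map_idI)
  then show ?case
    using pmor_id_rho[OF subst_word_words[OF w f] xs] pmor_id_rho[OF w pow_nth[OF f xs]]
      X.Comp_Id_right[OF sbs_hom[OF w f xs]] X.Comp_Id_left[OF sbs_hom[OF w f xs]] homD[OF sbs_hom[OF w f xs]] by simp
qed

context lawvere_theory
begin

abbreviation "K \<equiv> PsAlg T"

abbreviation mor where "mor \<equiv> pointwise_mor T"

lemma mor_comp: "mor A B G \<Longrightarrow> mor B C H \<Longrightarrow> mor A C (pmor_comp T H G)"
  by (rule mor_pair.pointwise_mor_comp) (simp add: mor_pair_def)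

lemma mor_id_left: "mor A B H \<Longrightarrow> pmor_comp T (pmor_id T B) H = H"
  by (meson pointwise_mor.axioms(1) pre_mor.axioms(2) pre_mor.pmor_id_left pointwise_algebra.pointwise_mor_id)

lemma mor_id_right: "mor A B H \<Longrightarrow> pmor_comp T H (pmor_id T A) = H"
  by (meson pointwise_mor.axioms(1) pre_mor.axioms(1) pre_mor.pmor_id_right pointwise_algebra.pointwise_mor_id)

text \<open>Composition of functors and the formula for composite coherences are strictly
  associative. The typing of pasted cone cells in \<open>psnats_cone\<close> relies on this
  equality.\<close>

lemma mor_assoc:
  assumes "mor A B G" "mor B C H" "mor C D L"
  shows "pmor_comp T L (pmor_comp T H G) = pmor_comp T (pmor_comp T L H) G"
proof -
  interpret GH: mor_pair T A B C G H using assms by (simp add: mor_pair_def)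
  interpret HL: mor_pair T B C D H L using assms by (simp add: mor_pair_def)
  interpret GH_L: mor_pair T A C D "pmor_comp T H G" L using assms mor_comp by (auto simp: mor_pair_def)
  interpret G_HL: mor_pair T A B D G "pmor_comp T L H" using assms mor_comp by (auto simp: mor_pair_def)
  show ?thesis
  proof (rule pmor_eqI[OF GH_L.pre_mor_comp G_HL.pre_mor_comp])
    fix w n xs assume w: "w \<in> words T n" and xs: "xs \<in> Obj (pow_cat (Cat A) n)"
    note Gx = GH.G.map_mo[OF xs]
    show "rho (pmor_comp T L (pmor_comp T H G)) w xs = rho (pmor_comp T (pmor_comp T L H) G) w xs"
      unfolding GH_L.HG_rho[OF w xs] G_HL.HG_rho[OF w xs] HL.HG_rho[OF w Gx] GH.HG_rho[OF w xs] GH.map_HG_mo[OF xs]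
        HL.HG_ma[OF homD[OF GH.G.rho_hom[OF w xs], THEN conjunct1]]
      unfolding HL.H.MD(7)[OF GH.H.MD(5)[OF GH.G.rho_hom[OF w xs]] GH.H.rho_hom[OF w Gx]]
      by (rule HL.H.B.X.Comp_assoc[OF HL.H.MD(5)[OF GH.H.MD(5)[OF GH.G.rho_hom[OF w xs]]]
            HL.H.MD(5)[OF GH.H.rho_hom[OF w Gx]] HL.H.rho_hom[OF w GH.H.map_mo[OF Gx]]])
  qed (use GH_L.HG_mo GH_L.HG_ma G_HL.HG_mo G_HL.HG_ma GH.HG_mo GH.HG_ma HL.HG_mo HL.HG_ma GH.G.MD(3,4) in auto)
qed

end

abbreviation ce :: "('t, 'o, 'a) pcell \<Rightarrow> 'o \<Rightarrow> 'a" where "ce \<alpha> \<equiv> NComp (CNat \<alpha>)"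

lemma PsAlg_sel [simp]:
  "Obj (Und (PsAlg T)) = small_palgs T" "Arr (Und (PsAlg T)) = small_pmors T"
  "Dom (Und (PsAlg T)) = MSrc" "Cod (Und (PsAlg T)) = MTrg"
  "Id (Und (PsAlg T)) = pmor_id T" "Comp (Und (PsAlg T)) = pmor_comp T"
  "Obj (Vert (PsAlg T)) = small_pmors T" "Dom (Vert (PsAlg T)) = CSrc" "Cod (Vert (PsAlg T)) = CTrg"
  by (simp_all add: PsAlg_def)

lemma PsAlg_cell_sel [simp]:
  "CSrc (Comp (Vert (PsAlg T)) \<beta> \<alpha>) = CSrc \<alpha>" "CTrg (Comp (Vert (PsAlg T)) \<beta> \<alpha>) = CTrg \<beta>"
  "CNat (Comp (Vert (PsAlg T)) \<beta> \<alpha>) = CNat \<beta> \<circ>\<^sub>v CNat \<alpha>"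
  "CSrc (Id (Vert (PsAlg T)) H) = H" "CTrg (Id (Vert (PsAlg T)) H) = H" "CNat (Id (Vert (PsAlg T)) H) = nat_id (MFun H)"
  "CSrc (HComp (PsAlg T) \<beta> \<alpha>) = pmor_comp T (CSrc \<beta>) (CSrc \<alpha>)"
  "CTrg (HComp (PsAlg T) \<beta> \<alpha>) = pmor_comp T (CTrg \<beta>) (CTrg \<alpha>)"
  "CNat (HComp (PsAlg T) \<beta> \<alpha>) = CNat \<beta> \<star> CNat \<alpha>"
  by (simp_all add: PsAlg_def)

section \<open>Two-cells: vertical composites, whiskerings and invertibility\<close>

context lawvere_theory
begin

abbreviation cells where "cells \<equiv> pseudo_algebra_cells T"

lemma small_palgs_pointwise: "A \<in> small_palgs T \<Longrightarrow> pointwise_algebra T A"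
  by (rule pseudo_algebra_pointwise[OF lawvere_theory_axioms]) (simp add: small_palgs_def)

text \<open>Bridge between the record \<open>PsAlg T\<close> and the pointwise locales. Fixing the
  two ends in advance avoids carrying \<open>MSrc\<close> and \<open>MTrg\<close> through the
  calculations.\<close>

lemma hom_Und_iff:
  assumes "A \<in> small_palgs T" "B \<in> small_palgs T"
  shows "H \<in> hom (Und K) A B \<longleftrightarrow> mor A B H"
proof
  assume "H \<in> hom (Und K) A B"
  then have H: "MSrc H = A" "MTrg H = B" "pseudo_algebra_mor T H" by (auto simp: hom_def small_pmors_def)
  show "mor A B H"
    using pseudo_algebra_mor_pointwise[OF lawvere_theory_axioms _ _ H(3)] assms unfolding H(1,2)
    by (simp add: small_palgs_def)
next
  assume m: "mor A B H"
  then interpret H: pointwise_mor T A B H .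
  show "H \<in> hom (Und K) A B"
    using assms pointwise_pseudo_algebra_mor[OF m] H.MSrc H.MTrg by (simp add: hom_def small_pmors_def)
qed

lemma small_mor: "A \<in> small_palgs T \<Longrightarrow> B \<in> small_palgs T \<Longrightarrow> mor A B H \<Longrightarrow> H \<in> small_pmors T"
  using hom_Und_iff homD by fastforce

lemma mor_id: "A \<in> small_palgs T \<Longrightarrow> mor A A (pmor_id T A)"
  by (rule pointwise_algebra.pointwise_mor_id[OF small_palgs_pointwise])

lemma hom_Vert_iff:
  assumes "G \<in> small_pmors T" "H \<in> small_pmors T"
  shows "\<alpha> \<in> hom (Vert K) G H \<longleftrightarrow> \<alpha> \<in> cells G H"
proof -
  have "Arr (Vert K) = (\<Union>G \<in> small_pmors T. \<Union>H \<in> small_pmors T. cells G H)" by (simp add: PsAlg_def)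
  then show ?thesis using assms by (auto simp: hom_def) (auto simp: pseudo_algebra_cells_def)
qed

lemma cells_iff:
  assumes "mor A B G" "mor A B H"
  shows "\<alpha> \<in> cells G H \<longleftrightarrow> CSrc \<alpha> = G \<and> CTrg \<alpha> = H \<and> CNat \<alpha> \<in> nat_transs (MFun G) (MFun H) \<and>
    (\<forall>n. \<forall>w \<in> words T n. \<forall>xs \<in> Obj (pow_cat (Cat A) n).
      Comp (Cat B) (rho H w xs) (ce \<alpha> (opo A w xs)) = Comp (Cat B) (opa B w (map (ce \<alpha>) xs)) (rho G w xs))"
proof -
  interpret G: pointwise_mor T A B G by fact
  interpret H: pointwise_mor T A B H by fact
  have "(MRho H w \<circ>\<^sub>v (CNat \<alpha> \<star> nat_id (Phi A w)) = (nat_id (Phi B w) \<star> nat_pow (CNat \<alpha>) n) \<circ>\<^sub>v MRho G w) \<longleftrightarrow>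
    (\<forall>xs \<in> Obj (pow_cat (Cat A) n).
      Comp (Cat B) (rho H w xs) (ce \<alpha> (opo A w xs)) = Comp (Cat B) (opa B w (map (ce \<alpha>) xs)) (rho G w xs))"
    if n: "CNat \<alpha> \<in> nat_transs (MFun G) (MFun H)" and w: "w \<in> words T n" for w n
  proof -
    note d = nat_transsD(1,2)[OF n] nat_transsD(1,2)[OF nat_isos_transs[OF G.MRho[OF w]]]
      nat_transsD(1,2)[OF nat_isos_transs[OF H.MRho[OF w]]]
    have 1: "NComp (CNat \<alpha> \<star> nat_id (Phi A w)) xs = ce \<alpha> (opo A w xs)" if "xs \<in> Obj (pow_cat (Cat A) n)" for xs
      by (rule hcomp_id_right[OF G.B.Cat n G.MFun H.MFun G.A.Phi[OF w] that])
    have 2: "NComp (nat_id (Phi B w) \<star> nat_pow (CNat \<alpha>) n) xs = opa B w (map (ce \<alpha>) xs)" if "xs \<in> Obj (pow_cat (Cat A) n)" for xs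
      using hcomp_id_left[OF G.B.Cat G.B.Phi[OF w] nat_pow_transs[OF G.A.Cat G.MFun H.MFun n] G.pow_functors H.pow_functors that]
        nat_pow_NComp[of xs "CNat \<alpha>" n] that d(1) G.MD(1) by simp
    show ?thesis
      by (subst nat_vcomp_eq_iff[of _ "pow_cat (Cat A) n" "Cat B"])
         (use 1 2 d functorsD(1,2)[OF G.src_functors[OF w]] in \<open>simp_all del: pow_cat_sel func_comp_sel cong: ball_cong\<close>)
  qed
  then show ?thesis
    using G.MSrc G.MTrg H.MSrc H.MTrg unfolding pseudo_algebra_cells_def
    by (simp del: pow_cat_sel cong: conj_cong ball_cong)
qed

lemma
  assumes "mor A B G" "mor A B H" "\<alpha> \<in> cells G H"
  shows cell_hom: "x \<in> Obj (Cat A) \<Longrightarrow> ce \<alpha> x \<in> hom (Cat B) (mo G x) (mo H x)"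
    and cell_square: "f \<in> hom (Cat A) x y \<Longrightarrow> square (Cat B) (ma G f) (ce \<alpha> x) (ce \<alpha> y) (ma H f)"
    and cell_rho: "w \<in> words T n \<Longrightarrow> xs \<in> Obj (pow_cat (Cat A) n) \<Longrightarrow>
      square (Cat B) (rho G w xs) (ce \<alpha> (opo A w xs)) (opa B w (map (ce \<alpha>) xs)) (rho H w xs)"
    and cell_map: "xs \<in> Obj (pow_cat (Cat A) n) \<Longrightarrow> map (ce \<alpha>) xs \<in> hom (pow_cat (Cat B) n) (map (mo G) xs) (map (mo H) xs)"
    and cell_sel: "CSrc \<alpha> = G" "CTrg \<alpha> = H" "CNat \<alpha> \<in> nat_transs (MFun G) (MFun H)"
proof -
  interpret G: pointwise_mor T A B G by fact
  interpret H: pointwise_mor T A B H by fact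
  show s: "CSrc \<alpha> = G" "CTrg \<alpha> = H" "CNat \<alpha> \<in> nat_transs (MFun G) (MFun H)"
    using assms(3) cells_iff[OF assms(1,2)] by auto
  show h: "ce \<alpha> x \<in> hom (Cat B) (mo G x) (mo H x)" if "x \<in> Obj (Cat A)" for x
    using nat_transsD(5)[OF s(3)] that G.MD(1,2) by simp
  show "square (Cat B) (ma G f) (ce \<alpha> x) (ce \<alpha> y) (ma H f)" if "f \<in> hom (Cat A) x y"
    by (rule nat_transs_square[OF s(3) G.MFun H.MFun that G.A.Cat])
  show m: "map (ce \<alpha>) xs \<in> hom (pow_cat (Cat B) n) (map (mo G) xs) (map (mo H) xs)" if "xs \<in> Obj (pow_cat (Cat A) n)" for xs n
    using that h by (auto simp: hom_pow_iff subset_iff)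
  show "square (Cat B) (rho G w xs) (ce \<alpha> (opo A w xs)) (opa B w (map (ce \<alpha>) xs)) (rho H w xs)"
    if w: "w \<in> words T n" and xs: "xs \<in> Obj (pow_cat (Cat A) n)"
  proof (rule G.B.X.squareI[OF G.rho_hom[OF w xs] H.rho_hom[OF w xs] h[OF G.A.PhiD(3)[OF w xs]] G.B.PhiD(5)[OF w m[OF xs]]])
    show "Comp (Cat B) (rho H w xs) (ce \<alpha> (opo A w xs)) = Comp (Cat B) (opa B w (map (ce \<alpha>) xs)) (rho G w xs)"
      using assms(3) cells_iff[OF assms(1,2)] w xs by blast
  qed
qed

lemma cell_eqI:
  assumes "mor A B G" "mor A B H" "\<alpha> \<in> cells G H" "\<beta> \<in> cells G H" "\<And>x. x \<in> Obj (Cat A) \<Longrightarrow> ce \<alpha> x = ce \<beta> x"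
  shows "\<alpha> = \<beta>"
proof -
  interpret G: pointwise_mor T A B G by fact
  note a = cell_sel[OF assms(1-3)] and b = cell_sel[OF assms(1,2,4)]
  have "CNat \<alpha> = CNat \<beta>"
    by (rule nat_transs_eqI[OF a(3) b(3)]) (use assms(5) G.MD(1) in simp)
  then show ?thesis using a b by (cases \<alpha>; cases \<beta>) simp
qed

lemma cellI:
  assumes "mor A B G" "mor A B H" "CSrc \<alpha> = G" "CTrg \<alpha> = H" "NSrc (CNat \<alpha>) = MFun G" "NTrg (CNat \<alpha>) = MFun H"
    "ce \<alpha> \<in> extensional (Obj (Cat A))"
    "\<And>x. x \<in> Obj (Cat A) \<Longrightarrow> ce \<alpha> x \<in> hom (Cat B) (mo G x) (mo H x)"
    "\<And>f x y. f \<in> hom (Cat A) x y \<Longrightarrow> square (Cat B) (ma G f) (ce \<alpha> x) (ce \<alpha> y) (ma H f)"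
    "\<And>w n xs. w \<in> words T n \<Longrightarrow> xs \<in> Obj (pow_cat (Cat A) n) \<Longrightarrow>
      square (Cat B) (rho G w xs) (ce \<alpha> (opo A w xs)) (opa B w (map (ce \<alpha>) xs)) (rho H w xs)"
  shows "\<alpha> \<in> cells G H"
proof -
  interpret G: pointwise_mor T A B G by fact
  interpret H: pointwise_mor T A B H by fact
  have "CNat \<alpha> \<in> nat_transs (MFun G) (MFun H)"
    by (rule nat_transsI_hom[OF assms(5,6) G.MFun H.MFun G.A.Cat assms(7,8)])
       (use assms(9) in \<open>auto simp: square_def\<close>)
  then show ?thesis unfolding cells_iff[OF assms(1,2)] using assms(3,4,10) by (auto simp: square_def)
qed

lemma vcomp_cell:
  assumes "mor A B G" "mor A B H" "mor A B L" "\<alpha> \<in> cells G H" "\<beta> \<in> cells H L"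
  shows "vcomp K \<beta> \<alpha> \<in> cells G L" "x \<in> Obj (Cat A) \<Longrightarrow> ce (vcomp K \<beta> \<alpha>) x = Comp (Cat B) (ce \<beta> x) (ce \<alpha> x)"
proof -
  interpret G: pointwise_mor T A B G by fact
  interpret H: pointwise_mor T A B H by fact
  interpret L: pointwise_mor T A B L by fact
  note a = cell_sel[OF assms(1,2,4)] and b = cell_sel[OF assms(2,3,5)]
  have s: "NSrc (CNat \<alpha>) = MFun G" "NTrg (CNat \<beta>) = MFun L" using nat_transsD(1,2)[OF a(3)] nat_transsD(1,2)[OF b(3)] by simp_all
  show c: "ce (vcomp K \<beta> \<alpha>) x = Comp (Cat B) (ce \<beta> x) (ce \<alpha> x)" if "x \<in> Obj (Cat A)" for x
    using that s G.MD(1,2) by simp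
  show "vcomp K \<beta> \<alpha> \<in> cells G L"
  proof (rule cellI[OF assms(1,3)])
    show "ce (vcomp K \<beta> \<alpha>) \<in> extensional (Obj (Cat A))" using s G.MD(1) by (simp add: nat_vcomp_def)
    show "ce (vcomp K \<beta> \<alpha>) x \<in> hom (Cat B) (mo G x) (mo L x)" if "x \<in> Obj (Cat A)" for x
      unfolding c[OF that] by (rule G.B.X.Comp_hom[OF cell_hom[OF assms(1,2,4) that] cell_hom[OF assms(2,3,5) that]])
    show "square (Cat B) (ma G f) (ce (vcomp K \<beta> \<alpha>) x) (ce (vcomp K \<beta> \<alpha>) y) (ma L f)" if f: "f \<in> hom (Cat A) x y" for f x y
    proof -
      have xy: "x \<in> Obj (Cat A)" "y \<in> Obj (Cat A)" using G.A.X.hom_Obj[OF f] by auto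
      \<comment> \<open>\<open>square_comp\<close> pastes along vertical sides, so each naturality
        square is reflected to have the components of the cells as its horizontal sides.\<close>
      have "square (Cat B) (ce \<alpha> x) (ma G f) (ma H f) (ce \<alpha> y)" "square (Cat B) (ce \<beta> x) (ma H f) (ma L f) (ce \<beta> y)"
        using cell_square[OF assms(1,2,4) f] cell_square[OF assms(2,3,5) f] by (auto simp: square_def hom_def)
      from G.B.X.square_comp[OF this] show ?thesis using c xy by (auto simp: square_def hom_def)
    qed
    show "square (Cat B) (rho G w xs) (ce (vcomp K \<beta> \<alpha>) (opo A w xs)) (opa B w (map (ce (vcomp K \<beta> \<alpha>)) xs)) (rho L w xs)"
      if w: "w \<in> words T n" and xs: "xs \<in> Obj (pow_cat (Cat A) n)" for w n xs
    proof -
      have "map (ce (vcomp K \<beta> \<alpha>)) xs = map2 (Comp (Cat B)) (map (ce \<beta>) xs) (map (ce \<alpha>) xs)"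
        by (rule nth_equalityI) (use xs c in \<open>auto simp: subset_iff simp del: PsAlg_cell_sel\<close>)
      then have e: "opa B w (map (ce (vcomp K \<beta> \<alpha>)) xs) = Comp (Cat B) (opa B w (map (ce \<beta>) xs)) (opa B w (map (ce \<alpha>) xs))"
        using G.B.PhiD(7)[OF w cell_map[OF assms(1,2,4) xs] cell_map[OF assms(2,3,5) xs]] by simp
      have "square (Cat B) (ce \<alpha> (opo A w xs)) (rho G w xs) (rho H w xs) (opa B w (map (ce \<alpha>) xs))"
        "square (Cat B) (ce \<beta> (opo A w xs)) (rho H w xs) (rho L w xs) (opa B w (map (ce \<beta>) xs))"
        using cell_rho[OF assms(1,2,4) w xs] cell_rho[OF assms(2,3,5) w xs] by (auto simp: square_def hom_def)
      from G.B.X.square_comp[OF this] show ?thesis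
        unfolding e c[OF G.A.PhiD(3)[OF w xs]] by (auto simp: square_def hom_def)
    qed
  qed (use a b s in simp_all)
qed

lemma id_cell:
  assumes "mor A B G"
  shows "id2 K G \<in> cells G G" "x \<in> Obj (Cat A) \<Longrightarrow> ce (id2 K G) x = Id (Cat B) (mo G x)"
proof -
  interpret G: pointwise_mor T A B G by fact
  show c: "ce (id2 K G) x = Id (Cat B) (mo G x)" if "x \<in> Obj (Cat A)" for x using that G.MD(1,2) by simp
  show "id2 K G \<in> cells G G"
    unfolding cells_iff[OF assms assms]
  proof (intro conjI allI ballI)
    show "CNat (id2 K G) \<in> nat_transs (MFun G) (MFun G)"
      using nat_isos_transs[OF nat_id_isos[OF G.A.Cat G.B.Cat G.MFun]] by simp
    fix n w xs assume w: "w \<in> words T n" and xs: "xs \<in> Obj (pow_cat (Cat A) n)"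
    have "map (ce (id2 K G)) xs = map (Id (Cat B)) (map (mo G) xs)"
      using xs c by (auto simp: subset_iff simp del: PsAlg_cell_sel)
    then have "opa B w (map (ce (id2 K G)) xs) = Id (Cat B) (opo B w (map (mo G) xs))"
      using G.B.PhiD(6)[OF w G.map_mo[OF xs]] by (simp del: map_map PsAlg_cell_sel)
    then show "Comp (Cat B) (rho G w xs) (ce (id2 K G) (opo A w xs)) = Comp (Cat B) (opa B w (map (ce (id2 K G)) xs)) (rho G w xs)"
      unfolding c[OF G.A.PhiD(3)[OF w xs]]
      using G.B.X.Comp_Id_left[OF G.rho_hom[OF w xs]] G.B.X.Comp_Id_right[OF G.rho_hom[OF w xs]] by simp
  qed simp_all
qed

text \<open>The coherence square is the image under \<open>L\<close> of that of \<alpha>, pasted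
  with naturality of \<open>rho L\<close> at the components of \<alpha>.\<close>

lemma whisker_left:
  assumes "mor A B G" "mor A B H" "mor B C L" "\<alpha> \<in> cells G H"
  shows "HComp K (id2 K L) \<alpha> \<in> cells (pmor_comp T L G) (pmor_comp T L H)"
    and "x \<in> Obj (Cat A) \<Longrightarrow> ce (HComp K (id2 K L) \<alpha>) x = ma L (ce \<alpha> x)"
proof -
  interpret G: mor_pair T A B C G L using assms by (simp add: mor_pair_def)
  interpret H: mor_pair T A B C H L using assms by (simp add: mor_pair_def)
  note a = cell_sel[OF assms(1,2,4)]
  show c: "ce (HComp K (id2 K L) \<alpha>) x = ma L (ce \<alpha> x)" if "x \<in> Obj (Cat A)" for x
    using hcomp_id_left[OF G.H.B.Cat G.H.MFun a(3) G.G.MFun H.G.MFun that] by simp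
  show "HComp K (id2 K L) \<alpha> \<in> cells (pmor_comp T L G) (pmor_comp T L H)"
    unfolding cells_iff[OF mor_comp[OF assms(1,3)] mor_comp[OF assms(2,3)]]
  proof (intro conjI allI ballI)
    show "CNat (HComp K (id2 K L) \<alpha>) \<in> nat_transs (MFun (pmor_comp T L G)) (MFun (pmor_comp T L H))"
      using hcomp_transs[OF G.G.A.Cat G.G.B.Cat G.H.B.Cat nat_isos_transs[OF nat_id_isos[OF G.G.B.Cat G.H.B.Cat G.H.MFun]]
          G.H.MFun G.H.MFun a(3) G.G.MFun H.G.MFun] by simp
    fix n w xs assume w: "w \<in> words T n" and xs: "xs \<in> Obj (pow_cat (Cat A) n)"
    have m: "map (ce (HComp K (id2 K L) \<alpha>)) xs = map (ma L) (map (ce \<alpha>) xs)"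
      using xs c by (auto simp: subset_iff simp del: PsAlg_cell_sel)
    note wx = G.G.A.PhiD(3)[OF w xs]
    note sq = functor_square[OF G.H.MFun G.G.B.Cat cell_rho[OF assms(1,2,4) w xs]] G.H.rho_square[OF w cell_map[OF assms(1,2,4) xs]]
    from G.H.B.X.square_comp[OF this]
    show "Comp (Cat C) (rho (pmor_comp T L H) w xs) (ce (HComp K (id2 K L) \<alpha>) (opo A w xs))
      = Comp (Cat C) (opa C w (map (ce (HComp K (id2 K L) \<alpha>)) xs)) (rho (pmor_comp T L G) w xs)"
      unfolding c[OF wx] m G.HG_rho[OF w xs] H.HG_rho[OF w xs] by (simp add: square_def)
  qed (use a in simp_all)
qed

text \<open>Here naturality of \<alpha> at \<open>rho L\<close> is pasted with the coherence square
  of \<alpha> at the images of the arguments.\<close>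

lemma whisker_right:
  assumes "mor B C G" "mor B C H" "mor A B L" "\<alpha> \<in> cells G H"
  shows "HComp K \<alpha> (id2 K L) \<in> cells (pmor_comp T G L) (pmor_comp T H L)"
    and "x \<in> Obj (Cat A) \<Longrightarrow> ce (HComp K \<alpha> (id2 K L)) x = ce \<alpha> (mo L x)"
proof -
  interpret G: mor_pair T A B C L G using assms by (simp add: mor_pair_def)
  interpret H: mor_pair T A B C L H using assms by (simp add: mor_pair_def)
  note a = cell_sel[OF assms(1,2,4)]
  show c: "ce (HComp K \<alpha> (id2 K L)) x = ce \<alpha> (mo L x)" if "x \<in> Obj (Cat A)" for x
    using hcomp_id_right[OF G.H.B.Cat a(3) G.H.MFun H.H.MFun G.G.MFun that] by simp
  show "HComp K \<alpha> (id2 K L) \<in> cells (pmor_comp T G L) (pmor_comp T H L)"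
    unfolding cells_iff[OF mor_comp[OF assms(3,1)] mor_comp[OF assms(3,2)]]
  proof (intro conjI allI ballI)
    show "CNat (HComp K \<alpha> (id2 K L)) \<in> nat_transs (MFun (pmor_comp T G L)) (MFun (pmor_comp T H L))"
      using hcomp_transs[OF G.G.A.Cat G.G.B.Cat G.H.B.Cat a(3) G.H.MFun H.H.MFun
          nat_isos_transs[OF nat_id_isos[OF G.G.A.Cat G.G.B.Cat G.G.MFun]] G.G.MFun G.G.MFun] by simp
    fix n w xs assume w: "w \<in> words T n" and xs: "xs \<in> Obj (pow_cat (Cat A) n)"
    have m: "map (ce (HComp K \<alpha> (id2 K L))) xs = map (ce \<alpha>) (map (mo L) xs)"
      using xs c by (auto simp: subset_iff simp del: PsAlg_cell_sel)
    note wx = G.G.A.PhiD(3)[OF w xs]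
    have "square (Cat C) (ma G (rho L w xs)) (ce \<alpha> (mo L (opo A w xs))) (ce \<alpha> (opo B w (map (mo L) xs))) (ma H (rho L w xs))"
      by (rule cell_square[OF assms(1,2,4) G.G.rho_hom[OF w xs]])
    from G.H.B.X.square_comp[OF this cell_rho[OF assms(1,2,4) w G.G.map_mo[OF xs]]]
    show "Comp (Cat C) (rho (pmor_comp T H L) w xs) (ce (HComp K \<alpha> (id2 K L)) (opo A w xs))
      = Comp (Cat C) (opa C w (map (ce (HComp K \<alpha> (id2 K L))) xs)) (rho (pmor_comp T G L) w xs)"
      unfolding c[OF wx] m G.HG_rho[OF w xs] H.HG_rho[OF w xs] by (simp add: square_def)
  qed (use a in simp_all)
qed

text \<open>The inverse cell has the componentwise inverses; its naturality and its compatibility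
  with \<open>rho\<close> come from reversing squares of isomorphisms (\<open>square_inv\<close>).
  Thus invertibility of the cells of a cone can be stated on components.\<close>

lemma inv_2cells_iff:
  assumes "A \<in> small_palgs T" "B \<in> small_palgs T" "mor A B G" "mor A B H"
  shows "\<alpha> \<in> inv_2cells K G H \<longleftrightarrow> \<alpha> \<in> cells G H \<and> (\<forall>x \<in> Obj (Cat A). iso_in (Cat B) (ce \<alpha> x))"
proof -
  interpret G: pointwise_mor T A B G by fact
  interpret H: pointwise_mor T A B H by fact
  note s = small_mor[OF assms(1-3)] small_mor[OF assms(1,2,4)]
  show ?thesis
  proof
    assume "\<alpha> \<in> inv_2cells K G H"
    then have a: "\<alpha> \<in> hom (Vert K) G H" "iso_in (Vert K) \<alpha>" by (auto simp: inv_2cells_def)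
    have ac: "\<alpha> \<in> cells G H" using a(1) hom_Vert_iff[OF s] by simp
    obtain \<beta> where b: "\<beta> \<in> hom (Vert K) H G" "vcomp K \<beta> \<alpha> = id2 K G" "vcomp K \<alpha> \<beta> = id2 K H"
      using a by (auto simp: iso_in_def hom_def)
    have bc: "\<beta> \<in> cells H G" using b(1) hom_Vert_iff[OF s(2,1)] by simp
    have "iso_in (Cat B) (ce \<alpha> x)" if x: "x \<in> Obj (Cat A)" for x
      by (rule G.B.X.iso_inI[OF cell_hom[OF assms(3,4) ac x] cell_hom[OF assms(4,3) bc x]])
         (use vcomp_cell(2)[OF assms(3,4,3) ac bc x] vcomp_cell(2)[OF assms(4,3,4) bc ac x] b(2,3)
            id_cell(2)[OF assms(3) x] id_cell(2)[OF assms(4) x] in \<open>simp_all del: PsAlg_cell_sel\<close>)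
    then show "\<alpha> \<in> cells G H \<and> (\<forall>x \<in> Obj (Cat A). iso_in (Cat B) (ce \<alpha> x))" using ac by blast
  next
    assume "\<alpha> \<in> cells G H \<and> (\<forall>x \<in> Obj (Cat A). iso_in (Cat B) (ce \<alpha> x))"
    then have ac: "\<alpha> \<in> cells G H" and iso: "\<And>x. x \<in> Obj (Cat A) \<Longrightarrow> iso_in (Cat B) (ce \<alpha> x)" by auto
    define \<beta> where "\<beta> = \<lparr>CSrc = H, CTrg = G, CNat = \<lparr>NSrc = MFun H, NTrg = MFun G,
      NComp = restrict (\<lambda>x. inv_arr (Cat B) (ce \<alpha> x)) (Obj (Cat A))\<rparr>\<rparr>"
    have c: "ce \<beta> x = inv_arr (Cat B) (ce \<alpha> x)" if "x \<in> Obj (Cat A)" for x using that by (simp add: \<beta>_def)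
    note h = cell_hom[OF assms(3,4) ac]
    have bc: "\<beta> \<in> cells H G"
    proof (rule cellI[OF assms(4,3)])
      show "ce \<beta> x \<in> hom (Cat B) (mo H x) (mo G x)" if "x \<in> Obj (Cat A)" for x
        unfolding c[OF that] by (rule G.B.X.inv_arr(1)[OF iso[OF that] h[OF that]])
      show "square (Cat B) (ma H f) (ce \<beta> x) (ce \<beta> y) (ma G f)" if f: "f \<in> hom (Cat A) x y" for f x y
      proof -
        have xy: "x \<in> Obj (Cat A)" "y \<in> Obj (Cat A)" using G.A.X.hom_Obj[OF f] by auto
        have "square (Cat B) (ce \<alpha> x) (ma G f) (ma H f) (ce \<alpha> y)"
          using cell_square[OF assms(3,4) ac f] by (auto simp: square_def hom_def)
        from G.B.X.square_inv[OF iso[OF xy(1)] iso[OF xy(2)] this] show ?thesis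
          unfolding c[OF xy(1)] c[OF xy(2)] by (auto simp: square_def hom_def)
      qed
      show "square (Cat B) (rho H w xs) (ce \<beta> (opo A w xs)) (opa B w (map (ce \<beta>) xs)) (rho G w xs)"
        if w: "w \<in> words T n" and xs: "xs \<in> Obj (pow_cat (Cat A) n)" for w n xs
      proof -
        note wx = G.A.PhiD(3)[OF w xs] and m = cell_map[OF assms(3,4) ac xs]
        have l: "length xs = n" using xs by simp
        have isos: "iso_in (Cat B) (map (ce \<alpha>) xs ! i)" if "i < n" for i using xs iso that by (auto simp: subset_iff)
        have ip: "iso_in (pow_cat (Cat B) n) (map (ce \<alpha>) xs)" by (rule iso_pow_cat[OF G.B.Cat isos]) (use l in auto)
        \<comment> \<open>Inverses in a power are taken entrywise, and an operation, being a
          functor, preserves them. Hence the operation applied to the inverse components is itself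
          an inverse.\<close>
        have "inv_arr (pow_cat (Cat B) n) (map (ce \<alpha>) xs) = map (ce \<beta>) xs"
        proof (rule category.inv_arr_eqI[OF G.B.PX m])
          have hi: "\<And>x. x \<in> set xs \<Longrightarrow> ce \<beta> x \<in> hom (Cat B) (mo H x) (mo G x)"
            "\<And>x. x \<in> set xs \<Longrightarrow> Comp (Cat B) (ce \<beta> x) (ce \<alpha> x) = Id (Cat B) (mo G x)"
            "\<And>x. x \<in> set xs \<Longrightarrow> Comp (Cat B) (ce \<alpha> x) (ce \<beta> x) = Id (Cat B) (mo H x)"
            using xs c G.B.X.inv_arr[OF iso h] by (auto simp: subset_iff)
          show "map (ce \<beta>) xs \<in> hom (pow_cat (Cat B) n) (map (mo H) xs) (map (mo G) xs)"
            using hi(1) l by (auto simp: hom_pow_iff)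
          show "Comp (pow_cat (Cat B) n) (map (ce \<beta>) xs) (map (ce \<alpha>) xs) = Id (pow_cat (Cat B) n) (map (mo G) xs)"
            by (rule nth_equalityI) (use hi l in auto)
          show "Comp (pow_cat (Cat B) n) (map (ce \<alpha>) xs) (map (ce \<beta>) xs) = Id (pow_cat (Cat B) n) (map (mo H) xs)"
            by (rule nth_equalityI) (use hi l in auto)
        qed
        then have e: "opa B w (map (ce \<beta>) xs) = inv_arr (Cat B) (opa B w (map (ce \<alpha>) xs))"
          and i2: "iso_in (Cat B) (opa B w (map (ce \<alpha>) xs))"
          using functor_iso[OF G.B.PX G.B.Cat G.B.Phi[OF w] ip m] by simp_all
        have "square (Cat B) (ce \<alpha> (opo A w xs)) (rho G w xs) (rho H w xs) (opa B w (map (ce \<alpha>) xs))"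
          using cell_rho[OF assms(3,4) ac w xs] by (auto simp: square_def hom_def)
        from G.B.X.square_inv[OF iso[OF wx] i2 this] show ?thesis
          unfolding c[OF wx] e by (auto simp: square_def hom_def)
      qed
    qed (simp_all add: \<beta>_def)
    have "vcomp K \<beta> \<alpha> = id2 K G"
      by (rule cell_eqI[OF assms(3,3) vcomp_cell(1)[OF assms(3,4,3) ac bc] id_cell(1)[OF assms(3)]])
         (use vcomp_cell(2)[OF assms(3,4,3) ac bc] id_cell(2)[OF assms(3)] c G.B.X.inv_arr[OF iso h] in \<open>simp del: PsAlg_cell_sel\<close>)
    moreover have "vcomp K \<alpha> \<beta> = id2 K H"
      by (rule cell_eqI[OF assms(4,4) vcomp_cell(1)[OF assms(4,3,4) bc ac] id_cell(1)[OF assms(4)]])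
         (use vcomp_cell(2)[OF assms(4,3,4) bc ac] id_cell(2)[OF assms(4)] c G.B.X.inv_arr[OF iso h] in \<open>simp del: PsAlg_cell_sel\<close>)
    ultimately have "iso_in (Vert K) \<alpha>"
      using ac bc hom_Vert_iff[OF s] hom_Vert_iff[OF s(2,1)] cell_sel(1,2)[OF assms(3,4) ac] homD[of \<alpha> "Vert K"]
      unfolding iso_in_def by (auto intro!: bexI[of _ \<beta>] simp del: PsAlg_cell_sel)
    then show "\<alpha> \<in> inv_2cells K G H" using ac hom_Vert_iff[OF s] by (simp add: inv_2cells_def)
  qed
qed

end

section \<open>Cones over a diagram of pseudo algebras\<close>

locale diagram = lawvere_theory T + J: category J + F: pseudo_functor J "PsAlg T" F
  for T :: "'t thy" and J :: "('jo, 'ja) cat"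
    and F :: "('jo, 'ja, ('t, 'u, 'u) palg, ('t, 'u, 'u) pmor, ('t, 'u, 'u) pcell) psfun"
begin

abbreviation "FX j \<equiv> Cat (PObj F j)"

lemma F_small: "j \<in> Obj J \<Longrightarrow> PObj F j \<in> small_palgs T"
  using F.PObj_closed by simp

lemma F_mor:
  assumes "f \<in> hom J a b"
  shows "mor (PObj F a) (PObj F b) (PArr F f)"
proof -
  have "a \<in> Obj J" "b \<in> Obj J" using J.hom_Obj[OF assms] by auto
  then show ?thesis using hom_Und_iff[OF F_small F_small] F.PArr_hom[OF assms] by simp
qed

lemma F_unit: "j \<in> Obj J \<Longrightarrow> PUnit F j \<in> cells (pmor_id T (PObj F j)) (PArr F (Id J j))"
  using F.PUnit_cell[of j] inv_2cells_iff[OF F_small F_small mor_id[OF F_small] F_mor[OF J.Id_hom]] by simp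

lemma F_comp:
  assumes "f \<in> hom J a b" "g \<in> hom J b c"
  shows "PComp F g f \<in> cells (pmor_comp T (PArr F g) (PArr F f)) (PArr F (Comp J g f))"
proof -
  have ob: "a \<in> Obj J" "c \<in> Obj J" using J.hom_Obj assms by auto
  show ?thesis
    using F.PComp_cell[OF assms]
      inv_2cells_iff[OF F_small[OF ob(1)] F_small[OF ob(2)] mor_comp[OF F_mor[OF assms(1)] F_mor[OF assms(2)]] F_mor[OF J.Comp_hom[OF assms]]]
    by simp
qed

abbreviation const :: "('t, 'u, 'u) palg \<Rightarrow> ('jo, 'ja, ('t, 'u, 'u) palg, ('t, 'u, 'u) pmor, ('t, 'u, 'u) pcell) psfun"
  where "const \<equiv> const_psfun K"

lemma const_psfun_sel [simp]:
  "PObj (const_psfun (PsAlg T) V) j = V" "PArr (const_psfun (PsAlg T) V) f = pmor_id T V"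
  "PUnit (const_psfun (PsAlg T) V) j = Id (Vert (PsAlg T)) (pmor_id T V)"
  "PComp (const_psfun (PsAlg T) V) g f = Id (Vert (PsAlg T)) (pmor_id T V)"
  by (simp_all add: const_psfun_def)

text \<open>A pseudo natural transformation to a constant functor, written pointwise. The identity
  morphism of \<open>V\<close> and the coherence cells of the constant functor drop out, so the cell
  at \<open>f\<close> runs from the leg at the source of \<open>f\<close> to the leg at the target
  after \<open>PArr F f\<close>.\<close>

definition cone :: "('t, 'u, 'u) palg \<Rightarrow> ('jo, 'ja, ('t, 'u, 'u) pmor, ('t, 'u, 'u) pcell) psnat \<Rightarrow> bool" where
  "cone V \<sigma> \<longleftrightarrow> TObj \<sigma> \<in> extensional (Obj J) \<and> TArr \<sigma> \<in> extensional (Arr J) \<and>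
     (\<forall>j \<in> Obj J. mor (PObj F j) V (TObj \<sigma> j)) \<and>
     (\<forall>f \<in> Arr J. TArr \<sigma> f \<in> cells (TObj \<sigma> (Dom J f)) (pmor_comp T (TObj \<sigma> (Cod J f)) (PArr F f)) \<and>
        (\<forall>x \<in> Obj (FX (Dom J f)). iso_in (Cat V) (ce (TArr \<sigma> f) x))) \<and>
     (\<forall>j \<in> Obj J. \<forall>x \<in> Obj (FX j). ce (TArr \<sigma> (Id J j)) x = ma (TObj \<sigma> j) (ce (PUnit F j) x)) \<and>
     (\<forall>f \<in> Arr J. \<forall>g \<in> Arr J. Dom J g = Cod J f \<longrightarrow> (\<forall>x \<in> Obj (FX (Dom J f)).
        ce (TArr \<sigma> (Comp J g f)) x = Comp (Cat V) (ma (TObj \<sigma> (Cod J g)) (ce (PComp F g f) x))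
          (Comp (Cat V) (ce (TArr \<sigma> g) (mo (PArr F f) x)) (ce (TArr \<sigma> f) x))))"

text \<open>With the next two lemmas this removes the identities that the constant functor
  contributes to the axioms for cones and modifications; it rests on \<open>pmor_id\<close> being a
  strict unit.\<close>

lemma id_Vert_id:
  assumes V: "V \<in> small_palgs T" and m: "mor A V H"
  shows "HComp K (id2 K (pmor_id T V)) (id2 K H) = id2 K H"
proof -
  note i = id_cell(1)[OF m]
  interpret H: pointwise_mor T A V H by fact
  have c: "HComp K (id2 K (pmor_id T V)) (id2 K H) \<in> cells H H"
    using whisker_left(1)[OF m m mor_id[OF V] i] mor_id_left[OF m] by simp
  show ?thesis
    by (rule cell_eqI[OF m m c i])
       (use whisker_left(2)[OF m m mor_id[OF V] i] id_cell(2)[OF m] H.MD(3) homD[OF H.B.X.Id_hom]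
         in \<open>simp del: PsAlg_cell_sel\<close>)
qed

lemma whisker_id:
  assumes V: "V \<in> small_palgs T" and m: "mor A V G" "mor A V H" and a: "\<alpha> \<in> cells G H"
  shows "HComp K (id2 K (pmor_id T V)) \<alpha> = \<alpha>"
proof -
  interpret G: pointwise_mor T A V G by fact
  have c: "HComp K (id2 K (pmor_id T V)) \<alpha> \<in> cells G H"
    using whisker_left(1)[OF m mor_id[OF V] a] mor_id_left[OF m(1)] mor_id_left[OF m(2)] by simp
  show ?thesis
    by (rule cell_eqI[OF m c a])
       (use whisker_left(2)[OF m mor_id[OF V] a] homD[OF cell_hom[OF m a]] in \<open>simp del: PsAlg_cell_sel\<close>)
qed

lemma vcomp_id_right:
  assumes m: "mor A V G" "mor A V H" and a: "\<alpha> \<in> cells G H"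
  shows "vcomp K \<alpha> (id2 K G) = \<alpha>"
proof -
  interpret G: pointwise_mor T A V G by fact
  show ?thesis
    by (rule cell_eqI[OF m vcomp_cell(1)[OF m(1,1,2) id_cell(1)[OF m(1)] a] a])
       (use vcomp_cell(2)[OF m(1,1,2) id_cell(1)[OF m(1)] a] id_cell(2)[OF m(1)] G.B.X.Comp_Id_right[OF cell_hom[OF m a]]
         in \<open>simp del: PsAlg_cell_sel\<close>)
qed

text \<open>An equation between 2-cells may be replaced by equations of components only when both
  sides are known to be cells between the same morphisms. So the translations \<open>R\<close>
  assume that legs and cells have the right types, and the final case distinction shows that either
  description entails this.\<close>

lemma psnats_cone:
  assumes V: "V \<in> small_palgs T"
  shows "\<sigma> \<in> psnats J K F (const V) \<longleftrightarrow> cone V \<sigma>"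
proof -
  have 1: "(\<forall>j \<in> Obj J. TObj \<sigma> j \<in> hom (Und K) (PObj F j) (PObj (const V) j))
    \<longleftrightarrow> (\<forall>j \<in> Obj J. mor (PObj F j) V (TObj \<sigma> j))"
    using hom_Und_iff[OF F_small V] by auto
  {
    assume m: "\<forall>j \<in> Obj J. mor (PObj F j) V (TObj \<sigma> j)"
    have mD: "mor (PObj F (Dom J f)) V (TObj \<sigma> (Dom J f))" "mor (PObj F (Dom J f)) V (pmor_comp T (TObj \<sigma> (Cod J f)) (PArr F f))"
      if "f \<in> Arr J" for f
      using m that J.Dom_closed J.Cod_closed mor_comp[OF F_mor[OF J.Arr_hom[OF that]]] by auto
    have 2: "TArr \<sigma> f \<in> inv_2cells K (comp1 K (PArr (const V) f) (TObj \<sigma> (Dom J f))) (comp1 K (TObj \<sigma> (Cod J f)) (PArr F f))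
        \<longleftrightarrow> TArr \<sigma> f \<in> cells (TObj \<sigma> (Dom J f)) (pmor_comp T (TObj \<sigma> (Cod J f)) (PArr F f)) \<and>
          (\<forall>x \<in> Obj (FX (Dom J f)). iso_in (Cat V) (ce (TArr \<sigma> f) x))" if "f \<in> Arr J" for f
      using mor_id_left[OF mD(1)[OF that]] inv_2cells_iff[OF F_small[OF J.Dom_closed[OF that]] V mD[OF that]] by simp
    assume t: "\<forall>f \<in> Arr J. TArr \<sigma> f \<in> cells (TObj \<sigma> (Dom J f)) (pmor_comp T (TObj \<sigma> (Cod J f)) (PArr F f))"
    have 3: "vcomp K (TArr \<sigma> (Id J j)) (HComp K (PUnit (const V) j) (id2 K (TObj \<sigma> j))) = HComp K (id2 K (TObj \<sigma> j)) (PUnit F j)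
        \<longleftrightarrow> (\<forall>x \<in> Obj (FX j). ce (TArr \<sigma> (Id J j)) x = ma (TObj \<sigma> j) (ce (PUnit F j) x))" if j: "j \<in> Obj J" for j
    proof -
      have mj: "mor (PObj F j) V (TObj \<sigma> j)" using m j by blast
      have i: "Id J j \<in> Arr J" "Dom J (Id J j) = j" "Cod J (Id J j) = j" using homD[OF J.Id_hom[OF j]] by auto
      note mF = F_mor[OF J.Id_hom[OF j]]
      have t': "TArr \<sigma> (Id J j) \<in> cells (TObj \<sigma> j) (pmor_comp T (TObj \<sigma> j) (PArr F (Id J j)))" using t i by force
      note w = whisker_left[OF mor_id[OF F_small[OF j]] mF mj F_unit[OF j], unfolded mor_id_right[OF mj]]
      have l: "vcomp K (TArr \<sigma> (Id J j)) (HComp K (PUnit (const V) j) (id2 K (TObj \<sigma> j))) = TArr \<sigma> (Id J j)"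
        using id_Vert_id[OF V mj] vcomp_id_right[OF mj mor_comp[OF mF mj] t'] by (simp del: PsAlg_cell_sel)
      show ?thesis unfolding l using cell_eqI[OF mj mor_comp[OF mF mj] t' w(1)] w(2) by auto
    qed
    have 4: "vcomp K (TArr \<sigma> (Comp J g f)) (HComp K (PComp (const V) g f) (id2 K (TObj \<sigma> (Dom J f))))
        = vcomp K (HComp K (id2 K (TObj \<sigma> (Cod J g))) (PComp F g f))
            (vcomp K (HComp K (TArr \<sigma> g) (id2 K (PArr F f))) (HComp K (id2 K (PArr (const V) g)) (TArr \<sigma> f)))
        \<longleftrightarrow> (\<forall>x \<in> Obj (FX (Dom J f)).
        ce (TArr \<sigma> (Comp J g f)) x = Comp (Cat V) (ma (TObj \<sigma> (Cod J g)) (ce (PComp F g f) x))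
          (Comp (Cat V) (ce (TArr \<sigma> g) (mo (PArr F f) x)) (ce (TArr \<sigma> f) x)))"
      if f: "f \<in> Arr J" and g: "g \<in> Arr J" and gf: "Dom J g = Cod J f" for f g
    proof -
      have fh: "f \<in> hom J (Dom J f) (Cod J f)" and gh: "g \<in> hom J (Cod J f) (Cod J g)" using f g gf by (auto simp: hom_def)
      note gfh = J.Comp_hom[OF fh gh]
      have i: "Comp J g f \<in> Arr J" "Dom J (Comp J g f) = Dom J f" "Cod J (Comp J g f) = Cod J g" using homD[OF gfh] by auto
      have ma: "mor (PObj F (Dom J f)) V (TObj \<sigma> (Dom J f))" and mb: "mor (PObj F (Cod J f)) V (TObj \<sigma> (Cod J f))"
        and mc: "mor (PObj F (Cod J g)) V (TObj \<sigma> (Cod J g))" using m f g J.Dom_closed J.Cod_closed by auto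
      note Ff = F_mor[OF fh] and Fg = F_mor[OF gh] and Fgf = F_mor[OF gfh]
      have tf: "TArr \<sigma> f \<in> cells (TObj \<sigma> (Dom J f)) (pmor_comp T (TObj \<sigma> (Cod J f)) (PArr F f))"
        and tg: "TArr \<sigma> g \<in> cells (TObj \<sigma> (Cod J f)) (pmor_comp T (TObj \<sigma> (Cod J g)) (PArr F g))"
        and tgf: "TArr \<sigma> (Comp J g f) \<in> cells (TObj \<sigma> (Dom J f)) (pmor_comp T (TObj \<sigma> (Cod J g)) (PArr F (Comp J g f)))"
        using t f g gf i by (metis, metis, metis)
      note mbf = mor_comp[OF Ff mb] and mcg = mor_comp[OF Fg mc] and mcgf = mor_comp[OF Fgf mc]
      have mcg_f: "mor (PObj F (Dom J f)) V (pmor_comp T (pmor_comp T (TObj \<sigma> (Cod J g)) (PArr F g)) (PArr F f))"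
        by (rule mor_comp[OF Ff mcg])
      have l: "vcomp K (TArr \<sigma> (Comp J g f)) (HComp K (PComp (const V) g f) (id2 K (TObj \<sigma> (Dom J f)))) = TArr \<sigma> (Comp J g f)"
        using id_Vert_id[OF V ma] vcomp_id_right[OF ma mcgf tgf] by (simp del: PsAlg_cell_sel)
      have w0: "HComp K (id2 K (PArr (const V) g)) (TArr \<sigma> f) = TArr \<sigma> f"
        using whisker_id[OF V ma mbf tf] by (simp del: PsAlg_cell_sel)
      note w1 = whisker_right[OF mb mcg Ff tg]
      note w2 = vcomp_cell[OF ma mbf mcg_f tf w1(1)]
      \<comment> \<open>Strict associativity of morphisms makes the target of the pasted cells for
        \<open>f\<close> and \<open>g\<close> equal to the source of the whiskered
        \<open>PComp\<close>.\<close>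
      note w3 = whisker_left[OF mor_comp[OF Ff Fg] Fgf mc F_comp[OF fh gh], unfolded mor_assoc[OF Ff Fg mc]]
      note w4 = vcomp_cell[OF ma mcg_f mcgf w2(1) w3(1)]
      have e: "ce (vcomp K (HComp K (id2 K (TObj \<sigma> (Cod J g))) (PComp F g f)) (vcomp K (HComp K (TArr \<sigma> g) (id2 K (PArr F f))) (TArr \<sigma> f))) x
        = Comp (Cat V) (ma (TObj \<sigma> (Cod J g)) (ce (PComp F g f) x)) (Comp (Cat V) (ce (TArr \<sigma> g) (mo (PArr F f) x)) (ce (TArr \<sigma> f) x))"
        if "x \<in> Obj (FX (Dom J f))" for x
        using w4(2)[OF that] w3(2)[OF that] w2(2)[OF that] w1(2)[OF that] by (simp del: PsAlg_cell_sel)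
      show ?thesis unfolding l w0 using cell_eqI[OF ma mcgf tgf w4(1)] e by auto
    qed
    note 2 3 4
  } note R = this
  show ?thesis
  proof (cases "(\<forall>j \<in> Obj J. mor (PObj F j) V (TObj \<sigma> j)) \<and>
      (\<forall>f \<in> Arr J. TArr \<sigma> f \<in> cells (TObj \<sigma> (Dom J f)) (pmor_comp T (TObj \<sigma> (Cod J f)) (PArr F f)))")
    case True
    then show ?thesis unfolding psnats_def cone_def mem_Collect_eq 1
      using R by (simp del: PsAlg_cell_sel PsAlg_sel const_psfun_sel cong: conj_cong ball_cong)
  next
    case False
    have "\<not> cone V \<sigma>" using False unfolding cone_def by blast
    moreover have "\<sigma> \<notin> psnats J K F (const V)"
    proof
      assume s: "\<sigma> \<in> psnats J K F (const V)"
      then have m: "\<forall>j \<in> Obj J. mor (PObj F j) V (TObj \<sigma> j)" using 1 unfolding psnats_def by blast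
      have mD: "mor (PObj F (Dom J f)) V (TObj \<sigma> (Dom J f))" "mor (PObj F (Dom J f)) V (pmor_comp T (TObj \<sigma> (Cod J f)) (PArr F f))"
        if "f \<in> Arr J" for f
        using m that J.Dom_closed J.Cod_closed mor_comp[OF F_mor[OF J.Arr_hom[OF that]]] by auto
      have q: "TArr \<sigma> f \<in> inv_2cells K (comp1 K (PArr (const V) f) (TObj \<sigma> (Dom J f))) (comp1 K (TObj \<sigma> (Cod J f)) (PArr F f))"
        if "f \<in> Arr J" for f using s that unfolding psnats_def by blast
      have "TArr \<sigma> f \<in> cells (TObj \<sigma> (Dom J f)) (pmor_comp T (TObj \<sigma> (Cod J f)) (PArr F f))" if "f \<in> Arr J" for f
        using q[OF that] mor_id_left[OF mD(1)[OF that]] inv_2cells_iff[OF F_small[OF J.Dom_closed[OF that]] V mD[OF that]]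
        by simp
      then show False using m False by blast
    qed
    ultimately show ?thesis by simp
  qed
qed

lemma
  assumes "cone V \<sigma>"
  shows cone_mor: "j \<in> Obj J \<Longrightarrow> mor (PObj F j) V (TObj \<sigma> j)"
    and cone_cell: "f \<in> hom J a b \<Longrightarrow> TArr \<sigma> f \<in> cells (TObj \<sigma> a) (pmor_comp T (TObj \<sigma> b) (PArr F f))"
    and cone_iso: "f \<in> hom J a b \<Longrightarrow> x \<in> Obj (FX a) \<Longrightarrow> iso_in (Cat V) (ce (TArr \<sigma> f) x)"
    and cone_unit: "j \<in> Obj J \<Longrightarrow> x \<in> Obj (FX j) \<Longrightarrow> ce (TArr \<sigma> (Id J j)) x = ma (TObj \<sigma> j) (ce (PUnit F j) x)"
    and cone_comp: "f \<in> hom J a b \<Longrightarrow> g \<in> hom J b c \<Longrightarrow> x \<in> Obj (FX a) \<Longrightarrow>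
      ce (TArr \<sigma> (Comp J g f)) x = Comp (Cat V) (ma (TObj \<sigma> c) (ce (PComp F g f) x))
          (Comp (Cat V) (ce (TArr \<sigma> g) (mo (PArr F f) x)) (ce (TArr \<sigma> f) x))"
  using assms unfolding cone_def hom_def by auto

text \<open>As for cones: the whiskering with the identity of \<open>V\<close> disappears, and the
  modification axiom becomes one equation for each object of \<open>FX (Dom J f)\<close>.\<close>

lemma modifs_iff:
  assumes V: "V \<in> small_palgs T"
  shows "\<Xi> \<in> modifs J K F (const V) \<longleftrightarrow> cone V (MoSrc \<Xi>) \<and> cone V (MoTrg \<Xi>) \<and>
    MoComp \<Xi> \<in> extensional (Obj J) \<and>
    (\<forall>j \<in> Obj J. MoComp \<Xi> j \<in> cells (TObj (MoSrc \<Xi>) j) (TObj (MoTrg \<Xi>) j)) \<and>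
    (\<forall>f \<in> Arr J. \<forall>x \<in> Obj (FX (Dom J f)).
      Comp (Cat V) (ce (MoComp \<Xi> (Cod J f)) (mo (PArr F f) x)) (ce (TArr (MoSrc \<Xi>) f) x)
      = Comp (Cat V) (ce (TArr (MoTrg \<Xi>) f) x) (ce (MoComp \<Xi> (Dom J f)) x))"
proof -
  have 1: "MoComp \<Xi> j \<in> hom (Vert K) (TObj (MoSrc \<Xi>) j) (TObj (MoTrg \<Xi>) j)
      \<longleftrightarrow> MoComp \<Xi> j \<in> cells (TObj (MoSrc \<Xi>) j) (TObj (MoTrg \<Xi>) j)"
    if s: "cone V (MoSrc \<Xi>)" and t: "cone V (MoTrg \<Xi>)" and j: "j \<in> Obj J" for j
      by (rule hom_Vert_iff[OF small_mor[OF F_small[OF j] V cone_mor[OF s j]] small_mor[OF F_small[OF j] V cone_mor[OF t j]]])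
  {
    assume s: "cone V (MoSrc \<Xi>)" and t: "cone V (MoTrg \<Xi>)"
    assume c: "\<forall>j \<in> Obj J. MoComp \<Xi> j \<in> cells (TObj (MoSrc \<Xi>) j) (TObj (MoTrg \<Xi>) j)"
    have 2: "vcomp K (HComp K (MoComp \<Xi> (Cod J f)) (id2 K (PArr F f))) (TArr (MoSrc \<Xi>) f)
        = vcomp K (TArr (MoTrg \<Xi>) f) (HComp K (id2 K (PArr (const V) f)) (MoComp \<Xi> (Dom J f)))
      \<longleftrightarrow> (\<forall>x \<in> Obj (FX (Dom J f)).
        Comp (Cat V) (ce (MoComp \<Xi> (Cod J f)) (mo (PArr F f) x)) (ce (TArr (MoSrc \<Xi>) f) x)
        = Comp (Cat V) (ce (TArr (MoTrg \<Xi>) f) x) (ce (MoComp \<Xi> (Dom J f)) x))" if f: "f \<in> Arr J" for f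
    proof -
      note fh = J.Arr_hom[OF f] and a = J.Dom_closed[OF f] and b = J.Cod_closed[OF f]
      note sa = cone_mor[OF s a] and sb = cone_mor[OF s b] and ta = cone_mor[OF t a] and tb = cone_mor[OF t b]
      note Ff = F_mor[OF fh]
      have ca: "MoComp \<Xi> (Dom J f) \<in> cells (TObj (MoSrc \<Xi>) (Dom J f)) (TObj (MoTrg \<Xi>) (Dom J f))"
        and cb: "MoComp \<Xi> (Cod J f) \<in> cells (TObj (MoSrc \<Xi>) (Cod J f)) (TObj (MoTrg \<Xi>) (Cod J f))" using c a b by auto
      note w1 = whisker_right[OF sb tb Ff cb]
      note v1 = vcomp_cell[OF sa mor_comp[OF Ff sb] mor_comp[OF Ff tb] cone_cell[OF s fh] w1(1)]
      note v2 = vcomp_cell[OF sa ta mor_comp[OF Ff tb] ca cone_cell[OF t fh]]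
      have w0: "HComp K (id2 K (PArr (const V) f)) (MoComp \<Xi> (Dom J f)) = MoComp \<Xi> (Dom J f)"
        using whisker_id[OF V sa ta ca] by (simp del: PsAlg_cell_sel)
      show ?thesis unfolding w0
        using cell_eqI[OF sa mor_comp[OF Ff tb] v1(1) v2(1)] v1(2) v2(2) w1(2) by (auto simp del: PsAlg_cell_sel)
    qed
    note 2
  } note R = this
  show ?thesis unfolding modifs_def mem_Collect_eq psnats_cone[OF V]
    using 1 R by (simp del: PsAlg_cell_sel PsAlg_sel const_psfun_sel cong: conj_cong ball_cong)
qed

section \<open>The two categories compared by the universal property\<close>

lemma Mor_sel [simp]: "Obj (Mor K A B) = hom (Und K) A B" "Dom (Mor K A B) = CSrc" "Cod (Mor K A B) = CTrg"
  "Id (Mor K A B) = Id (Vert K)" "Comp (Mor K A B) = Comp (Vert K)"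
  by (simp_all add: Mor_def)

lemma hom_Mor_iff:
  assumes "A \<in> small_palgs T" "B \<in> small_palgs T"
  shows "\<alpha> \<in> hom (Mor K A B) G H \<longleftrightarrow> mor A B G \<and> mor A B H \<and> \<alpha> \<in> cells G H"
proof -
  have "\<alpha> \<in> hom (Mor K A B) G H \<longleftrightarrow> \<alpha> \<in> hom (Vert K) G H \<and> mor A B G \<and> mor A B H"
    using hom_Und_iff[OF assms] by (auto simp: hom_def Mor_def)
  then show ?thesis using hom_Vert_iff small_mor[OF assms] by blast
qed

lemma category_Mor:
  assumes "A \<in> small_palgs T" "B \<in> small_palgs T"
  shows "category (Mor K A B)"
proof
  note h = hom_Mor_iff[OF assms]
  have ar: "mor A B (CSrc f) \<and> mor A B (CTrg f)" if "f \<in> Arr (Mor K A B)" for f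
    using that hom_Und_iff[OF assms] by (simp add: Mor_def)
  fix f assume "f \<in> Arr (Mor K A B)"
  then show "Dom (Mor K A B) f \<in> Obj (Mor K A B)" "Cod (Mor K A B) f \<in> Obj (Mor K A B)"
    using ar hom_Und_iff[OF assms] by simp_all
next
  note h = hom_Mor_iff[OF assms]
  fix a assume "a \<in> Obj (Mor K A B)"
  then show "Id (Mor K A B) a \<in> hom (Mor K A B) a a"
    unfolding h using hom_Und_iff[OF assms] id_cell(1) by simp
next
  note h = hom_Mor_iff[OF assms]
  fix f a b assume f: "f \<in> hom (Mor K A B) a b"
  then have fa: "mor A B a" "mor A B b" "f \<in> cells a b" unfolding h by auto
  interpret a: pointwise_mor T A B a by fact
  show "Comp (Mor K A B) f (Id (Mor K A B) a) = f" using vcomp_id_right[OF fa] by simp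
  have "vcomp K (id2 K b) f = f"
    by (rule cell_eqI[OF fa(1,2) vcomp_cell(1)[OF fa(1,2,2,3) id_cell(1)[OF fa(2)]] fa(3)])
       (use vcomp_cell(2)[OF fa(1,2,2,3) id_cell(1)[OF fa(2)]] id_cell(2)[OF fa(2)] a.B.X.Comp_Id_left[OF cell_hom[OF fa]]
         in \<open>simp del: PsAlg_cell_sel\<close>)
  then show "Comp (Mor K A B) (Id (Mor K A B) b) f = f" by simp
  fix g c assume g: "g \<in> hom (Mor K A B) b c"
  then have ga: "mor A B c" "g \<in> cells b c" unfolding h by auto
  show gf: "Comp (Mor K A B) g f \<in> hom (Mor K A B) a c"
    unfolding h using vcomp_cell(1)[OF fa(1,2) ga(1) fa(3) ga(2)] fa ga by simp
  fix k d assume "k \<in> hom (Mor K A B) c d"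
  then have ka: "mor A B d" "k \<in> cells c d" unfolding h by auto
  note gf = vcomp_cell[OF fa(1,2) ga(1) fa(3) ga(2)] and kg = vcomp_cell[OF fa(2) ga(1) ka(1) ga(2) ka(2)]
  note l = vcomp_cell[OF fa(1) ga(1) ka(1) gf(1) ka(2)] and r = vcomp_cell[OF fa(1,2) ka(1) fa(3) kg(1)]
  have "vcomp K k (vcomp K g f) = vcomp K (vcomp K k g) f"
    by (rule cell_eqI[OF fa(1) ka(1) l(1) r(1)])
       (use l(2) r(2) gf(2) kg(2) a.B.X.Comp_assoc[OF cell_hom[OF fa] cell_hom[OF fa(2) ga] cell_hom[OF ga(1) ka]]
         in \<open>simp del: PsAlg_cell_sel\<close>)
  then show "Comp (Mor K A B) k (Comp (Mor K A B) g f) = Comp (Mor K A B) (Comp (Mor K A B) k g) f" by simp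
qed

abbreviation "Cones V \<equiv> pseudo_cone_cat J K F V"

lemma Cones_sel [simp]: "Arr (Cones V) = modifs J K F (const V)" "Dom (Cones V) = MoSrc" "Cod (Cones V) = MoTrg"
  "Id (Cones V) \<sigma> = \<lparr>MoSrc = \<sigma>, MoTrg = \<sigma>, MoComp = restrict (\<lambda>j. id2 K (TObj \<sigma> j)) (Obj J)\<rparr>"
  "Comp (Cones V) \<Theta> \<Xi> = \<lparr>MoSrc = MoSrc \<Xi>, MoTrg = MoTrg \<Theta>, MoComp = restrict (\<lambda>j. vcomp K (MoComp \<Theta> j) (MoComp \<Xi> j)) (Obj J)\<rparr>"
  by (simp_all add: pseudo_cone_cat_def psnat_cat_def)

lemma Cones_Obj: "V \<in> small_palgs T \<Longrightarrow> \<sigma> \<in> Obj (Cones V) \<longleftrightarrow> cone V \<sigma>"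
  using psnats_cone by (simp add: pseudo_cone_cat_def psnat_cat_def)

lemma hom_Cones_iff:
  assumes V: "V \<in> small_palgs T"
  shows "\<Xi> \<in> hom (Cones V) \<sigma> \<tau> \<longleftrightarrow> MoSrc \<Xi> = \<sigma> \<and> MoTrg \<Xi> = \<tau> \<and> cone V \<sigma> \<and> cone V \<tau> \<and>
    MoComp \<Xi> \<in> extensional (Obj J) \<and> (\<forall>j \<in> Obj J. MoComp \<Xi> j \<in> cells (TObj \<sigma> j) (TObj \<tau> j)) \<and>
    (\<forall>f \<in> Arr J. \<forall>x \<in> Obj (FX (Dom J f)).
      Comp (Cat V) (ce (MoComp \<Xi> (Cod J f)) (mo (PArr F f) x)) (ce (TArr \<sigma> f) x)
      = Comp (Cat V) (ce (TArr \<tau> f) x) (ce (MoComp \<Xi> (Dom J f)) x))"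
  unfolding hom_def using modifs_iff[OF V] by auto

lemma modif_eqI:
  assumes "V \<in> small_palgs T" "\<Xi> \<in> hom (Cones V) \<sigma> \<tau>" "\<Theta> \<in> hom (Cones V) \<sigma> \<tau>"
    "\<And>j x. j \<in> Obj J \<Longrightarrow> x \<in> Obj (FX j) \<Longrightarrow> ce (MoComp \<Xi> j) x = ce (MoComp \<Theta> j) x"
  shows "\<Xi> = \<Theta>"
proof -
  note X = assms(2)[unfolded hom_Cones_iff[OF assms(1)]] and Y = assms(3)[unfolded hom_Cones_iff[OF assms(1)]]
  have "MoComp \<Xi> = MoComp \<Theta>"
  proof (rule extensionalityI[of _ "Obj J"])
    fix j assume j: "j \<in> Obj J"
    show "MoComp \<Xi> j = MoComp \<Theta> j"
      by (rule cell_eqI[OF cone_mor[of V \<sigma>] cone_mor[of V \<tau>]]) (use X Y j assms(4) in auto)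
  qed (use X Y in auto)
  then show ?thesis using X Y by (cases \<Xi>; cases \<Theta>) simp
qed

text \<open>The modification axiom at \<open>f\<close> is a square with components of the
  modification as horizontal sides and cone cells as vertical ones, so composites are handled by
  pasting.\<close>

lemma Comp_Cones_hom:
  assumes V: "V \<in> small_palgs T" and X: "\<Xi> \<in> hom (Cones V) \<sigma> \<tau>" and Y: "\<Theta> \<in> hom (Cones V) \<tau> \<upsilon>"
  shows "Comp (Cones V) \<Theta> \<Xi> \<in> hom (Cones V) \<sigma> \<upsilon>"
    and "j \<in> Obj J \<Longrightarrow> x \<in> Obj (FX j) \<Longrightarrow>
      ce (MoComp (Comp (Cones V) \<Theta> \<Xi>) j) x = Comp (Cat V) (ce (MoComp \<Theta> j) x) (ce (MoComp \<Xi> j) x)"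
proof -
  note X = X[unfolded hom_Cones_iff[OF V]] and Y = Y[unfolded hom_Cones_iff[OF V]]
  interpret V: pointwise_algebra T V by (rule small_palgs_pointwise[OF V])
  have c: "cone V \<sigma>" "cone V \<tau>" "cone V \<upsilon>" using X Y by auto
  have cx: "MoComp \<Xi> j \<in> cells (TObj \<sigma> j) (TObj \<tau> j)" and cy: "MoComp \<Theta> j \<in> cells (TObj \<tau> j) (TObj \<upsilon> j)" if "j \<in> Obj J" for j
    using X Y that by auto
  note v = vcomp_cell[OF cone_mor[OF c(1)] cone_mor[OF c(2)] cone_mor[OF c(3)] cx cy]
  show e: "ce (MoComp (Comp (Cones V) \<Theta> \<Xi>) j) x = Comp (Cat V) (ce (MoComp \<Theta> j) x) (ce (MoComp \<Xi> j) x)"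
    if "j \<in> Obj J" "x \<in> Obj (FX j)" for j x
    using v(2)[of j x] that by (simp del: PsAlg_cell_sel)
  show "Comp (Cones V) \<Theta> \<Xi> \<in> hom (Cones V) \<sigma> \<upsilon>"
    unfolding hom_Cones_iff[OF V]
  proof (intro conjI ballI)
    fix f x assume f: "f \<in> Arr J" and x: "x \<in> Obj (FX (Dom J f))"
    note fh = J.Arr_hom[OF f] and a = J.Dom_closed[OF f] and b = J.Cod_closed[OF f]
    interpret Ff: pointwise_mor T "PObj F (Dom J f)" "PObj F (Cod J f)" "PArr F f" by (rule F_mor[OF fh])
    have fx: "mo (PArr F f) x \<in> Obj (FX (Cod J f))" by (rule Ff.MD(3)[OF x])
    have mF: "mo (pmor_comp T H (PArr F f)) x = mo H (mo (PArr F f) x)" for H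
      using x Ff.MD(1) by simp
    note h1 = cell_hom[OF cone_mor[OF c(1) a] mor_comp[OF F_mor[OF fh] cone_mor[OF c(1) b]] cone_cell[OF c(1) fh] x, unfolded mF]
    note h2 = cell_hom[OF cone_mor[OF c(2) a] mor_comp[OF F_mor[OF fh] cone_mor[OF c(2) b]] cone_cell[OF c(2) fh] x, unfolded mF]
    note h3 = cell_hom[OF cone_mor[OF c(3) a] mor_comp[OF F_mor[OF fh] cone_mor[OF c(3) b]] cone_cell[OF c(3) fh] x, unfolded mF]
    note xa = cell_hom[OF cone_mor[OF c(1) a] cone_mor[OF c(2) a] cx[OF a] x]
    note xb = cell_hom[OF cone_mor[OF c(1) b] cone_mor[OF c(2) b] cx[OF b] fx]
    note ya = cell_hom[OF cone_mor[OF c(2) a] cone_mor[OF c(3) a] cy[OF a] x]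
    note yb = cell_hom[OF cone_mor[OF c(2) b] cone_mor[OF c(3) b] cy[OF b] fx]
    have "square (Cat V) (ce (MoComp \<Xi> (Dom J f)) x) (ce (TArr \<sigma> f) x) (ce (TArr \<tau> f) x) (ce (MoComp \<Xi> (Cod J f)) (mo (PArr F f) x))"
      "square (Cat V) (ce (MoComp \<Theta> (Dom J f)) x) (ce (TArr \<tau> f) x) (ce (TArr \<upsilon> f) x) (ce (MoComp \<Theta> (Cod J f)) (mo (PArr F f) x))"
      using X Y f x by (auto intro!: V.X.squareI[OF xa xb h1 h2] V.X.squareI[OF ya yb h2 h3])
    from V.X.square_comp[OF this]
    show "Comp (Cat V) (ce (MoComp (Comp (Cones V) \<Theta> \<Xi>) (Cod J f)) (mo (PArr F f) x)) (ce (TArr \<sigma> f) x)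
      = Comp (Cat V) (ce (TArr \<upsilon> f) x) (ce (MoComp (Comp (Cones V) \<Theta> \<Xi>) (Dom J f)) x)"
      unfolding e[OF a x] e[OF b fx] by (simp add: square_def)
  qed (use X Y c v(1) in \<open>simp_all del: PsAlg_cell_sel\<close>)
qed

lemma Id_Cones_hom:
  assumes V: "V \<in> small_palgs T" and c: "cone V \<sigma>"
  shows "Id (Cones V) \<sigma> \<in> hom (Cones V) \<sigma> \<sigma>"
    and "j \<in> Obj J \<Longrightarrow> x \<in> Obj (FX j) \<Longrightarrow> ce (MoComp (Id (Cones V) \<sigma>) j) x = Id (Cat V) (mo (TObj \<sigma> j) x)"
proof -
  interpret V: pointwise_algebra T V by (rule small_palgs_pointwise[OF V])
  show e: "ce (MoComp (Id (Cones V) \<sigma>) j) x = Id (Cat V) (mo (TObj \<sigma> j) x)" if "j \<in> Obj J" "x \<in> Obj (FX j)" for j x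
    using id_cell(2)[OF cone_mor[OF c that(1)] that(2)] that by (simp del: PsAlg_cell_sel)
  show "Id (Cones V) \<sigma> \<in> hom (Cones V) \<sigma> \<sigma>"
    unfolding hom_Cones_iff[OF V]
  proof (intro conjI ballI)
    fix f x assume f: "f \<in> Arr J" and x: "x \<in> Obj (FX (Dom J f))"
    note fh = J.Arr_hom[OF f] and a = J.Dom_closed[OF f] and b = J.Cod_closed[OF f]
    interpret Ff: pointwise_mor T "PObj F (Dom J f)" "PObj F (Cod J f)" "PArr F f" by (rule F_mor[OF fh])
    have fx: "mo (PArr F f) x \<in> Obj (FX (Cod J f))" by (rule Ff.MD(3)[OF x])
    have mF: "mo (pmor_comp T H (PArr F f)) x = mo H (mo (PArr F f) x)" for H
      using x Ff.MD(1) by simp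
    note h1 = cell_hom[OF cone_mor[OF c a] mor_comp[OF F_mor[OF fh] cone_mor[OF c b]] cone_cell[OF c fh] x, unfolded mF]
    show "Comp (Cat V) (ce (MoComp (Id (Cones V) \<sigma>) (Cod J f)) (mo (PArr F f) x)) (ce (TArr \<sigma> f) x)
      = Comp (Cat V) (ce (TArr \<sigma> f) x) (ce (MoComp (Id (Cones V) \<sigma>) (Dom J f)) x)"
      unfolding e[OF a x] e[OF b fx] using V.X.Comp_Id_left[OF h1] V.X.Comp_Id_right[OF h1] by simp
  qed (use c id_cell(1)[OF cone_mor[OF c]] in \<open>simp_all del: PsAlg_cell_sel\<close>)
qed

lemma category_Cones:
  assumes V: "V \<in> small_palgs T"
  shows "category (Cones V)"
proof
  interpret V: pointwise_algebra T V by (rule small_palgs_pointwise[OF V])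
  have mh: "ce (MoComp \<Xi> j) x \<in> hom (Cat V) (mo (TObj \<sigma> j) x) (mo (TObj \<tau> j) x)"
    if "\<Xi> \<in> hom (Cones V) \<sigma> \<tau>" "j \<in> Obj J" "x \<in> Obj (FX j)" for \<Xi> \<sigma> \<tau> j x
    by (rule cell_hom[OF cone_mor[of V \<sigma>] cone_mor[of V \<tau>] _ that(3)]) (use that hom_Cones_iff[OF V] in auto)
  {
    fix \<Xi> assume "\<Xi> \<in> Arr (Cones V)"
    then show "Dom (Cones V) \<Xi> \<in> Obj (Cones V)" "Cod (Cones V) \<Xi> \<in> Obj (Cones V)"
      using modifs_iff[OF V] Cones_Obj[OF V] by simp_all
  }
  {
    fix \<sigma> assume "\<sigma> \<in> Obj (Cones V)"
    then show "Id (Cones V) \<sigma> \<in> hom (Cones V) \<sigma> \<sigma>" using Id_Cones_hom(1)[OF V] Cones_Obj[OF V] by blast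
  }
  fix \<Xi> \<sigma> \<tau> assume X: "\<Xi> \<in> hom (Cones V) \<sigma> \<tau>"
  then have c: "cone V \<sigma>" "cone V \<tau>" using hom_Cones_iff[OF V] by auto
  note ids = Id_Cones_hom[OF V c(1)] and idt = Id_Cones_hom[OF V c(2)]
  show "Comp (Cones V) \<Xi> (Id (Cones V) \<sigma>) = \<Xi>"
    by (rule modif_eqI[OF V Comp_Cones_hom(1)[OF V ids(1) X] X])
       (use Comp_Cones_hom(2)[OF V ids(1) X] ids(2) V.X.Comp_Id_right[OF mh[OF X]] in \<open>simp del: Cones_sel PsAlg_cell_sel\<close>)
  show "Comp (Cones V) (Id (Cones V) \<tau>) \<Xi> = \<Xi>"
    by (rule modif_eqI[OF V Comp_Cones_hom(1)[OF V X idt(1)] X])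
       (use Comp_Cones_hom(2)[OF V X idt(1)] idt(2) V.X.Comp_Id_left[OF mh[OF X]] in \<open>simp del: Cones_sel PsAlg_cell_sel\<close>)
  fix \<Theta> \<upsilon> assume Y: "\<Theta> \<in> hom (Cones V) \<tau> \<upsilon>"
  show "Comp (Cones V) \<Theta> \<Xi> \<in> hom (Cones V) \<sigma> \<upsilon>" by (rule Comp_Cones_hom(1)[OF V X Y])
  fix \<Omega> \<phi> assume Z: "\<Omega> \<in> hom (Cones V) \<upsilon> \<phi>"
  note YX = Comp_Cones_hom[OF V X Y] and ZY = Comp_Cones_hom[OF V Y Z]
  note l = Comp_Cones_hom[OF V YX(1) Z] and r = Comp_Cones_hom[OF V X ZY(1)]
  show "Comp (Cones V) \<Omega> (Comp (Cones V) \<Theta> \<Xi>) = Comp (Cones V) (Comp (Cones V) \<Omega> \<Theta>) \<Xi>"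
    by (rule modif_eqI[OF V l(1) r(1)])
       (use l(2) r(2) YX(2) ZY(2) V.X.Comp_assoc[OF mh[OF X] mh[OF Y] mh[OF Z]] in \<open>simp del: Cones_sel PsAlg_cell_sel\<close>)
qed

section \<open>Composing a cone with a morphism\<close>

lemma cone_postcomp_sel [simp]:
  "j \<in> Obj J \<Longrightarrow> TObj (cone_postcomp J K \<pi> b) j = pmor_comp T b (TObj \<pi> j)"
  "f \<in> Arr J \<Longrightarrow> TArr (cone_postcomp J K \<pi> b) f = HComp K (id2 K b) (TArr \<pi> f)"
  by (simp_all add: cone_postcomp_def)

text \<open>The cone conditions consist of equations and invertibility statements in
  \<open>Cat W\<close>, and the functor of \<open>b\<close> preserves both. Associativity of
  composition of morphisms gives the types of the new cells.\<close>

lemma cone_postcomp: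
  assumes c: "cone W \<pi>" and b: "mor W V b"
  shows "cone V (cone_postcomp J K \<pi> b)"
    and "f \<in> Arr J \<Longrightarrow> x \<in> Obj (FX (Dom J f)) \<Longrightarrow> ce (TArr (cone_postcomp J K \<pi> b) f) x = ma b (ce (TArr \<pi> f) x)"
proof -
  interpret b: pointwise_mor T W V b by fact
  note w = whisker_left[OF cone_mor[OF c] mor_comp[OF F_mor cone_mor[OF c]] b cone_cell[OF c]]
  show e: "ce (TArr (cone_postcomp J K \<pi> b) f) x = ma b (ce (TArr \<pi> f) x)" if "f \<in> Arr J" "x \<in> Obj (FX (Dom J f))" for f x
    using w(2)[OF J.Dom_closed[OF that(1)] J.Arr_hom[OF that(1)] J.Cod_closed[OF that(1)] J.Arr_hom[OF that(1)]] that
    by (simp del: PsAlg_cell_sel)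
  have mp: "ma (pmor_comp T b (TObj \<pi> j)) k = ma b (ma (TObj \<pi> j) k)" if "j \<in> Obj J" "k \<in> Arr (FX j)" for j k
  proof -
    interpret p: pointwise_mor T "PObj F j" W "TObj \<pi> j" by (rule cone_mor[OF c that(1)])
    show ?thesis using that p.MD(1) by simp
  qed
  have hx: "ce (TArr \<pi> f) x \<in> hom (Cat W) (mo (TObj \<pi> (Dom J f)) x) (mo (TObj \<pi> (Cod J f)) (mo (PArr F f) x))"
    and Fx: "mo (PArr F f) x \<in> Obj (FX (Cod J f))" if f: "f \<in> Arr J" and x: "x \<in> Obj (FX (Dom J f))" for f x
  proof -
    note fh = J.Arr_hom[OF f]
    interpret Ff: pointwise_mor T "PObj F (Dom J f)" "PObj F (Cod J f)" "PArr F f" by (rule F_mor[OF fh])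
    show "mo (PArr F f) x \<in> Obj (FX (Cod J f))" by (rule Ff.MD(3)[OF x])
    show "ce (TArr \<pi> f) x \<in> hom (Cat W) (mo (TObj \<pi> (Dom J f)) x) (mo (TObj \<pi> (Cod J f)) (mo (PArr F f) x))"
      using cell_hom[OF cone_mor[OF c J.Dom_closed[OF f]] mor_comp[OF F_mor[OF fh] cone_mor[OF c J.Cod_closed[OF f]]] cone_cell[OF c fh] x]
        x Ff.MD(1) by simp
  qed
  show "cone V (cone_postcomp J K \<pi> b)" unfolding cone_def
  proof (intro conjI ballI impI)
    show "TObj (cone_postcomp J K \<pi> b) \<in> extensional (Obj J)" "TArr (cone_postcomp J K \<pi> b) \<in> extensional (Arr J)"
      by (simp_all add: cone_postcomp_def)
  next
    fix j assume "j \<in> Obj J"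
    then show "mor (PObj F j) V (TObj (cone_postcomp J K \<pi> b) j)" using mor_comp[OF cone_mor[OF c] b] by simp
  next
    fix f assume f: "f \<in> Arr J"
    note fh = J.Arr_hom[OF f] and d = J.Dom_closed[OF f] and cd = J.Cod_closed[OF f]
    show "TArr (cone_postcomp J K \<pi> b) f \<in> cells (TObj (cone_postcomp J K \<pi> b) (Dom J f))
       (pmor_comp T (TObj (cone_postcomp J K \<pi> b) (Cod J f)) (PArr F f))"
      using w(1)[OF d fh cd fh] mor_assoc[OF F_mor[OF fh] cone_mor[OF c cd] b] f d cd by (simp del: PsAlg_cell_sel)
    fix x assume x: "x \<in> Obj (FX (Dom J f))"
    show "iso_in (Cat V) (ce (TArr (cone_postcomp J K \<pi> b) f) x)"
      unfolding e[OF f x] by (rule functor_iso(1)[OF b.A.Cat b.B.Cat b.MFun cone_iso[OF c fh x] hx[OF f x]])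
  next
    fix j x assume j: "j \<in> Obj J" and x: "x \<in> Obj (FX j)"
    have i: "Id J j \<in> Arr J" "Dom J (Id J j) = j" using homD[OF J.Id_hom[OF j]] by auto
    have "ce (PUnit F j) x \<in> Arr (FX j)"
      using homD[OF cell_hom[OF mor_id[OF F_small[OF j]] F_mor[OF J.Id_hom[OF j]] F_unit[OF j] x]] by blast
    then show "ce (TArr (cone_postcomp J K \<pi> b) (Id J j)) x = ma (TObj (cone_postcomp J K \<pi> b) j) (ce (PUnit F j) x)"
      using e[of "Id J j" x] i x j cone_unit[OF c j x] mp[OF j] by (simp del: PsAlg_cell_sel pmor_comp_sel)
  next
    fix f g x assume f: "f \<in> Arr J" and g: "g \<in> Arr J" and gf: "Dom J g = Cod J f" and x: "x \<in> Obj (FX (Dom J f))"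
    have fh: "f \<in> hom J (Dom J f) (Cod J f)" and gh: "g \<in> hom J (Cod J f) (Cod J g)" using f g gf by (auto simp: hom_def)
    note gfh = J.Comp_hom[OF fh gh]
    have i: "Comp J g f \<in> Arr J" "Dom J (Comp J g f) = Dom J f" using homD[OF gfh] by auto
    note cd = J.Cod_closed[OF g]
    interpret p: pointwise_mor T "PObj F (Cod J g)" W "TObj \<pi> (Cod J g)" by (rule cone_mor[OF c cd])
    interpret Ff: pointwise_mor T "PObj F (Dom J f)" "PObj F (Cod J f)" "PArr F f" by (rule F_mor[OF fh])
    interpret Fg: pointwise_mor T "PObj F (Cod J f)" "PObj F (Cod J g)" "PArr F g" by (rule F_mor[OF gh])
    have pc: "ce (PComp F g f) x \<in> hom (FX (Cod J g)) (mo (PArr F g) (mo (PArr F f) x)) (mo (PArr F (Comp J g f)) x)"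
      using cell_hom[OF mor_comp[OF F_mor[OF fh] F_mor[OF gh]] F_mor[OF gfh] F_comp[OF fh gh] x] x Ff.MD(1) by simp
    have fx: "mo (PArr F f) x \<in> Obj (FX (Dom J g))" using Fx[OF f x] gf by simp
    note h1 = hx[OF f x] and h2 = hx[OF g fx, unfolded gf] and h3 = p.MD(5)[OF pc]
    have "ma b (Comp (Cat W) (ma (TObj \<pi> (Cod J g)) (ce (PComp F g f) x)) (Comp (Cat W) (ce (TArr \<pi> g) (mo (PArr F f) x)) (ce (TArr \<pi> f) x)))
      = Comp (Cat V) (ma b (ma (TObj \<pi> (Cod J g)) (ce (PComp F g f) x))) (Comp (Cat V) (ma b (ce (TArr \<pi> g) (mo (PArr F f) x))) (ma b (ce (TArr \<pi> f) x)))"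
      using b.MD(7)[OF b.A.X.Comp_hom[OF h1 h2] h3] b.MD(7)[OF h1 h2] by simp
    then show "ce (TArr (cone_postcomp J K \<pi> b) (Comp J g f)) x = Comp (Cat V) (ma (TObj (cone_postcomp J K \<pi> b) (Cod J g)) (ce (PComp F g f) x))
          (Comp (Cat V) (ce (TArr (cone_postcomp J K \<pi> b) g) (mo (PArr F f) x)) (ce (TArr (cone_postcomp J K \<pi> b) f) x))"
      using e[OF i(1)] i(2) e[OF f x] e[OF g fx] cone_comp[OF c fh gh x] mp[OF cd homD[OF pc, THEN conjunct1]] x cd
      by (simp del: PsAlg_cell_sel cone_postcomp_sel(2) pmor_comp_sel)
  qed
qed

text \<open>The modification axiom at \<open>f\<close> and \<open>x\<close> is naturality of \<beta>
  at the arrow \<open>ce (TArr \<pi> f) x\<close>.\<close>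

lemma cone_functor_AMap:
  assumes W: "W \<in> small_palgs T" and V: "V \<in> small_palgs T" and c: "cone W \<pi>" and \<beta>: "\<beta> \<in> hom (Mor K W V) b b'"
  shows "AMap (cone_functor J K F W \<pi> V) \<beta> \<in> hom (Cones V) (cone_postcomp J K \<pi> b) (cone_postcomp J K \<pi> b')"
    and "j \<in> Obj J \<Longrightarrow> x \<in> Obj (FX j) \<Longrightarrow> ce (MoComp (AMap (cone_functor J K F W \<pi> V) \<beta>) j) x = ce \<beta> (mo (TObj \<pi> j) x)"
proof -
  have b: "mor W V b" "mor W V b'" "\<beta> \<in> cells b b'" using \<beta> hom_Mor_iff[OF W V] by auto
  interpret b: pointwise_mor T W V b by fact
  interpret b': pointwise_mor T W V b' by fact
  note w = whisker_right[OF b(1,2) cone_mor[OF c] b(3)]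
  have A: "AMap (cone_functor J K F W \<pi> V) \<beta> = \<lparr>MoSrc = cone_postcomp J K \<pi> b, MoTrg = cone_postcomp J K \<pi> b',
      MoComp = restrict (\<lambda>j. HComp K \<beta> (id2 K (TObj \<pi> j))) (Obj J)\<rparr>"
    using homD[OF \<beta>] by (simp add: cone_functor_def)
  show e: "ce (MoComp (AMap (cone_functor J K F W \<pi> V) \<beta>) j) x = ce \<beta> (mo (TObj \<pi> j) x)" if "j \<in> Obj J" "x \<in> Obj (FX j)" for j x
    unfolding A using w(2)[OF that] that by (simp del: PsAlg_cell_sel)
  show "AMap (cone_functor J K F W \<pi> V) \<beta> \<in> hom (Cones V) (cone_postcomp J K \<pi> b) (cone_postcomp J K \<pi> b')"
    unfolding hom_Cones_iff[OF V]
  proof (intro conjI ballI)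
    show "cone V (cone_postcomp J K \<pi> b)" "cone V (cone_postcomp J K \<pi> b')" using cone_postcomp(1)[OF c] b by auto
    fix f x assume f: "f \<in> Arr J" and x: "x \<in> Obj (FX (Dom J f))"
    note fh = J.Arr_hom[OF f] and d = J.Dom_closed[OF f] and cd = J.Cod_closed[OF f]
    interpret Ff: pointwise_mor T "PObj F (Dom J f)" "PObj F (Cod J f)" "PArr F f" by (rule F_mor[OF fh])
    have fx: "mo (PArr F f) x \<in> Obj (FX (Cod J f))" by (rule Ff.MD(3)[OF x])
    have h: "ce (TArr \<pi> f) x \<in> hom (Cat W) (mo (TObj \<pi> (Dom J f)) x) (mo (TObj \<pi> (Cod J f)) (mo (PArr F f) x))"
      using cell_hom[OF cone_mor[OF c d] mor_comp[OF F_mor[OF fh] cone_mor[OF c cd]] cone_cell[OF c fh] x] x Ff.MD(1) by simp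
    from cell_square[OF b h]
    show "Comp (Cat V) (ce (MoComp (AMap (cone_functor J K F W \<pi> V) \<beta>) (Cod J f)) (mo (PArr F f) x)) (ce (TArr (cone_postcomp J K \<pi> b) f) x)
      = Comp (Cat V) (ce (TArr (cone_postcomp J K \<pi> b') f) x) (ce (MoComp (AMap (cone_functor J K F W \<pi> V) \<beta>) (Dom J f)) x)"
      unfolding e[OF d x] e[OF cd fx] cone_postcomp(2)[OF c b(1) f x] cone_postcomp(2)[OF c b(2) f x] by (simp add: square_def)
  qed (use w(1) in \<open>simp_all add: A del: PsAlg_cell_sel\<close>)
qed

text \<open>Preservation of identities and composites is tested on components, where it is the
  formula for identity 2-cells and vertical composites at the objects
  \<open>mo (TObj \<pi> j) x\<close>.\<close>

lemma cone_functor_functors: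
  assumes W: "W \<in> small_palgs T" and V: "V \<in> small_palgs T" and c: "cone W \<pi>"
  shows "cone_functor J K F W \<pi> V \<in> functors (Mor K W V) (Cones V)"
proof (rule functorsI_hom[OF category_Mor[OF W V]])
  let ?F = "cone_functor J K F W \<pi> V"
  interpret V: pointwise_algebra T V by (rule small_palgs_pointwise[OF V])
  interpret M: category "Mor K W V" by (rule category_Mor[OF W V])
  note A = cone_functor_AMap[OF W V c]
  have O: "OMap ?F b = cone_postcomp J K \<pi> b" if "mor W V b" for b
    using that hom_Und_iff[OF W V] by (simp add: cone_functor_def)
  {
    fix b assume "b \<in> Obj (Mor K W V)"
    then have b: "mor W V b" using hom_Und_iff[OF W V] by simp
    interpret b: pointwise_mor T W V b by fact
    note cb = cone_postcomp(1)[OF c b]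
    show "OMap ?F b \<in> Obj (Cones V)" using Cones_Obj[OF V] O[OF b] cb by simp
    have ib: "id2 K b \<in> hom (Mor K W V) b b" unfolding hom_Mor_iff[OF W V] using b id_cell(1)[OF b] by simp
    show "AMap ?F (Id (Mor K W V) b) = Id (Cones V) (OMap ?F b)"
    proof (unfold Mor_sel O[OF b], rule modif_eqI[OF V A(1)[OF ib] Id_Cones_hom(1)[OF V cb]])
      fix j x assume j: "j \<in> Obj J" and x: "x \<in> Obj (FX j)"
      interpret p: pointwise_mor T "PObj F j" W "TObj \<pi> j" by (rule cone_mor[OF c j])
      show "ce (MoComp (AMap ?F (id2 K b)) j) x = ce (MoComp (Id (Cones V) (cone_postcomp J K \<pi> b)) j) x"
        unfolding A(2)[OF ib j x] Id_Cones_hom(2)[OF V cb j x] id_cell(2)[OF b p.MD(3)[OF x]]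
        using j x p.MD(1) by simp
    qed
  }
  {
    fix \<beta> b b' assume "\<beta> \<in> hom (Mor K W V) b b'"
    then show "AMap ?F \<beta> \<in> hom (Cones V) (OMap ?F b) (OMap ?F b')"
      using A(1)[of \<beta> b b'] O hom_Mor_iff[OF W V] by simp
  }
  {
    fix \<beta> \<gamma> b b' b'' assume \<beta>: "\<beta> \<in> hom (Mor K W V) b b'" and \<gamma>: "\<gamma> \<in> hom (Mor K W V) b' b''"
    have m: "mor W V b" "mor W V b'" "mor W V b''" "\<beta> \<in> cells b b'" "\<gamma> \<in> cells b' b''"
      using \<beta> \<gamma> hom_Mor_iff[OF W V] by auto
    note \<gamma>\<beta> = M.Comp_hom[OF \<beta> \<gamma>]
    show "AMap ?F (Comp (Mor K W V) \<gamma> \<beta>) = Comp (Cones V) (AMap ?F \<gamma>) (AMap ?F \<beta>)"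
    proof (rule modif_eqI[OF V A(1)[OF \<gamma>\<beta>] Comp_Cones_hom(1)[OF V A(1)[OF \<beta>] A(1)[OF \<gamma>]]])
      fix j x assume j: "j \<in> Obj J" and x: "x \<in> Obj (FX j)"
      interpret p: pointwise_mor T "PObj F j" W "TObj \<pi> j" by (rule cone_mor[OF c j])
      show "ce (MoComp (AMap ?F (Comp (Mor K W V) \<gamma> \<beta>)) j) x = ce (MoComp (Comp (Cones V) (AMap ?F \<gamma>) (AMap ?F \<beta>)) j) x"
        unfolding A(2)[OF \<gamma>\<beta> j x] Comp_Cones_hom(2)[OF V A(1)[OF \<beta>] A(1)[OF \<gamma>] j x] A(2)[OF \<beta> j x] A(2)[OF \<gamma> j x]
        using vcomp_cell(2)[OF m p.MD(3)[OF x]] by (simp del: PsAlg_cell_sel)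
    qed
  }
qed (simp_all add: cone_functor_def)

end

section \<open>The term model\<close>

text \<open>Untyped terms; arities and membership are imposed by \<open>Tm\<close>.
  \<open>Op\<close> takes a whole word of \<open>T\<close>, and no term is rewritten: applying a
  composite word and nesting applications give different terms.\<close>

datatype ('t, 'jo, 'u) tm = In 'jo 'u | Op 't "('t, 'jo, 'u) tm list"

text \<open>An arrow of the term model is stored as its source, its target and the family of its values in
  all cones to small pseudo algebras, so arrows with the same values are equal without passing to a quotient.\<close>

type_synonym ('t, 'jo, 'ja, 'u) garr = "('t, 'jo, 'u) tm \<times> ('t, 'jo, 'u) tm \<times>
  (('t, 'u, 'u) palg \<times> ('jo, 'ja, ('t, 'u, 'u) pmor, ('t, 'u, 'u) pcell) psnat \<Rightarrow> 'u)"

abbreviation src :: "('t, 'jo, 'ja, 'u) garr \<Rightarrow> ('t, 'jo, 'u) tm" where "src g \<equiv> fst g"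
abbreviation trg :: "('t, 'jo, 'ja, 'u) garr \<Rightarrow> ('t, 'jo, 'u) tm" where "trg g \<equiv> fst (snd g)"
abbreviation val :: "('t, 'jo, 'ja, 'u) garr \<Rightarrow> ('t, 'u, 'u) palg \<Rightarrow>
    ('jo, 'ja, ('t, 'u, 'u) pmor, ('t, 'u, 'u) pcell) psnat \<Rightarrow> 'u" where
  "val g V \<sigma> \<equiv> snd (snd g) (V, \<sigma>)"

text \<open>The extension of the cone \<sigma> to all terms that is strict for the operations. It
  exists without any coherence because the terms are free.\<close>

primrec ob :: "('t, 'u, 'u) palg \<Rightarrow> ('jo, 'ja, ('t, 'u, 'u) pmor, ('t, 'u, 'u) pcell) psnat \<Rightarrow> ('t, 'jo, 'u) tm \<Rightarrow> 'u" where
  "ob V \<sigma> (In j x) = mo (TObj \<sigma> j) x"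
| "ob V \<sigma> (Op w ts) = opo V w (map (ob V \<sigma>) ts)"

context diagram
begin

inductive_set Tm :: "('t, 'jo, 'u) tm set" where
  In: "j \<in> Obj J \<Longrightarrow> x \<in> Obj (FX j) \<Longrightarrow> In j x \<in> Tm"
| Op: "w \<in> words T (length ts) \<Longrightarrow> \<forall>t \<in> set ts. t \<in> Tm \<Longrightarrow> Op w ts \<in> Tm"

text \<open>Values outside small algebras and cones are pinned to \<open>undefined\<close>, so that
  arrows with the same ends and the same values at all cones are equal in HOL.\<close>

definition mk :: "('t, 'jo, 'u) tm \<Rightarrow> ('t, 'jo, 'u) tm \<Rightarrow> (('t, 'u, 'u) palg \<Rightarrow>
    ('jo, 'ja, ('t, 'u, 'u) pmor, ('t, 'u, 'u) pcell) psnat \<Rightarrow> 'u) \<Rightarrow> ('t, 'jo, 'ja, 'u) garr" where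
  "mk s t \<phi> = (s, t, \<lambda>(V, \<sigma>). if V \<in> small_palgs T \<and> cone V \<sigma> then \<phi> V \<sigma> else undefined)"

lemma mk_sel [simp]: "src (mk s t \<phi>) = s" "trg (mk s t \<phi>) = t"
  "V \<in> small_palgs T \<Longrightarrow> cone V \<sigma> \<Longrightarrow> val (mk s t \<phi>) V \<sigma> = \<phi> V \<sigma>"
  by (simp_all add: mk_def)

text \<open>Each formal arrow takes as its value the datum of \<open>V\<close> or \<sigma> that it
  stands for. Source and target are remembered as terms, because composability is decided on terms
  and not on their values.\<close>

definition "gid t = mk t t (\<lambda>V \<sigma>. Id (Cat V) (ob V \<sigma> t))"
definition "gcomp h g = mk (src g) (trg h) (\<lambda>V \<sigma>. Comp (Cat V) (val h V \<sigma>) (val g V \<sigma>))"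
definition "ginv g = mk (trg g) (src g) (\<lambda>V \<sigma>. inv_arr (Cat V) (val g V \<sigma>))"
definition "gop w gs = mk (Op w (map src gs)) (Op w (map trg gs)) (\<lambda>V \<sigma>. opa V w (map (\<lambda>g. val g V \<sigma>) gs))"
definition "gin j f = mk (In j (Dom (FX j) f)) (In j (Cod (FX j) f)) (\<lambda>V \<sigma>. ma (TObj \<sigma> j) f)"
definition "gasc w ws ts = mk (Op (gam T w ws) ts) (Op w (evs T Op ws ts)) (\<lambda>V \<sigma>. asc V w ws (map (ob V \<sigma>) ts))"
definition "gunt t = mk (Op (word1 T) [t]) t (\<lambda>V \<sigma>. unt V [ob V \<sigma> t])"
definition "gsbs w l f ts = mk (Op (subst_word T l w f) ts) (Op w (map ((!) ts) f)) (\<lambda>V \<sigma>. sbs V w l f (map (ob V \<sigma>) ts))"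
definition "grho j w xs = mk (In j (opo (PObj F j) w xs)) (Op w (map (In j) xs)) (\<lambda>V \<sigma>. rho (TObj \<sigma> j) w xs)"
definition "gcone f x = mk (In (Dom J f) x) (In (Cod J f) (mo (PArr F f) x)) (\<lambda>V \<sigma>. ce (TArr \<sigma> f) x)"

lemmas g_defs = gid_def gcomp_def ginv_def gop_def gin_def gasc_def gunt_def gsbs_def grho_def gcone_def

text \<open>The generators that receive formal inverses. The first three are the coherences of
  \<open>W\<close>; \<open>grho\<close> makes the inclusion of each \<open>PObj F j\<close> a
  morphism, and \<open>gcone\<close> makes these inclusions a cone. Arrows of the diagram's algebras
  are kept out, as they need not be invertible.\<close>

inductive_set Str :: "('t, 'jo, 'ja, 'u) garr set" where
  asc: "w \<in> words T (length ws) \<Longrightarrow> word_list T ws \<Longrightarrow> set ts \<subseteq> Tm \<Longrightarrow>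
    length ts = sum_list (map (Dom T) ws) \<Longrightarrow> gasc w ws ts \<in> Str"
| unt: "t \<in> Tm \<Longrightarrow> gunt t \<in> Str"
| sbs: "w \<in> words T k \<Longrightarrow> fin_fun k l f \<Longrightarrow> set ts \<subseteq> Tm \<Longrightarrow> length ts = l \<Longrightarrow> gsbs w l f ts \<in> Str"
| rho: "j \<in> Obj J \<Longrightarrow> w \<in> words T n \<Longrightarrow> xs \<in> Obj (pow_cat (FX j) n) \<Longrightarrow> grho j w xs \<in> Str"
| cone: "f \<in> Arr J \<Longrightarrow> x \<in> Obj (FX (Dom J f)) \<Longrightarrow> gcone f x \<in> Str"

text \<open>No relations are imposed. That \<open>gin\<close> is functorial, that the structural
  arrows are natural and that the coherence axioms hold will all follow from the comparison of
  arrows by value.\<close>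

inductive_set Gen :: "('t, 'jo, 'ja, 'u) garr set" where
  gid: "t \<in> Tm \<Longrightarrow> gid t \<in> Gen"
| gcomp: "g \<in> Gen \<Longrightarrow> h \<in> Gen \<Longrightarrow> src h = trg g \<Longrightarrow> gcomp h g \<in> Gen"
| gop: "w \<in> words T (length gs) \<Longrightarrow> \<forall>g \<in> set gs. g \<in> Gen \<Longrightarrow> gop w gs \<in> Gen"
| gin: "j \<in> Obj J \<Longrightarrow> f \<in> Arr (FX j) \<Longrightarrow> gin j f \<in> Gen"
| str: "g \<in> Str \<Longrightarrow> g \<in> Gen"
| inv: "g \<in> Str \<Longrightarrow> ginv g \<in> Gen"

lemma F_pointwise: "j \<in> Obj J \<Longrightarrow> pointwise_algebra T (PObj F j)"
  by (rule small_palgs_pointwise[OF F_small])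

lemma ob_Obj:
  assumes "V \<in> small_palgs T" "cone V \<sigma>" "t \<in> Tm"
  shows "ob V \<sigma> t \<in> Obj (Cat V)"
  using assms(3)
proof induction
  case (In j x)
  interpret m: pointwise_mor T "PObj F j" V "TObj \<sigma> j" by (rule cone_mor[OF assms(2) In(1)])
  show ?case using m.MD(3)[OF In(2)] by simp
next
  case (Op w ts)
  interpret V: pointwise_algebra T V by (rule small_palgs_pointwise[OF assms(1)])
  show ?case using V.PhiD(3)[OF Op(1), of "map (ob V \<sigma>) ts"] Op(2) by auto
qed

lemma map_ob_Obj:
  assumes "V \<in> small_palgs T" "cone V \<sigma>" "set ts \<subseteq> Tm" "length ts = n"
  shows "map (ob V \<sigma>) ts \<in> Obj (pow_cat (Cat V) n)"
  using ob_Obj[OF assms(1,2)] assms(3,4) by auto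

lemma map_ob_evs: "map (ob V \<sigma>) (evs T Op ws ts) = evs T (opo V) ws (map (ob V \<sigma>) ts)"
  by (simp add: map_evs evs_map)

lemma evs_Op_Tm:
  assumes "word_list T ws" "set ts \<subseteq> Tm" "length ts = sum_list (map (Dom T) ws)"
  shows "set (evs T Op ws ts) \<subseteq> Tm"
  using assms by (intro set_evs Tm.Op) (auto simp: word_list_def)

text \<open>The last clause matches the convention in \<open>mk\<close>: it makes agreement at all
  cones sufficient for equality.\<close>

definition typed :: "('t, 'jo, 'ja, 'u) garr \<Rightarrow> bool" where
  "typed g \<longleftrightarrow> src g \<in> Tm \<and> trg g \<in> Tm \<and>
    (\<forall>V \<sigma>. V \<in> small_palgs T \<longrightarrow> cone V \<sigma> \<longrightarrow> val g V \<sigma> \<in> hom (Cat V) (ob V \<sigma> (src g)) (ob V \<sigma> (trg g))) \<and>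
    (\<forall>V \<sigma>. \<not> (V \<in> small_palgs T \<and> cone V \<sigma>) \<longrightarrow> val g V \<sigma> = undefined)"

lemma typed_mk:
  assumes "s \<in> Tm" "t \<in> Tm"
    "\<And>V \<sigma>. V \<in> small_palgs T \<Longrightarrow> cone V \<sigma> \<Longrightarrow> \<phi> V \<sigma> \<in> hom (Cat V) (ob V \<sigma> s) (ob V \<sigma> t)"
  shows "typed (mk s t \<phi>)"
  using assms by (simp add: typed_def mk_def)

lemma typed_val: "typed g \<Longrightarrow> V \<in> small_palgs T \<Longrightarrow> cone V \<sigma> \<Longrightarrow>
    val g V \<sigma> \<in> hom (Cat V) (ob V \<sigma> (src g)) (ob V \<sigma> (trg g))"
  by (simp add: typed_def)

lemma garr_eqI:
  assumes "typed g" "typed h" "src g = src h" "trg g = trg h"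
    "\<And>V \<sigma>. V \<in> small_palgs T \<Longrightarrow> cone V \<sigma> \<Longrightarrow> val g V \<sigma> = val h V \<sigma>"
  shows "g = h"
proof -
  have "snd (snd g) = snd (snd h)"
    using assms(1,2,5) unfolding typed_def by (intro ext) (metis surj_pair)
  then show ?thesis using assms(3,4) by (cases g; cases h) auto
qed

text \<open>At a cone, a structural arrow takes as its value a component of a natural isomorphism or
  of an invertible cone cell. Invertibility of the value is what gives \<open>ginv\<close> a
  meaningful value.\<close>

lemma Str_typed:
  assumes "g \<in> Str"
  shows "typed g \<and> (\<forall>V \<sigma>. V \<in> small_palgs T \<longrightarrow> cone V \<sigma> \<longrightarrow> iso_in (Cat V) (val g V \<sigma>))"
  using assms
proof induction
  case (asc w ws ts)
  note ts = map_ob_Obj[OF _ _ asc(3,4)]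
  have "gam T w ws \<in> words T (length ts)" using gam_words[OF asc(1,2)] asc(4) by simp
  then have "Op (gam T w ws) ts \<in> Tm" "Op w (evs T Op ws ts) \<in> Tm"
    using asc evs_Op_Tm[OF asc(2-4)] by (auto intro!: Tm.Op)
  moreover have "asc V w ws (map (ob V \<sigma>) ts) \<in> hom (Cat V) (ob V \<sigma> (Op (gam T w ws) ts)) (ob V \<sigma> (Op w (evs T Op ws ts)))
      \<and> iso_in (Cat V) (asc V w ws (map (ob V \<sigma>) ts))"
    if V: "V \<in> small_palgs T" "cone V \<sigma>" for V \<sigma>
  proof -
    interpret V: pointwise_algebra T V by (rule small_palgs_pointwise[OF V(1)])
    show ?thesis using V.asc_hom[OF asc(1,2) ts[OF V]] V.asc_iso[OF asc(1,2) ts[OF V]] by (simp only: ob.simps map_ob_evs)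
  qed
  ultimately show ?case unfolding gasc_def by (auto intro!: typed_mk)
next
  case (unt t)
  have "Op (word1 T) [t] \<in> Tm" using unt word1_words by (auto intro!: Tm.Op)
  moreover have "unt V [ob V \<sigma> t] \<in> hom (Cat V) (ob V \<sigma> (Op (word1 T) [t])) (ob V \<sigma> t) \<and> iso_in (Cat V) (unt V [ob V \<sigma> t])"
    if V: "V \<in> small_palgs T" "cone V \<sigma>" for V \<sigma>
  proof -
    interpret V: pointwise_algebra T V by (rule small_palgs_pointwise[OF V(1)])
    show ?thesis using V.unt_hom[OF ob_Obj[OF V unt]] V.unt_iso[OF ob_Obj[OF V unt]] by simp
  qed
  ultimately show ?case unfolding gunt_def using unt by (auto intro!: typed_mk)
next
  case (sbs w k l f ts)
  note ts = map_ob_Obj[OF _ _ sbs(3,4)]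
  have m: "map (ob V \<sigma>) (map ((!) ts) f) = map ((!) (map (ob V \<sigma>) ts)) f" for V \<sigma>
    using sbs(2,4) by (auto simp: fin_fun_def)
  have "set (map ((!) ts) f) \<subseteq> Tm" using set_map_nth[OF sbs(2,4)] sbs(3) by blast
  then have "Op (subst_word T l w f) ts \<in> Tm" "Op w (map ((!) ts) f) \<in> Tm"
    using sbs subst_word_words[OF sbs(1,2)] by (auto intro!: Tm.Op simp: fin_fun_def)
  moreover have "sbs V w l f (map (ob V \<sigma>) ts) \<in> hom (Cat V) (ob V \<sigma> (Op (subst_word T l w f) ts)) (ob V \<sigma> (Op w (map ((!) ts) f)))
      \<and> iso_in (Cat V) (sbs V w l f (map (ob V \<sigma>) ts))"
    if V: "V \<in> small_palgs T" "cone V \<sigma>" for V \<sigma>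
  proof -
    interpret V: pointwise_algebra T V by (rule small_palgs_pointwise[OF V(1)])
    show ?thesis using V.sbs_hom[OF sbs(1,2) ts[OF V]] V.sbs_iso[OF sbs(1,2) ts[OF V]] by (simp only: ob.simps m)
  qed
  ultimately show ?case unfolding gsbs_def by (auto intro!: typed_mk)
next
  case (rho j w n xs)
  interpret Fj: pointwise_algebra T "PObj F j" by (rule F_pointwise[OF rho(1)])
  have "In j (opo (PObj F j) w xs) \<in> Tm" "Op w (map (In j) xs) \<in> Tm"
    using rho Fj.PhiD(3)[OF rho(2,3)] by (auto intro!: Tm.intros)
  moreover have "rho (TObj \<sigma> j) w xs \<in> hom (Cat V) (ob V \<sigma> (In j (opo (PObj F j) w xs))) (ob V \<sigma> (Op w (map (In j) xs)))
      \<and> iso_in (Cat V) (rho (TObj \<sigma> j) w xs)"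
    if V: "V \<in> small_palgs T" "cone V \<sigma>" for V \<sigma>
  proof -
    interpret m: pointwise_mor T "PObj F j" V "TObj \<sigma> j" by (rule cone_mor[OF V(2) rho(1)])
    show ?thesis using m.rho_hom[OF rho(2,3)] m.rho_iso[OF rho(2,3)] by (simp add: comp_def)
  qed
  ultimately show ?case unfolding grho_def by (auto intro!: typed_mk)
next
  case (cone f x)
  note fh = J.Arr_hom[OF cone(1)] and d = J.Dom_closed[OF cone(1)] and cd = J.Cod_closed[OF cone(1)]
  interpret Ff: pointwise_mor T "PObj F (Dom J f)" "PObj F (Cod J f)" "PArr F f" by (rule F_mor[OF fh])
  have "In (Dom J f) x \<in> Tm" "In (Cod J f) (mo (PArr F f) x) \<in> Tm"
    using cone(2) d cd Ff.MD(3)[OF cone(2)] by (auto intro!: Tm.In)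
  moreover have "ce (TArr \<sigma> f) x \<in> hom (Cat V) (ob V \<sigma> (In (Dom J f) x)) (ob V \<sigma> (In (Cod J f) (mo (PArr F f) x)))
      \<and> iso_in (Cat V) (ce (TArr \<sigma> f) x)"
    if V: "V \<in> small_palgs T" "cone V \<sigma>" for V \<sigma>
    using cell_hom[OF cone_mor[OF V(2) d] mor_comp[OF F_mor[OF fh] cone_mor[OF V(2) cd]] cone_cell[OF V(2) fh] cone(2)]
      cone_iso[OF V(2) fh cone(2)] cone(2) Ff.MD(1) by simp
  ultimately show ?case unfolding gcone_def by (auto intro!: typed_mk)
qed

text \<open>Induction on the generation of arrows; the formal inverses are the case that needs the
  second half of \<open>Str_typed\<close>.\<close>

lemma Gen_typed: "g \<in> Gen \<Longrightarrow> typed g"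
proof (induction rule: Gen.induct)
  case (gid t)
  show ?case unfolding gid_def
  proof (rule typed_mk[OF gid gid])
    fix V \<sigma> assume V: "V \<in> small_palgs T" "cone V \<sigma>"
    interpret V: pointwise_algebra T V by (rule small_palgs_pointwise[OF V(1)])
    show "Id (Cat V) (ob V \<sigma> t) \<in> hom (Cat V) (ob V \<sigma> t) (ob V \<sigma> t)" by (rule V.X.Id_hom[OF ob_Obj[OF V gid]])
  qed
next
  case (gcomp g h)
  show ?case unfolding gcomp_def
  proof (rule typed_mk)
    fix V \<sigma> assume V: "V \<in> small_palgs T" "cone V \<sigma>"
    interpret V: pointwise_algebra T V by (rule small_palgs_pointwise[OF V(1)])
    show "Comp (Cat V) (val h V \<sigma>) (val g V \<sigma>) \<in> hom (Cat V) (ob V \<sigma> (src g)) (ob V \<sigma> (trg h))"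
      using V.X.Comp_hom[OF typed_val[OF gcomp(4) V]] typed_val[OF gcomp(5) V] gcomp(3) by simp
  qed (use gcomp in \<open>simp_all add: typed_def\<close>)
next
  case (gop w gs)
  show ?case unfolding gop_def
  proof (rule typed_mk)
    show "Op w (map src gs) \<in> Tm" "Op w (map trg gs) \<in> Tm" using gop by (auto intro!: Tm.Op simp: typed_def)
    fix V \<sigma> assume V: "V \<in> small_palgs T" "cone V \<sigma>"
    interpret V: pointwise_algebra T V by (rule small_palgs_pointwise[OF V(1)])
    have "map (\<lambda>g. val g V \<sigma>) gs \<in> hom (pow_cat (Cat V) (length gs)) (map (ob V \<sigma>) (map src gs)) (map (ob V \<sigma>) (map trg gs))"
      using gop(2) typed_val[OF _ V] by (simp add: hom_pow_iff)
    from V.PhiD(5)[OF gop(1) this]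
    show "opa V w (map (\<lambda>g. val g V \<sigma>) gs) \<in> hom (Cat V) (ob V \<sigma> (Op w (map src gs))) (ob V \<sigma> (Op w (map trg gs)))"
      by simp
  qed
next
  case (gin j f)
  interpret Fj: pointwise_algebra T "PObj F j" by (rule F_pointwise[OF gin(1)])
  show ?case unfolding gin_def
  proof (rule typed_mk)
    show "In j (Dom (FX j) f) \<in> Tm" "In j (Cod (FX j) f) \<in> Tm"
      using gin Fj.X.Dom_closed Fj.X.Cod_closed by (auto intro!: Tm.In)
    fix V \<sigma> assume V: "V \<in> small_palgs T" "cone V \<sigma>"
    interpret m: pointwise_mor T "PObj F j" V "TObj \<sigma> j" by (rule cone_mor[OF V(2) gin(1)])
    show "ma (TObj \<sigma> j) f \<in> hom (Cat V) (ob V \<sigma> (In j (Dom (FX j) f))) (ob V \<sigma> (In j (Cod (FX j) f)))"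
      using m.MD(5)[OF Fj.X.Arr_hom[OF gin(2)]] by simp
  qed
next
  case (str g)
  then show ?case using Str_typed by blast
next
  case (inv g)
  show ?case unfolding ginv_def
  proof (rule typed_mk)
    fix V \<sigma> assume V: "V \<in> small_palgs T" "cone V \<sigma>"
    interpret V: pointwise_algebra T V by (rule small_palgs_pointwise[OF V(1)])
    show "inv_arr (Cat V) (val g V \<sigma>) \<in> hom (Cat V) (ob V \<sigma> (trg g)) (ob V \<sigma> (src g))"
      using V.X.inv_arr(1) Str_typed[OF inv] V typed_val by blast
  qed (use Str_typed[OF inv] in \<open>simp_all add: typed_def\<close>)
qed

end

section \<open>Smallness of the sets of terms and of arrows\<close>

locale small_diagram = diagram T J F for T :: "'t thy" and J :: "('jo, 'ja) cat"
    and F :: "('jo, 'ja, ('t, 'u, 'u) palg, ('t, 'u, 'u) pmor, ('t, 'u, 'u) pcell) psfun" +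
  assumes U: "universe TYPE('u)" and small_T: "small_cat TYPE('u) T" and small_J: "small_cat TYPE('u) J"
begin

lemma small_parts: "small_set TYPE('u) (Arr T)" "small_set TYPE('u) (Obj J)" "small_set TYPE('u) (Arr J)"
  "j \<in> Obj J \<Longrightarrow> small_set TYPE('u) (Obj (FX j))" "j \<in> Obj J \<Longrightarrow> small_set TYPE('u) (Arr (FX j))"
  using small_T small_J F_small by (auto simp: small_cat_def small_palgs_def)

lemma small_Tm: "small_set TYPE('u) Tm"
proof -
  let ?B = "(\<lambda>(j, x). In j x) ` (SIGMA j : Obj J. Obj (FX j))"
  have "small_set TYPE('u) (finitary_closure ?B (Arr T) Op)"
    using small_parts by (intro small_finitary_closure[OF U] small_image small_Sigma[OF U])
  moreover have "Tm \<subseteq> finitary_closure ?B (Arr T) Op"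
  proof
    fix t assume "t \<in> Tm"
    then show "t \<in> finitary_closure ?B (Arr T) Op"
    proof induction
      case (In j x)
      then show ?case by (intro finitary_closure.base image_eqI[of _ _ "(j, x)"]) auto
    next
      case (Op w ts)
      then show ?case using words_Arr by (intro finitary_closure.step) auto
    qed
  qed
  ultimately show ?thesis by (rule small_subset)
qed

lemma small_Str: "small_set TYPE('u) Str"
proof -
  \<comment> \<open>Structural arrows are indexed by finite lists over small sets. The side
    conditions on arities are dropped, which only enlarges the set, and finite functions are taken
    as arbitrary lists of natural numbers.\<close>
  let ?S = "(\<lambda>(w, ws, ts). gasc w ws ts) ` (Arr T \<times> lists (Arr T) \<times> lists Tm) \<union> gunt ` Tm
    \<union> (\<lambda>(w, l, f, ts). gsbs w l f ts) ` (Arr T \<times> UNIV \<times> lists UNIV \<times> lists Tm)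
    \<union> (\<lambda>(j, w, xs). grho j w xs) ` (SIGMA j : Obj J. Arr T \<times> lists (Obj (FX j)))
    \<union> (\<lambda>(f, x). gcone f x) ` (SIGMA f : Arr J. Obj (FX (Dom J f)))"
  have "small_set TYPE('u) ?S"
    using small_parts small_Tm J.Dom_closed
    by (intro small_Un[OF U] small_image small_Sigma[OF U] small_lists[OF U] small_nat[OF U]) auto
  moreover have "Str \<subseteq> ?S"
  proof
    fix g assume "g \<in> Str"
    then show "g \<in> ?S"
    proof cases
      case (asc w ws ts)
      then have "(w, ws, ts) \<in> Arr T \<times> lists (Arr T) \<times> lists Tm"
        using words_Arr by (auto simp: in_lists_conv_set word_list_def)
      then show ?thesis unfolding asc(1) by (intro UnI1 image_eqI[of _ _ "(w, ws, ts)"]) auto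
    next
      case (unt t)
      then show ?thesis by blast
    next
      case (sbs w k l f ts)
      then have "(w, l, f, ts) \<in> Arr T \<times> UNIV \<times> lists UNIV \<times> lists Tm"
        using words_Arr by (auto simp: in_lists_conv_set)
      then show ?thesis unfolding sbs(1) by (intro UnI1[OF UnI1[OF UnI2]] image_eqI[of _ _ "(w, l, f, ts)"]) auto
    next
      case (rho j w n xs)
      then have "(j, w, xs) \<in> (SIGMA j : Obj J. Arr T \<times> lists (Obj (FX j)))"
        using words_Arr by (auto simp: in_lists_conv_set)
      then show ?thesis unfolding rho(1) by (intro UnI1[OF UnI2] image_eqI[of _ _ "(j, w, xs)"]) auto
    next
      case (cone f x)
      then show ?thesis unfolding cone(1) by (intro UnI2 image_eqI[of _ _ "(f, x)"]) auto
    qed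
  qed
  ultimately show ?thesis by (rule small_subset)
qed

lemma small_Gen: "small_set TYPE('u) Gen"
proof -
  let ?B = "gid ` Tm \<union> (\<lambda>(j, f). gin j f) ` (SIGMA j : Obj J. Arr (FX j)) \<union> Str \<union> ginv ` Str"
  \<comment> \<open>\<open>None\<close> stands for composition, reading a list \<open>[g, h]\<close>
    as \<open>g\<close> followed by \<open>h\<close>; \<open>Some w\<close> stands for the operation
    of \<open>w\<close>.\<close>
  let ?P = "{None} \<union> Some ` Arr T"
  let ?h = "\<lambda>p gs. case p of None \<Rightarrow> gcomp (gs ! 1) (gs ! 0) | Some w \<Rightarrow> gop w gs"
  have B: "small_set TYPE('u) ?B"
    using small_parts small_Tm small_Str by (intro small_Un[OF U] small_image small_Sigma[OF U])
  have P: "small_set TYPE('u) ?P"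
    by (rule small_Un[OF U small_finite[OF U] small_image[OF small_parts(1)]]) simp
  have "Gen \<subseteq> finitary_closure ?B ?P ?h"
  proof
    fix g assume "g \<in> Gen"
    then show "g \<in> finitary_closure ?B ?P ?h"
    proof induction
      case (gid t)
      then show ?case by (intro finitary_closure.base) blast
    next
      case (gcomp g h)
      then show ?case using finitary_closure.step[of None ?P "[g, h]" ?B ?h] by simp
    next
      case (gop w gs)
      then show ?case using finitary_closure.step[of "Some w" ?P gs ?B ?h] words_Arr by auto
    next
      case (gin j f)
      then show ?case by (intro finitary_closure.base UnI1[OF UnI1[OF UnI2]] image_eqI[of _ _ "(j, f)"]) auto
    next
      case (str g)
      then show ?case by (intro finitary_closure.base) blast
    next
      case (inv g)
      then show ?case by (intro finitary_closure.base) blast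
    qed
  qed
  then show ?thesis by (rule small_subset[OF small_finitary_closure[OF U B P]])
qed

end

text \<open>The objects and arrows of a small pseudo algebra are elements of the universe \<open>'u\<close>; \<open>eo\<close> and \<open>ea\<close>
  encode terms and arrows in it.\<close>

locale term_model = small_diagram T J F for T :: "'t thy" and J :: "('jo, 'ja) cat"
    and F :: "('jo, 'ja, ('t, 'u, 'u) palg, ('t, 'u, 'u) pmor, ('t, 'u, 'u) pcell) psfun" +
  fixes eo :: "('t, 'jo, 'u) tm \<Rightarrow> 'u" and ea :: "('t, 'jo, 'ja, 'u) garr \<Rightarrow> 'u"
  assumes inj_eo: "inj_on eo Tm" and inj_ea: "inj_on ea Gen"
begin

definition "dc = the_inv_into Tm eo"
definition "dg = the_inv_into Gen ea"

lemma dc [simp]: "t \<in> Tm \<Longrightarrow> dc (eo t) = t"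
  unfolding dc_def by (rule the_inv_into_f_f[OF inj_eo])

lemma dg [simp]: "g \<in> Gen \<Longrightarrow> dg (ea g) = g"
  unfolding dg_def by (rule the_inv_into_f_f[OF inj_ea])

lemma map_dc [simp]: "set ts \<subseteq> Tm \<Longrightarrow> map (dc \<circ> eo) ts = ts"
  by (rule map_idI) auto

lemma map_dg [simp]: "set gs \<subseteq> Gen \<Longrightarrow> map (dg \<circ> ea) gs = gs"
  by (rule map_idI) auto

lemma Gen_Tm: "g \<in> Gen \<Longrightarrow> src g \<in> Tm" "g \<in> Gen \<Longrightarrow> trg g \<in> Tm"
  using Gen_typed by (auto simp: typed_def)

lemma Gen_val: "g \<in> Gen \<Longrightarrow> V \<in> small_palgs T \<Longrightarrow> cone V \<sigma> \<Longrightarrow>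
    val g V \<sigma> \<in> hom (Cat V) (ob V \<sigma> (src g)) (ob V \<sigma> (trg g))"
  using Gen_typed typed_val by blast

text \<open>The engine of the construction: to prove an equation in the term model it suffices to
  prove the equation of values in every small pseudo algebra, where the axioms are
  available.\<close>

lemma Gen_eqI:
  assumes "g \<in> Gen" "h \<in> Gen" "src g = src h" "trg g = trg h"
    "\<And>V \<sigma>. V \<in> small_palgs T \<Longrightarrow> cone V \<sigma> \<Longrightarrow> pointwise_algebra T V \<Longrightarrow> val g V \<sigma> = val h V \<sigma>"
  shows "g = h"
  using assms garr_eqI[OF Gen_typed Gen_typed] small_palgs_pointwise by blast

section \<open>The category of terms\<close>

definition WC :: "('u, 'u) cat" where
  "WC = \<lparr>Obj = eo ` Tm, Arr = ea ` Gen, Dom = (\<lambda>a. eo (src (dg a))), Cod = (\<lambda>a. eo (trg (dg a))),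
     Id = (\<lambda>u. ea (gid (dc u))), Comp = (\<lambda>b a. ea (gcomp (dg b) (dg a)))\<rparr>"

lemma WC_sel [simp]:
  "Obj WC = eo ` Tm" "Arr WC = ea ` Gen"
  "g \<in> Gen \<Longrightarrow> Dom WC (ea g) = eo (src g)" "g \<in> Gen \<Longrightarrow> Cod WC (ea g) = eo (trg g)"
  "t \<in> Tm \<Longrightarrow> Id WC (eo t) = ea (gid t)"
  "g \<in> Gen \<Longrightarrow> h \<in> Gen \<Longrightarrow> Comp WC (ea h) (ea g) = ea (gcomp h g)"
  by (simp_all add: WC_def)

lemma eo_eq: "s \<in> Tm \<Longrightarrow> t \<in> Tm \<Longrightarrow> eo s = eo t \<longleftrightarrow> s = t"
  using inj_eo by (auto simp: inj_on_def)

lemma WC_hom: "g \<in> Gen \<Longrightarrow> ea g \<in> hom WC (eo (src g)) (eo (trg g))"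
  by (simp add: hom_def)

lemma WC_homE:
  assumes "a \<in> hom WC x y"
  obtains g where "g \<in> Gen" "a = ea g" "x = eo (src g)" "y = eo (trg g)"
  using assms by (auto simp: hom_def)

text \<open>Each law holds in every \<open>Cat V\<close>, hence for the recorded values.\<close>

lemma WC_category: "category WC"
proof
  fix a assume "a \<in> Arr WC"
  then show "Dom WC a \<in> Obj WC" "Cod WC a \<in> Obj WC" using Gen_Tm by auto
next
  fix x assume "x \<in> Obj WC"
  then obtain t where t: "t \<in> Tm" "x = eo t" by auto
  then show "Id WC x \<in> hom WC x x" using WC_hom[OF Gen.gid[OF t(1)]] by (simp add: gid_def)
next
  fix a x y assume "a \<in> hom WC x y"
  then obtain g where g: "g \<in> Gen" "a = ea g" "x = eo (src g)" "y = eo (trg g)" by (rule WC_homE)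
  note s = Gen_Tm(1)[OF g(1)] and t = Gen_Tm(2)[OF g(1)]
  note ids = Gen.gid[OF s] and idt = Gen.gid[OF t]
  have "gcomp g (gid (src g)) = g"
  proof (rule Gen_eqI[OF Gen.gcomp[OF ids g(1)] g(1)])
    fix V \<sigma> assume V: "V \<in> small_palgs T" "cone V \<sigma>" and "pointwise_algebra T V"
    interpret V: pointwise_algebra T V by fact
    show "val (gcomp g (gid (src g))) V \<sigma> = val g V \<sigma>"
      using V V.X.Comp_Id_right[OF Gen_val[OF g(1) V]] by (simp add: gcomp_def gid_def)
  qed (simp_all add: gcomp_def gid_def)
  then show "Comp WC a (Id WC x) = a" using g s ids by simp
  have "gcomp (gid (trg g)) g = g"
  proof (rule Gen_eqI[OF Gen.gcomp[OF g(1) idt] g(1)])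
    fix V \<sigma> assume V: "V \<in> small_palgs T" "cone V \<sigma>" and "pointwise_algebra T V"
    interpret V: pointwise_algebra T V by fact
    show "val (gcomp (gid (trg g)) g) V \<sigma> = val g V \<sigma>"
      using V V.X.Comp_Id_left[OF Gen_val[OF g(1) V]] by (simp add: gcomp_def gid_def)
  qed (simp_all add: gcomp_def gid_def)
  then show "Comp WC (Id WC y) a = a" using g t idt by simp
  fix b z assume "b \<in> hom WC y z"
  then obtain h where h: "h \<in> Gen" "b = ea h" "y = eo (src h)" "z = eo (trg h)" by (rule WC_homE)
  \<comment> \<open>Composability in \<open>WC\<close> is equality of codes; injectivity of
    \<open>eo\<close> turns it into the equality of terms under which \<open>Gen\<close> is closed
    under \<open>gcomp\<close>.\<close>
  have hg: "src h = trg g" using g h eo_eq[OF Gen_Tm(1)[OF h(1)] t] by simp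
  note gc = Gen.gcomp[OF g(1) h(1) hg]
  show "Comp WC b a \<in> hom WC x z"
    using WC_hom[OF gc] g h by (simp add: gcomp_def)
  fix c v assume "c \<in> hom WC z v"
  then obtain k where k: "k \<in> Gen" "c = ea k" "z = eo (src k)" "v = eo (trg k)" by (rule WC_homE)
  have kh: "src k = trg h" using k h eo_eq[OF Gen_Tm(1)[OF k(1)] Gen_Tm(2)[OF h(1)]] by simp
  note kc = Gen.gcomp[OF h(1) k(1) kh]
  have k1: "src k = trg (gcomp h g)" and k2: "src (gcomp k h) = trg g" using kh hg by (simp_all add: gcomp_def)
  have "gcomp k (gcomp h g) = gcomp (gcomp k h) g"
  proof (rule Gen_eqI[OF Gen.gcomp[OF gc k(1) k1] Gen.gcomp[OF g(1) kc k2]])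
    fix V \<sigma> assume V: "V \<in> small_palgs T" "cone V \<sigma>" and "pointwise_algebra T V"
    interpret V: pointwise_algebra T V by fact
    show "val (gcomp k (gcomp h g)) V \<sigma> = val (gcomp (gcomp k h) g) V \<sigma>"
      using V V.X.Comp_assoc[OF Gen_val[OF g(1) V, folded hg] Gen_val[OF h(1) V, folded kh] Gen_val[OF k(1) V]]
      by (simp add: gcomp_def)
  qed (simp_all add: gcomp_def)
  then show "Comp WC c (Comp WC b a) = Comp WC (Comp WC c b) a" using g h k gc kc by simp
qed

lemma WC_pow_ObjE:
  assumes "us \<in> Obj (pow_cat WC n)"
  obtains ts where "us = map eo ts" "set ts \<subseteq> Tm" "length ts = n"
proof -
  have "us \<in> lists (eo ` Tm)" using assms by (auto simp: in_lists_conv_set)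
  then obtain ts where "ts \<in> lists Tm" "us = map eo ts" by (auto simp: lists_image)
  then show ?thesis using that[of ts] assms by (auto simp: in_lists_conv_set)
qed

lemma WC_pow_ArrE:
  assumes "us \<in> Arr (pow_cat WC n)"
  obtains gs where "us = map ea gs" "set gs \<subseteq> Gen" "length gs = n"
proof -
  have "us \<in> lists (ea ` Gen)" using assms by (auto simp: in_lists_conv_set)
  then obtain gs where "gs \<in> lists Gen" "us = map ea gs" by (auto simp: lists_image)
  then show ?thesis using that[of gs] assms by (auto simp: in_lists_conv_set)
qed

lemma WC_pow_ObjI: "set ts \<subseteq> Tm \<Longrightarrow> length ts = n \<Longrightarrow> map eo ts \<in> Obj (pow_cat WC n)"
  by auto

lemma WC_pow_ArrI: "set gs \<subseteq> Gen \<Longrightarrow> length gs = n \<Longrightarrow> map ea gs \<in> Arr (pow_cat WC n)"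
  by auto

lemma set_src: "set gs \<subseteq> Gen \<Longrightarrow> set (map src gs) \<subseteq> Tm"
  and set_trg: "set gs \<subseteq> Gen \<Longrightarrow> set (map trg gs) \<subseteq> Tm"
  using Gen_Tm by auto

lemma WC_pow_Dom: "set gs \<subseteq> Gen \<Longrightarrow> Dom (pow_cat WC n) (map ea gs) = map eo (map src gs)"
  and WC_pow_Cod: "set gs \<subseteq> Gen \<Longrightarrow> Cod (pow_cat WC n) (map ea gs) = map eo (map trg gs)"
  by auto

text \<open>The values of \<open>ginv g\<close> are the inverses of the values of \<open>g\<close>,
  so both composites have the values of identities.\<close>

lemma WC_iso:
  assumes "g \<in> Str"
  shows "iso_in WC (ea g)" "inv_arr WC (ea g) = ea (ginv g)"
proof -
  interpret WC: category WC by (rule WC_category)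
  note g = Gen.str[OF assms] and i = Gen.inv[OF assms]
  have st: "src (ginv g) = trg g" "trg (ginv g) = src g" by (simp_all add: ginv_def)
  note c1 = Gen.gcomp[OF g i st(1)] and c2 = Gen.gcomp[OF i g st(2)[symmetric]]
  have v: "Comp (Cat V) (val (ginv g) V \<sigma>) (val g V \<sigma>) = Id (Cat V) (ob V \<sigma> (src g))"
    "Comp (Cat V) (val g V \<sigma>) (val (ginv g) V \<sigma>) = Id (Cat V) (ob V \<sigma> (trg g))"
    if "V \<in> small_palgs T" "cone V \<sigma>" for V \<sigma>
  proof -
    interpret V: pointwise_algebra T V by (rule small_palgs_pointwise[OF that(1)])
    have "iso_in (Cat V) (val g V \<sigma>)" using Str_typed[OF assms] that by blast
    note n = V.X.inv_arr[OF this Gen_val[OF g that]]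
    show "Comp (Cat V) (val (ginv g) V \<sigma>) (val g V \<sigma>) = Id (Cat V) (ob V \<sigma> (src g))"
      "Comp (Cat V) (val g V \<sigma>) (val (ginv g) V \<sigma>) = Id (Cat V) (ob V \<sigma> (trg g))"
      using n that by (simp_all add: ginv_def)
  qed
  have 1: "gcomp (ginv g) g = gid (src g)"
    by (rule Gen_eqI[OF c1 Gen.gid[OF Gen_Tm(1)[OF g]]]) (use v in \<open>simp_all add: gcomp_def gid_def st\<close>)
  have 2: "gcomp g (ginv g) = gid (trg g)"
    by (rule Gen_eqI[OF c2 Gen.gid[OF Gen_Tm(2)[OF g]]]) (use v in \<open>simp_all add: gcomp_def gid_def st\<close>)
  have h: "ea g \<in> hom WC (eo (src g)) (eo (trg g))" "ea (ginv g) \<in> hom WC (eo (trg g)) (eo (src g))"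
    using WC_hom[OF g] WC_hom[OF i] st by simp_all
  have e: "Comp WC (ea (ginv g)) (ea g) = Id WC (eo (src g))" "Comp WC (ea g) (ea (ginv g)) = Id WC (eo (trg g))"
    using 1 2 g i Gen_Tm by simp_all
  show "iso_in WC (ea g)" by (rule WC.iso_inI[OF h e])
  show "inv_arr WC (ea g) = ea (ginv g)" by (rule WC.inv_arr_eqI[OF h e])
qed

section \<open>Operations and coherence isomorphisms of the term model\<close>

definition wPhi :: "'t \<Rightarrow> ('u list, 'u list, 'u, 'u) func" where
  "wPhi w = \<lparr>Src = pow_cat WC (Dom T w), Trg = WC,
     OMap = restrict (\<lambda>us. eo (Op w (map dc us))) (Obj (pow_cat WC (Dom T w))),
     AMap = restrict (\<lambda>al. ea (gop w (map dg al))) (Arr (pow_cat WC (Dom T w)))\<rparr>"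

text \<open>The common shape of the three kinds of coherence: a formal arrow \<open>g ts\<close> for
  each list of terms. One lemma, \<open>wnat_isos\<close>, then yields naturality and invertibility
  for all of them.\<close>

definition wnat :: "nat \<Rightarrow> ('u list, 'u list, 'u, 'u) func \<Rightarrow> ('u list, 'u list, 'u, 'u) func \<Rightarrow>
    (('t, 'jo, 'u) tm list \<Rightarrow> ('t, 'jo, 'ja, 'u) garr) \<Rightarrow> ('u list, 'u list, 'u, 'u) ntrans" where
  "wnat n P Q g = \<lparr>NSrc = P, NTrg = Q, NComp = restrict (\<lambda>us. ea (g (map dc us))) (Obj (pow_cat WC n))\<rparr>"

definition W :: "('t, 'u, 'u) palg" where
  "W = \<lparr>Cat = WC, Phi = wPhi,
     CC = (\<lambda>w ws. wnat (sum_list (map (Dom T) ws)) (wPhi (gam T w ws))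
       (end_gam WC (map (Dom T) ws) (wPhi w) (map wPhi ws)) (gasc w ws)),
     CI = wnat 1 (wPhi (word1 T)) (end_unit WC) (\<lambda>ts. gunt (hd ts)),
     CS = (\<lambda>w l f. wnat l (wPhi (subst_word T l w f)) (end_subst WC l (wPhi w) f) (gsbs w l f))\<rparr>"

lemma W_sel [simp]: "Cat W = WC" "Phi W = wPhi"
  by (simp_all add: W_def)

lemma wPhi_OMap:
  assumes "w \<in> words T n" "set ts \<subseteq> Tm" "length ts = n"
  shows "OMap (wPhi w) (map eo ts) = eo (Op w ts)"
  using WC_pow_ObjI[OF assms(2,3)] words_Dom[OF assms(1)] assms(2) by (simp add: wPhi_def)

lemma wPhi_AMap:
  assumes "w \<in> words T n" "set gs \<subseteq> Gen" "length gs = n"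
  shows "AMap (wPhi w) (map ea gs) = ea (gop w gs)"
  using WC_pow_ArrI[OF assms(2,3)] words_Dom[OF assms(1)] assms(2) by (simp add: wPhi_def)

lemma val_hom_pow:
  assumes "set gs \<subseteq> Gen" "V \<in> small_palgs T" "cone V \<sigma>" "length gs = n"
  shows "map (\<lambda>g. val g V \<sigma>) gs \<in> hom (pow_cat (Cat V) n) (map (ob V \<sigma>) (map src gs)) (map (ob V \<sigma>) (map trg gs))"
proof -
  have "gs ! i \<in> Gen" if "i < n" for i using that assms(1,4) by (metis nth_mem subsetD)
  then show ?thesis using assms(4) Gen_val[OF _ assms(2,3)] by (simp add: hom_pow_iff)
qed

text \<open>Preservation of identities and composites is checked by value, where it is functoriality
  of the operation of \<open>w\<close> in each \<open>V\<close>.\<close>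

lemma wPhi_functors:
  assumes w: "w \<in> words T n"
  shows "wPhi w \<in> functors (pow_cat WC n) WC"
proof (rule functorsI)
  interpret P: category "pow_cat WC n" by (rule category_pow_cat[OF WC_category])
  show "Src (wPhi w) = pow_cat WC n" "Trg (wPhi w) = WC" "OMap (wPhi w) \<in> extensional (Obj (pow_cat WC n))"
    "AMap (wPhi w) \<in> extensional (Arr (pow_cat WC n))" using words_Dom[OF w] by (simp_all add: wPhi_def)
  fix us assume "us \<in> Obj (pow_cat WC n)"
  then obtain ts where ts: "us = map eo ts" "set ts \<subseteq> Tm" "length ts = n" by (rule WC_pow_ObjE)
  have t: "Op w ts \<in> Tm" using w ts by (auto intro!: Tm.Op)
  then show "OMap (wPhi w) us \<in> Obj WC" using wPhi_OMap[OF w ts(2,3)] ts by simp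
  have s: "set (map gid ts) \<subseteq> Gen" using ts by (auto intro!: Gen.gid)
  have "Id (pow_cat WC n) us = map ea (map gid ts)" using ts by (auto simp: subset_iff)
  moreover have "gop w (map gid ts) = gid (Op w ts)"
  proof (rule Gen_eqI[OF Gen.gop Gen.gid[OF t]])
    fix V \<sigma> assume V: "V \<in> small_palgs T" "cone V \<sigma>" and "pointwise_algebra T V"
    interpret V: pointwise_algebra T V by fact
    show "val (gop w (map gid ts)) V \<sigma> = val (gid (Op w ts)) V \<sigma>"
      using V.PhiD(6)[OF w map_ob_Obj[OF V ts(2,3)]] V by (simp add: gop_def gid_def comp_def)
  qed (use w ts s in \<open>auto simp: gop_def gid_def comp_def\<close>)
  ultimately show "AMap (wPhi w) (Id (pow_cat WC n) us) = Id WC (OMap (wPhi w) us)"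
    using wPhi_AMap[OF w s] wPhi_OMap[OF w ts(2,3)] ts t by (simp del: pow_cat_sel map_map)
next
  interpret P: category "pow_cat WC n" by (rule category_pow_cat[OF WC_category])
  fix al assume al: "al \<in> Arr (pow_cat WC n)"
  then obtain gs where gs: "al = map ea gs" "set gs \<subseteq> Gen" "length gs = n" by (rule WC_pow_ArrE)
  have g: "gop w gs \<in> Gen" using w gs by (auto intro!: Gen.gop)
  show "AMap (wPhi w) al \<in> hom WC (OMap (wPhi w) (Dom (pow_cat WC n) al)) (OMap (wPhi w) (Cod (pow_cat WC n) al))"
    unfolding gs(1) WC_pow_Dom[OF gs(2)] WC_pow_Cod[OF gs(2)] wPhi_AMap[OF w gs(2,3)]
    using wPhi_OMap[OF w set_src[OF gs(2)]] wPhi_OMap[OF w set_trg[OF gs(2)]] WC_hom[OF g] gs(3) by (simp add: gop_def)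
  fix bs assume bs: "bs \<in> Arr (pow_cat WC n)" and eq: "Dom (pow_cat WC n) bs = Cod (pow_cat WC n) al"
  then obtain hs where hs: "bs = map ea hs" "set hs \<subseteq> Gen" "length hs = n" using WC_pow_ArrE by metis
  have h: "gop w hs \<in> Gen" using w hs by (auto intro!: Gen.gop)
  \<comment> \<open>Composability of the lists is known for codes; injectivity of \<open>eo\<close>
    gives it for the formal ends, so \<open>gcomp\<close> applies entry by entry.\<close>
  have "map eo (map src hs) = map eo (map trg gs)"
    using eq unfolding gs(1) hs(1) WC_pow_Dom[OF hs(2)] WC_pow_Cod[OF gs(2)] .
  moreover have "inj_on eo (set (map src hs) \<union> set (map trg gs))"
    using inj_on_subset[OF inj_eo] set_src[OF hs(2)] set_trg[OF gs(2)] by simp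
  ultimately have m: "map src hs = map trg gs" by (rule map_inj_on)
  have mi: "src (hs ! i) = trg (gs ! i)" if "i < n" for i
    using arg_cong[OF m, of "\<lambda>l. l ! i"] that gs(3) hs(3) by simp
  let ?c = "map2 gcomp hs gs"
  have gi: "gs ! i \<in> Gen" "hs ! i \<in> Gen" if "i < n" for i
    using that gs(2,3) hs(2,3) by (metis nth_mem subsetD)+
  have cG: "set ?c \<subseteq> Gen"
  proof
    fix c assume "c \<in> set ?c"
    then obtain i where "i < n" "c = gcomp (hs ! i) (gs ! i)" using gs hs by (auto simp: in_set_conv_nth)
    then show "c \<in> Gen" using gi mi by (auto intro!: Gen.gcomp)
  qed
  have l: "length ?c = n" using gs hs by simp
  have "Comp (pow_cat WC n) bs al = map ea ?c"
    by (rule nth_equalityI) (use gs(1,3) hs(1,3) gi in simp_all)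
  moreover have "gop w ?c = gcomp (gop w hs) (gop w gs)"
  proof (rule Gen_eqI[OF Gen.gop Gen.gcomp[OF g h]])
    have 1: "map src ?c = map src gs" "map trg ?c = map trg hs"
      by (rule nth_equalityI; use gs hs in \<open>simp add: gcomp_def\<close>)+
    then show "src (gop w ?c) = src (gcomp (gop w hs) (gop w gs))" "trg (gop w ?c) = trg (gcomp (gop w hs) (gop w gs))"
      by (simp_all add: gop_def gcomp_def del: map_map)
    show "src (gop w hs) = trg (gop w gs)" using m by (simp add: gop_def)
    fix V \<sigma> assume V: "V \<in> small_palgs T" "cone V \<sigma>" and "pointwise_algebra T V"
    interpret V: pointwise_algebra T V by fact
    have 2: "map (\<lambda>g. val g V \<sigma>) ?c = map2 (Comp (Cat V)) (map (\<lambda>g. val g V \<sigma>) hs) (map (\<lambda>g. val g V \<sigma>) gs)"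
      by (rule nth_equalityI) (use gs hs V in \<open>simp_all add: gcomp_def\<close>)
    show "val (gop w ?c) V \<sigma> = val (gcomp (gop w hs) (gop w gs)) V \<sigma>"
      using V.PhiD(7)[OF w val_hom_pow[OF gs(2) V gs(3)] val_hom_pow[OF hs(2) V hs(3), unfolded m]] V 2
      by (simp add: gop_def gcomp_def)
  qed (use w cG l in auto)
  ultimately show "AMap (wPhi w) (Comp (pow_cat WC n) bs al) = Comp WC (AMap (wPhi w) bs) (AMap (wPhi w) al)"
    using wPhi_AMap[OF w cG l] wPhi_AMap[OF w gs(2,3)] wPhi_AMap[OF w hs(2,3)] gs(1) hs(1) g h by simp
qed

sublocale W: algebra_ops T W
  by (intro algebra_ops.intro algebra_ops_axioms.intro lawvere_theory_axioms)
    (simp_all add: WC_category wPhi_functors)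

lemma evs_wPhi_OMap:
  assumes wl: "word_list T ws" and ts: "set ts \<subseteq> Tm" "length ts = sum_list (map (Dom T) ws)"
  shows "evs T (opo W) ws (map eo ts) = map eo (evs T Op ws ts)"
proof (rule nth_equalityI)
  fix i assume "i < length (evs T (opo W) ws (map eo ts))"
  then have i: "i < length ws" by simp
  then have "ws ! i \<in> words T (Dom T (ws ! i))" using wl by (simp add: word_list_def)
  moreover have "set (split_blocks (map (Dom T) ws) ts ! i) \<subseteq> Tm" "length (split_blocks (map (Dom T) ws) ts ! i) = Dom T (ws ! i)"
    using i ts set_split_blocks_nth[of i "map (Dom T) ws" ts] by (auto simp: length_split_blocks_nth)
  ultimately show "evs T (opo W) ws (map eo ts) ! i = map eo (evs T Op ws ts) ! i"
    using i wPhi_OMap by (simp add: evs_nth split_blocks_map)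
qed simp

lemma evs_wPhi_AMap:
  assumes wl: "word_list T ws" and gs: "set gs \<subseteq> Gen" "length gs = sum_list (map (Dom T) ws)"
  shows "evs T (opa W) ws (map ea gs) = map ea (evs T gop ws gs)"
proof (rule nth_equalityI)
  fix i assume "i < length (evs T (opa W) ws (map ea gs))"
  then have i: "i < length ws" by simp
  then have "ws ! i \<in> words T (Dom T (ws ! i))" using wl by (simp add: word_list_def)
  moreover have "set (split_blocks (map (Dom T) ws) gs ! i) \<subseteq> Gen" "length (split_blocks (map (Dom T) ws) gs ! i) = Dom T (ws ! i)"
    using i gs set_split_blocks_nth[of i "map (Dom T) ws" gs] by (auto simp: length_split_blocks_nth)
  ultimately show "evs T (opa W) ws (map ea gs) ! i = map ea (evs T gop ws gs) ! i"
    using i wPhi_AMap by (simp add: evs_nth split_blocks_map)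
qed simp

lemma evs_gop_Gen:
  assumes "word_list T ws" "set gs \<subseteq> Gen" "length gs = sum_list (map (Dom T) ws)"
  shows "set (evs T gop ws gs) \<subseteq> Gen"
  using assms by (intro set_evs Gen.gop) (auto simp: word_list_def)

text \<open>Structural arrows have formal inverses, so the components are isomorphisms at once.
  Naturality is reduced to an equation between generated arrows, to which \<open>Gen_eqI\<close>
  applies.\<close>

lemma wnat_isos:
  assumes P: "P \<in> functors (pow_cat WC n) WC" and Q: "Q \<in> functors (pow_cat WC n) WC"
    and g: "\<And>ts. set ts \<subseteq> Tm \<Longrightarrow> length ts = n \<Longrightarrow>
      g ts \<in> Str \<and> OMap P (map eo ts) = eo (src (g ts)) \<and> OMap Q (map eo ts) = eo (trg (g ts))"
    and nat: "\<And>gs. set gs \<subseteq> Gen \<Longrightarrow> length gs = n \<Longrightarrow> \<exists>a \<in> Gen. \<exists>b \<in> Gen.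
      AMap P (map ea gs) = ea a \<and> AMap Q (map ea gs) = ea b \<and> gcomp (g (map trg gs)) a = gcomp b (g (map src gs))"
  shows "wnat n P Q g \<in> nat_isos P Q"
proof (rule nat_isosI, rule nat_transsI)
  note FD = functorsD[OF P] and GD = functorsD[OF Q]
  show "NSrc (wnat n P Q g) = P" "NTrg (wnat n P Q g) = Q" "Src P = pow_cat WC n" "Src Q = pow_cat WC n"
    "Trg P = WC" "Trg Q = WC" "NComp (wnat n P Q g) \<in> extensional (Obj (pow_cat WC n))"
    using FD GD by (simp_all add: wnat_def)
  have c: "NComp (wnat n P Q g) (map eo ts) = ea (g ts)" if "set ts \<subseteq> Tm" "length ts = n" for ts
    using WC_pow_ObjI[OF that] that by (simp add: wnat_def)
  {
    fix us assume "us \<in> Obj (pow_cat WC n)"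
    then obtain ts where ts: "us = map eo ts" "set ts \<subseteq> Tm" "length ts = n" by (rule WC_pow_ObjE)
    show "NComp (wnat n P Q g) us \<in> hom WC (OMap P us) (OMap Q us)"
      using c[OF ts(2,3)] g[OF ts(2,3)] WC_hom[OF Gen.str] ts(1) by simp
  }
  {
    fix us assume "us \<in> Obj (Src P)"
    then obtain ts where ts: "us = map eo ts" "set ts \<subseteq> Tm" "length ts = n" unfolding FD(1) by (rule WC_pow_ObjE)
    show "iso_in (Trg P) (NComp (wnat n P Q g) us)"
      using c[OF ts(2,3)] g[OF ts(2,3)] WC_iso(1) ts(1) FD(2) by simp
  }
  fix al assume "al \<in> Arr (pow_cat WC n)"
  then obtain gs where gs: "al = map ea gs" "set gs \<subseteq> Gen" "length gs = n" by (rule WC_pow_ArrE)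
  obtain a b where ab: "a \<in> Gen" "b \<in> Gen" "AMap P al = ea a" "AMap Q al = ea b"
    "gcomp (g (map trg gs)) a = gcomp b (g (map src gs))" using nat[OF gs(2,3)] gs(1) by blast
  have l: "length (map src gs) = n" "length (map trg gs) = n" using gs by simp_all
  have "g (map src gs) \<in> Gen" "g (map trg gs) \<in> Gen"
    using g[OF set_src[OF gs(2)] l(1)] g[OF set_trg[OF gs(2)] l(2)] Gen.str by auto
  then show "Comp WC (NComp (wnat n P Q g) (Cod (pow_cat WC n) al)) (AMap P al)
      = Comp WC (AMap Q al) (NComp (wnat n P Q g) (Dom (pow_cat WC n) al))"
    unfolding gs(1) WC_pow_Dom[OF gs(2)] WC_pow_Cod[OF gs(2)] c[OF set_src[OF gs(2)] l(1)] c[OF set_trg[OF gs(2)] l(2)]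
    using ab gs(1) by simp
qed

lemma asc_W:
  assumes "w \<in> words T (length ws)" "word_list T ws" "set ts \<subseteq> Tm" "length ts = sum_list (map (Dom T) ws)"
  shows "asc W w ws (map eo ts) = ea (gasc w ws ts)"
  using WC_pow_ObjI[OF assms(3,4)] assms(3) by (simp add: W_def wnat_def)

lemma unt_W: "t \<in> Tm \<Longrightarrow> unt W [eo t] = ea (gunt t)"
  by (simp add: W_def wnat_def)

lemma sbs_W:
  assumes "set ts \<subseteq> Tm" "length ts = l"
  shows "sbs W w l f (map eo ts) = ea (gsbs w l f ts)"
  using WC_pow_ObjI[OF assms] assms(1) by (simp add: W_def wnat_def)

lemma map_nth_eo: "fin_fun k l f \<Longrightarrow> length xs = l \<Longrightarrow> map ((!) (map h xs)) f = map h (map ((!) xs) f)"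
  by (auto simp: fin_fun_def)

text \<open>Naturality of each family holds by value: it is naturality of \<open>CC\<close>,
  \<open>CI\<close> or \<open>CS\<close> in every \<open>V\<close>. The work lies in matching the
  ends of the formal arrows with the source and target functors.\<close>

sublocale W: pre_algebra T W
proof (intro pre_algebra.intro W.algebra_ops_axioms pre_algebra_axioms.intro)
  fix w ws assume w: "w \<in> words T (length ws)" and wl: "word_list T ws"
  let ?N = "sum_list (map (Dom T) ws)"
  note gw = gam_words[OF w wl]
  have "wnat ?N (wPhi (gam T w ws)) (end_gam WC (map (Dom T) ws) (wPhi w) (map wPhi ws)) (gasc w ws)
      \<in> nat_isos (wPhi (gam T w ws)) (end_gam WC (map (Dom T) ws) (wPhi w) (map wPhi ws))"
  proof (rule wnat_isos[OF wPhi_functors[OF gw]])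
    show "end_gam WC (map (Dom T) ws) (wPhi w) (map wPhi ws) \<in> functors (pow_cat WC ?N) WC"
      using W.end_gam_functors[OF w wl] by simp
  next
    fix ts assume ts: "set ts \<subseteq> Tm" "length ts = ?N"
    have "OMap (end_gam WC (map (Dom T) ws) (wPhi w) (map wPhi ws)) (map eo ts) = eo (Op w (evs T Op ws ts))"
      using W.end_gam_OMap[of "map eo ts" ws w] WC_pow_ObjI[OF ts] evs_wPhi_OMap[OF wl ts] wPhi_OMap[OF w evs_Op_Tm[OF wl ts]]
      by simp
    then show "gasc w ws ts \<in> Str \<and> OMap (wPhi (gam T w ws)) (map eo ts) = eo (src (gasc w ws ts)) \<and>
        OMap (end_gam WC (map (Dom T) ws) (wPhi w) (map wPhi ws)) (map eo ts) = eo (trg (gasc w ws ts))"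
      using wPhi_OMap[OF gw ts] Str.asc[OF w wl ts] by (simp add: gasc_def)
  next
    fix gs assume gs: "set gs \<subseteq> Gen" "length gs = ?N"
    note eg = evs_gop_Gen[OF wl gs]
    have a: "gop (gam T w ws) gs \<in> Gen" and b: "gop w (evs T gop ws gs) \<in> Gen"
      using gw w gs eg by (auto intro!: Gen.gop)
    have l: "length (map src gs) = ?N" "length (map trg gs) = ?N" using gs by simp_all
    note s1 = Str.asc[OF w wl set_src[OF gs(1)] l(1)] and s2 = Str.asc[OF w wl set_trg[OF gs(1)] l(2)]
    have e1: "map src (evs T gop ws gs) = evs T Op ws (map src gs)" "map trg (evs T gop ws gs) = evs T Op ws (map trg gs)"
      by (simp_all add: map_evs evs_map gop_def)
    have AE: "AMap (end_gam WC (map (Dom T) ws) (wPhi w) (map wPhi ws)) (map ea gs) = ea (gop w (evs T gop ws gs))"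
      using W.end_gam_AMap[of "map ea gs" ws w] WC_pow_ArrI[OF gs] evs_wPhi_AMap[OF wl gs] wPhi_AMap[OF w eg] by simp
    have n: "gcomp (gasc w ws (map trg gs)) (gop (gam T w ws) gs) = gcomp (gop w (evs T gop ws gs)) (gasc w ws (map src gs))"
    proof (rule Gen_eqI[OF Gen.gcomp[OF a Gen.str[OF s2]] Gen.gcomp[OF Gen.str[OF s1] b]])
      fix V \<sigma> assume V: "V \<in> small_palgs T" "cone V \<sigma>" and "pointwise_algebra T V"
      interpret V: pointwise_algebra T V by fact
      have "map (\<lambda>g. val g V \<sigma>) (evs T gop ws gs) = evs T (opa V) ws (map (\<lambda>g. val g V \<sigma>) gs)"
        using V by (simp add: map_evs evs_map gop_def)
      then show "val (gcomp (gasc w ws (map trg gs)) (gop (gam T w ws) gs)) V \<sigma> = val (gcomp (gop w (evs T gop ws gs)) (gasc w ws (map src gs))) V \<sigma>"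
        using V.asc_square[OF w wl val_hom_pow[OF gs(1) V gs(2)]] V by (simp add: gcomp_def gasc_def gop_def square_def)
    qed (simp_all add: gcomp_def gasc_def gop_def e1 del: map_map)
    show "\<exists>a \<in> Gen. \<exists>b \<in> Gen. AMap (wPhi (gam T w ws)) (map ea gs) = ea a \<and>
        AMap (end_gam WC (map (Dom T) ws) (wPhi w) (map wPhi ws)) (map ea gs) = ea b \<and>
        gcomp (gasc w ws (map trg gs)) a = gcomp b (gasc w ws (map src gs))"
      using a b n AE wPhi_AMap[OF gw gs] by blast
  qed
  then show "CC W w ws \<in> nat_isos (Phi W (gam T w ws)) (end_gam (Cat W) (map (Dom T) ws) (Phi W w) (map (Phi W) ws))"
    by (simp add: W_def)
next
  have "wnat 1 (wPhi (word1 T)) (end_unit WC) (\<lambda>ts. gunt (hd ts)) \<in> nat_isos (wPhi (word1 T)) (end_unit WC)"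
  proof (rule wnat_isos[OF wPhi_functors[OF word1_words] end_unit_functors[OF WC_category]])
    fix ts assume ts: "set ts \<subseteq> Tm" "length ts = 1"
    then obtain t where t: "ts = [t]" "t \<in> Tm" by (auto simp: length_Suc_conv)
    then show "gunt (hd ts) \<in> Str \<and> OMap (wPhi (word1 T)) (map eo ts) = eo (src (gunt (hd ts))) \<and>
        OMap (end_unit WC) (map eo ts) = eo (trg (gunt (hd ts)))"
      using wPhi_OMap[OF word1_words ts] Str.unt[OF t(2)] by (simp add: gunt_def)
  next
    fix gs assume gs: "set gs \<subseteq> Gen" "length gs = 1"
    then obtain g where g: "gs = [g]" "g \<in> Gen" by (auto simp: length_Suc_conv)
    have a: "gop (word1 T) [g] \<in> Gen" using word1_words g by (auto intro!: Gen.gop)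
    note s1 = Str.unt[OF Gen_Tm(1)[OF g(2)]] and s2 = Str.unt[OF Gen_Tm(2)[OF g(2)]]
    have n: "gcomp (gunt (trg g)) (gop (word1 T) [g]) = gcomp g (gunt (src g))"
    proof (rule Gen_eqI[OF Gen.gcomp[OF a Gen.str[OF s2]] Gen.gcomp[OF Gen.str[OF s1] g(2)]])
      fix V \<sigma> assume V: "V \<in> small_palgs T" "cone V \<sigma>" and "pointwise_algebra T V"
      interpret V: pointwise_algebra T V by fact
      show "val (gcomp (gunt (trg g)) (gop (word1 T) [g])) V \<sigma> = val (gcomp g (gunt (src g))) V \<sigma>"
        using V.unt_square[OF Gen_val[OF g(2) V]] V by (simp add: gcomp_def gunt_def gop_def square_def)
    qed (simp_all add: gcomp_def gunt_def gop_def)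
    have "AMap (wPhi (word1 T)) (map ea gs) = ea (gop (word1 T) [g])" using wPhi_AMap[OF word1_words gs] g by simp
    moreover have "AMap (end_unit WC) (map ea gs) = ea g" using g by simp
    ultimately show "\<exists>a \<in> Gen. \<exists>b \<in> Gen. AMap (wPhi (word1 T)) (map ea gs) = ea a \<and> AMap (end_unit WC) (map ea gs) = ea b \<and>
        gcomp (gunt (hd (map trg gs))) a = gcomp b (gunt (hd (map src gs)))"
      using a g n by (intro bexI[of _ "gop (word1 T) [g]"] bexI[of _ g]) simp_all
  qed
  then show "CI W \<in> nat_isos (Phi W (word1 T)) (end_unit (Cat W))" by (simp add: W_def)
next
  fix w k l f assume w: "w \<in> words T k" and f: "fin_fun k l f"
  note sw = subst_word_words[OF w f]
  have "wnat l (wPhi (subst_word T l w f)) (end_subst WC l (wPhi w) f) (gsbs w l f)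
      \<in> nat_isos (wPhi (subst_word T l w f)) (end_subst WC l (wPhi w) f)"
  proof (rule wnat_isos[OF wPhi_functors[OF sw]])
    show "end_subst WC l (wPhi w) f \<in> functors (pow_cat WC l) WC" using W.end_subst_functors[OF w f] by simp
  next
    fix ts assume ts: "set ts \<subseteq> Tm" "length ts = l"
    have tf: "set (map ((!) ts) f) \<subseteq> Tm" "length (map ((!) ts) f) = k"
      using set_map_nth[OF f ts(2)] ts(1) f by (auto simp: fin_fun_def)
    have "OMap (end_subst WC l (wPhi w) f) (map eo ts) = eo (Op w (map ((!) ts) f))"
      using W.end_subst_OMap[of "map eo ts" l "wPhi w" f] WC_pow_ObjI[OF ts] wPhi_OMap[OF w tf] map_nth_eo[OF f ts(2), of eo]
      by simp
    then show "gsbs w l f ts \<in> Str \<and> OMap (wPhi (subst_word T l w f)) (map eo ts) = eo (src (gsbs w l f ts)) \<and>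
        OMap (end_subst WC l (wPhi w) f) (map eo ts) = eo (trg (gsbs w l f ts))"
      using wPhi_OMap[OF sw ts] Str.sbs[OF w f ts] by (simp add: gsbs_def)
  next
    fix gs assume gs: "set gs \<subseteq> Gen" "length gs = l"
    have gf: "set (map ((!) gs) f) \<subseteq> Gen" "length (map ((!) gs) f) = k"
      using set_map_nth[OF f gs(2)] gs(1) f by (auto simp: fin_fun_def)
    have a: "gop (subst_word T l w f) gs \<in> Gen" and b: "gop w (map ((!) gs) f) \<in> Gen"
      using sw w gs gf by (auto intro!: Gen.gop)
    have l: "length (map src gs) = l" "length (map trg gs) = l" using gs by simp_all
    note s1 = Str.sbs[OF w f set_src[OF gs(1)] l(1)] and s2 = Str.sbs[OF w f set_trg[OF gs(1)] l(2)]
    have AE: "AMap (end_subst WC l (wPhi w) f) (map ea gs) = ea (gop w (map ((!) gs) f))"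
      using W.end_subst_AMap[of "map ea gs" l "wPhi w" f] WC_pow_ArrI[OF gs] wPhi_AMap[OF w gf] map_nth_eo[OF f gs(2), of ea] by simp
    have n: "gcomp (gsbs w l f (map trg gs)) (gop (subst_word T l w f) gs) = gcomp (gop w (map ((!) gs) f)) (gsbs w l f (map src gs))"
    proof (rule Gen_eqI[OF Gen.gcomp[OF a Gen.str[OF s2]] Gen.gcomp[OF Gen.str[OF s1] b]])
      fix V \<sigma> assume V: "V \<in> small_palgs T" "cone V \<sigma>" and "pointwise_algebra T V"
      interpret V: pointwise_algebra T V by fact
      show "val (gcomp (gsbs w l f (map trg gs)) (gop (subst_word T l w f) gs)) V \<sigma> = val (gcomp (gop w (map ((!) gs) f)) (gsbs w l f (map src gs))) V \<sigma>"
        using V.sbs_square[OF w f val_hom_pow[OF gs(1) V gs(2)]] V map_nth_eo[OF f gs(2), of "\<lambda>g. val g V \<sigma>"]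
        by (simp add: gcomp_def gsbs_def gop_def square_def del: map_map)
    qed (simp_all add: gcomp_def gsbs_def gop_def map_nth_eo[OF f gs(2)] del: map_map)
    show "\<exists>a \<in> Gen. \<exists>b \<in> Gen. AMap (wPhi (subst_word T l w f)) (map ea gs) = ea a \<and>
        AMap (end_subst WC l (wPhi w) f) (map ea gs) = ea b \<and>
        gcomp (gsbs w l f (map trg gs)) a = gcomp b (gsbs w l f (map src gs))"
      using a b n AE wPhi_AMap[OF sw gs] by blast
  qed
  then show "CS W w l f \<in> nat_isos (Phi W (subst_word T l w f)) (end_subst (Cat W) l (Phi W w) f)" by (simp add: W_def)
qed

end

section \<open>Values under a cone and the coherence axioms\<close>

context term_model
begin

text \<open>\<open>obv\<close> and \<open>va\<close> are \<open>ob\<close> and \<open>val\<close> on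
  codes; they become the object and arrow maps of the evaluation morphism.\<close>

definition obv :: "('t, 'u, 'u) palg \<Rightarrow> ('jo, 'ja, ('t, 'u, 'u) pmor, ('t, 'u, 'u) pcell) psnat \<Rightarrow> 'u \<Rightarrow> 'u" where
  "obv V \<sigma> u = ob V \<sigma> (dc u)"

definition va :: "('t, 'u, 'u) palg \<Rightarrow> ('jo, 'ja, ('t, 'u, 'u) pmor, ('t, 'u, 'u) pcell) psnat \<Rightarrow> 'u \<Rightarrow> 'u" where
  "va V \<sigma> a = val (dg a) V \<sigma>"

lemma obv_eo [simp]: "t \<in> Tm \<Longrightarrow> obv V \<sigma> (eo t) = ob V \<sigma> t"
  by (simp add: obv_def)

lemma va_ea [simp]: "g \<in> Gen \<Longrightarrow> va V \<sigma> (ea g) = val g V \<sigma>"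
  by (simp add: va_def)

lemma map_obv_eo [simp]: "set ts \<subseteq> Tm \<Longrightarrow> map (obv V \<sigma>) (map eo ts) = map (ob V \<sigma>) ts"
  by auto

lemma map_va_ea [simp]: "set gs \<subseteq> Gen \<Longrightarrow> map (va V \<sigma>) (map ea gs) = map (\<lambda>g. val g V \<sigma>) gs"
  by auto

text \<open>The criterion \<open>Gen_eqI\<close> on the level of codes; stated with hom-sets of
  \<open>WC\<close>, it applies to composites without decoding them.\<close>

lemma WC_eqI:
  assumes "a \<in> hom WC x y" "b \<in> hom WC x y"
    "\<And>V \<sigma>. V \<in> small_palgs T \<Longrightarrow> cone V \<sigma> \<Longrightarrow> va V \<sigma> a = va V \<sigma> b"
  shows "a = b"
proof -
  obtain g where g: "g \<in> Gen" "a = ea g" "x = eo (src g)" "y = eo (trg g)" by (rule WC_homE[OF assms(1)])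
  obtain h where h: "h \<in> Gen" "b = ea h" "x = eo (src h)" "y = eo (trg h)" by (rule WC_homE[OF assms(2)])
  have "g = h"
  proof (rule Gen_eqI[OF g(1) h(1)])
    show "src g = src h" "trg g = trg h" using g h eo_eq Gen_Tm by metis+
    show "val g V \<sigma> = val h V \<sigma>" if "V \<in> small_palgs T" "cone V \<sigma>" for V \<sigma>
      using assms(3)[OF that] g h by simp
  qed
  then show ?thesis using g h by simp
qed

text \<open>For a fixed cone, \<open>obv\<close> and \<open>va\<close> preserve all structure
  strictly, by the way the formal arrows were defined. These rules rewrite a coherence equation of
  \<open>W\<close> into the corresponding one of \<open>V\<close>.\<close>

context
  fixes V \<sigma>
  assumes V: "V \<in> small_palgs T" and \<sigma>: "cone V \<sigma>"
begin

lemma obv_Obj: "u \<in> Obj WC \<Longrightarrow> obv V \<sigma> u \<in> Obj (Cat V)"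
  using ob_Obj[OF V \<sigma>] by auto

lemma va_hom:
  assumes "a \<in> hom WC x y"
  shows "va V \<sigma> a \<in> hom (Cat V) (obv V \<sigma> x) (obv V \<sigma> y)"
proof -
  obtain g where g: "g \<in> Gen" "a = ea g" "x = eo (src g)" "y = eo (trg g)" by (rule WC_homE[OF assms])
  then show ?thesis using Gen_val[OF g(1) V \<sigma>] Gen_Tm by simp
qed

lemma va_Id:
  assumes "u \<in> Obj WC"
  shows "va V \<sigma> (Id WC u) = Id (Cat V) (obv V \<sigma> u)"
proof -
  obtain t where t: "t \<in> Tm" "u = eo t" using assms by auto
  then show ?thesis using Gen.gid[OF t(1)] V \<sigma> by (simp add: gid_def)
qed

lemma va_Comp:
  assumes "a \<in> hom WC x y" "b \<in> hom WC y z"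
  shows "va V \<sigma> (Comp WC b a) = Comp (Cat V) (va V \<sigma> b) (va V \<sigma> a)"
proof -
  obtain g where g: "g \<in> Gen" "a = ea g" "x = eo (src g)" "y = eo (trg g)" by (rule WC_homE[OF assms(1)])
  obtain h where h: "h \<in> Gen" "b = ea h" "y = eo (src h)" "z = eo (trg h)" by (rule WC_homE[OF assms(2)])
  have "src h = trg g" using g h eo_eq[OF Gen_Tm(1)[OF h(1)] Gen_Tm(2)[OF g(1)]] by simp
  then show ?thesis using Gen.gcomp[OF g(1) h(1)] g h V \<sigma> by (simp add: gcomp_def)
qed

lemma obv_op:
  assumes "w \<in> words T n" "us \<in> Obj (pow_cat WC n)"
  shows "obv V \<sigma> (opo W w us) = opo V w (map (obv V \<sigma>) us)"
proof -
  obtain ts where ts: "us = map eo ts" "set ts \<subseteq> Tm" "length ts = n" by (rule WC_pow_ObjE[OF assms(2)])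
  have "Op w ts \<in> Tm" using assms ts by (auto intro!: Tm.Op)
  then show ?thesis using wPhi_OMap[OF assms(1) ts(2,3)] ts by (simp del: map_map)
qed

lemma va_op:
  assumes "w \<in> words T n" "al \<in> Arr (pow_cat WC n)"
  shows "va V \<sigma> (opa W w al) = opa V w (map (va V \<sigma>) al)"
proof -
  obtain gs where gs: "al = map ea gs" "set gs \<subseteq> Gen" "length gs = n" by (rule WC_pow_ArrE[OF assms(2)])
  have "gop w gs \<in> Gen" using assms gs by (auto intro!: Gen.gop)
  then show ?thesis using wPhi_AMap[OF assms(1) gs(2,3)] gs V \<sigma> by (simp add: gop_def del: map_map)
qed

lemma va_asc:
  assumes "w \<in> words T (length ws)" "word_list T ws" "us \<in> Obj (pow_cat WC (sum_list (map (Dom T) ws)))"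
  shows "va V \<sigma> (asc W w ws us) = asc V w ws (map (obv V \<sigma>) us)"
proof -
  obtain ts where ts: "us = map eo ts" "set ts \<subseteq> Tm" "length ts = sum_list (map (Dom T) ws)" by (rule WC_pow_ObjE[OF assms(3)])
  show ?thesis using asc_W[OF assms(1,2) ts(2,3)] Gen.str[OF Str.asc[OF assms(1,2) ts(2,3)]] ts V \<sigma>
    by (simp add: gasc_def del: map_map)
qed

lemma va_unt:
  assumes "u \<in> Obj WC"
  shows "va V \<sigma> (unt W [u]) = unt V [obv V \<sigma> u]"
proof -
  obtain t where t: "t \<in> Tm" "u = eo t" using assms by auto
  then show ?thesis using unt_W[OF t(1)] Gen.str[OF Str.unt[OF t(1)]] V \<sigma> by (simp add: gunt_def)
qed

lemma va_sbs:
  assumes "w \<in> words T k" "fin_fun k l f" "us \<in> Obj (pow_cat WC l)"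
  shows "va V \<sigma> (sbs W w l f us) = sbs V w l f (map (obv V \<sigma>) us)"
proof -
  obtain ts where ts: "us = map eo ts" "set ts \<subseteq> Tm" "length ts = l" by (rule WC_pow_ObjE[OF assms(3)])
  show ?thesis using sbs_W[OF ts(2,3)] Gen.str[OF Str.sbs[OF assms(1,2) ts(2,3)]] ts V \<sigma>
    by (simp add: gsbs_def del: map_map)
qed

lemma map_obv_Obj: "us \<in> Obj (pow_cat WC n) \<Longrightarrow> map (obv V \<sigma>) us \<in> Obj (pow_cat (Cat V) n)"
  using obv_Obj by (auto simp: subset_iff image_iff)

lemma map_obv_evs:
  assumes "word_list T ws" "us \<in> Obj (pow_cat WC (sum_list (map (Dom T) ws)))"
  shows "map (obv V \<sigma>) (evs T (opo W) ws us) = evs T (opo V) ws (map (obv V \<sigma>) us)"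
  unfolding map_evs evs_map
proof (rule evs_cong)
  show "length us = sum_list (map (Dom T) ws)" using assms(2) by simp
  fix w ys assume "w \<in> set ws" "length ys = Dom T w" "set ys \<subseteq> set us"
  then show "obv V \<sigma> (opo W w ys) = opo V w (map (obv V \<sigma>) ys)"
    using assms by (intro obv_op) (auto simp: word_list_def subset_iff)
qed

end

lemmas W_eqI = WC_eqI[folded W_sel(1)]

text \<open>All axioms are treated alike. The two sides are shown to be parallel, using identities
  of words and regroupings of lists for their ends; their values at a cone are the two sides of the
  same axiom in \<open>V\<close> at \<open>map (obv V \<sigma>) us\<close>.\<close>

lemma W_pointwise: "pointwise_algebra T W"
proof (intro pointwise_algebra.intro W.pre_algebra_axioms pointwise_algebra_axioms.intro)
  fix w ws wss us
  assume w: "w \<in> words T (length ws)" and l: "length wss = length ws"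
    and ws: "\<And>i. i < length ws \<Longrightarrow> ws ! i \<in> words T (length (wss ! i))" and wss: "word_list T (concat wss)"
    and us: "us \<in> Obj (pow_cat (Cat W) (sum_list (map (Dom T) (concat wss))))"
  let ?ns = "map (\<lambda>vs. sum_list (map (Dom T) vs)) wss"
  have th: "gam T (gam T w ws) (concat wss) = gam T w (map2 (gam T) ws wss)"
    "word_list T (map2 (gam T) ws wss)" "map (Dom T) (map2 (gam T) ws wss) = ?ns"
    "length (concat wss) = sum_list (map (Dom T) ws)" "word_list T ws"
    by (rule gam_assoc[OF w l ws wss] word_list_map2_gam[OF w l ws wss] map_Dom_map2_gam[OF w l ws wss]
      length_concat_words[OF w l ws wss] word_list_nested(2)[OF w l ws wss]; assumption)+
  have wi: "word_list T (wss ! i)" if "i < length ws" for i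
    using that by (intro word_list_nested(1)[OF w l ws wss])
  have d: "\<And>i. i < length ws \<Longrightarrow> Dom T (ws ! i) = length (wss ! i)" using words_Dom[OF ws] .
  have N: "sum_list ?ns = sum_list (map (Dom T) (concat wss))" by (simp add: map_concat sum_list_concat comp_def)
  have gw: "gam T w ws \<in> words T (length (concat wss))" using gam_words[OF w th(5)] th(4) by simp
  have w2: "w \<in> words T (length (map2 (gam T) ws wss))" using w l by simp
  have us2: "us \<in> Obj (pow_cat (Cat W) (sum_list (map (Dom T) (map2 (gam T) ws wss))))" using us unfolding th(3) N .
  have us3: "us \<in> Obj (pow_cat (Cat W) (sum_list ?ns))" using us unfolding N .
  have lu: "length us = sum_list (map (Dom T) (concat wss))" using us by simp
  note ea1 = W.evs_opo[OF wss us, unfolded th(4)]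
  have b: "split_blocks ?ns us ! i \<in> Obj (pow_cat (Cat W) (sum_list (map (Dom T) (wss ! i))))" if "i < length ws" for i
    using blocks_Obj[OF us3, of i] that l by (simp del: pow_cat_sel)
  note a1 = W.asc_hom[OF gw wss us] and a2 = W.asc_hom[OF w th(5) ea1] and a3 = W.asc_hom[OF w2 th(2) us2]
  let ?al = "map (\<lambda>i. asc W (ws ! i) (wss ! i) (split_blocks ?ns us ! i)) [0..<length ws]"
  \<comment> \<open>The inner coherences form one arrow of the power; its ends are identified by
    cutting \<open>us\<close> according to the groups.\<close>
  have al: "?al \<in> hom (pow_cat (Cat W) (length ws)) (evs T (opo W) (map2 (gam T) ws wss) us) (evs T (opo W) ws (evs T (opo W) (concat wss) us))"
    unfolding hom_pow_iff
  proof (intro conjI allI impI)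
    fix i assume i: "i < length ws"
    have "evs T (opo W) (map2 (gam T) ws wss) us ! i = opo W (gam T (ws ! i) (wss ! i)) (split_blocks ?ns us ! i)"
      using i l by (simp add: evs_nth th(3) del: map_map)
    moreover have "evs T (opo W) ws (evs T (opo W) (concat wss) us) ! i = opo W (ws ! i) (evs T (opo W) (wss ! i) (split_blocks ?ns us ! i))"
      using i by (simp add: evs_evs[OF l d lu])
    ultimately show "?al ! i \<in> hom (Cat W) (evs T (opo W) (map2 (gam T) ws wss) us ! i) (evs T (opo W) ws (evs T (opo W) (concat wss) us) ! i)"
      using i W.asc_hom[OF ws[OF i] wi[OF i] b[OF i]] by simp
  qed (use l in simp_all)
  note p = W.PhiD(5)[OF w al]
  \<comment> \<open>The two source words are equal by \<open>th(1)\<close>; without folding it the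
    sides would not be visibly parallel.\<close>
  show "Comp (Cat W) (asc W w ws (evs T (opo W) (concat wss) us)) (asc W (gam T w ws) (concat wss) us)
      = Comp (Cat W) (opa W w ?al) (asc W w (map2 (gam T) ws wss) us)"
  proof (rule W_eqI[OF W.X.Comp_hom[OF a1 a2] W.X.Comp_hom[OF a3 p, folded th(1)]])
    fix V \<sigma> assume Vs: "V \<in> small_palgs T" "cone V \<sigma>"
    interpret V: pointwise_algebra T V by (rule small_palgs_pointwise[OF Vs(1)])
    have e: "map (va V \<sigma>) ?al = map (\<lambda>i. asc V (ws ! i) (wss ! i) (split_blocks ?ns (map (obv V \<sigma>) us) ! i)) [0..<length ws]"
      using l va_asc[OF Vs ws wi] b by (simp add: split_blocks_map del: pow_cat_sel)
    show "va V \<sigma> (Comp (Cat W) (asc W w ws (evs T (opo W) (concat wss) us)) (asc W (gam T w ws) (concat wss) us))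
      = va V \<sigma> (Comp (Cat W) (opa W w ?al) (asc W w (map2 (gam T) ws wss) us))"
      using va_Comp[OF Vs, of "asc W (gam T w ws) (concat wss) us" _ _ "asc W w ws (evs T (opo W) (concat wss) us)", OF a1[unfolded W_sel(1)] a2[unfolded W_sel(1)]]
        va_Comp[OF Vs, OF a3[unfolded W_sel(1)] p[unfolded W_sel(1)]]
        va_asc[OF Vs gw wss us[unfolded W_sel(1)]] va_asc[OF Vs w th(5) ea1[unfolded W_sel(1)]] va_asc[OF Vs w2 th(2) us2[unfolded W_sel(1)]]
        va_op[OF Vs w homD[OF al[unfolded W_sel(1)], THEN conjunct1]] e map_obv_evs[OF Vs wss us[unfolded W_sel(1)]]
        V.asc_asc[OF w l ws wss map_obv_Obj[OF Vs us[unfolded W_sel(1)]]]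
      by (simp only: W_sel(1))
  qed
next
  fix w k us assume w: "w \<in> words T k" and us: "us \<in> Obj (pow_cat (Cat W) k)"
  have k: "sum_list (map (Dom T) (replicate k (word1 T))) = k"
    unfolding map_Dom_replicate_word1 by (simp add: sum_list_replicate)
  have w1: "w \<in> words T (length (replicate k (word1 T)))" using w by simp
  have us1: "us \<in> Obj (pow_cat (Cat W) (sum_list (map (Dom T) (replicate k (word1 T)))))" using us unfolding k .
  note a1 = W.asc_hom[OF w1 word_list_word1 us1, unfolded gam_unit_right[OF w]]
  have lu: "length us = k" using us by simp
  let ?al = "map (\<lambda>x. unt W [x]) us"
  have al: "?al \<in> hom (pow_cat (Cat W) k) (evs T (opo W) (replicate k (word1 T)) us) us"
    unfolding evs_word1[OF lu] hom_pow_iff using us W.unt_hom by (auto simp: subset_iff simp del: W_sel)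
  note p = W.PhiD(5)[OF w al]
  show "Comp (Cat W) (opa W w ?al) (asc W w (replicate k (word1 T)) us) = Id (Cat W) (opo W w us)"
  proof (rule W_eqI[OF W.X.Comp_hom[OF a1 p] W.X.Id_hom[OF W.PhiD(3)[OF w us]]])
    fix V \<sigma> assume Vs: "V \<in> small_palgs T" "cone V \<sigma>"
    interpret V: pointwise_algebra T V by (rule small_palgs_pointwise[OF Vs(1)])
    have e: "map (va V \<sigma>) ?al = map (\<lambda>x. unt V [x]) (map (obv V \<sigma>) us)"
      using us va_unt[OF Vs] by (auto simp: subset_iff)
    show "va V \<sigma> (Comp (Cat W) (opa W w ?al) (asc W w (replicate k (word1 T)) us)) = va V \<sigma> (Id (Cat W) (opo W w us))"
      using va_Comp[OF Vs, OF a1[unfolded W_sel(1)] p[unfolded W_sel(1)]] va_Id[OF Vs W.PhiD(3)[OF w us, unfolded W_sel(1)]]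
        va_asc[OF Vs w1 word_list_word1 us1[unfolded W_sel(1)]] va_op[OF Vs w homD[OF al[unfolded W_sel(1)], THEN conjunct1]] e
        obv_op[OF Vs w us[unfolded W_sel(1)]] V.unt_right[OF w map_obv_Obj[OF Vs us[unfolded W_sel(1)]]]
      by (simp only: W_sel(1))
  qed
next
  fix w k us assume w: "w \<in> words T k" and us: "us \<in> Obj (pow_cat (Cat W) k)"
  have w1: "word1 T \<in> words T (length [w])" using word1_words by simp
  have us1: "us \<in> Obj (pow_cat (Cat W) (sum_list (map (Dom T) [w])))" using us words_Dom[OF w] by simp
  have lu: "length us = Dom T w" using us words_Dom[OF w] by simp
  note wl = word_list_single[OF w]
  note a1 = W.asc_hom[OF w1 wl us1, unfolded gam_unit_left[OF w] evs_singleton[OF lu]]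
  note ou = W.PhiD(3)[OF w us]
  note p = W.unt_hom[OF ou]
  show "Comp (Cat W) (unt W [opo W w us]) (asc W (word1 T) [w] us) = Id (Cat W) (opo W w us)"
  proof (rule W_eqI[OF W.X.Comp_hom[OF a1 p] W.X.Id_hom[OF ou]])
    fix V \<sigma> assume Vs: "V \<in> small_palgs T" "cone V \<sigma>"
    interpret V: pointwise_algebra T V by (rule small_palgs_pointwise[OF Vs(1)])
    show "va V \<sigma> (Comp (Cat W) (unt W [opo W w us]) (asc W (word1 T) [w] us)) = va V \<sigma> (Id (Cat W) (opo W w us))"
      using va_Comp[OF Vs, OF a1[unfolded W_sel(1)] p[unfolded W_sel(1)]] va_Id[OF Vs ou[unfolded W_sel(1)]]
        va_asc[OF Vs w1 wl us1[unfolded W_sel(1)]] va_unt[OF Vs ou[unfolded W_sel(1)]]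
        obv_op[OF Vs w us[unfolded W_sel(1)]] V.unt_left[OF w map_obv_Obj[OF Vs us[unfolded W_sel(1)]]]
      by (simp only: W_sel(1))
  qed
next
  fix w k ws f us assume w: "w \<in> words T k" and f: "fin_fun k (length ws) f" and wl: "word_list T ws"
    and us: "us \<in> Obj (pow_cat (Cat W) (sum_list (map (Dom T) ws)))"
  let ?N = "sum_list (map (Dom T) ws)" and ?g = "block_fun (map (Dom T) ws) f" and ?vs = "map ((!) ws) f"
  note th = subst_gam_outer[OF w f wl] word_list_map_nth[OF w f wl] words_length_map_nth[OF w f wl]
    fin_fun_block_fun_Dom[OF w f wl]
  note gw = gam_words[OF th(3,2)] and sw = subst_word_words[OF w f]
  have lu: "length us = ?N" using us by simp
  note ug = W.pow_nth[OF th(4) us] and eu = W.evs_opo[OF wl us]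
  note a1 = W.sbs_hom[OF gw th(4) us] and a2 = W.asc_hom[OF th(3,2) ug, unfolded evs_block_fun[OF f lu]]
    and b1 = W.asc_hom[OF sw wl us, folded th(1)] and b2 = W.sbs_hom[OF w f eu]
  show "Comp (Cat W) (asc W w ?vs (map ((!) us) ?g)) (sbs W (gam T w ?vs) ?N ?g us)
    = Comp (Cat W) (sbs W w (length ws) f (evs T (opo W) ws us)) (asc W (subst_word T (length ws) w f) ws us)"
  proof (rule W_eqI[OF W.X.Comp_hom[OF a1 a2] W.X.Comp_hom[OF b1 b2]])
    fix V \<sigma> assume Vs: "V \<in> small_palgs T" "cone V \<sigma>"
    interpret V: pointwise_algebra T V by (rule small_palgs_pointwise[OF Vs(1)])
    show "va V \<sigma> (Comp (Cat W) (asc W w ?vs (map ((!) us) ?g)) (sbs W (gam T w ?vs) ?N ?g us))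
      = va V \<sigma> (Comp (Cat W) (sbs W w (length ws) f (evs T (opo W) ws us)) (asc W (subst_word T (length ws) w f) ws us))"
      using va_Comp[OF Vs, OF a1[unfolded W_sel(1)] a2[unfolded W_sel(1)]] va_Comp[OF Vs, OF b1[unfolded W_sel(1)] b2[unfolded W_sel(1)]]
        va_asc[OF Vs th(3,2) ug[unfolded W_sel(1)]] va_asc[OF Vs sw wl us[unfolded W_sel(1)]]
        va_sbs[OF Vs gw th(4) us[unfolded W_sel(1)]] va_sbs[OF Vs w f eu[unfolded W_sel(1)]]
        map_obv_evs[OF Vs wl us[unfolded W_sel(1)]] map_nth_eo[OF th(4) lu, of "obv V \<sigma>"]
        V.asc_sbs_outer[OF w f wl map_obv_Obj[OF Vs us[unfolded W_sel(1)]]]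
      by (simp only: W_sel(1))
  qed
next
  fix w k ws gs ns' us
  assume w: "w \<in> words T k" and l: "length ws = k" "length gs = k" "length ns' = k"
    and ws: "\<And>i. i < k \<Longrightarrow> ws ! i \<in> words T (Dom T (ws ! i))"
    and gs: "\<And>i. i < k \<Longrightarrow> fin_fun (Dom T (ws ! i)) (ns' ! i) (gs ! i)"
    and us: "us \<in> Obj (pow_cat (Cat W) (sum_list ns'))"
  let ?N = "sum_list ns'" and ?g = "block_sum ns' gs"
  let ?vs = "map (\<lambda>i. subst_word T (ns' ! i) (ws ! i) (gs ! i)) [0..<k]"
  have th: "subst_word T ?N (gam T w ws) ?g = gam T w ?vs" "map (Dom T) ?vs = ns'" "word_list T ?vs"
    "fin_fun (sum_list (map (Dom T) ws)) ?N ?g" "word_list T ws"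
    by (rule subst_gam_inner[OF w l ws gs] map_Dom_substs[OF w l ws gs] word_list_substs[OF w l ws gs]
      fin_fun_block_sum_Dom[OF w l ws gs] word_list_inner[OF w l ws gs]; assumption)+
  have w': "w \<in> words T (length ws)" "w \<in> words T (length ?vs)" using w l by simp_all
  note gw = gam_words[OF w'(1) th(5)]
  have lu: "length us = ?N" using us by simp
  note ug = W.pow_nth[OF th(4) us]
  have us2: "us \<in> Obj (pow_cat (Cat W) (sum_list (map (Dom T) ?vs)))" using us unfolding th(2) .
  have eb: "evs T (opo W) ws (map ((!) us) ?g) = map (\<lambda>i. opo W (ws ! i) (map ((!) (split_blocks ns' us ! i)) (gs ! i))) [0..<k]"
    using l gs lu by (simp add: evs_block_sum)
  have b: "split_blocks ns' us ! i \<in> Obj (pow_cat (Cat W) (ns' ! i))" if "i < k" for i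
    using blocks_Obj[OF us, of i] that l by (simp del: pow_cat_sel)
  let ?al = "map (\<lambda>i. sbs W (ws ! i) (ns' ! i) (gs ! i) (split_blocks ns' us ! i)) [0..<k]"
  have al: "?al \<in> hom (pow_cat (Cat W) k) (evs T (opo W) ?vs us) (evs T (opo W) ws (map ((!) us) ?g))"
    unfolding hom_pow_iff eb
    using l W.sbs_hom[OF ws gs b] by (simp add: evs_nth th(2) del: map_map W_sel)
  note a1 = W.sbs_hom[OF gw th(4) us] and a2 = W.asc_hom[OF w'(1) th(5) ug]
    and b1 = W.asc_hom[OF w'(2) th(3) us2, folded th(1)] and b2 = W.PhiD(5)[OF w al]
  show "Comp (Cat W) (asc W w ws (map ((!) us) ?g)) (sbs W (gam T w ws) ?N ?g us) = Comp (Cat W) (opa W w ?al) (asc W w ?vs us)"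
  proof (rule W_eqI[OF W.X.Comp_hom[OF a1 a2] W.X.Comp_hom[OF b1 b2]])
    fix V \<sigma> assume Vs: "V \<in> small_palgs T" "cone V \<sigma>"
    interpret V: pointwise_algebra T V by (rule small_palgs_pointwise[OF Vs(1)])
    have e: "map (va V \<sigma>) ?al = map (\<lambda>i. sbs V (ws ! i) (ns' ! i) (gs ! i) (split_blocks ns' (map (obv V \<sigma>) us) ! i)) [0..<k]"
      using l va_sbs[OF Vs ws gs] b by (simp add: split_blocks_map del: pow_cat_sel)
    show "va V \<sigma> (Comp (Cat W) (asc W w ws (map ((!) us) ?g)) (sbs W (gam T w ws) ?N ?g us))
      = va V \<sigma> (Comp (Cat W) (opa W w ?al) (asc W w ?vs us))"
      using va_Comp[OF Vs, OF a1[unfolded W_sel(1)] a2[unfolded W_sel(1)]] va_Comp[OF Vs, OF b1[unfolded W_sel(1)] b2[unfolded W_sel(1)]]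
        va_asc[OF Vs w'(1) th(5) ug[unfolded W_sel(1)]] va_asc[OF Vs w'(2) th(3) us2[unfolded W_sel(1)]]
        va_sbs[OF Vs gw th(4) us[unfolded W_sel(1)]] va_op[OF Vs w homD[OF al[unfolded W_sel(1)], THEN conjunct1]] e
        map_nth_eo[OF th(4) lu, of "obv V \<sigma>"]
        V.asc_sbs_inner[OF w l ws gs map_obv_Obj[OF Vs us[unfolded W_sel(1)]]]
      by (simp only: W_sel(1))
  qed
next
  fix w k l f m g us assume w: "w \<in> words T k" and f: "fin_fun k l f" and g: "fin_fun l m g"
    and us: "us \<in> Obj (pow_cat (Cat W) m)"
  note sw = subst_word_words[OF w f] and gf = fin_fun_map_nth[OF f g] and ug = W.pow_nth[OF g us]
  have lu: "length us = m" using us by simp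
  note a1 = W.sbs_hom[OF sw g us, unfolded subst_subst[OF w f g]] and a2 = W.sbs_hom[OF w f ug, folded map_nth_map_nth[OF f g]]
    and b = W.sbs_hom[OF w gf us]
  show "Comp (Cat W) (sbs W w l f (map ((!) us) g)) (sbs W (subst_word T l w f) m g us) = sbs W w m (map ((!) g) f) us"
  proof (rule W_eqI[OF W.X.Comp_hom[OF a1 a2] b])
    fix V \<sigma> assume Vs: "V \<in> small_palgs T" "cone V \<sigma>"
    interpret V: pointwise_algebra T V by (rule small_palgs_pointwise[OF Vs(1)])
    show "va V \<sigma> (Comp (Cat W) (sbs W w l f (map ((!) us) g)) (sbs W (subst_word T l w f) m g us)) = va V \<sigma> (sbs W w m (map ((!) g) f) us)"
      using va_Comp[OF Vs, OF a1[unfolded W_sel(1)] a2[unfolded W_sel(1)]]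
        va_sbs[OF Vs sw g us[unfolded W_sel(1)]] va_sbs[OF Vs w f ug[unfolded W_sel(1)]] va_sbs[OF Vs w gf us[unfolded W_sel(1)]]
        map_nth_eo[OF g lu, of "obv V \<sigma>"] V.sbs_sbs[OF w f g map_obv_Obj[OF Vs us[unfolded W_sel(1)]]]
      by (simp only: W_sel(1))
  qed
next
  fix w k us assume w: "w \<in> words T k" and us: "us \<in> Obj (pow_cat (Cat W) k)"
  note ou = W.PhiD(3)[OF w us]
  have lu: "length us = k" using us by simp
  have mi: "map ((!) us) [0..<k] = us" using lu map_nth[of us] by simp
  note a = W.sbs_hom[OF w fin_fun_id us, unfolded subst_id[OF w] mi]
  show "sbs W w k [0..<k] us = Id (Cat W) (opo W w us)"
  proof (rule W_eqI[OF a W.X.Id_hom[OF ou]])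
    fix V \<sigma> assume Vs: "V \<in> small_palgs T" "cone V \<sigma>"
    interpret V: pointwise_algebra T V by (rule small_palgs_pointwise[OF Vs(1)])
    show "va V \<sigma> (sbs W w k [0..<k] us) = va V \<sigma> (Id (Cat W) (opo W w us))"
      using va_sbs[OF Vs w fin_fun_id us[unfolded W_sel(1)]] va_Id[OF Vs ou[unfolded W_sel(1)]]
        obv_op[OF Vs w us[unfolded W_sel(1)]] V.sbs_id[OF w map_obv_Obj[OF Vs us[unfolded W_sel(1)]]]
      by (simp only: W_sel(1))
  qed
qed

sublocale W: pointwise_algebra T W by (rule W_pointwise)

lemma W_small: "W \<in> small_palgs T"
  using pointwise_pseudo_algebra[OF W_pointwise]
  by (simp add: small_palgs_def small_cat_def small_image[OF small_Tm] small_image[OF small_Gen])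

end

section \<open>Evaluation morphisms out of the term model\<close>

context term_model
begin

definition evF :: "('t, 'u, 'u) palg \<Rightarrow> ('jo, 'ja, ('t, 'u, 'u) pmor, ('t, 'u, 'u) pcell) psnat \<Rightarrow> ('u, 'u, 'u, 'u) func" where
  "evF V \<sigma> = \<lparr>Src = WC, Trg = Cat V, OMap = restrict (obv V \<sigma>) (Obj WC), AMap = restrict (va V \<sigma>) (Arr WC)\<rparr>"

text \<open>Evaluation commutes with the operations on the nose, so its coherences are identities;
  \<open>ev_strict\<close> shows that the functor used here as the source is also the required
  target.\<close>

definition ev :: "('t, 'u, 'u) palg \<Rightarrow> ('jo, 'ja, ('t, 'u, 'u) pmor, ('t, 'u, 'u) pcell) psnat \<Rightarrow> ('t, 'u, 'u) pmor" where
  "ev V \<sigma> = \<lparr>MSrc = W, MTrg = V, MFun = evF V \<sigma>,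
     MRho = restrict (\<lambda>w. nat_id (func_comp (evF V \<sigma>) (wPhi w))) (\<Union>n. words T n)\<rparr>"

lemma ev_sel: "u \<in> Obj WC \<Longrightarrow> mo (ev V \<sigma>) u = obv V \<sigma> u" "a \<in> Arr WC \<Longrightarrow> ma (ev V \<sigma>) a = va V \<sigma> a"
  by (simp_all add: ev_def evF_def del: WC_sel)

context
  fixes V \<sigma>
  assumes V: "V \<in> small_palgs T" and \<sigma>: "cone V \<sigma>"
begin

interpretation V: pointwise_algebra T V by (rule small_palgs_pointwise[OF V])

lemma evF_functors: "evF V \<sigma> \<in> functors WC (Cat V)"
proof (rule functorsI_hom[OF WC_category])
  interpret WC: category WC by (rule WC_category)
  fix x assume x: "x \<in> Obj WC"
  show "OMap (evF V \<sigma>) x \<in> Obj (Cat V)" using obv_Obj[OF V \<sigma> x] x by (simp add: evF_def del: WC_sel)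
  show "AMap (evF V \<sigma>) (Id WC x) = Id (Cat V) (OMap (evF V \<sigma>) x)"
    using va_Id[OF V \<sigma> x] x homD[OF WC.Id_hom[OF x]] by (simp add: evF_def del: WC_sel)
next
  fix f x y assume "f \<in> hom WC x y" "x \<in> Obj WC" "y \<in> Obj WC"
  then show "AMap (evF V \<sigma>) f \<in> hom (Cat V) (OMap (evF V \<sigma>) x) (OMap (evF V \<sigma>) y)"
    using va_hom[OF V \<sigma>] homD[of f WC x y] by (simp add: evF_def del: WC_sel)
next
  interpret WC: category WC by (rule WC_category)
  fix f g x y z assume f: "f \<in> hom WC x y" and g: "g \<in> hom WC y z"
  then show "AMap (evF V \<sigma>) (Comp WC g f) = Comp (Cat V) (AMap (evF V \<sigma>) g) (AMap (evF V \<sigma>) f)"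
    using va_Comp[OF V \<sigma> f g] homD[OF f] homD[OF g] homD[OF WC.Comp_hom[OF f g]] by (simp add: evF_def del: WC_sel)
qed (simp_all add: evF_def)

lemma ev_pow: "us \<in> Obj (pow_cat WC n) \<Longrightarrow> map (mo (ev V \<sigma>)) us = map (obv V \<sigma>) us"
  using ev_sel(1) by (auto simp del: WC_sel)

lemma ev_strict:
  assumes w: "w \<in> words T n"
  shows "func_comp (evF V \<sigma>) (wPhi w) = func_comp (Phi V w) (func_pow (evF V \<sigma>) n)"
proof (rule functors_eqI)
  note p = func_pow_functors[OF WC_category evF_functors, of n] and e = functorsD[OF evF_functors]
  note wD = functorsD[OF wPhi_functors[OF w]]
  show "func_comp (evF V \<sigma>) (wPhi w) \<in> functors (pow_cat WC n) (Cat V)"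
    by (rule func_comp_functors[OF category_pow_cat[OF WC_category] wPhi_functors[OF w] evF_functors])
  show "func_comp (Phi V w) (func_pow (evF V \<sigma>) n) \<in> functors (pow_cat WC n) (Cat V)"
    by (rule func_comp_functors[OF category_pow_cat[OF WC_category] p V.Phi[OF w]])
  fix us
  {
    assume us: "us \<in> Obj (pow_cat WC n)"
    have "OMap (func_pow (evF V \<sigma>) n) us = map (obv V \<sigma>) us"
      using us e(1) by (auto simp: func_pow_OMap evF_def subset_iff)
    then show "OMap (func_comp (evF V \<sigma>) (wPhi w)) us = OMap (func_comp (Phi V w) (func_pow (evF V \<sigma>) n)) us"
      using us wD(1) wD(3)[OF us] functorsD(1)[OF p] obv_op[OF V \<sigma> w us]
      by (simp del: pow_cat_sel func_pow_sel WC_sel) (simp add: evF_def del: WC_sel)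
  }
  {
    assume us: "us \<in> Arr (pow_cat WC n)"
    have "AMap (func_pow (evF V \<sigma>) n) us = map (va V \<sigma>) us"
      using us e(1) by (auto simp: func_pow_AMap evF_def subset_iff)
    then show "AMap (func_comp (evF V \<sigma>) (wPhi w)) us = AMap (func_comp (Phi V w) (func_pow (evF V \<sigma>) n)) us"
      using us wD(1) wD(4)[OF us] functorsD(1)[OF p] va_op[OF V \<sigma> w us]
      by (simp del: pow_cat_sel func_pow_sel WC_sel) (simp add: evF_def del: WC_sel)
  }
qed

lemma ev_rho:
  assumes w: "w \<in> words T n" and us: "us \<in> Obj (pow_cat WC n)"
  shows "rho (ev V \<sigma>) w us = Id (Cat V) (opo V w (map (obv V \<sigma>) us))"
proof -
  note wD = functorsD[OF wPhi_functors[OF w]] and e = functorsD[OF evF_functors]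
  have "rho (ev V \<sigma>) w us = Id (Cat V) (OMap (evF V \<sigma>) (OMap (wPhi w) us))"
    using w us wD(1) e(2) by (auto simp: ev_def simp del: pow_cat_sel)
  then show ?thesis using wD(3)[OF us] obv_op[OF V \<sigma> w us] by (simp add: evF_def del: WC_sel)
qed

text \<open>With identity coherences the three compatibilities reduce to \<open>va_asc\<close>,
  \<open>va_unt\<close> and \<open>va_sbs\<close>: the coherences of \<open>W\<close> evaluate to
  those of \<open>V\<close>.\<close>

lemma ev_mor: "mor W V (ev V \<sigma>)"
proof (intro pointwise_mor.intro pre_mor.intro pre_mor_axioms.intro W.pointwise_algebra_axioms V.pointwise_algebra_axioms
    pointwise_mor_axioms.intro)
  show "MSrc (ev V \<sigma>) = W" "MTrg (ev V \<sigma>) = V" "MRho (ev V \<sigma>) \<in> extensional (\<Union>n. words T n)"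
    by (simp_all add: ev_def)
  show "MFun (ev V \<sigma>) \<in> functors (Cat W) (Cat V)" using evF_functors by (simp add: ev_def)
  fix w n assume w: "w \<in> words T n"
  have "func_comp (evF V \<sigma>) (wPhi w) \<in> functors (pow_cat WC n) (Cat V)"
    by (rule func_comp_functors[OF category_pow_cat[OF WC_category] wPhi_functors[OF w] evF_functors])
  from nat_id_isos[OF category_pow_cat[OF WC_category] V.Cat this]
  show "MRho (ev V \<sigma>) w \<in> nat_isos (func_comp (MFun (ev V \<sigma>)) (Phi W w)) (func_comp (Phi V w) (func_pow (MFun (ev V \<sigma>)) n))"
    using w ev_strict[OF w] by (auto simp: ev_def)
next
  fix w ws us assume w: "w \<in> words T (length ws)" and wl: "word_list T ws"
    and us: "us \<in> Obj (pow_cat (Cat W) (sum_list (map (Dom T) ws)))"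
  have us': "us \<in> Obj (pow_cat WC (sum_list (map (Dom T) ws)))" using us by simp
  have ea': "evs T (opo W) ws us \<in> Obj (pow_cat WC (length ws))" using W.evs_opo[OF wl us] by simp
  note obs = map_obv_Obj[OF V \<sigma> us'] and gw = gam_words[OF w wl]
  note eV = V.evs_opo[OF wl obs]
  have e: "evs T (rho (ev V \<sigma>)) ws us = map (Id (Cat V)) (evs T (opo V) ws (map (obv V \<sigma>) us))"
    unfolding map_evs evs_map
  proof (rule evs_cong)
    show "length us = sum_list (map (Dom T) ws)" using us by simp
    fix w ys assume "w \<in> set ws" "length ys = Dom T w" "set ys \<subseteq> set us"
    then show "rho (ev V \<sigma>) w ys = Id (Cat V) (opo V w (map (obv V \<sigma>) ys))"
      using wl us' by (intro ev_rho) (auto simp: word_list_def subset_iff)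
  qed
  have i: "opa V w (map (Id (Cat V)) (evs T (opo V) ws (map (obv V \<sigma>) us))) = Id (Cat V) (opo V w (evs T (opo V) ws (map (obv V \<sigma>) us)))"
    using V.PhiD(6)[OF w eV] by simp
  note h = V.asc_hom[OF w wl obs] and ih = V.X.Id_hom[OF V.PhiD(3)[OF w eV]]
  have a: "asc W w ws us \<in> Arr WC" using homD[OF W.asc_hom[OF w wl us]] by simp
  show "Comp (Cat V) (asc V w ws (map (mo (ev V \<sigma>)) us)) (rho (ev V \<sigma>) (gam T w ws) us)
      = Comp (Cat V) (Comp (Cat V) (opa V w (evs T (rho (ev V \<sigma>)) ws us)) (rho (ev V \<sigma>) w (evs T (opo W) ws us)))
          (ma (ev V \<sigma>) (asc W w ws us))"
    unfolding e i ev_rho[OF gw us'] ev_rho[OF w ea'] ev_pow[OF us'] map_obv_evs[OF V \<sigma> wl us'] ev_sel(2)[OF a] va_asc[OF V \<sigma> w wl us']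
    using V.X.Comp_Id_left[OF h] V.X.Comp_Id_right[OF h] V.X.Comp_Id_left[OF ih] by simp
next
  fix u assume "u \<in> Obj (Cat W)"
  then have u: "u \<in> Obj WC" by simp
  have u1: "[u] \<in> Obj (pow_cat WC 1)" using u by simp
  note h = V.unt_hom[OF obv_Obj[OF V \<sigma> u]]
  have a: "unt W [u] \<in> Arr WC" using homD[OF W.unt_hom[of u]] u by simp
  show "Comp (Cat V) (unt V [mo (ev V \<sigma>) u]) (rho (ev V \<sigma>) (word1 T) [u]) = ma (ev V \<sigma>) (unt W [u])"
    unfolding ev_rho[OF word1_words u1] ev_sel(1)[OF u] ev_sel(2)[OF a] va_unt[OF V \<sigma> u]
    using V.X.Comp_Id_right[OF h] by simp
next
  fix w k l f us assume w: "w \<in> words T k" and f: "fin_fun k l f" and us: "us \<in> Obj (pow_cat (Cat W) l)"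
  have us': "us \<in> Obj (pow_cat WC l)" and uf: "map ((!) us) f \<in> Obj (pow_cat WC k)"
    using us W.pow_nth[OF f us] by simp_all
  have lu: "length us = l" using us by simp
  note obs = map_obv_Obj[OF V \<sigma> us'] and sw = subst_word_words[OF w f]
  note h = V.sbs_hom[OF w f obs, unfolded map_nth_eo[OF f lu]]
  have a: "sbs W w l f us \<in> Arr WC" using homD[OF W.sbs_hom[OF w f us]] by simp
  show "Comp (Cat V) (sbs V w l f (map (mo (ev V \<sigma>)) us)) (rho (ev V \<sigma>) (subst_word T l w f) us)
      = Comp (Cat V) (rho (ev V \<sigma>) w (map ((!) us) f)) (ma (ev V \<sigma>) (sbs W w l f us))"
    unfolding ev_rho[OF sw us'] ev_rho[OF w uf] ev_pow[OF us'] ev_sel(2)[OF a] va_sbs[OF V \<sigma> w f us']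
    using V.X.Comp_Id_left[OF h] V.X.Comp_Id_right[OF h] by simp
qed

lemma va_gin: "j \<in> Obj J \<Longrightarrow> f \<in> Arr (FX j) \<Longrightarrow> va V \<sigma> (ea (gin j f)) = ma (TObj \<sigma> j) f"
  using Gen.gin V \<sigma> by (simp add: gin_def)

lemma va_grho: "j \<in> Obj J \<Longrightarrow> w \<in> words T n \<Longrightarrow> xs \<in> Obj (pow_cat (FX j) n) \<Longrightarrow>
    va V \<sigma> (ea (grho j w xs)) = rho (TObj \<sigma> j) w xs"
  using Gen.str[OF Str.rho] V \<sigma> by (simp add: grho_def del: pow_cat_sel)

lemma va_gcone: "f \<in> Arr J \<Longrightarrow> x \<in> Obj (FX (Dom J f)) \<Longrightarrow> va V \<sigma> (ea (gcone f x)) = ce (TArr \<sigma> f) x"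
  using Gen.str[OF Str.cone] V \<sigma> by (simp add: gcone_def)

lemma obv_In: "j \<in> Obj J \<Longrightarrow> x \<in> Obj (FX j) \<Longrightarrow> obv V \<sigma> (eo (In j x)) = mo (TObj \<sigma> j) x"
  using Tm.In by simp

end

section \<open>The cone of inclusions of the diagram into the term model\<close>

lemma gin_hom: "j \<in> Obj J \<Longrightarrow> f \<in> hom (FX j) x y \<Longrightarrow> ea (gin j f) \<in> hom WC (eo (In j x)) (eo (In j y))"
  using WC_hom[OF Gen.gin[of j f]] homD[of f "FX j" x y] by (simp add: gin_def)

lemma map_In_Tm: "j \<in> Obj J \<Longrightarrow> xs \<in> Obj (pow_cat (FX j) n) \<Longrightarrow> set (map (In j) xs) \<subseteq> Tm"
  using Tm.In by auto

lemma grho_hom: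
  assumes "j \<in> Obj J" "w \<in> words T n" "xs \<in> Obj (pow_cat (FX j) n)"
  shows "ea (grho j w xs) \<in> hom WC (eo (In j (opo (PObj F j) w xs))) (opo W w (map eo (map (In j) xs)))"
  using WC_hom[OF Gen.str[OF Str.rho[OF assms]]] wPhi_OMap[OF assms(2) map_In_Tm[OF assms(1,3)]] assms(3)
  by (simp add: grho_def)

lemma gcone_hom:
  assumes "f \<in> hom J a b" "x \<in> Obj (FX a)"
  shows "ea (gcone f x) \<in> hom WC (eo (In a x)) (eo (In b (mo (PArr F f) x)))"
  using WC_hom[OF Gen.str[OF Str.cone[of f x]]] homD[OF assms(1)] assms(2) by (simp add: gcone_def)

definition inF :: "'jo \<Rightarrow> ('u, 'u, 'u, 'u) func" where
  "inF j = \<lparr>Src = FX j, Trg = WC, OMap = restrict (\<lambda>x. eo (In j x)) (Obj (FX j)),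
     AMap = restrict (\<lambda>f. ea (gin j f)) (Arr (FX j))\<rparr>"

text \<open>The coherences are the generators \<open>grho\<close>: an operation carried out in
  \<open>PObj F j\<close> and the formal operation on the included objects give different
  terms.\<close>

definition inm :: "'jo \<Rightarrow> ('t, 'u, 'u) pmor" where
  "inm j = \<lparr>MSrc = PObj F j, MTrg = W, MFun = inF j,
     MRho = restrict (\<lambda>w. \<lparr>NSrc = func_comp (inF j) (Phi (PObj F j) w), NTrg = func_comp (wPhi w) (func_pow (inF j) (Dom T w)),
       NComp = restrict (\<lambda>xs. ea (grho j w xs)) (Obj (pow_cat (FX j) (Dom T w)))\<rparr>) (\<Union>n. words T n)\<rparr>"

lemma inm_sel: "x \<in> Obj (FX j) \<Longrightarrow> mo (inm j) x = eo (In j x)" "f \<in> Arr (FX j) \<Longrightarrow> ma (inm j) f = ea (gin j f)"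
  by (simp_all add: inm_def inF_def)

lemma map_inm: "xs \<in> Obj (pow_cat (FX j) n) \<Longrightarrow> map (mo (inm j)) xs = map eo (map (In j) xs)"
  using inm_sel(1) by auto

lemma inm_rho:
  assumes "w \<in> words T n" "xs \<in> Obj (pow_cat (FX j) n)"
  shows "rho (inm j) w xs = ea (grho j w xs)"
  using assms words_Dom[OF assms(1)] by (auto simp: inm_def)

context
  fixes j
  assumes j: "j \<in> Obj J"
begin

interpretation Fj: pointwise_algebra T "PObj F j" by (rule F_pointwise[OF j])

text \<open>Under a cone \<sigma> the value of \<open>gin j f\<close> is the image of
  \<open>f\<close> under the leg at \<open>j\<close>, so functoriality of every leg gives
  functoriality here.\<close>

lemma inF_functors: "inF j \<in> functors (FX j) WC"
proof (rule functorsI_hom[OF Fj.Cat])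
  interpret WC: category WC by (rule WC_category)
  fix x assume x: "x \<in> Obj (FX j)"
  then show "OMap (inF j) x \<in> Obj WC" using Tm.In[OF j] by (simp add: inF_def)
  note ih = Fj.X.Id_hom[OF x]
  have "ea (gin j (Id (FX j) x)) = Id WC (eo (In j x))"
  proof (rule WC_eqI[OF gin_hom[OF j ih] WC.Id_hom])
    show xW: "eo (In j x) \<in> Obj WC" using Tm.In[OF j x] by simp
    fix V \<sigma> assume Vs: "V \<in> small_palgs T" "cone V \<sigma>"
    interpret m: pointwise_mor T "PObj F j" V "TObj \<sigma> j" by (rule cone_mor[OF Vs(2) j])
    show "va V \<sigma> (ea (gin j (Id (FX j) x))) = va V \<sigma> (Id WC (eo (In j x)))"
      using va_gin[OF Vs j homD[OF ih, THEN conjunct1]] va_Id[OF Vs xW] obv_In[OF Vs j x] m.MD(6)[OF x] by simp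
  qed
  then show "AMap (inF j) (Id (FX j) x) = Id WC (OMap (inF j) x)" using x homD[OF ih] by (simp add: inF_def)
next
  fix f x y assume "f \<in> hom (FX j) x y" "x \<in> Obj (FX j)" "y \<in> Obj (FX j)"
  then show "AMap (inF j) f \<in> hom WC (OMap (inF j) x) (OMap (inF j) y)"
    using gin_hom[OF j] homD[of f "FX j" x y] by (simp add: inF_def)
next
  interpret WC: category WC by (rule WC_category)
  fix f g x y z assume f: "f \<in> hom (FX j) x y" and g: "g \<in> hom (FX j) y z"
  note gf = Fj.X.Comp_hom[OF f g]
  have "ea (gin j (Comp (FX j) g f)) = Comp WC (ea (gin j g)) (ea (gin j f))"
  proof (rule WC_eqI[OF gin_hom[OF j gf] WC.Comp_hom[OF gin_hom[OF j f] gin_hom[OF j g]]])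
    fix V \<sigma> assume Vs: "V \<in> small_palgs T" "cone V \<sigma>"
    interpret m: pointwise_mor T "PObj F j" V "TObj \<sigma> j" by (rule cone_mor[OF Vs(2) j])
    show "va V \<sigma> (ea (gin j (Comp (FX j) g f))) = va V \<sigma> (Comp WC (ea (gin j g)) (ea (gin j f)))"
      using va_gin[OF Vs j homD[OF f, THEN conjunct1]] va_gin[OF Vs j homD[OF g, THEN conjunct1]] va_gin[OF Vs j homD[OF gf, THEN conjunct1]]
        va_Comp[OF Vs gin_hom[OF j f] gin_hom[OF j g]] m.MD(7)[OF f g] by simp
  qed
  then show "AMap (inF j) (Comp (FX j) g f) = Comp WC (AMap (inF j) g) (AMap (inF j) f)"
    using homD[OF f] homD[OF g] homD[OF gf] by (simp add: inF_def)
qed (simp_all add: inF_def)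

text \<open>By value, naturality of \<open>grho\<close> is naturality of \<open>rho\<close> for
  every leg; invertibility holds because \<open>grho\<close> is structural.\<close>

lemma inm_MRho:
  assumes w: "w \<in> words T n"
  shows "MRho (inm j) w \<in> nat_isos (func_comp (MFun (inm j)) (Phi (PObj F j) w)) (func_comp (Phi W w) (func_pow (MFun (inm j)) n))"
proof (rule nat_isosI, rule nat_transsI_hom)
  interpret WC: category WC by (rule WC_category)
  have mf: "MFun (inm j) = inF j" by (simp add: inm_def)
  note p = func_pow_functors[OF Fj.Cat inF_functors, of n]
  have mw: "MRho (inm j) w = \<lparr>NSrc = func_comp (inF j) (Phi (PObj F j) w), NTrg = func_comp (wPhi w) (func_pow (inF j) n),
       NComp = restrict (\<lambda>xs. ea (grho j w xs)) (Obj (pow_cat (FX j) n))\<rparr>"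
    using w words_Dom[OF w] by (auto simp: inm_def)
  show "NSrc (MRho (inm j) w) = func_comp (MFun (inm j)) (Phi (PObj F j) w)"
    "NTrg (MRho (inm j) w) = func_comp (Phi W w) (func_pow (MFun (inm j)) n)"
    "NComp (MRho (inm j) w) \<in> extensional (Obj (pow_cat (FX j) n))"
    unfolding mf mw by simp_all
  show SF: "func_comp (MFun (inm j)) (Phi (PObj F j) w) \<in> functors (pow_cat (FX j) n) WC"
    unfolding mf by (rule func_comp_functors[OF Fj.PX Fj.Phi[OF w] inF_functors])
  show TF: "func_comp (Phi W w) (func_pow (MFun (inm j)) n) \<in> functors (pow_cat (FX j) n) WC"
    unfolding mf W_sel by (rule func_comp_functors[OF Fj.PX p wPhi_functors[OF w]])
  show "category (pow_cat (FX j) n)" by (rule Fj.PX)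
  have so: "OMap (func_comp (MFun (inm j)) (Phi (PObj F j) w)) xs = eo (In j (opo (PObj F j) w xs))"
    and to: "OMap (func_comp (Phi W w) (func_pow (MFun (inm j)) n)) xs = opo W w (map eo (map (In j) xs))"
    if xs: "xs \<in> Obj (pow_cat (FX j) n)" for xs
  proof -
    have "OMap (func_pow (inF j) n) xs = map eo (map (In j) xs)"
      using xs functorsD(1)[OF inF_functors] by (auto simp: func_pow_OMap inF_def)
    then show "OMap (func_comp (Phi W w) (func_pow (MFun (inm j)) n)) xs = opo W w (map eo (map (In j) xs))"
      using xs functorsD(1)[OF p] unfolding mf by (simp del: pow_cat_sel func_pow_sel W_sel map_map)
    show "OMap (func_comp (MFun (inm j)) (Phi (PObj F j) w)) xs = eo (In j (opo (PObj F j) w xs))"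
      using xs Fj.PhiD(1)[OF w] Fj.PhiD(3)[OF w xs] unfolding mf by (simp add: inF_def del: pow_cat_sel)
  qed
  {
    fix xs assume xs: "xs \<in> Obj (pow_cat (FX j) n)"
    show "NComp (MRho (inm j) w) xs \<in> hom WC (OMap (func_comp (MFun (inm j)) (Phi (PObj F j) w)) xs) (OMap (func_comp (Phi W w) (func_pow (MFun (inm j)) n)) xs)"
      unfolding so[OF xs] to[OF xs] inm_rho[OF w xs] by (rule grho_hom[OF j w xs])
  }
  {
    fix xs assume "xs \<in> Obj (Src (func_comp (MFun (inm j)) (Phi (PObj F j) w)))"
    then have xs: "xs \<in> Obj (pow_cat (FX j) n)" unfolding functorsD(1)[OF SF] .
    show "iso_in (Trg (func_comp (MFun (inm j)) (Phi (PObj F j) w))) (NComp (MRho (inm j) w) xs)"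
      unfolding functorsD(2)[OF SF] inm_rho[OF w xs] by (rule WC_iso(1)[OF Str.rho[OF j w xs]])
  }
  fix fs xs ys assume f: "fs \<in> hom (pow_cat (FX j) n) xs ys" and xs: "xs \<in> Obj (pow_cat (FX j) n)" and ys: "ys \<in> Obj (pow_cat (FX j) n)"
  have fa: "fs \<in> Arr (pow_cat (FX j) n)" using homD[OF f] by blast
  note pf = Fj.PhiD(5)[OF w f]
  have sa: "AMap (func_comp (MFun (inm j)) (Phi (PObj F j) w)) fs = ea (gin j (opa (PObj F j) w fs))"
    using fa Fj.PhiD(1)[OF w] homD[OF pf] unfolding mf by (simp add: inF_def del: pow_cat_sel)
  let ?gs = "map (\<lambda>f. ea (gin j f)) fs"
  have gs: "?gs \<in> hom (pow_cat WC n) (map eo (map (In j) xs)) (map eo (map (In j) ys))"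
    using f gin_hom[OF j] by (simp add: hom_pow_iff)
  have ta: "AMap (func_comp (Phi W w) (func_pow (MFun (inm j)) n)) fs = opa W w ?gs"
  proof -
    have "AMap (func_pow (inF j) n) fs = ?gs"
      using fa functorsD(1)[OF inF_functors] by (auto simp: func_pow_AMap inF_def)
    then show ?thesis
      using fa functorsD(1)[OF p] unfolding mf by (simp del: pow_cat_sel func_pow_sel W_sel map_map)
  qed
  note g1 = gin_hom[OF j pf] and r1 = grho_hom[OF j w xs] and r2 = grho_hom[OF j w ys]
  have g2: "opa W w ?gs \<in> hom WC (opo W w (map eo (map (In j) xs))) (opo W w (map eo (map (In j) ys)))"
    using W.PhiD(5)[OF w] gs by (simp del: map_map)
  show "Comp WC (NComp (MRho (inm j) w) ys) (AMap (func_comp (MFun (inm j)) (Phi (PObj F j) w)) fs)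
    = Comp WC (AMap (func_comp (Phi W w) (func_pow (MFun (inm j)) n)) fs) (NComp (MRho (inm j) w) xs)"
    unfolding sa ta inm_rho[OF w xs] inm_rho[OF w ys]
  proof (rule WC_eqI[OF WC.Comp_hom[OF g1 r2] WC.Comp_hom[OF r1 g2]])
    fix V \<sigma> assume Vs: "V \<in> small_palgs T" "cone V \<sigma>"
    interpret m: pointwise_mor T "PObj F j" V "TObj \<sigma> j" by (rule cone_mor[OF Vs(2) j])
    have "map (va V \<sigma>) ?gs = map (ma (TObj \<sigma> j)) fs"
      using va_gin[OF Vs j] fa by (auto simp: subset_iff)
    then show "va V \<sigma> (Comp WC (ea (grho j w ys)) (ea (gin j (opa (PObj F j) w fs)))) = va V \<sigma> (Comp WC (opa W w ?gs) (ea (grho j w xs)))"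
      using va_Comp[OF Vs g1 r2] va_Comp[OF Vs r1 g2] va_grho[OF Vs j w xs] va_grho[OF Vs j w ys] va_gin[OF Vs j homD[OF pf, THEN conjunct1]]
        va_op[OF Vs w homD[OF gs, THEN conjunct1]] m.rho_square[OF w f] by (simp add: square_def del: map_map W_sel)
  qed
qed

text \<open>Each compatibility evaluates, at a cone \<sigma>, to the same compatibility for the
  morphism \<open>TObj \<sigma> j\<close>.\<close>

lemma inm_mor: "mor (PObj F j) W (inm j)"
proof (intro pointwise_mor.intro pre_mor.intro pre_mor_axioms.intro W.pointwise_algebra_axioms Fj.pointwise_algebra_axioms
    pointwise_mor_axioms.intro inm_MRho)
  interpret WC: category WC by (rule WC_category)
  show "MSrc (inm j) = PObj F j" "MTrg (inm j) = W" "MRho (inm j) \<in> extensional (\<Union>n. words T n)"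
    by (simp_all add: inm_def)
  show "MFun (inm j) \<in> functors (FX j) (Cat W)" using inF_functors by (simp add: inm_def)
  have obm: "map (obv V \<sigma>) (map eo (map (In j) xs)) = map (mo (TObj \<sigma> j)) xs"
    if "V \<in> small_palgs T" "cone V \<sigma>" "xs \<in> Obj (pow_cat (FX j) n)" for V \<sigma> xs n
    using obv_In[OF that(1,2) j] that(3) by (auto simp: subset_iff)
  have mW: "map eo (map (In j) xs) \<in> Obj (pow_cat WC n)" if "xs \<in> Obj (pow_cat (FX j) n)" for xs n
    using that by (intro WC_pow_ObjI[OF map_In_Tm[OF j that]]) simp
  {
    fix w ws xs assume w: "w \<in> words T (length ws)" and wl: "word_list T ws"
      and xs: "xs \<in> Obj (pow_cat (FX j) (sum_list (map (Dom T) ws)))"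
    note gw = gam_words[OF w wl] and eo' = Fj.evs_opo[OF wl xs] and us = mW[OF xs]
    have wn: "ws ! i \<in> words T (Dom T (ws ! i))" if "i < length ws" for i using wl that by (simp add: word_list_def)
    have b: "split_blocks (map (Dom T) ws) xs ! i \<in> Obj (pow_cat (FX j) (Dom T (ws ! i)))" if "i < length ws" for i
      using blocks_Obj[OF xs, of i] that by (simp del: pow_cat_sel)
    let ?gs = "evs T (\<lambda>w ys. ea (grho j w ys)) ws xs"
    have er: "evs T (rho (inm j)) ws xs = ?gs"
      by (rule nth_equalityI) (use inm_rho[OF wn b] in \<open>simp_all add: evs_nth\<close>)
    have gs: "?gs \<in> hom (pow_cat WC (length ws)) (map eo (map (In j) (evs T (opo (PObj F j)) ws xs))) (evs T (opo W) ws (map eo (map (In j) xs)))"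
      using grho_hom[OF j wn b] by (simp add: hom_pow_iff evs_nth split_blocks_map del: W_sel)
    note r1 = grho_hom[OF j gw xs] and r2 = grho_hom[OF j w eo'] and g1 = gin_hom[OF j Fj.asc_hom[OF w wl xs]]
    have a1: "asc W w ws (map eo (map (In j) xs)) \<in> hom WC (opo W (gam T w ws) (map eo (map (In j) xs))) (opo W w (evs T (opo W) ws (map eo (map (In j) xs))))"
      using W.asc_hom[OF w wl] us by simp
    have p1: "opa W w ?gs \<in> hom WC (opo W w (map eo (map (In j) (evs T (opo (PObj F j)) ws xs)))) (opo W w (evs T (opo W) ws (map eo (map (In j) xs))))"
      using W.PhiD(5)[OF w] gs by (simp del: map_map)
    show "Comp (Cat W) (asc W w ws (map (mo (inm j)) xs)) (rho (inm j) (gam T w ws) xs)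
      = Comp (Cat W) (Comp (Cat W) (opa W w (evs T (rho (inm j)) ws xs)) (rho (inm j) w (evs T (opo (PObj F j)) ws xs)))
          (ma (inm j) (asc (PObj F j) w ws xs))"
      unfolding W_sel(1) er map_inm[OF xs] inm_rho[OF gw xs] inm_rho[OF w eo'] inm_sel(2)[OF homD[OF Fj.asc_hom[OF w wl xs], THEN conjunct1]]
    proof (rule WC_eqI[OF WC.Comp_hom[OF r1 a1] WC.Comp_hom[OF g1 WC.Comp_hom[OF r2 p1]]])
      fix V \<sigma> assume Vs: "V \<in> small_palgs T" "cone V \<sigma>"
      interpret m: pointwise_mor T "PObj F j" V "TObj \<sigma> j" by (rule cone_mor[OF Vs(2) j])
      have "map (va V \<sigma>) ?gs = evs T (rho (TObj \<sigma> j)) ws xs"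
        by (rule nth_equalityI) (use va_grho[OF Vs j wn b] in \<open>simp_all add: evs_nth\<close>)
      then show "va V \<sigma> (Comp WC (asc W w ws (map eo (map (In j) xs))) (ea (grho j (gam T w ws) xs)))
        = va V \<sigma> (Comp WC (Comp WC (opa W w ?gs) (ea (grho j w (evs T (opo (PObj F j)) ws xs)))) (ea (gin j (asc (PObj F j) w ws xs))))"
        using va_Comp[OF Vs r1 a1] va_Comp[OF Vs g1 WC.Comp_hom[OF r2 p1]] va_Comp[OF Vs r2 p1]
          va_asc[OF Vs w wl us] va_grho[OF Vs j gw xs] va_grho[OF Vs j w eo'] va_op[OF Vs w homD[OF gs, THEN conjunct1]]
          va_gin[OF Vs j homD[OF Fj.asc_hom[OF w wl xs], THEN conjunct1]] obm[OF Vs xs] m.rho_asc[OF w wl xs]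
        by (simp only:)
    qed
  }
  {
    fix x assume x: "x \<in> Obj (FX j)"
    have x1: "[x] \<in> Obj (pow_cat (FX j) 1)" using x by simp
    have xW: "eo (In j x) \<in> Obj WC" using Tm.In[OF j x] by simp
    note r1 = grho_hom[OF j word1_words x1, simplified list.map] and g1 = gin_hom[OF j Fj.unt_hom[OF x]]
    have u1: "unt W [eo (In j x)] \<in> hom WC (opo W (word1 T) [eo (In j x)]) (eo (In j x))"
      using W.unt_hom xW by simp
    show "Comp (Cat W) (unt W [mo (inm j) x]) (rho (inm j) (word1 T) [x]) = ma (inm j) (unt (PObj F j) [x])"
      unfolding W_sel(1) inm_rho[OF word1_words x1] inm_sel(1)[OF x] inm_sel(2)[OF homD[OF Fj.unt_hom[OF x], THEN conjunct1]]
    proof (rule WC_eqI[OF WC.Comp_hom[OF r1 u1] g1])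
      fix V \<sigma> assume Vs: "V \<in> small_palgs T" "cone V \<sigma>"
      interpret m: pointwise_mor T "PObj F j" V "TObj \<sigma> j" by (rule cone_mor[OF Vs(2) j])
      show "va V \<sigma> (Comp WC (unt W [eo (In j x)]) (ea (grho j (word1 T) [x]))) = va V \<sigma> (ea (gin j (unt (PObj F j) [x])))"
        using va_Comp[OF Vs r1 u1] va_unt[OF Vs xW] va_grho[OF Vs j word1_words x1] obv_In[OF Vs j x]
          va_gin[OF Vs j homD[OF Fj.unt_hom[OF x], THEN conjunct1]] m.rho_unt[OF x] by (simp only:)
    qed
  }
  {
    fix w k l f xs assume w: "w \<in> words T k" and f: "fin_fun k l f" and xs: "xs \<in> Obj (pow_cat (FX j) l)"
    note sw = subst_word_words[OF w f] and xf = Fj.pow_nth[OF f xs] and us = mW[OF xs]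
    have lx: "length xs = l" using xs by simp
    note r1 = grho_hom[OF j sw xs] and r2 = grho_hom[OF j w xf] and g1 = gin_hom[OF j Fj.sbs_hom[OF w f xs]]
    have mf: "map ((!) (map eo (map (In j) xs))) f = map eo (map (In j) (map ((!) xs) f))"
      using map_nth_eo[OF f lx, of "eo \<circ> In j"] by simp
    have s1: "sbs W w l f (map eo (map (In j) xs)) \<in> hom WC (opo W (subst_word T l w f) (map eo (map (In j) xs))) (opo W w (map eo (map (In j) (map ((!) xs) f))))"
      using W.sbs_hom[OF w f, of "map eo (map (In j) xs)"] us unfolding mf by simp
    show "Comp (Cat W) (sbs W w l f (map (mo (inm j)) xs)) (rho (inm j) (subst_word T l w f) xs)
      = Comp (Cat W) (rho (inm j) w (map ((!) xs) f)) (ma (inm j) (sbs (PObj F j) w l f xs))"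
      unfolding W_sel(1) map_inm[OF xs] inm_rho[OF sw xs] inm_rho[OF w xf] inm_sel(2)[OF homD[OF Fj.sbs_hom[OF w f xs], THEN conjunct1]]
    proof (rule WC_eqI[OF WC.Comp_hom[OF r1 s1] WC.Comp_hom[OF g1 r2]])
      fix V \<sigma> assume Vs: "V \<in> small_palgs T" "cone V \<sigma>"
      interpret m: pointwise_mor T "PObj F j" V "TObj \<sigma> j" by (rule cone_mor[OF Vs(2) j])
      show "va V \<sigma> (Comp WC (sbs W w l f (map eo (map (In j) xs))) (ea (grho j (subst_word T l w f) xs)))
        = va V \<sigma> (Comp WC (ea (grho j w (map ((!) xs) f))) (ea (gin j (sbs (PObj F j) w l f xs))))"
        using va_Comp[OF Vs r1 s1] va_Comp[OF Vs g1 r2] va_sbs[OF Vs w f us] va_grho[OF Vs j sw xs] va_grho[OF Vs j w xf]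
          va_gin[OF Vs j homD[OF Fj.sbs_hom[OF w f xs], THEN conjunct1]] obm[OF Vs xs] m.rho_sbs[OF w f xs] by (simp only:)
    qed
  }
qed

end

definition inc :: "'ja \<Rightarrow> ('t, 'u, 'u) pcell" where
  "inc f = \<lparr>CSrc = inm (Dom J f), CTrg = pmor_comp T (inm (Cod J f)) (PArr F f),
     CNat = \<lparr>NSrc = MFun (inm (Dom J f)), NTrg = MFun (pmor_comp T (inm (Cod J f)) (PArr F f)),
       NComp = restrict (\<lambda>x. ea (gcone f x)) (Obj (FX (Dom J f)))\<rparr>\<rparr>"

definition inj_cone :: "('jo, 'ja, ('t, 'u, 'u) pmor, ('t, 'u, 'u) pcell) psnat" where
  "inj_cone = \<lparr>TObj = restrict inm (Obj J), TArr = restrict inc (Arr J)\<rparr>"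

text \<open>For every cone \<sigma> the cell \<open>TArr \<sigma> f\<close> is natural and
  compatible with \<open>rho\<close>; since these cells are the values of \<open>gcone f\<close>,
  the family \<open>gcone f\<close> inherits both properties.\<close>

lemma inc_cells:
  assumes fh: "f \<in> hom J a b"
  shows "inc f \<in> cells (inm a) (pmor_comp T (inm b) (PArr F f))" "x \<in> Obj (FX a) \<Longrightarrow> ce (inc f) x = ea (gcone f x)"
proof -
  interpret WC: category WC by (rule WC_category)
  have ab: "Dom J f = a" "Cod J f = b" "f \<in> Arr J" "a \<in> Obj J" "b \<in> Obj J" using homD[OF fh] J.hom_Obj[OF fh] by auto
  show c: "ce (inc f) x = ea (gcone f x)" if "x \<in> Obj (FX a)" for x using that ab by (simp add: inc_def)
  interpret Fb: mor_pair T "PObj F a" "PObj F b" W "PArr F f" "inm b"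
    using F_mor[OF fh] inm_mor[OF ab(5)] by (simp add: mor_pair_def)
  interpret ia: pointwise_mor T "PObj F a" W "inm a" by (rule inm_mor[OF ab(4)])
  note m1 = inm_mor[OF ab(4)] and m2 = mor_comp[OF F_mor[OF fh] inm_mor[OF ab(5)]]
  have Fx: "mo (PArr F f) x \<in> Obj (FX b)" if "x \<in> Obj (FX a)" for x by (rule Fb.G.MD(3)[OF that])
  have m2o: "mo (pmor_comp T (inm b) (PArr F f)) x = eo (In b (mo (PArr F f) x))" if "x \<in> Obj (FX a)" for x
    unfolding Fb.HG_mo[OF that] by (rule inm_sel(1)[OF Fx[OF that]])
  have m2a: "ma (pmor_comp T (inm b) (PArr F f)) k = ea (gin b (ma (PArr F f) k))" if "k \<in> Arr (FX a)" for k
    unfolding Fb.HG_ma[OF that] by (rule inm_sel(2)[OF Fb.G.MD(4)[OF that]])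
  have sV: "TArr \<sigma> f \<in> cells (TObj \<sigma> a) (pmor_comp T (TObj \<sigma> b) (PArr F f))"
    "mor (PObj F a) V (TObj \<sigma> a)" "mor (PObj F a) V (pmor_comp T (TObj \<sigma> b) (PArr F f))"
    "mor_pair T (PObj F a) (PObj F b) V (PArr F f) (TObj \<sigma> b)"
    if "cone V \<sigma>" for V \<sigma>
    using cone_cell[OF that fh] cone_mor[OF that ab(4)] mor_comp[OF F_mor[OF fh] cone_mor[OF that ab(5)]]
      F_mor[OF fh] cone_mor[OF that ab(5)] by (auto simp: mor_pair_def)
  have vc: "va V \<sigma> (ea (gcone f x)) = ce (TArr \<sigma> f) x" if "V \<in> small_palgs T" "cone V \<sigma>" "x \<in> Obj (FX a)" for V \<sigma> x
    using va_gcone[OF that(1,2) ab(3)] that(3) ab(1) by simp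
  show "inc f \<in> cells (inm a) (pmor_comp T (inm b) (PArr F f))"
  proof (rule cellI[OF m1 m2])
    show "CSrc (inc f) = inm a" "CTrg (inc f) = pmor_comp T (inm b) (PArr F f)" "NSrc (CNat (inc f)) = MFun (inm a)"
      "NTrg (CNat (inc f)) = MFun (pmor_comp T (inm b) (PArr F f))" "ce (inc f) \<in> extensional (Obj (FX a))"
      using ab by (simp_all add: inc_def)
    have ch: "ce (inc f) x \<in> hom (Cat W) (mo (inm a) x) (mo (pmor_comp T (inm b) (PArr F f)) x)" if "x \<in> Obj (FX a)" for x
      unfolding c[OF that] m2o[OF that] inm_sel(1)[OF that] W_sel(1) by (rule gcone_hom[OF fh that])
    then show "\<And>x. x \<in> Obj (FX a) \<Longrightarrow> ce (inc f) x \<in> hom (Cat W) (mo (inm a) x) (mo (pmor_comp T (inm b) (PArr F f)) x)" .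
    fix k x y assume k: "k \<in> hom (FX a) x y"
    have xy: "x \<in> Obj (FX a)" "y \<in> Obj (FX a)" "k \<in> Arr (FX a)" using Fb.G.A.X.hom_Obj[OF k] homD[OF k] by auto
    note g1 = gin_hom[OF ab(4) k] and g2 = gin_hom[OF ab(5) Fb.G.MD(5)[OF k]] and c1 = gcone_hom[OF fh xy(1)] and c2 = gcone_hom[OF fh xy(2)]
    show "square (Cat W) (ma (inm a) k) (ce (inc f) x) (ce (inc f) y) (ma (pmor_comp T (inm b) (PArr F f)) k)"
      unfolding c[OF xy(1)] c[OF xy(2)] m2a[OF xy(3)] inm_sel(2)[OF xy(3)] W_sel(1)
    proof (rule WC.squareI[OF g1 g2 c1 c2], rule WC_eqI[OF WC.Comp_hom[OF c1 g2] WC.Comp_hom[OF g1 c2]])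
      fix V \<sigma> assume Vs: "V \<in> small_palgs T" "cone V \<sigma>"
      interpret S: mor_pair T "PObj F a" "PObj F b" V "PArr F f" "TObj \<sigma> b" by (rule sV(4)[OF Vs(2)])
      show "va V \<sigma> (Comp WC (ea (gin b (ma (PArr F f) k))) (ea (gcone f x))) = va V \<sigma> (Comp WC (ea (gcone f y)) (ea (gin a k)))"
        using va_Comp[OF Vs c1 g2] va_Comp[OF Vs g1 c2] vc[OF Vs xy(1)] vc[OF Vs xy(2)] va_gin[OF Vs ab(4) xy(3)]
          va_gin[OF Vs ab(5) Fb.G.MD(4)[OF xy(3)]] cell_square[OF sV(2,3,1)[OF Vs(2)] k] S.HG_ma[OF xy(3)]
        by (simp add: square_def del: WC_sel pmor_comp_sel)
    qed
  next
    fix w n xs assume w: "w \<in> words T n" and xs: "xs \<in> Obj (pow_cat (FX a) n)"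
    note ox = Fb.G.A.PhiD(3)[OF w xs] and Fxs = Fb.G.map_mo[OF xs]
    let ?gs = "map (\<lambda>x. ea (gcone f x)) xs"
    have m: "map (ce (inc f)) xs = ?gs" using xs c by (auto simp: subset_iff)
    have gs: "?gs \<in> hom (pow_cat WC n) (map eo (map (In a) xs)) (map eo (map (In b) (map (mo (PArr F f)) xs)))"
      using xs gcone_hom[OF fh] by (auto simp: hom_pow_iff subset_iff)
    have p: "opa W w ?gs \<in> hom WC (opo W w (map eo (map (In a) xs))) (opo W w (map eo (map (In b) (map (mo (PArr F f)) xs))))"
      using W.PhiD(5)[OF w] gs by (simp del: map_map)
    note r1 = grho_hom[OF ab(4) w xs] and r2 = grho_hom[OF ab(5) w Fxs] and g2 = gin_hom[OF ab(5) Fb.G.rho_hom[OF w xs]]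
      and c1 = gcone_hom[OF fh ox]
    note ra = homD[OF Fb.G.rho_hom[OF w xs], THEN conjunct1]
    show "square (Cat W) (rho (inm a) w xs) (ce (inc f) (opo (PObj F a) w xs)) (opa W w (map (ce (inc f)) xs)) (rho (pmor_comp T (inm b) (PArr F f)) w xs)"
      unfolding c[OF ox] m Fb.HG_rho[OF w xs] inm_rho[OF w xs] inm_rho[OF w Fxs] inm_sel(2)[OF ra] W_sel(1)
    proof (rule WC.squareI[OF r1 WC.Comp_hom[OF g2 r2] c1 p], rule WC_eqI[OF WC.Comp_hom[OF c1 WC.Comp_hom[OF g2 r2]] WC.Comp_hom[OF r1 p]])
      fix V \<sigma> assume Vs: "V \<in> small_palgs T" "cone V \<sigma>"
      interpret S: mor_pair T "PObj F a" "PObj F b" V "PArr F f" "TObj \<sigma> b" by (rule sV(4)[OF Vs(2)])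
      have mv: "map (va V \<sigma>) ?gs = map (ce (TArr \<sigma> f)) xs" using xs vc[OF Vs] by (auto simp: subset_iff)
      show "va V \<sigma> (Comp WC (Comp WC (ea (grho b w (map (mo (PArr F f)) xs))) (ea (gin b (rho (PArr F f) w xs)))) (ea (gcone f (opo (PObj F a) w xs))))
        = va V \<sigma> (Comp WC (opa W w ?gs) (ea (grho a w xs)))"
        using va_Comp[OF Vs c1 WC.Comp_hom[OF g2 r2]] va_Comp[OF Vs g2 r2] va_Comp[OF Vs r1 p] vc[OF Vs ox]
          va_grho[OF Vs ab(4) w xs] va_grho[OF Vs ab(5) w Fxs] va_gin[OF Vs ab(5) ra] va_op[OF Vs w homD[OF gs, THEN conjunct1]] mv
          cell_rho[OF sV(2,3,1)[OF Vs(2)] w xs] S.HG_rho[OF w xs]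
        by (simp only: square_def)
    qed
  qed
qed

lemma inj_cone_sel: "j \<in> Obj J \<Longrightarrow> TObj inj_cone j = inm j" "f \<in> Arr J \<Longrightarrow> TArr inj_cone f = inc f"
  by (simp_all add: inj_cone_def)

text \<open>The unit and composition laws evaluate to \<open>cone_unit\<close> and
  \<open>cone_comp\<close> of every cone; the cells are invertible because \<open>gcone\<close> is
  structural.\<close>

lemma inj_cone: "cone W inj_cone"
  unfolding cone_def
proof (intro conjI ballI impI)
  interpret WC: category WC by (rule WC_category)
  show "TObj inj_cone \<in> extensional (Obj J)" "TArr inj_cone \<in> extensional (Arr J)" by (simp_all add: inj_cone_def)
  show "mor (PObj F j) W (TObj inj_cone j)" if "j \<in> Obj J" for j using inm_mor[OF that] inj_cone_sel that by simp
  {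
    fix f assume f: "f \<in> Arr J"
    note fh = J.Arr_hom[OF f]
    show "TArr inj_cone f \<in> cells (TObj inj_cone (Dom J f)) (pmor_comp T (TObj inj_cone (Cod J f)) (PArr F f))"
      using inc_cells(1)[OF fh] inj_cone_sel f J.Dom_closed[OF f] J.Cod_closed[OF f] by simp
    fix x assume "x \<in> Obj (FX (Dom J f))"
    then show "iso_in (Cat W) (ce (TArr inj_cone f) x)"
      using inc_cells(2)[OF fh] inj_cone_sel f WC_iso(1)[OF Str.cone[OF f]] by simp
  }
  {
    fix j x assume j: "j \<in> Obj J" and x: "x \<in> Obj (FX j)"
    note ih = J.Id_hom[OF j]
    have i: "Id J j \<in> Arr J" "Dom J (Id J j) = j" using homD[OF ih] by auto
    interpret Fj: pointwise_algebra T "PObj F j" by (rule F_pointwise[OF j])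
    have u: "ce (PUnit F j) x \<in> hom (FX j) x (mo (PArr F (Id J j)) x)"
      using cell_hom[OF mor_id[OF F_small[OF j]] F_mor[OF ih] F_unit[OF j] x] x by simp
    note ua = homD[OF u, THEN conjunct1]
    have "ea (gcone (Id J j) x) = ea (gin j (ce (PUnit F j) x))"
    proof (rule WC_eqI[OF gcone_hom[OF ih x] gin_hom[OF j u]])
      fix V \<sigma> assume Vs: "V \<in> small_palgs T" "cone V \<sigma>"
      show "va V \<sigma> (ea (gcone (Id J j) x)) = va V \<sigma> (ea (gin j (ce (PUnit F j) x)))"
        using va_gcone[OF Vs i(1)] va_gin[OF Vs j ua] cone_unit[OF Vs(2) j x] x i(2) by simp
    qed
    then show "ce (TArr inj_cone (Id J j)) x = ma (TObj inj_cone j) (ce (PUnit F j) x)"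
      using inj_cone_sel j i inc_cells(2)[OF ih x] inm_sel(2)[OF ua] by simp
  }
  {
    fix f g x assume f: "f \<in> Arr J" and g: "g \<in> Arr J" and gf: "Dom J g = Cod J f" and x: "x \<in> Obj (FX (Dom J f))"
    have fh: "f \<in> hom J (Dom J f) (Cod J f)" and gh: "g \<in> hom J (Cod J f) (Cod J g)" using f g gf by (auto simp: hom_def)
    note gfh = J.Comp_hom[OF fh gh]
    have i: "Comp J g f \<in> Arr J" "Dom J (Comp J g f) = Dom J f" using homD[OF gfh] by auto
    note cd = J.Cod_closed[OF g]
    interpret Ff: pointwise_mor T "PObj F (Dom J f)" "PObj F (Cod J f)" "PArr F f" by (rule F_mor[OF fh])
    have fx: "mo (PArr F f) x \<in> Obj (FX (Cod J f))" by (rule Ff.MD(3)[OF x])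
    have pc: "ce (PComp F g f) x \<in> hom (FX (Cod J g)) (mo (PArr F g) (mo (PArr F f) x)) (mo (PArr F (Comp J g f)) x)"
      using cell_hom[OF mor_comp[OF F_mor[OF fh] F_mor[OF gh]] F_mor[OF gfh] F_comp[OF fh gh] x] x Ff.MD(1) by simp
    note pa = homD[OF pc, THEN conjunct1]
    note c1 = gcone_hom[OF fh x] and c2 = gcone_hom[OF gh fx] and g1 = gin_hom[OF cd pc]
    have "ea (gcone (Comp J g f) x) = Comp WC (ea (gin (Cod J g) (ce (PComp F g f) x))) (Comp WC (ea (gcone g (mo (PArr F f) x))) (ea (gcone f x)))"
    proof (rule WC_eqI[OF gcone_hom[OF gfh x] WC.Comp_hom[OF WC.Comp_hom[OF c1 c2] g1]])
      fix V \<sigma> assume Vs: "V \<in> small_palgs T" "cone V \<sigma>"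
      show "va V \<sigma> (ea (gcone (Comp J g f) x)) = va V \<sigma> (Comp WC (ea (gin (Cod J g) (ce (PComp F g f) x))) (Comp WC (ea (gcone g (mo (PArr F f) x))) (ea (gcone f x))))"
        using va_Comp[OF Vs WC.Comp_hom[OF c1 c2] g1] va_Comp[OF Vs c1 c2] va_gin[OF Vs cd pa] va_gcone[OF Vs f x]
          va_gcone[OF Vs g, unfolded gf, OF fx] va_gcone[OF Vs i(1), unfolded i(2), OF x] cone_comp[OF Vs(2) fh gh x] by simp
    qed
    then show "ce (TArr inj_cone (Comp J g f)) x = Comp (Cat W) (ma (TObj inj_cone (Cod J g)) (ce (PComp F g f) x))
          (Comp (Cat W) (ce (TArr inj_cone g) (mo (PArr F f) x)) (ce (TArr inj_cone f) x))"
      using inj_cone_sel f g i cd inc_cells(2)[OF fh x] inc_cells(2)[OF gh fx] inc_cells(2)[OF gfh x] inm_sel(2)[OF pa] by simp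
  }
qed

end

section \<open>The universal property\<close>

text \<open>Recursion whose step also sees the argument terms: in \<open>al\<close> the coherences
  of two morphisms at these terms enter the step.\<close>

primrec fold_tm :: "('jo \<Rightarrow> 'u \<Rightarrow> 'u) \<Rightarrow> ('t \<Rightarrow> ('t, 'jo, 'u) tm list \<Rightarrow> 'u list \<Rightarrow> 'u) \<Rightarrow> ('t, 'jo, 'u) tm \<Rightarrow> 'u" where
  "fold_tm g h (In j x) = g j x"
| "fold_tm g h (Op w ts) = h w ts (map (fold_tm g h) ts)"

lemma (in diagram) cone_eqI:
  assumes "cone V \<sigma>" "cone V \<tau>" "\<And>j. j \<in> Obj J \<Longrightarrow> TObj \<sigma> j = TObj \<tau> j"
    "\<And>f x. f \<in> Arr J \<Longrightarrow> x \<in> Obj (FX (Dom J f)) \<Longrightarrow> ce (TArr \<sigma> f) x = ce (TArr \<tau> f) x"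
  shows "\<sigma> = \<tau>"
proof -
  have "TObj \<sigma> = TObj \<tau>"
    using assms(1-3) by (intro extensionalityI[of _ "Obj J"]) (auto simp: cone_def)
  moreover have "TArr \<sigma> = TArr \<tau>"
  proof (rule extensionalityI[of _ "Arr J"])
    fix f assume f: "f \<in> Arr J"
    note fh = J.Arr_hom[OF f] and d = J.Dom_closed[OF f] and cd = J.Cod_closed[OF f]
    show "TArr \<sigma> f = TArr \<tau> f"
      by (rule cell_eqI[OF cone_mor[OF assms(1) d] mor_comp[OF F_mor[OF fh] cone_mor[OF assms(1) cd]] cone_cell[OF assms(1) fh]])
         (use cone_cell[OF assms(2) fh] assms(3)[OF d] assms(3)[OF cd] assms(4)[OF f] in simp_all)
  qed (use assms(1,2) in \<open>simp_all add: cone_def\<close>)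
  ultimately show ?thesis by (cases \<sigma>; cases \<tau>) simp
qed

context term_model
begin

text \<open>An equality of cones, not just an isomorphism. Evaluation has identity coherences and
  sends \<open>gin\<close>, \<open>grho\<close> and \<open>gcone\<close> to the arrow maps of the
  legs, their coherences and the cone cells.\<close>

lemma postcomp_ev:
  assumes V: "V \<in> small_palgs T" and \<sigma>: "cone V \<sigma>"
  shows "cone_postcomp J K inj_cone (ev V \<sigma>) = \<sigma>"
proof (rule cone_eqI[OF cone_postcomp(1)[OF inj_cone ev_mor[OF V \<sigma>]] \<sigma>])
  fix j assume j: "j \<in> Obj J"
  interpret m: pointwise_mor T "PObj F j" V "TObj \<sigma> j" by (rule cone_mor[OF \<sigma> j])
  interpret p: mor_pair T "PObj F j" W V "inm j" "ev V \<sigma>"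
    using inm_mor[OF j] ev_mor[OF V \<sigma>] by (simp add: mor_pair_def)
  have "pmor_comp T (ev V \<sigma>) (inm j) = TObj \<sigma> j"
  proof (rule pmor_eqI[OF p.pre_mor_comp m.pre_mor_axioms])
    fix x assume x: "x \<in> Obj (FX j)"
    have "eo (In j x) \<in> Obj WC" using Tm.In[OF j x] by simp
    then show "mo (pmor_comp T (ev V \<sigma>) (inm j)) x = mo (TObj \<sigma> j) x"
      using p.HG_mo[OF x] inm_sel(1)[OF x] ev_sel(1) obv_In[OF V \<sigma> j x] by (simp del: pmor_comp_sel)
  next
    fix f assume f: "f \<in> Arr (FX j)"
    have "ea (gin j f) \<in> Arr WC" using Gen.gin[OF j f] by simp
    then show "ma (pmor_comp T (ev V \<sigma>) (inm j)) f = ma (TObj \<sigma> j) f"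
      using p.HG_ma[OF f] inm_sel(2)[OF f] ev_sel(2) va_gin[OF V \<sigma> j f] by (simp del: pmor_comp_sel)
  next
    fix w n xs assume w: "w \<in> words T n" and xs: "xs \<in> Obj (pow_cat (FX j) n)"
    have us: "map eo (map (In j) xs) \<in> Obj (pow_cat WC n)"
      using xs by (intro WC_pow_ObjI[OF map_In_Tm[OF j xs]]) simp
    have o: "map (obv V \<sigma>) (map eo (map (In j) xs)) = map (mo (TObj \<sigma> j)) xs"
      using obv_In[OF V \<sigma> j] xs by (auto simp: subset_iff)
    have "ea (grho j w xs) \<in> Arr WC" using Gen.str[OF Str.rho[OF j w xs]] by simp
    then show "rho (pmor_comp T (ev V \<sigma>) (inm j)) w xs = rho (TObj \<sigma> j) w xs"
      unfolding p.HG_rho[OF w xs] map_inm[OF xs] inm_rho[OF w xs] ev_rho[OF V \<sigma> w us] o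
      using ev_sel(2) va_grho[OF V \<sigma> j w xs] m.B.X.Comp_Id_left[OF m.rho_hom[OF w xs]] by simp
  qed
  then show "TObj (cone_postcomp J K inj_cone (ev V \<sigma>)) j = TObj \<sigma> j" using j inj_cone_sel by simp
next
  fix f x assume f: "f \<in> Arr J" and x: "x \<in> Obj (FX (Dom J f))"
  have "ea (gcone f x) \<in> Arr WC" using Gen.str[OF Str.cone[OF f x]] by simp
  then show "ce (TArr (cone_postcomp J K inj_cone (ev V \<sigma>)) f) x = ce (TArr \<sigma> f) x"
    using cone_postcomp(2)[OF inj_cone ev_mor[OF V \<sigma>] f x] inj_cone_sel(2)[OF f] inc_cells(2)[OF J.Arr_hom[OF f] x]
      ev_sel(2) va_gcone[OF V \<sigma> f x] by simp
qed

text \<open>Induction on terms: compatibility with \<open>rho\<close> determines the component at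
  \<open>Op w ts\<close> from those at \<open>ts\<close>, since \<open>rho b'\<close> is invertible.
  This will give faithfulness.\<close>

lemma W_cell_eqI:
  assumes V: "V \<in> small_palgs T" and m: "mor W V b" "mor W V b'" and c: "\<beta> \<in> cells b b'" "\<gamma> \<in> cells b b'"
    and e: "\<And>j x. j \<in> Obj J \<Longrightarrow> x \<in> Obj (FX j) \<Longrightarrow> ce \<beta> (eo (In j x)) = ce \<gamma> (eo (In j x))"
  shows "\<beta> = \<gamma>"
proof (rule cell_eqI[OF m c])
  interpret b: pointwise_mor T W V b by fact
  interpret b': pointwise_mor T W V b' by fact
  have "ce \<beta> (eo t) = ce \<gamma> (eo t)" if "t \<in> Tm" for t using that
  proof induction
    case (In j x)
    then show ?case by (rule e)
  next
    case (Op w ts)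
    then have us: "map eo ts \<in> Obj (pow_cat (Cat W) (length ts))" by auto
    have "set ts \<subseteq> Tm" using Op by auto
    then have o: "eo (Op w ts) = opo W w (map eo ts)" using wPhi_OMap[OF Op(1)] by simp
    have m': "map (ce \<beta>) (map eo ts) = map (ce \<gamma>) (map eo ts)" using Op(2) by auto
    note ou = W.PhiD(3)[OF Op(1) us]
    note sq1 = cell_rho[OF m c(1) Op(1) us] and sq2 = cell_rho[OF m c(2) Op(1) us]
    show ?case unfolding o
      by (rule b.B.X.iso_cancel_left[OF b'.rho_iso[OF Op(1) us] b'.rho_hom[OF Op(1) us] cell_hom[OF m c(1) ou] cell_hom[OF m c(2) ou]])
         (use sq1 sq2 m' in \<open>simp add: square_def del: map_map W_sel\<close>)
  qed
  then show "ce \<beta> x = ce \<gamma> x" if "x \<in> Obj (Cat W)" for x using that by auto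
qed

section \<open>Extending a modification to a 2-cell out of the term model\<close>

context
  fixes V b b' \<Xi>
  assumes V: "V \<in> small_palgs T" and b: "mor W V b" and b': "mor W V b'"
    and \<Xi>: "\<Xi> \<in> hom (Cones V) (cone_postcomp J K inj_cone b) (cone_postcomp J K inj_cone b')"
begin

interpretation b: pointwise_mor T W V b by (rule b)
interpretation b': pointwise_mor T W V b' by (rule b')

text \<open>The only possible component at each term: at \<open>Op w ts\<close>, compatibility with
  \<open>rho\<close> is solved for it by inverting \<open>rho b'\<close>. Compatibility with the
  operations is thereby built in, and naturality is what remains.\<close>

definition al :: "('t, 'jo, 'u) tm \<Rightarrow> 'u" where
  "al = fold_tm (\<lambda>j. ce (MoComp \<Xi> j)) (\<lambda>w ts as. Comp (Cat V) (inv_arr (Cat V) (rho b' w (map eo ts)))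
     (Comp (Cat V) (opa V w as) (rho b w (map eo ts))))"

lemma al_In: "al (In j x) = ce (MoComp \<Xi> j) x"
  by (simp add: al_def)

lemma al_Op: "al (Op w ts) = Comp (Cat V) (inv_arr (Cat V) (rho b' w (map eo ts)))
    (Comp (Cat V) (opa V w (map al ts)) (rho b w (map eo ts)))"
  by (simp add: al_def)

lemma \<Xi>_cell:
  assumes j: "j \<in> Obj J"
  shows "mor (PObj F j) V (pmor_comp T b (inm j))" "mor (PObj F j) V (pmor_comp T b' (inm j))"
    "MoComp \<Xi> j \<in> cells (pmor_comp T b (inm j)) (pmor_comp T b' (inm j))"
  using mor_comp[OF inm_mor[OF j]] b b' \<Xi> j inj_cone_sel(1)[OF j] unfolding hom_Cones_iff[OF V] by auto

text \<open>The cells of \<Xi> live on the algebras \<open>PObj F j\<close>; these formulas turn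
  what they satisfy into statements about \<open>b\<close> and \<open>b'\<close> at the terms
  \<open>In j x\<close>.\<close>

lemma comp_inm:
  assumes j: "j \<in> Obj J" and H: "mor W V H"
  shows "x \<in> Obj (FX j) \<Longrightarrow> mo (pmor_comp T H (inm j)) x = mo H (eo (In j x))"
    and "f \<in> Arr (FX j) \<Longrightarrow> ma (pmor_comp T H (inm j)) f = ma H (ea (gin j f))"
    and "w \<in> words T n \<Longrightarrow> xs \<in> Obj (pow_cat (FX j) n) \<Longrightarrow>
      rho (pmor_comp T H (inm j)) w xs = Comp (Cat V) (rho H w (map eo (map (In j) xs))) (ma H (ea (grho j w xs)))"
proof -
  interpret p: mor_pair T "PObj F j" W V "inm j" H using inm_mor[OF j] H by (simp add: mor_pair_def)
  show "x \<in> Obj (FX j) \<Longrightarrow> mo (pmor_comp T H (inm j)) x = mo H (eo (In j x))"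
    "f \<in> Arr (FX j) \<Longrightarrow> ma (pmor_comp T H (inm j)) f = ma H (ea (gin j f))"
    "w \<in> words T n \<Longrightarrow> xs \<in> Obj (pow_cat (FX j) n) \<Longrightarrow>
      rho (pmor_comp T H (inm j)) w xs = Comp (Cat V) (rho H w (map eo (map (In j) xs))) (ma H (ea (grho j w xs)))"
    by (simp_all only: p.HG_mo p.HG_ma p.HG_rho inm_sel map_inm inm_rho)
qed

lemma eo_pow: "set ts \<subseteq> Tm \<Longrightarrow> length ts = n \<Longrightarrow> map eo ts \<in> Obj (pow_cat (Cat W) n)"
  by auto

lemma al_hom: "t \<in> Tm \<Longrightarrow> al t \<in> hom (Cat V) (mo b (eo t)) (mo b' (eo t))"
proof (induction rule: Tm.induct)
  case (In j x)
  show ?case unfolding al_In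
    using cell_hom[OF \<Xi>_cell[OF In(1)] In(2)] comp_inm(1)[OF In(1) b In(2)] comp_inm(1)[OF In(1) b' In(2)]
    by (simp del: pmor_comp_sel)
next
  case (Op w ts)
  have ts: "set ts \<subseteq> Tm" using Op(2) by auto
  note us = eo_pow[OF ts refl]
  have al: "map al ts \<in> hom (pow_cat (Cat V) (length ts)) (map (mo b) (map eo ts)) (map (mo b') (map eo ts))"
    using Op(2) by (simp add: hom_pow_iff)
  have o: "eo (Op w ts) = opo W w (map eo ts)" using wPhi_OMap[OF Op(1) ts refl] by simp
  show ?case unfolding al_Op o
    by (rule b.B.X.Comp_hom[OF b.B.X.Comp_hom[OF b.rho_hom[OF Op(1) us] b.B.PhiD(5)[OF Op(1) al]]
        b.B.X.inv_arr(1)[OF b'.rho_iso[OF Op(1) us] b'.rho_hom[OF Op(1) us]]])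
qed

lemma map_al:
  assumes "set ts \<subseteq> Tm" "length ts = n"
  shows "map al ts \<in> hom (pow_cat (Cat V) n) (map (mo b) (map eo ts)) (map (mo b') (map eo ts))"
proof -
  have "al (ts ! i) \<in> hom (Cat V) (mo b (eo (ts ! i))) (mo b' (eo (ts ! i)))" if "i < n" for i
    using that assms by (intro al_hom) (metis nth_mem subsetD)
  then show ?thesis using assms(2) by (simp add: hom_pow_iff)
qed

text \<open>Composing with \<open>rho b'\<close> cancels the inverse in the recursion step of
  \<open>al\<close>.\<close>

lemma al_rho:
  assumes w: "w \<in> words T n" and ts: "set ts \<subseteq> Tm" "length ts = n"
  shows "square (Cat V) (rho b w (map eo ts)) (al (Op w ts)) (opa V w (map al ts)) (rho b' w (map eo ts))"
proof -
  note us = eo_pow[OF ts] and p = b.B.PhiD(5)[OF w map_al[OF ts]]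
  have o: "eo (Op w ts) = opo W w (map eo ts)" using wPhi_OMap[OF w ts] by simp
  have "Op w ts \<in> Tm" using w ts by (auto intro!: Tm.Op)
  note ah = al_hom[OF this, unfolded o]
  note iv = b.B.X.inv_arr[OF b'.rho_iso[OF w us] b'.rho_hom[OF w us]]
  note c = b.B.X.Comp_hom[OF b.rho_hom[OF w us] p]
  have "Comp (Cat V) (rho b' w (map eo ts)) (al (Op w ts)) = Comp (Cat V) (opa V w (map al ts)) (rho b w (map eo ts))"
    unfolding al_Op using b.B.X.Comp_assoc[OF c iv(1) b'.rho_hom[OF w us]] iv(3) b.B.X.Comp_Id_left[OF c] by simp
  then show ?thesis by (rule b.B.X.squareI[OF b.rho_hom[OF w us] b'.rho_hom[OF w us] ah p])
qed

definition natural :: "('t, 'jo, 'ja, 'u) garr \<Rightarrow> bool" where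
  "natural g \<longleftrightarrow> square (Cat V) (ma b (ea g)) (al (src g)) (al (trg g)) (ma b' (ea g))"

text \<open>The situation of an arrow whose target is an operation term: \<open>m\<close> and
  \<open>n\<close> are isomorphisms built from \<open>rho b\<close> and \<open>rho b'\<close> at the
  target, and naturality is checked after composing with them
  (\<open>square_cancel\<close>).\<close>

lemma naturalI:
  assumes g: "g \<in> Gen"
    and m: "iso_in (Cat V) m" "m \<in> hom (Cat V) (mo b (eo (trg g))) c" and n: "iso_in (Cat V) n" "n \<in> hom (Cat V) (mo b' (eo (trg g))) c'"
    and sq: "square (Cat V) (Comp (Cat V) m (ma b (ea g))) (al (src g)) v (Comp (Cat V) n (ma b' (ea g)))"
      "square (Cat V) m (al (trg g)) v n"
  shows "natural g"
  unfolding natural_def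
proof (rule b.B.X.square_cancel[OF m _ n _ _ _ sq])
  have "ea g \<in> hom (Cat W) (eo (src g)) (eo (trg g))" using WC_hom[OF g] by simp
  then show "ma b (ea g) \<in> hom (Cat V) (mo b (eo (src g))) (mo b (eo (trg g)))"
    "ma b' (ea g) \<in> hom (Cat V) (mo b' (eo (src g))) (mo b' (eo (trg g)))" using b.MD(5) b'.MD(5) by blast+
  show "al (src g) \<in> hom (Cat V) (mo b (eo (src g))) (mo b' (eo (src g)))"
    "al (trg g) \<in> hom (Cat V) (mo b (eo (trg g))) (mo b' (eo (trg g)))" using al_hom Gen_Tm[OF g] by blast+
qed

text \<open>For the coherences of \<open>W\<close>, the morphism axioms of \<open>b\<close> and
  \<open>b'\<close> replace the image of the arrow followed by \<open>rho\<close> with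
  \<open>rho\<close> followed by a coherence of \<open>V\<close>; the outer rectangle is then
  \<open>al_rho\<close> pasted with naturality in \<open>V\<close>. For \<open>grho\<close> the
  reason is compatibility of the cells of \<Xi> with \<open>rho\<close>, for \<open>gcone\<close> it
  is the modification axiom.\<close>

lemma Str_natural:
  assumes "g \<in> Str"
  shows "natural g"
  using assms
proof cases
  case (asc w ws ts)
  note w = asc(2) and wl = asc(3) and ts = asc(4,5)
  note us = eo_pow[OF ts] and gw = gam_words[OF w wl]
  note ets = evs_Op_Tm[OF wl ts]
  have ev: "evs T (opo W) ws (map eo ts) = map eo (evs T Op ws ts)" by (rule evs_wPhi_OMap[OF wl ts])
  have le: "length (evs T Op ws ts) = length ws" by simp
  note eus = W.evs_opo[OF wl us]
  have o: "eo (Op w (evs T Op ws ts)) = opo W w (evs T (opo W) ws (map eo ts))" using wPhi_OMap[OF w ets le] ev by simp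
  have wn: "ws ! i \<in> words T (Dom T (ws ! i))" if "i < length ws" for i using wl that by (simp add: word_list_def)
  have bl: "set (split_blocks (map (Dom T) ws) ts ! i) \<subseteq> Tm" "length (split_blocks (map (Dom T) ws) ts ! i) = Dom T (ws ! i)" if "i < length ws" for i
    using that ts set_split_blocks_nth[of i "map (Dom T) ws" ts] by (auto simp: length_split_blocks_nth)
  \<comment> \<open>For both \<open>b\<close> and \<open>b'\<close>: the passage from the image of a
    nested term to the nested operation in \<open>V\<close> is \<open>rho\<close> of the outer word,
    followed by \<open>rho\<close> of the inner words under the outer operation.\<close>
  have W: "evs T (rho H) ws (map eo ts) \<in> hom (pow_cat (Cat V) (length ws)) (map (mo H) (evs T (opo W) ws (map eo ts))) (evs T (opo V) ws (map (mo H) (map eo ts)))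
     \<and> iso_in (Cat V) (Comp (Cat V) (opa V w (evs T (rho H) ws (map eo ts))) (rho H w (evs T (opo W) ws (map eo ts))))"
    if H: "mor W V H" for H
  proof -
    interpret H: pointwise_mor T W V H by fact
    have bi: "rho H (ws ! i) (map eo (split_blocks (map (Dom T) ws) ts ! i)) \<in> hom (Cat V)
        (mo H (opo W (ws ! i) (map eo (split_blocks (map (Dom T) ws) ts ! i)))) (opo V (ws ! i) (map (mo H) (map eo (split_blocks (map (Dom T) ws) ts ! i))))"
      "iso_in (Cat V) (rho H (ws ! i) (map eo (split_blocks (map (Dom T) ws) ts ! i)))" if "i < length ws" for i
      using H.rho_hom[OF wn eo_pow[OF bl]] H.rho_iso[OF wn eo_pow[OF bl]] that by auto
    have h: "evs T (rho H) ws (map eo ts) \<in> hom (pow_cat (Cat V) (length ws)) (map (mo H) (evs T (opo W) ws (map eo ts))) (evs T (opo V) ws (map (mo H) (map eo ts)))"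
      using bi(1) by (simp add: hom_pow_iff evs_nth split_blocks_map del: W_sel)
    have i: "iso_in (pow_cat (Cat V) (length ws)) (evs T (rho H) ws (map eo ts))"
      by (rule iso_pow_cat[OF b.B.Cat]) (use bi(2) in \<open>simp_all add: evs_nth split_blocks_map\<close>)
    have "iso_in (Cat V) (opa V w (evs T (rho H) ws (map eo ts)))"
      by (rule functor_iso(1)[OF b.B.PX b.B.Cat b.B.Phi[OF w] i h])
    from b.B.X.iso_Comp[OF H.rho_iso[OF w eus] H.rho_hom[OF w eus] this b.B.PhiD(5)[OF w h]] h show ?thesis by blast
  qed
  let ?m = "\<lambda>H. Comp (Cat V) (opa V w (evs T (rho H) ws (map eo ts))) (rho H w (evs T (opo W) ws (map eo ts)))"
  have mh: "?m b \<in> hom (Cat V) (mo b (opo W w (evs T (opo W) ws (map eo ts)))) (opo V w (evs T (opo V) ws (map (mo b) (map eo ts))))"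
    using b.B.X.Comp_hom[OF b.rho_hom[OF w eus] b.B.PhiD(5)[OF w conjunct1[OF W[OF b]]]] .
  have nh: "?m b' \<in> hom (Cat V) (mo b' (opo W w (evs T (opo W) ws (map eo ts)))) (opo V w (evs T (opo V) ws (map (mo b') (map eo ts))))"
    using b.B.X.Comp_hom[OF b'.rho_hom[OF w eus] b.B.PhiD(5)[OF w conjunct1[OF W[OF b']]]] .
  have g: "gasc w ws ts \<in> Gen" and eg: "ea (gasc w ws ts) = asc W w ws (map eo ts)"
    using Gen.str[OF Str.asc[OF w wl ts]] asc_W[OF w wl ts] by simp_all
  have st: "src (gasc w ws ts) = Op (gam T w ws) ts" "trg (gasc w ws ts) = Op w (evs T Op ws ts)" by (simp_all add: gasc_def)
  \<comment> \<open>The outer rectangle: compatibility of \<open>al\<close> with \<open>rho\<close>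
    at the composite word, then naturality of \<open>asc V\<close> at the components
    \<open>map al ts\<close>.\<close>
  note sq1 = b.B.X.square_comp[OF al_rho[OF gw ts] b.B.asc_square[OF w wl map_al[OF ts]]]
  have sq2: "square (pow_cat (Cat V) (length ws)) (evs T (rho b) ws (map eo ts)) (map al (evs T Op ws ts)) (evs T (opa V) ws (map al ts)) (evs T (rho b') ws (map eo ts))"
    by (rule square_pow_cat) (use al_rho[OF wn bl] in \<open>simp_all add: evs_nth split_blocks_map\<close>)
  \<comment> \<open>The right square: compatibility at the outer word, then the compatibilities at
    the inner words under the operation of \<open>w\<close>.\<close>
  note sq3 = b.B.X.square_comp[OF al_rho[OF w ets le, folded ev] functor_square[OF b.B.Phi[OF w] b.B.PX sq2]]
  show ?thesis unfolding asc(1)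
    by (rule naturalI[OF g, of "?m b" _ "?m b'"])
       (use W[OF b] W[OF b'] mh nh sq1 sq3 b.rho_asc[OF w wl us] b'.rho_asc[OF w wl us] in \<open>simp_all only: st eg o\<close>)
next
  case (unt t)
  note t = unt(2)
  have ts: "set [t] \<subseteq> Tm" "length [t] = 1" and tW: "eo t \<in> Obj (Cat W)" using t by simp_all
  have g: "gunt t \<in> Gen" and eg: "ea (gunt t) = unt W [eo t]" using Gen.str[OF Str.unt[OF t]] unt_W[OF t] by simp_all
  have st: "src (gunt t) = Op (word1 T) [t]" "trg (gunt t) = t" by (simp_all add: gunt_def)
  \<comment> \<open>Nothing has to be cancelled here: \<open>rho_unt\<close> already writes the
    images of \<open>gunt t\<close> as composites of \<open>rho\<close> and the unit coherence of
    \<open>V\<close>.\<close>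
  from b.B.X.square_comp[OF al_rho[OF word1_words ts, simplified list.map] b.B.unt_square[OF al_hom[OF t]]]
  show ?thesis unfolding unt(1) natural_def st eg b.rho_unt[OF tW, symmetric] b'.rho_unt[OF tW, symmetric] .
next
  case (sbs w k l f ts)
  note w = sbs(2) and f = sbs(3) and ts = sbs(4,5)
  note us = eo_pow[OF ts] and sw = subst_word_words[OF w f]
  have tf: "set (map ((!) ts) f) \<subseteq> Tm" "length (map ((!) ts) f) = k"
    using set_map_nth[OF f ts(2)] ts(1) f by (auto simp: fin_fun_def)
  note uf = eo_pow[OF tf]
  have mf: "map ((!) (map eo ts)) f = map eo (map ((!) ts) f)" "map ((!) (map al ts)) f = map al (map ((!) ts) f)"
    using map_nth_eo[OF f ts(2)] by blast+
  have o: "eo (Op w (map ((!) ts) f)) = opo W w (map eo (map ((!) ts) f))" using wPhi_OMap[OF w tf] by simp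
  have g: "gsbs w l f ts \<in> Gen" and eg: "ea (gsbs w l f ts) = sbs W w l f (map eo ts)"
    using Gen.str[OF Str.sbs[OF w f ts]] sbs_W[OF ts] by simp_all
  have st: "src (gsbs w l f ts) = Op (subst_word T l w f) ts" "trg (gsbs w l f ts) = Op w (map ((!) ts) f)" by (simp_all add: gsbs_def)
  note sq1 = b.B.X.square_comp[OF al_rho[OF sw ts] b.B.sbs_square[OF w f map_al[OF ts], unfolded mf]]
  show ?thesis unfolding sbs(1)
    by (rule naturalI[OF g, of "rho b w (map eo (map ((!) ts) f))" _ "rho b' w (map eo (map ((!) ts) f))"])
       (use b.rho_iso[OF w uf] b'.rho_iso[OF w uf] b.rho_hom[OF w uf] b'.rho_hom[OF w uf] sq1 al_rho[OF w tf]
          b.rho_sbs[OF w f us, unfolded mf] b'.rho_sbs[OF w f us, unfolded mf] in \<open>simp_all only: st eg o\<close>)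
next
  case (rho j w n xs)
  note j = rho(2) and w = rho(3) and xs = rho(4)
  have ts: "set (map (In j) xs) \<subseteq> Tm" "length (map (In j) xs) = n" using map_In_Tm[OF j xs] xs by simp_all
  note us = eo_pow[OF ts]
  have o: "eo (Op w (map (In j) xs)) = opo W w (map eo (map (In j) xs))" using wPhi_OMap[OF w ts] by simp
  note g = Gen.str[OF Str.rho[OF j w xs]]
  have st: "src (grho j w xs) = In j (opo (PObj F j) w xs)" "trg (grho j w xs) = Op w (map (In j) xs)" by (simp_all add: grho_def)
  have m: "map (ce (MoComp \<Xi> j)) xs = map al (map (In j) xs)" by (simp add: al_In)
  \<comment> \<open>The coherence of the composite leg is \<open>rho b\<close> after the image of
    \<open>grho\<close>, so compatibility of the cell \<open>MoComp \<Xi> j\<close> is already the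
    outer rectangle.\<close>
  note sq1 = cell_rho[OF \<Xi>_cell[OF j] w xs, unfolded comp_inm(3)[OF j b w xs] comp_inm(3)[OF j b' w xs] m, folded al_In]
  show ?thesis unfolding rho(1)
    by (rule naturalI[OF g, of "rho b w (map eo (map (In j) xs))" _ "rho b' w (map eo (map (In j) xs))"])
       (use b.rho_iso[OF w us] b'.rho_iso[OF w us] b.rho_hom[OF w us] b'.rho_hom[OF w us] sq1 al_rho[OF w ts] in \<open>simp_all only: st o\<close>)
next
  case (cone f x)
  note f = cone(2) and x = cone(3)
  note fh = J.Arr_hom[OF f] and d = J.Dom_closed[OF f] and cd = J.Cod_closed[OF f]
  interpret Ff: pointwise_mor T "PObj F (Dom J f)" "PObj F (Cod J f)" "PArr F f" by (rule F_mor[OF fh])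
  have fx: "mo (PArr F f) x \<in> Obj (FX (Cod J f))" by (rule Ff.MD(3)[OF x])
  note g = gcone_hom[OF fh x]
  have gW: "ea (gcone f x) \<in> hom (Cat W) (eo (In (Dom J f) x)) (eo (In (Cod J f) (mo (PArr F f) x)))" using g by simp
  have st: "src (gcone f x) = In (Dom J f) x" "trg (gcone f x) = In (Cod J f) (mo (PArr F f) x)" by (simp_all add: gcone_def)
  have "Comp (Cat V) (ce (MoComp \<Xi> (Cod J f)) (mo (PArr F f) x)) (ma b (ea (gcone f x)))
    = Comp (Cat V) (ma b' (ea (gcone f x))) (ce (MoComp \<Xi> (Dom J f)) x)"
  proof -
    have "Comp (Cat V) (ce (MoComp \<Xi> (Cod J f)) (mo (PArr F f) x)) (ce (TArr (cone_postcomp J K inj_cone b) f) x)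
      = Comp (Cat V) (ce (TArr (cone_postcomp J K inj_cone b') f) x) (ce (MoComp \<Xi> (Dom J f)) x)"
      using \<Xi>[unfolded hom_Cones_iff[OF V]] f x by blast
    then show ?thesis
      by (simp only: cone_postcomp(2)[OF inj_cone b f x] cone_postcomp(2)[OF inj_cone b' f x] inj_cone_sel(2)[OF f] inc_cells(2)[OF fh x])
  qed
  then show ?thesis unfolding cone(1) natural_def st al_In
    using al_hom[OF Tm.In[OF d x]] al_hom[OF Tm.In[OF cd fx]] b.MD(5)[OF gW] b'.MD(5)[OF gW] unfolding al_In
    by (auto intro!: b.B.X.squareI)
qed

text \<open>Naturality squares paste under composition, are preserved by operations and reverse for
  formal inverses. The property depends on the arrow and not on how it was generated, so the
  identification of arrows by value does no harm.\<close>

lemma Gen_natural: "g \<in> Gen \<Longrightarrow> natural g"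
proof (induction rule: Gen.induct)
  case (gid t)
  have tW: "eo t \<in> Obj (Cat W)" and e: "ea (gid t) = Id (Cat W) (eo t)" using gid by simp_all
  note h = al_hom[OF gid]
  have "src (gid t) = t" "trg (gid t) = t" by (simp_all add: gid_def)
  then show ?case unfolding natural_def e b.MD(6)[OF tW] b'.MD(6)[OF tW]
    using b.B.X.Comp_Id_left[OF h] b.B.X.Comp_Id_right[OF h] b.B.X.Id_hom b.B.X.hom_Obj[OF h] h
    by (auto intro!: b.B.X.squareI)
next
  case (gcomp g h)
  have gh: "ea g \<in> hom (Cat W) (eo (src g)) (eo (trg g))" "ea h \<in> hom (Cat W) (eo (trg g)) (eo (trg h))"
    using WC_hom[OF gcomp(1)] WC_hom[OF gcomp(2)] gcomp(3) by simp_all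
  have e: "ea (gcomp h g) = Comp (Cat W) (ea h) (ea g)" using gcomp by simp
  have "src (gcomp h g) = src g" "trg (gcomp h g) = trg h" by (simp_all add: gcomp_def)
  then show ?case
    using b.B.X.square_comp[OF gcomp(4)[unfolded natural_def] gcomp(5)[unfolded natural_def gcomp(3)]]
    unfolding natural_def e b.MD(7)[OF gh] b'.MD(7)[OF gh] by simp
next
  case (gop w gs)
  note w = gop(1)
  have gs: "set gs \<subseteq> Gen" using gop(2) by blast
  note g = Gen.gop[OF w] 
  have gG: "gop w gs \<in> Gen" using g gs by blast
  have s: "set (map src gs) \<subseteq> Tm" "length (map src gs) = length gs" and t: "set (map trg gs) \<subseteq> Tm" "length (map trg gs) = length gs"
    using set_src[OF gs] set_trg[OF gs] by simp_all
  note vs = eo_pow[OF t]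
  have st: "src (gop w gs) = Op w (map src gs)" "trg (gop w gs) = Op w (map trg gs)" by (simp_all add: gop_def)
  have e: "ea (gop w gs) = opa W w (map ea gs)" using wPhi_AMap[OF w gs refl] by simp
  have h: "map ea gs \<in> hom (pow_cat (Cat W) (length gs)) (map eo (map src gs)) (map eo (map trg gs))"
  proof -
    have "gs ! i \<in> Gen" if "i < length gs" for i using that gs by (metis nth_mem subsetD)
    then show ?thesis using WC_hom by (simp add: hom_pow_iff)
  qed
  have o: "eo (Op w (map trg gs)) = opo W w (map eo (map trg gs))" using wPhi_OMap[OF w t] by simp
  have sq: "square (pow_cat (Cat V) (length gs)) (map (ma b) (map ea gs)) (map al (map src gs)) (map al (map trg gs)) (map (ma b') (map ea gs))"
    by (rule square_pow_cat) (use gop(2) in \<open>simp_all add: natural_def\<close>)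
  \<comment> \<open>The squares of the argument arrows are collected in the power and sent through
    the operation of \<open>w\<close>; naturality of \<open>rho b\<close> and \<open>rho b'\<close>
    relates the result to the images of \<open>gop w gs\<close>.\<close>
  note sq1 = b.B.X.square_comp[OF al_rho[OF w s] functor_square[OF b.B.Phi[OF w] b.B.PX sq]]
  have n: "Comp (Cat V) (rho b w (map eo (map trg gs))) (ma b (opa W w (map ea gs))) = Comp (Cat V) (opa V w (map (ma b) (map ea gs))) (rho b w (map eo (map src gs)))"
    "Comp (Cat V) (rho b' w (map eo (map trg gs))) (ma b' (opa W w (map ea gs))) = Comp (Cat V) (opa V w (map (ma b') (map ea gs))) (rho b' w (map eo (map src gs)))"
    using b.rho_square[OF w h] b'.rho_square[OF w h] by (simp_all only: square_def)
  show ?case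
    by (rule naturalI[OF gG, of "rho b w (map eo (map trg gs))" _ "rho b' w (map eo (map trg gs))"])
       (use b.rho_iso[OF w vs] b'.rho_iso[OF w vs] b.rho_hom[OF w vs] b'.rho_hom[OF w vs] sq1 al_rho[OF w t] in \<open>simp_all only: st e o n\<close>)
next
  case (gin j f)
  interpret Fj: pointwise_algebra T "PObj F j" by (rule F_pointwise[OF gin(1)])
  have st: "src (gin j f) = In j (Dom (FX j) f)" "trg (gin j f) = In j (Cod (FX j) f)" by (simp_all add: gin_def)
  show ?case
    using cell_square[OF \<Xi>_cell[OF gin(1)] Fj.X.Arr_hom[OF gin(2)]]
    unfolding natural_def st al_In comp_inm(2)[OF gin(1) b gin(2)] comp_inm(2)[OF gin(1) b' gin(2)] .
next
  case (str g)
  then show ?case by (rule Str_natural)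
next
  case (inv g)
  \<comment> \<open>The functors of \<open>b\<close> and \<open>b'\<close> send the inverse of a
    structural arrow to the inverse of its image, so the square for \<open>ginv g\<close> is the
    reversed square for \<open>g\<close>.\<close>
  have h: "ea g \<in> hom (Cat W) (eo (src g)) (eo (trg g))" using WC_hom[OF Gen.str[OF inv]] by simp
  have i: "iso_in (Cat W) (ea g)" and e: "ea (ginv g) = inv_arr (Cat W) (ea g)" using WC_iso[OF inv] by simp_all
  note f = functor_iso[OF W.Cat b.B.Cat b.MFun i h] and f' = functor_iso[OF W.Cat b.B.Cat b'.MFun i h]
  have "src (ginv g) = trg g" "trg (ginv g) = src g" by (simp_all add: ginv_def)
  then show ?case
    using b.B.X.square_inv[OF f(1) f'(1) Str_natural[OF inv, unfolded natural_def]]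
    unfolding natural_def e f(2) f'(2) by simp
qed

text \<open>The preimage has the components \<open>al\<close>: it is natural by
  \<open>Gen_natural\<close>, compatible with the operations by \<open>al_rho\<close>, and agrees
  with \<Xi> on the terms \<open>In j x\<close> by definition.\<close>

lemma cone_functor_full: "\<exists>\<beta> \<in> hom (Mor K W V) b b'. AMap (cone_functor J K F W inj_cone V) \<beta> = \<Xi>"
proof -
  define \<beta> where "\<beta> = \<lparr>CSrc = b, CTrg = b', CNat = \<lparr>NSrc = MFun b, NTrg = MFun b',
    NComp = restrict (\<lambda>u. al (dc u)) (Obj WC)\<rparr>\<rparr>"
  have c: "ce \<beta> (eo t) = al t" if "t \<in> Tm" for t using that by (simp add: \<beta>_def)
  have bc: "\<beta> \<in> cells b b'"
  proof (rule cellI[OF b b'])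
    show "CSrc \<beta> = b" "CTrg \<beta> = b'" "NSrc (CNat \<beta>) = MFun b" "NTrg (CNat \<beta>) = MFun b'" "ce \<beta> \<in> extensional (Obj (Cat W))"
      by (simp_all add: \<beta>_def)
    show "ce \<beta> x \<in> hom (Cat V) (mo b x) (mo b' x)" if "x \<in> Obj (Cat W)" for x
      using that al_hom c by auto
    show "square (Cat V) (ma b f) (ce \<beta> x) (ce \<beta> y) (ma b' f)" if f: "f \<in> hom (Cat W) x y" for f x y
    proof -
      obtain g where g: "g \<in> Gen" "f = ea g" "x = eo (src g)" "y = eo (trg g)"
        by (rule WC_homE[OF f[unfolded W_sel]])
      then show ?thesis using Gen_natural[OF g(1)] c Gen_Tm[OF g(1)] by (simp add: natural_def)
    qed
    show "square (Cat V) (rho b w us) (ce \<beta> (opo W w us)) (opa V w (map (ce \<beta>) us)) (rho b' w us)"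
      if w: "w \<in> words T n" and us: "us \<in> Obj (pow_cat (Cat W) n)" for w n us
    proof -
      obtain ts where ts: "us = map eo ts" "set ts \<subseteq> Tm" "length ts = n" by (rule WC_pow_ObjE[OF us[unfolded W_sel]])
      have "Op w ts \<in> Tm" using w ts by (auto intro!: Tm.Op)
      moreover have "map (ce \<beta>) us = map al ts" using ts c by auto
      ultimately show ?thesis using al_rho[OF w ts(2,3)] wPhi_OMap[OF w ts(2,3)] c ts(1) by (simp del: map_map)
    qed
  qed
  have bh: "\<beta> \<in> hom (Mor K W V) b b'" using b b' bc hom_Mor_iff[OF W_small V] by simp
  have "AMap (cone_functor J K F W inj_cone V) \<beta> = \<Xi>"
  proof (rule modif_eqI[OF V cone_functor_AMap(1)[OF W_small V inj_cone bh] \<Xi>])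
    fix j x assume j: "j \<in> Obj J" and x: "x \<in> Obj (FX j)"
    show "ce (MoComp (AMap (cone_functor J K F W inj_cone V) \<beta>) j) x = ce (MoComp \<Xi> j) x"
      unfolding cone_functor_AMap(2)[OF W_small V inj_cone bh j x]
      using inj_cone_sel(1)[OF j] inm_sel(1)[OF x] c[OF Tm.In[OF j x]] al_In by simp
  qed
  then show ?thesis using bh by blast
qed

end

text \<open>The three hypotheses of \<open>equivalence_of_catsI\<close> are
  \<open>postcomp_ev\<close> for objects, \<open>cone_functor_full\<close> for fullness and
  \<open>W_cell_eqI\<close> for faithfulness.\<close>

lemma bicolimit_W: "bicolimit J K F W inj_cone"
  unfolding bicolimit_def
proof (intro conjI ballI)
  show "W \<in> Obj (Und K)" using W_small by simp
  show "inj_cone \<in> psnats J K F (const_psfun K W)" using psnats_cone[OF W_small] inj_cone by simp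
  fix V :: "('t, 'u, 'u) palg" assume "V \<in> Obj (Und K)"
  then have V: "V \<in> small_palgs T" by simp
  let ?F = "cone_functor J K F W inj_cone V"
  have O: "OMap ?F b = cone_postcomp J K inj_cone b" if "mor W V b" for b
    using that hom_Und_iff[OF W_small V] by (simp add: cone_functor_def)
  show "equivalence_of_cats (Mor K W V) (Cones V) ?F"
  proof (rule equivalence_of_catsI[OF category_Mor[OF W_small V] category_Cones[OF V] cone_functor_functors[OF W_small V inj_cone]])
    fix \<sigma> assume "\<sigma> \<in> Obj (Cones V)"
    then have \<sigma>: "cone V \<sigma>" using Cones_Obj[OF V] by simp
    note m = ev_mor[OF V \<sigma>]
    show "\<exists>c \<in> Obj (Mor K W V). OMap ?F c = \<sigma>"
      using m O[OF m] postcomp_ev[OF V \<sigma>] hom_Und_iff[OF W_small V] by (intro bexI[of _ "ev V \<sigma>"]) simp_all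
  next
    fix b b' \<Xi> assume "b \<in> Obj (Mor K W V)" "b' \<in> Obj (Mor K W V)" and X: "\<Xi> \<in> hom (Cones V) (OMap ?F b) (OMap ?F b')"
    then have m: "mor W V b" "mor W V b'" using hom_Und_iff[OF W_small V] by simp_all
    show "\<exists>\<beta> \<in> hom (Mor K W V) b b'. AMap ?F \<beta> = \<Xi>"
      by (rule cone_functor_full[OF V m X[unfolded O[OF m(1)] O[OF m(2)]]])
  next
    fix b b' \<beta> \<gamma> assume \<beta>: "\<beta> \<in> hom (Mor K W V) b b'" and \<gamma>: "\<gamma> \<in> hom (Mor K W V) b b'" and e: "AMap ?F \<beta> = AMap ?F \<gamma>"
    have m: "mor W V b" "mor W V b'" "\<beta> \<in> cells b b'" "\<gamma> \<in> cells b b'" using \<beta> \<gamma> hom_Mor_iff[OF W_small V] by auto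
    show "\<beta> = \<gamma>"
    proof (rule W_cell_eqI[OF V m])
      fix j x assume j: "j \<in> Obj J" and x: "x \<in> Obj (FX j)"
      show "ce \<beta> (eo (In j x)) = ce \<gamma> (eo (In j x))"
        using cone_functor_AMap(2)[OF W_small V inj_cone \<beta> j x] cone_functor_AMap(2)[OF W_small V inj_cone \<gamma> j x] e
          inj_cone_sel(1)[OF j] inm_sel(1)[OF x] by simp
    qed
  qed
qed

end

theorem theorem11p1:
  fixes T :: "'t thy"
    and J :: "('jo, 'ja) cat"
    and F :: "('jo, 'ja, ('t, 'u, 'u) palg, ('t, 'u, 'u) pmor, ('t, 'u, 'u) pcell) psfun"
  assumes "universe TYPE('u)"
    and "lawvere_theory T" and "small_cat TYPE('u) T"
    and "category J" and "small_cat TYPE('u) J"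
    and "pseudo_functor J (PsAlg T) F"
  shows "\<exists>W \<pi>. bicolimit J (PsAlg T) F W \<pi>"
proof -
  interpret small_diagram T J F
    using assms by (simp add: small_diagram_def small_diagram_axioms_def diagram_def)
  \<comment> \<open>Smallness provides the codes; any choice of injections instantiates the term
    model.\<close>
  obtain eo :: "('t, 'jo, 'u) tm \<Rightarrow> 'u" where eo: "inj_on eo Tm" by (rule small_set_inj[OF small_Tm])
  obtain ea :: "('t, 'jo, 'ja, 'u) garr \<Rightarrow> 'u" where ea: "inj_on ea Gen" by (rule small_set_inj[OF small_Gen])
  interpret term_model T J F eo ea by unfold_locales (fact eo, fact ea)
  show ?thesis using bicolimit_W by blast
qed

end
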